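(* Let $f:M\to M$, $M=\mathbb{T}^2\times\mathbb{S}\times\mathbb{T}^2$, be the $C^\infty$ diffeomorphism constructed in the context. For any $C^1$-neighborhood $\mathcal{U}_f$ of $f$ there exists a $C^\infty$ diffeomorphism $\widetilde f\in\mathcal{U}_f$, admitting a partially hyperbolic splitting of the same type as $f$, such that $\{(q_2,1,q_2)\}$ is a skeleton of $\widetilde f$.
   Context: Domination. $E\oplus_\succ F$ (for a diffeomorphism $f$) means: $E,F$ are $Df$-invariant of constant dimension, with trivial intersection and angles uniformly bounded away from $0$, and there are $c>0$, $\sigma<1$ with $\|Df^n v_F\|/\|Df^n v_E\|\le c\sigma^n\|v_F\|/\|v_E\|$ for all nonzero $v_E\in E,v_F\in F$, $n\ge1$. Cones: for subbundles $E,F$ with trivial intersection and $Df(E\oplus F)=E\oplus F$, $Df(F)=F$, put $\mathscr{C}_\alpha(E,F)=\{v_1+v_2: v_1\in E,v_2\in F,\|v_2\|\le\alpha\|v_1\|\}$; it is forward (resp. backward) invariant if $Df(\mathscr C_\alpha)\subset\mathscr C_{\kappa\alpha}$ (resp. $Df^{-1}(\mathscr C_\alpha)\subset\mathscr C_{\kappa\alpha}$) for some $\kappa\in(0,1)$. Construction of $f$. Let $\mathbb{S}=\mathbb{R}/2\mathbb{Z}$, $M=\mathbb{T}^2\times\mathbb{S}\times\mathbb{T}^2$, and let $A$ be the automorphism of $\mathbb{T}^2$ induced by $\begin{pmatrix}2&1\\1&1\end{pmatrix}$, with orthonormal eigenvectors $e^u$ (expanded) and $e^s$ (contracted). Put $\delta=1/10000$.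 Fix an even $C^\infty$ function $\psi:\mathbb{R}\to\mathbb{R}$ with $\psi=1$ on $[0,\delta/2]$, $\psi=0$ on $[\delta,\infty)$, strictly monotone on $(\delta/2,\delta)$. Fix a $C^\infty$ diffeomorphism $\phi:\mathbb{R}\to\mathbb{R}$ with $\phi(x+2)=\phi(x)+2$, whose only fixed points in $[0,2]$ are $0,1,2$, with $\phi'(0)=\frac12$, $\phi'(1)=\frac32$, and $1+\min_{x,y}(\phi'(x)-1)\psi(y)>0$. Let $Q(a,b,c)=c+\psi(\sqrt{a^2+b^2})(\phi(c)-c)$. Fix $n_0\ge1$ large and $\beta>0$ small such that: $A^{n_0}$ has four fixed points $p_1,p_2,q_1,q_2$ at pairwise distances $>10\delta$; the largest eigenvalue $\sigma_0$ of $A^{n_0}$ satisfies $\sigma_0\ge10000\max\{\max\partial_cQ,(\min\partial_cQ)^{-1}\}$; $\beta\le\frac{\delta}{2}\cdot\frac1{10000}$; $2\beta^2\log\frac34+(1-2\beta^2)\log\sigma_0>0$; and $|\phi'(x)-\frac12|<\frac1{10000}$ on $[-\beta,\beta]$. Fix $k$ with $\frac{3\delta}{2k}\le\frac{\beta}{10000}$ and let $$P(a,b,c,d,e)=d+\psi(kd)\,\psi\big(k\sqrt{a^2+b^2+c^2+e^2}\big)\Big(\tfrac{3d}{4\sigma_0}-d\Big).$$ Let $\pi_2(y)\in[-1,1)$ denote the representative of $y$ modulo $2$. Define $I:M\to M$ by: (i) if $x=p_1+ae^u+be^s$ with $|a|,|b|<5\delta$, $I(x,y,z)=(x,Q(a,b,y),z')$,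 where $z'=p_1+P(a,b,\pi_2(y),d,e)e^u+e\,e^s$ if $z=p_1+de^u+e\,e^s$ with $|d|,|e|<5\delta$, and $z'=z$ otherwise; (ii) if $x=p_2+ae^u+be^s$ with $|a|,|b|<5\delta$, $I(x,y,z)=(x,1+Q(a,b,y-1),z')$, where $z'=p_2+P(a,b,\pi_2(y-1),d,e)e^u+e\,e^s$ if $z=p_2+de^u+e\,e^s$ with $|d|,|e|<5\delta$, and $z'=z$ otherwise; (iii) if $x=q_1+ae^u+be^s$ with $|a|,|b|<5\delta$, $I(x,y,z)=(x,Q(a,b,y),z)$; (iv) if $x=q_2+ae^u+be^s$ with $|a|,|b|<5\delta$, $I(x,y,z)=(x,1+Q(a,b,y-1),z)$; (v) $I$ is the identity elsewhere. Let $f=(A^{n_1}\times\mathrm{id}\times A^{n_0})\circ I$, where $n_1$ is a sufficiently large multiple of $n_0$, namely: denoting by $E^{uu},E^{ss}$ (resp. $E^u,E^s$) the line fields on $M$ in directions $e^u,e^s$ of the first (resp. last) torus factor and by $T\mathbb{S}$ the direction of $\mathbb{S}$, the largest eigenvalue $\sigma_1$ of $A^{n_1}$ is larger than all first partial derivatives of $\sigma_0P$ and $Q$ (and than $(\min \partial_cQ)^{-1}$), and for some $\tau_1>0$ the cones $\mathscr C_{\tau_1}(E^{uu},E^u\oplus T\mathbb{S}\oplus E^s)$ and $\mathscr C_{\tau_1}(E^{ss},E^u\oplus T\mathbb{S}\oplus E^s)$ are respectively forward and backward invariant under $f$. Splitting. $f$ has a dominated splitting $TM=\widetilde{E^{uu}}\oplus_\succ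 E^{cu}\oplus_\succ E^{cs}$ with dimensions $1,1,3$ and $\widetilde{E^{uu}}$ uniformly expanding (here $E^{cu}=E^u$). A diffeomorphism $\widetilde f$ has a partially hyperbolic splitting of the same type as $f$ if it has a (necessarily unique) dominated splitting of dimensions $1,1,3$ whose first bundle is uniformly expanding; its third bundle is again denoted $E^{cs}$. All diffeomorphisms sufficiently $C^1$-close to $f$ have this property. Skeleton of $\widetilde f$. $W^s(\mathrm{Orb}(p))$ is the set of points whose forward orbit converges to the orbit of $p$, and $W^u$ is $W^s$ for the inverse map. A finite set $S$ is a skeleton if each element is a hyperbolic periodic point of $\widetilde f$ with stable index $\dim E^{cs}$ and: (a) every $C^1$ disk $D$ transverse to $E^{cs}$ intersects $W^s(\mathrm{Orb}(p))$ transversely for some $p\in S$; (b) for distinct $p,q\in S$, $W^s(\mathrm{Orb}(p))\cap W^u(\mathrm{Orb}(q))=\varnothing$. *)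

theory Defs
  imports "HOL-Analysis.Analysis"
begin

section \<open>The flat tori as quotients\<close>

lemma infdist_subgroup_shift:
  fixes L :: "'a::real_normed_vector set"
  assumes add: "\<And>a b. a \<in> L \<Longrightarrow> b \<in> L \<Longrightarrow> a + b \<in> L"
    and neg: "\<And>a. a \<in> L \<Longrightarrow> - a \<in> L" and l: "l \<in> L"
  shows "infdist (v + l) L = infdist v L"
proof -
  have le: "infdist (w + m) L \<le> infdist w L" if m: "m \<in> L" for w m
  proof -
    have ne: "L \<noteq> {}" using m by blast
    have "infdist (w + m) L \<le> dist w a" if "a \<in> L" for a
      using infdist_le[OF add[OF that m], of "w + m"] by (simp add: dist_norm)
    then show ?thesis
      unfolding infdist_notempty[OF ne, of w] by (intro cINF_greatest ne) auto
  qed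
  from le[OF l, of v] le[OF neg[OF l], of "v + l"] show ?thesis by simp
qed

lemma infdist_subgroup_minus:
  fixes L :: "'a::real_normed_vector set"
  assumes neg: "\<And>a. a \<in> L \<Longrightarrow> - a \<in> L" and zero: "0 \<in> L"
  shows "infdist (- v) L = infdist v L"
proof -
  have le: "infdist (- w) L \<le> infdist w L" for w
  proof -
    have ne: "L \<noteq> {}" using zero by blast
    have "infdist (- w) L \<le> dist w a" if "a \<in> L" for a
      using infdist_le[OF neg[OF that], of "- w"] by (simp add: dist_norm norm_minus_commute)
    then show ?thesis
      unfolding infdist_notempty[OF ne, of w] by (intro cINF_greatest ne) auto
  qed
  from le[of v] le[of "- v"] show ?thesis by simp
qed

lemma infdist_subgroup_triangle:
  fixes L :: "'a::real_normed_vector set"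
  assumes add: "\<And>a b. a \<in> L \<Longrightarrow> b \<in> L \<Longrightarrow> a + b \<in> L"
    and neg: "\<And>a. a \<in> L \<Longrightarrow> - a \<in> L" and zero: "0 \<in> L"
  shows "infdist (u + v) L \<le> infdist u L + infdist v L"
proof -
  have ne: "L \<noteq> {}" using zero by blast
  have "infdist (u + v) L - infdist v L \<le> dist u a" if a: "a \<in> L" for a
  proof -
    have "infdist (u + v) L = infdist (u + v + - a) L"
      using infdist_subgroup_shift[OF add neg neg[OF a]] by simp
    also have "\<dots> \<le> infdist v L + dist (u + v + - a) v" by (rule infdist_triangle)
    also have "dist (u + v + - a) v = dist u a" by (simp add: dist_norm)
    finally show ?thesis by simp
  qed
  then have "infdist (u + v) L - infdist v L \<le> infdist u L"
    unfolding infdist_notempty[OF ne, of u] by (intro cINF_greatest ne) auto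
  then show ?thesis by simp
qed

definition int_lattice :: "(real^2) set" where
  "int_lattice = {v. \<forall>i. v $ i \<in> \<int>}"

lemma int_lattice_add: "v \<in> int_lattice \<Longrightarrow> w \<in> int_lattice \<Longrightarrow> v + w \<in> int_lattice"
  and int_lattice_minus: "v \<in> int_lattice \<Longrightarrow> - v \<in> int_lattice"
  and int_lattice_zero: "0 \<in> int_lattice"
  by (auto simp: int_lattice_def)

lemma closed_int_lattice: "closed int_lattice"
  unfolding int_lattice_def
proof (rule closed_Collect_all)
  fix i :: 2
  have "closed ((\<lambda>v::real^2. v $ i) -` \<int>)"
    by (intro closed_vimage closed_Ints continuous_intros)
  then show "closed {v::real^2. v $ i \<in> \<int>}" by (simp add: vimage_def)
qed

text \<open>The two-torus \<open>\<real>\<^sup>2 / \<int>\<^sup>2\<close>.\<close>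

quotient_type torus = "real^2" / "\<lambda>v w. v - w \<in> int_lattice"
proof (rule equivpI)
  show "reflp (\<lambda>v w. v - w \<in> int_lattice)"
    by (auto intro!: reflpI simp: int_lattice_zero)
  show "symp (\<lambda>v w. v - w \<in> int_lattice)"
    by (rule sympI) (use int_lattice_minus in fastforce)
  show "transp (\<lambda>v w. v - w \<in> int_lattice)"
    by (rule transpI) (use int_lattice_add in fastforce)
qed

instantiation torus :: ab_group_add
begin

lift_definition zero_torus :: torus is 0 .
lift_definition plus_torus :: "torus \<Rightarrow> torus \<Rightarrow> torus" is "(+)"
  by (metis add_diff_add int_lattice_add)
lift_definition uminus_torus :: "torus \<Rightarrow> torus" is uminus
  by (metis int_lattice_minus minus_diff_minus)
lift_definition minus_torus :: "torus \<Rightarrow> torus \<Rightarrow> torus" is "(-)"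
proof -
  fix a b c d :: "real^2"
  assume "a - b \<in> int_lattice" "c - d \<in> int_lattice"
  from int_lattice_add[OF this(1) int_lattice_minus[OF this(2)]]
  show "a - c - (b - d) \<in> int_lattice" by (simp add: algebra_simps)
qed

instance
  by standard (transfer; simp add: int_lattice_zero algebra_simps)+

end

text \<open>The flat distance: \<open>infdist (v - w) int_lattice\<close> is the least distance between
  lifts of the two points.\<close>

instantiation torus :: metric_space
begin

lift_definition dist_torus :: "torus \<Rightarrow> torus \<Rightarrow> real" is "\<lambda>v w. infdist (v - w) int_lattice"
proof -
  fix a b c d :: "real^2"
  assume "a - b \<in> int_lattice" "c - d \<in> int_lattice"
  from int_lattice_add[OF this(1) int_lattice_minus[OF this(2)]]
  have "infdist ((b - d) + ((a - b) + - (c - d))) int_lattice = infdist (b - d) int_lattice"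
    by (rule infdist_subgroup_shift[rotated 2]) (fact int_lattice_add int_lattice_minus)+
  then show "infdist (a - c) int_lattice = infdist (b - d) int_lattice"
    by (simp add: algebra_simps)
qed

definition uniformity_torus :: "(torus \<times> torus) filter" where
  "uniformity_torus = (INF e\<in>{0<..}. principal {(x, y). dist x y < e})"

definition open_torus :: "torus set \<Rightarrow> bool" where
  "open_torus U = (\<forall>x\<in>U. eventually (\<lambda>(x', y). x' = x \<longrightarrow> y \<in> U) uniformity)"

instance
proof
  fix x y z :: torus
  show "(dist x y = 0) = (x = y)"
    by transfer
      (use in_closed_iff_infdist_zero[OF closed_int_lattice] int_lattice_zero in auto)
  show "dist x y \<le> dist x z + dist y z"
  proof transfer
    fix x y z :: "real^2"
    have "infdist (x - z + (z - y)) int_lattice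
        \<le> infdist (x - z) int_lattice + infdist (z - y) int_lattice"
      by (rule infdist_subgroup_triangle[OF int_lattice_add int_lattice_minus int_lattice_zero])
    moreover have "infdist (z - y) int_lattice = infdist (y - z) int_lattice"
      using infdist_subgroup_minus[OF int_lattice_minus int_lattice_zero, of "y - z"] by simp
    ultimately show "infdist (x - y) int_lattice
        \<le> infdist (x - z) int_lattice + infdist (y - z) int_lattice" by simp
  qed
qed (simp_all only: uniformity_torus_def open_torus_def)

end

definition even_lattice :: "real set" where
  "even_lattice = {t. t / 2 \<in> \<int>}"

lemma even_lattice_add: "s \<in> even_lattice \<Longrightarrow> t \<in> even_lattice \<Longrightarrow> s + t \<in> even_lattice"
  and even_lattice_minus: "t \<in> even_lattice \<Longrightarrow> - t \<in> even_lattice"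
  and even_lattice_zero: "0 \<in> even_lattice"
  by (auto simp: even_lattice_def add_divide_distrib)

lemma closed_even_lattice: "closed even_lattice"
proof -
  have "closed ((\<lambda>t::real. t / 2) -` \<int>)"
    by (intro closed_vimage closed_Ints continuous_intros) auto
  then show ?thesis by (simp add: even_lattice_def vimage_def)
qed

text \<open>The circle \<open>\<real> / 2\<int>\<close>.\<close>

quotient_type circle = real / "\<lambda>s t. s - t \<in> even_lattice"
proof (rule equivpI)
  show "reflp (\<lambda>s t. s - t \<in> even_lattice)"
    by (auto intro!: reflpI simp: even_lattice_zero)
  show "symp (\<lambda>s t. s - t \<in> even_lattice)"
    by (rule sympI) (use even_lattice_minus in fastforce)
  show "transp (\<lambda>s t. s - t \<in> even_lattice)"
    by (rule transpI) (use even_lattice_add in fastforce)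
qed

instantiation circle :: ab_group_add
begin

lift_definition zero_circle :: circle is 0 .
lift_definition plus_circle :: "circle \<Rightarrow> circle \<Rightarrow> circle" is "(+)"
  by (metis add_diff_add even_lattice_add)
lift_definition uminus_circle :: "circle \<Rightarrow> circle" is uminus
  by (metis even_lattice_minus minus_diff_minus)
lift_definition minus_circle :: "circle \<Rightarrow> circle \<Rightarrow> circle" is "(-)"
proof -
  fix a b c d :: real
  assume "a - b \<in> even_lattice" "c - d \<in> even_lattice"
  from even_lattice_add[OF this(1) even_lattice_minus[OF this(2)]]
  show "a - c - (b - d) \<in> even_lattice" by (simp add: algebra_simps)
qed

instance
  by standard (transfer; simp add: even_lattice_zero algebra_simps)+

end

instantiation circle :: metric_space
begin

lift_definition dist_circle :: "circle \<Rightarrow> circle \<Rightarrow> real" is "\<lambda>s t. infdist (s - t) even_lattice"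
proof -
  fix a b c d :: real
  assume "a - b \<in> even_lattice" "c - d \<in> even_lattice"
  from even_lattice_add[OF this(1) even_lattice_minus[OF this(2)]]
  have "infdist ((b - d) + ((a - b) + - (c - d))) even_lattice = infdist (b - d) even_lattice"
    by (rule infdist_subgroup_shift[rotated 2]) (fact even_lattice_add even_lattice_minus)+
  then show "infdist (a - c) even_lattice = infdist (b - d) even_lattice"
    by (simp add: algebra_simps)
qed

definition uniformity_circle :: "(circle \<times> circle) filter" where
  "uniformity_circle = (INF e\<in>{0<..}. principal {(x, y). dist x y < e})"

definition open_circle :: "circle set \<Rightarrow> bool" where
  "open_circle U = (\<forall>x\<in>U. eventually (\<lambda>(x', y). x' = x \<longrightarrow> y \<in> U) uniformity)"

instance
proof
  fix x y z :: circle
  show "(dist x y = 0) = (x = y)"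
    by transfer
      (use in_closed_iff_infdist_zero[OF closed_even_lattice] even_lattice_zero in auto)
  show "dist x y \<le> dist x z + dist y z"
  proof transfer
    fix x y z :: real
    have "infdist (x - z + (z - y)) even_lattice
        \<le> infdist (x - z) even_lattice + infdist (z - y) even_lattice"
      by (rule infdist_subgroup_triangle[OF even_lattice_add even_lattice_minus even_lattice_zero])
    moreover have "infdist (z - y) even_lattice = infdist (y - z) even_lattice"
      using infdist_subgroup_minus[OF even_lattice_minus even_lattice_zero, of "y - z"] by simp
    ultimately show "infdist (x - y) even_lattice
        \<le> infdist (x - z) even_lattice + infdist (y - z) even_lattice" by simp
  qed
qed (simp_all only: uniformity_circle_def open_circle_def)

end


section \<open>Calculus on the five-dimensional manifold\<close>

text \<open>The manifold carries the product metric.  Its universal cover is the Euclidean space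
  \<open>cover\<close>; the map \<open>covering\<close> is a local isometry whose local inverses are the charts, and
  by translation every tangent space is identified with \<open>cover\<close>.\<close>

type_synonym mfd = "torus \<times> circle \<times> torus"
type_synonym cover = "(real^2) \<times> real \<times> (real^2)"

definition covering :: "cover \<Rightarrow> mfd" where
  "covering = map_prod abs_torus (map_prod abs_circle abs_torus)"

primrec Ck_on :: "nat \<Rightarrow> 'a::real_normed_vector set \<Rightarrow> ('a \<Rightarrow> 'b::real_normed_vector) \<Rightarrow> bool" where
  "Ck_on 0 U f \<longleftrightarrow> continuous_on U f"
| "Ck_on (Suc k) U f \<longleftrightarrow> (\<forall>x\<in>U. f differentiable (at x)) \<and>
     (\<forall>v. Ck_on k U (\<lambda>x. frechet_derivative f (at x) v))"

definition smooth :: "('a::real_normed_vector \<Rightarrow> 'b::real_normed_vector) \<Rightarrow> bool" where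
  "smooth f \<longleftrightarrow> (\<forall>k. Ck_on k UNIV f)"

text \<open>Derivative of a manifold-valued map, read off from a local lift \<open>G\<close> to the cover.\<close>

definition has_lift_derivative ::
  "('a::real_normed_vector \<Rightarrow> mfd) \<Rightarrow> ('a \<Rightarrow> cover) \<Rightarrow> 'a \<Rightarrow> 'a set \<Rightarrow> bool" where
  "has_lift_derivative h D v S \<longleftrightarrow>
     (\<exists>G. covering (G v) = h v \<and> (\<forall>\<^sub>F w in at v within S. covering (G w) = h w) \<and>
          (G has_derivative D) (at v within S))"

definition tangent_map :: "(mfd \<Rightarrow> mfd) \<Rightarrow> mfd \<Rightarrow> cover \<Rightarrow> cover" where
  "tangent_map g x = (THE D. \<exists>a. covering a = x \<and> has_lift_derivative (g \<circ> covering) D a UNIV)"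

definition Ck_map :: "nat \<Rightarrow> (mfd \<Rightarrow> mfd) \<Rightarrow> bool" where
  "Ck_map k g \<longleftrightarrow>
     (\<forall>a. \<exists>U G. open U \<and> a \<in> U \<and> Ck_on k U G \<and> (\<forall>u\<in>U. covering (G u) = g (covering u)))"

definition Ck_diffeo :: "nat \<Rightarrow> (mfd \<Rightarrow> mfd) \<Rightarrow> bool" where
  "Ck_diffeo k g \<longleftrightarrow> bij g \<and> Ck_map k g \<and> Ck_map k (inv g)"

definition smooth_diffeo :: "(mfd \<Rightarrow> mfd) \<Rightarrow> bool" where
  "smooth_diffeo g \<longleftrightarrow> (\<forall>k. Ck_diffeo k g)"

text \<open>Neighbourhoods of \<open>f\<close> in the space of \<open>C\<^sup>1\<close> diffeomorphisms.\<close>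

definition C1_neighbourhood :: "(mfd \<Rightarrow> mfd) \<Rightarrow> (mfd \<Rightarrow> mfd) set \<Rightarrow> bool" where
  "C1_neighbourhood f U \<longleftrightarrow>
     (\<exists>\<epsilon>>0. \<forall>g. Ck_diffeo 1 g \<and>
        (\<forall>x. dist (f x) (g x) < \<epsilon> \<and>
             onorm (\<lambda>v. tangent_map f x v - tangent_map g x v) < \<epsilon>) \<longrightarrow> g \<in> U)"


section \<open>Subbundles, domination and cones\<close>

type_synonym subbundle = "mfd \<Rightarrow> cover set"

definition subspace_sum :: "'a::real_vector set \<Rightarrow> 'a set \<Rightarrow> 'a set" where
  "subspace_sum V W = {v + w |v w. v \<in> V \<and> w \<in> W}"

definition bundle_sum :: "subbundle \<Rightarrow> subbundle \<Rightarrow> subbundle" where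
  "bundle_sum E F = (\<lambda>x. subspace_sum (E x) (F x))"

definition invariant_bundle :: "(mfd \<Rightarrow> mfd) \<Rightarrow> subbundle \<Rightarrow> bool" where
  "invariant_bundle f E \<longleftrightarrow>
     (\<forall>x. subspace (E x)) \<and> (\<exists>d. \<forall>x. dim (E x) = d) \<and>
     (\<forall>x. tangent_map f x ` E x = E (f x))"

definition vec_angle :: "'a::real_inner \<Rightarrow> 'a \<Rightarrow> real" where
  "vec_angle v w = arccos ((v \<bullet> w) / (norm v * norm w))"

definition dominates :: "(mfd \<Rightarrow> mfd) \<Rightarrow> subbundle \<Rightarrow> subbundle \<Rightarrow> bool" where
  "dominates f E F \<longleftrightarrow>
     invariant_bundle f E \<and> invariant_bundle f F \<and> (\<forall>x. E x \<inter> F x = {0}) \<and>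
     (\<exists>\<theta>>0. \<forall>x. \<forall>v\<in>E x - {0}. \<forall>w\<in>F x - {0}. vec_angle v w \<ge> \<theta>) \<and>
     (\<exists>c>0. \<exists>\<sigma><1. \<forall>x. \<forall>v\<in>E x - {0}. \<forall>w\<in>F x - {0}. \<forall>n\<ge>1.
        norm (tangent_map (f ^^ n) x w) / norm (tangent_map (f ^^ n) x v)
          \<le> c * \<sigma> ^ n * (norm w / norm v))"

definition uniformly_expanding :: "(mfd \<Rightarrow> mfd) \<Rightarrow> subbundle \<Rightarrow> bool" where
  "uniformly_expanding f E \<longleftrightarrow>
     (\<exists>c>0. \<exists>\<sigma>. 0 < \<sigma> \<and> \<sigma> < 1 \<and>
        (\<forall>x. \<forall>v\<in>E x. \<forall>n. norm v \<le> c * \<sigma> ^ n * norm (tangent_map (f ^^ n) x v)))"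

text \<open>\<open>Euu \<oplus>\<^sub>\<succ> Ecu \<oplus>\<^sub>\<succ> Ecs\<close>, associated to the left; this also yields domination of \<open>Ecu \<oplus> Ecs\<close> by
  \<open>Euu\<close>.\<close>

definition ph_splitting :: "(mfd \<Rightarrow> mfd) \<Rightarrow> subbundle \<Rightarrow> subbundle \<Rightarrow> subbundle \<Rightarrow> bool" where
  "ph_splitting f Euu Ecu Ecs \<longleftrightarrow>
     dominates f Euu Ecu \<and> dominates f (bundle_sum Euu Ecu) Ecs \<and>
     (\<forall>x. dim (Euu x) = 1 \<and> dim (Ecu x) = 1 \<and> dim (Ecs x) = 3 \<and>
          subspace_sum (bundle_sum Euu Ecu x) (Ecs x) = UNIV) \<and>
     uniformly_expanding f Euu"

definition cone_field :: "real \<Rightarrow> subbundle \<Rightarrow> subbundle \<Rightarrow> subbundle" where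
  "cone_field \<alpha> E F = (\<lambda>x. {v + w |v w. v \<in> E x \<and> w \<in> F x \<and> norm w \<le> \<alpha> * norm v})"

text \<open>Backward invariance under \<open>f\<close> is forward invariance under \<open>inv f\<close>.\<close>

definition cone_invariant :: "(mfd \<Rightarrow> mfd) \<Rightarrow> real \<Rightarrow> subbundle \<Rightarrow> subbundle \<Rightarrow> bool" where
  "cone_invariant f \<alpha> E F \<longleftrightarrow>
     (\<exists>\<kappa>. 0 < \<kappa> \<and> \<kappa> < 1 \<and> (\<forall>x. tangent_map f x ` cone_field \<alpha> E F x \<subseteq> cone_field (\<kappa> * \<alpha>) E F (f x)))"


section \<open>Skeletons\<close>

definition orbit :: "(mfd \<Rightarrow> mfd) \<Rightarrow> mfd \<Rightarrow> mfd set" where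
  "orbit f p = range (\<lambda>n. (f ^^ n) p)"

definition Ws :: "(mfd \<Rightarrow> mfd) \<Rightarrow> mfd \<Rightarrow> mfd set" where
  "Ws f p = {x. (\<lambda>n. infdist ((f ^^ n) x) (orbit f p)) \<longlonglongrightarrow> 0}"

definition Wu :: "(mfd \<Rightarrow> mfd) \<Rightarrow> mfd \<Rightarrow> mfd set" where
  "Wu f p = Ws (inv f) p"

text \<open>A complex eigenvalue \<open>\<mu>\<close> of a real linear map, with eigenvector \<open>v + \<i> w\<close>.\<close>

definition complex_eigenvalue :: "('a::real_vector \<Rightarrow> 'a) \<Rightarrow> complex \<Rightarrow> bool" where
  "complex_eigenvalue L \<mu> \<longleftrightarrow>
     (\<exists>v w. (v, w) \<noteq> (0, 0) \<and>
        L v = Re \<mu> *\<^sub>R v - Im \<mu> *\<^sub>R w \<and> L w = Im \<mu> *\<^sub>R v + Re \<mu> *\<^sub>R w)"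

text \<open>Here \<open>n\<close> is any positive multiple of the period; neither hyperbolicity nor the stable index
  depends on its choice.\<close>

definition hyperbolic_periodic :: "(mfd \<Rightarrow> mfd) \<Rightarrow> mfd \<Rightarrow> nat \<Rightarrow> bool" where
  "hyperbolic_periodic f p n \<longleftrightarrow>
     n \<ge> 1 \<and> (f ^^ n) p = p \<and> (\<forall>\<mu>. complex_eigenvalue (tangent_map (f ^^ n) p) \<mu> \<longrightarrow> norm \<mu> \<noteq> 1)"

definition stable_index :: "(mfd \<Rightarrow> mfd) \<Rightarrow> mfd \<Rightarrow> nat \<Rightarrow> nat" where
  "stable_index f p n = dim {v. (\<lambda>m. (tangent_map (f ^^ n) p ^^ m) v) \<longlonglongrightarrow> 0}"

text \<open>A \<open>C\<^sup>1\<close> disk of dimension \<open>dim V\<close>: the embedding \<open>h\<close> of the closed unit ball of a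
  linear subspace \<open>V\<close>.  (The ambient space of \<open>V\<close> is only a convenient source of subspaces of all
  dimensions up to five.)  The tangent space at \<open>h v\<close> is \<open>h' v ` V\<close>.\<close>

definition C1_disk :: "cover set \<Rightarrow> (cover \<Rightarrow> mfd) \<Rightarrow> (cover \<Rightarrow> cover \<Rightarrow> cover) \<Rightarrow> bool" where
  "C1_disk V h h' \<longleftrightarrow>
     subspace V \<and> inj_on h (V \<inter> cball 0 1) \<and>
     (\<forall>v\<in>V \<inter> cball 0 1. has_lift_derivative h (h' v) v (V \<inter> cball 0 1) \<and> inj_on (h' v) V) \<and>
     (\<forall>w\<in>V. continuous_on (V \<inter> cball 0 1) (\<lambda>v. h' v w))"

definition disk_transverse :: "cover set \<Rightarrow> (cover \<Rightarrow> mfd) \<Rightarrow> (cover \<Rightarrow> cover \<Rightarrow> cover) \<Rightarrow> subbundle \<Rightarrow> bool" where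
  "disk_transverse V h h' E \<longleftrightarrow>
     (\<forall>v\<in>V \<inter> cball 0 1. subspace_sum (h' v ` V) (E (h v)) = UNIV)"

text \<open>The stable set of a hyperbolic orbit is an injectively immersed submanifold; its tangent
  space at a point is that of an embedded disk of full dimension \<open>d\<close> contained in it.\<close>

definition meets_transversely ::
  "cover set \<Rightarrow> (cover \<Rightarrow> mfd) \<Rightarrow> (cover \<Rightarrow> cover \<Rightarrow> cover) \<Rightarrow> nat \<Rightarrow> mfd set \<Rightarrow> bool" where
  "meets_transversely V h h' d W \<longleftrightarrow>
     (\<exists>X k k'. C1_disk X k k' \<and> dim X = d \<and> k ` (X \<inter> cball 0 1) \<subseteq> W \<and>
        (\<exists>v\<in>V \<inter> cball 0 1. \<exists>w\<in>X \<inter> cball 0 1.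
           h v = k w \<and> subspace_sum (h' v ` V) (k' w ` X) = UNIV))"

definition skeleton :: "(mfd \<Rightarrow> mfd) \<Rightarrow> subbundle \<Rightarrow> mfd set \<Rightarrow> bool" where
  "skeleton f Ecs S \<longleftrightarrow>
     finite S \<and>
     (\<forall>p\<in>S. \<exists>n. hyperbolic_periodic f p n \<and> stable_index f p n = dim (Ecs p)) \<and>
     (\<forall>V h h'. C1_disk V h h' \<and> disk_transverse V h h' Ecs \<longrightarrow>
        (\<exists>p\<in>S. meets_transversely V h h' (dim (Ecs p)) (Ws f p))) \<and>
     (\<forall>p\<in>S. \<forall>q\<in>S. p \<noteq> q \<longrightarrow> Ws f p \<inter> Wu f q = {})"


section \<open>The construction\<close>

definition \<delta> :: real where "\<delta> = 1 / 10000"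

definition cat_matrix :: "real^2^2" where
  "cat_matrix = vector [vector [2, 1], vector [1, 1]]"

lift_definition cat_map :: "torus \<Rightarrow> torus" is "\<lambda>v. cat_matrix *v v"
proof -
  have "cat_matrix *v u \<in> int_lattice" if "u \<in> int_lattice" for u
    using that by (auto simp: int_lattice_def cat_matrix_def matrix_vector_mult_def sum_2 forall_2)
  moreover fix v w :: "real^2"
  assume "v - w \<in> int_lattice"
  ultimately show "cat_matrix *v v - cat_matrix *v w \<in> int_lattice"
    by (simp flip: matrix_vector_mult_diff_distrib)
qed

definition cat_pow_max_eigenvalue :: "nat \<Rightarrow> real" where
  "cat_pow_max_eigenvalue n = Max {\<mu>. \<exists>v. v \<noteq> 0 \<and> (((*v) cat_matrix) ^^ n) v = \<mu> *\<^sub>R v}"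

definition cat_eigenbasis :: "real^2 \<Rightarrow> real^2 \<Rightarrow> bool" where
  "cat_eigenbasis eu es \<longleftrightarrow>
     norm eu = 1 \<and> norm es = 1 \<and> eu \<bullet> es = 0 \<and>
     (\<exists>\<mu>. \<bar>\<mu>\<bar> > 1 \<and> cat_matrix *v eu = \<mu> *\<^sub>R eu) \<and>
     (\<exists>\<mu>. \<bar>\<mu>\<bar> < 1 \<and> cat_matrix *v es = \<mu> *\<^sub>R es)"

definition bump :: "(real \<Rightarrow> real) \<Rightarrow> bool" where
  "bump \<psi> \<longleftrightarrow>
     smooth \<psi> \<and> (\<forall>t. \<psi> (- t) = \<psi> t) \<and> (\<forall>t\<in>{0..\<delta>/2}. \<psi> t = 1) \<and> (\<forall>t\<ge>\<delta>. \<psi> t = 0) \<and>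
     (strict_mono_on {\<delta>/2<..<\<delta>} \<psi> \<or> strict_antimono_on {\<delta>/2<..<\<delta>} \<psi>)"

text \<open>The infimum is a minimum: \<open>deriv \<phi>\<close> is continuous and periodic, \<open>\<psi>\<close> has compact support.\<close>

definition circle_diffeo :: "(real \<Rightarrow> real) \<Rightarrow> (real \<Rightarrow> real) \<Rightarrow> bool" where
  "circle_diffeo \<psi> \<phi> \<longleftrightarrow>
     bij \<phi> \<and> smooth \<phi> \<and> smooth (inv \<phi>) \<and> (\<forall>t. \<phi> (t + 2) = \<phi> t + 2) \<and>
     {t\<in>{0..2}. \<phi> t = t} = {0, 1, 2} \<and> deriv \<phi> 0 = 1/2 \<and> deriv \<phi> 1 = 3/2 \<and>
     1 + (INF (s, t)\<in>UNIV. (deriv \<phi> s - 1) * \<psi> t) > 0"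

definition Q_fun :: "(real \<Rightarrow> real) \<Rightarrow> (real \<Rightarrow> real) \<Rightarrow> real \<Rightarrow> real \<Rightarrow> real \<Rightarrow> real" where
  "Q_fun \<psi> \<phi> a b c = c + \<psi> (sqrt (a\<^sup>2 + b\<^sup>2)) * (\<phi> c - c)"

text \<open>The extrema below are attained, since the derivative is periodic in \<open>c\<close> and equal to \<open>1\<close>
  for large \<open>(a, b)\<close>.\<close>

definition max_dQ :: "(real \<Rightarrow> real) \<Rightarrow> (real \<Rightarrow> real) \<Rightarrow> real" where
  "max_dQ \<psi> \<phi> = (SUP (a, b, c)\<in>UNIV. deriv (Q_fun \<psi> \<phi> a b) c)"

definition min_dQ :: "(real \<Rightarrow> real) \<Rightarrow> (real \<Rightarrow> real) \<Rightarrow> real" where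
  "min_dQ \<psi> \<phi> = (INF (a, b, c)\<in>UNIV. deriv (Q_fun \<psi> \<phi> a b) c)"

definition P_fun :: "(real \<Rightarrow> real) \<Rightarrow> real \<Rightarrow> real \<Rightarrow> real \<Rightarrow> real \<Rightarrow> real \<Rightarrow> real \<Rightarrow> real \<Rightarrow> real" where
  "P_fun \<psi> k \<sigma>0 a b c d e =
     d + \<psi> (k * d) * \<psi> (k * sqrt (a\<^sup>2 + b\<^sup>2 + c\<^sup>2 + e\<^sup>2)) * (3 * d / (4 * \<sigma>0) - d)"

definition circle_rep :: "circle \<Rightarrow> real" where
  "circle_rep y = (THE t. -1 \<le> t \<and> t < 1 \<and> abs_circle t = y)"

definition box_point :: "real^2 \<Rightarrow> real^2 \<Rightarrow> torus \<Rightarrow> real \<Rightarrow> real \<Rightarrow> torus" where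
  "box_point eu es p a b = p + abs_torus (a *\<^sub>R eu + b *\<^sub>R es)"

definition in_box :: "real^2 \<Rightarrow> real^2 \<Rightarrow> torus \<Rightarrow> torus \<Rightarrow> bool" where
  "in_box eu es p x \<longleftrightarrow> (\<exists>a b. \<bar>a\<bar> < 5 * \<delta> \<and> \<bar>b\<bar> < 5 * \<delta> \<and> x = box_point eu es p a b)"

definition box_coords :: "real^2 \<Rightarrow> real^2 \<Rightarrow> torus \<Rightarrow> torus \<Rightarrow> real \<times> real" where
  "box_coords eu es p x =
     (THE (a, b). \<bar>a\<bar> < 5 * \<delta> \<and> \<bar>b\<bar> < 5 * \<delta> \<and> x = box_point eu es p a b)"

definition last_factor ::
  "(real \<Rightarrow> real) \<Rightarrow> real \<Rightarrow> real \<Rightarrow> real^2 \<Rightarrow> real^2 \<Rightarrow> torus \<Rightarrow> real \<Rightarrow> real \<Rightarrow> real \<Rightarrow> torus \<Rightarrow> torus" where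
  "last_factor \<psi> k \<sigma>0 eu es p a b c z =
     (if in_box eu es p z
      then (let (d, e) = box_coords eu es p z in box_point eu es p (P_fun \<psi> k \<sigma>0 a b c d e) e)
      else z)"

text \<open>The boxes around the four fixed points may overlap near their corners, but all clauses give
  the identity there, so the order of the cases is immaterial.  Since \<open>Q_fun \<psi> \<phi> a b\<close> commutes
  with the translation by \<open>2\<close>, it may be applied to the representative of the circle point.\<close>

definition I_map ::
  "(real \<Rightarrow> real) \<Rightarrow> (real \<Rightarrow> real) \<Rightarrow> real \<Rightarrow> real \<Rightarrow> real^2 \<Rightarrow> real^2 \<Rightarrow>
   torus \<Rightarrow> torus \<Rightarrow> torus \<Rightarrow> torus \<Rightarrow> mfd \<Rightarrow> mfd" where
  "I_map \<psi> \<phi> k \<sigma>0 eu es p1 p2 q1 q2 = (\<lambda>(x, y, z).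
     let c = circle_rep y; c' = circle_rep (y - abs_circle 1) in
     if in_box eu es p1 x then
       let (a, b) = box_coords eu es p1 x in
         (x, abs_circle (Q_fun \<psi> \<phi> a b c), last_factor \<psi> k \<sigma>0 eu es p1 a b c z)
     else if in_box eu es p2 x then
       let (a, b) = box_coords eu es p2 x in
         (x, abs_circle (1 + Q_fun \<psi> \<phi> a b c'), last_factor \<psi> k \<sigma>0 eu es p2 a b c' z)
     else if in_box eu es q1 x then
       let (a, b) = box_coords eu es q1 x in (x, abs_circle (Q_fun \<psi> \<phi> a b c), z)
     else if in_box eu es q2 x then
       let (a, b) = box_coords eu es q2 x in (x, abs_circle (1 + Q_fun \<psi> \<phi> a b c'), z)
     else (x, y, z))"

definition f_map ::
  "(real \<Rightarrow> real) \<Rightarrow> (real \<Rightarrow> real) \<Rightarrow> real \<Rightarrow> real \<Rightarrow> real^2 \<Rightarrow> real^2 \<Rightarrow>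
   torus \<Rightarrow> torus \<Rightarrow> torus \<Rightarrow> torus \<Rightarrow> nat \<Rightarrow> nat \<Rightarrow> mfd \<Rightarrow> mfd" where
  "f_map \<psi> \<phi> k \<sigma>0 eu es p1 p2 q1 q2 n0 n1 =
     map_prod (cat_map ^^ n1) (map_prod id (cat_map ^^ n0)) \<circ> I_map \<psi> \<phi> k \<sigma>0 eu es p1 p2 q1 q2"

text \<open>The fixed points and the parameters \<open>n0\<close>, \<open>\<beta>\<close>, \<open>k\<close>.\<close>

definition base_parameters ::
  "(real \<Rightarrow> real) \<Rightarrow> (real \<Rightarrow> real) \<Rightarrow> torus \<Rightarrow> torus \<Rightarrow> torus \<Rightarrow> torus \<Rightarrow>
   nat \<Rightarrow> real \<Rightarrow> real \<Rightarrow> real \<Rightarrow> bool" where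
  "base_parameters \<psi> \<phi> p1 p2 q1 q2 n0 \<sigma>0 \<beta> k \<longleftrightarrow>
     n0 \<ge> 1 \<and> \<beta> > 0 \<and> k > 0 \<and> \<sigma>0 = cat_pow_max_eigenvalue n0 \<and>
     (\<forall>p\<in>{p1, p2, q1, q2}. (cat_map ^^ n0) p = p) \<and>
     dist p1 p2 > 10 * \<delta> \<and> dist p1 q1 > 10 * \<delta> \<and> dist p1 q2 > 10 * \<delta> \<and>
     dist p2 q1 > 10 * \<delta> \<and> dist p2 q2 > 10 * \<delta> \<and> dist q1 q2 > 10 * \<delta> \<and>
     \<sigma>0 \<ge> 10000 * max (max_dQ \<psi> \<phi>) (inverse (min_dQ \<psi> \<phi>)) \<and>
     \<beta> \<le> \<delta> / 2 * (1 / 10000) \<and>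
     2 * \<beta>\<^sup>2 * ln (3/4) + (1 - 2 * \<beta>\<^sup>2) * ln \<sigma>0 > 0 \<and>
     (\<forall>t\<in>{-\<beta>..\<beta>}. \<bar>deriv \<phi> t - 1/2\<bar> < 1 / 10000) \<and>
     3 * \<delta> / (2 * k) \<le> \<beta> / 10000"

text \<open>\<open>n1\<close> is sufficiently large: \<open>\<sigma>1\<close> exceeds every first partial derivative of \<open>\<sigma>0 P\<close> and of
  \<open>Q\<close>, and the strong cones in the direction of the first factor are invariant.\<close>

definition n1_large ::
  "(real \<Rightarrow> real) \<Rightarrow> (real \<Rightarrow> real) \<Rightarrow> real^2 \<Rightarrow> real^2 \<Rightarrow> nat \<Rightarrow> nat \<Rightarrow> real \<Rightarrow> real \<Rightarrow>
   (mfd \<Rightarrow> mfd) \<Rightarrow> bool" where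
  "n1_large \<psi> \<phi> eu es n0 n1 \<sigma>0 k f \<longleftrightarrow>
     n0 dvd n1 \<and>
     (let \<sigma>1 = cat_pow_max_eigenvalue n1;
          P0 = (\<lambda>a b c d e. \<sigma>0 * P_fun \<psi> k \<sigma>0 a b c d e);
          Euu = (\<lambda>x. span {(eu, 0, 0)});
          Ess = (\<lambda>x. span {(es, 0, 0)});
          Ec = (\<lambda>x. span {(0, 0, eu), (0, 1, 0), (0, 0, es)})
      in (\<forall>a b c d e.
            deriv (\<lambda>t. P0 t b c d e) a < \<sigma>1 \<and> deriv (\<lambda>t. P0 a t c d e) b < \<sigma>1 \<and>
            deriv (\<lambda>t. P0 a b t d e) c < \<sigma>1 \<and> deriv (\<lambda>t. P0 a b c t e) d < \<sigma>1 \<and>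
            deriv (\<lambda>t. P0 a b c d t) e < \<sigma>1) \<and>
         (\<forall>a b c.
            deriv (\<lambda>t. Q_fun \<psi> \<phi> t b c) a < \<sigma>1 \<and> deriv (\<lambda>t. Q_fun \<psi> \<phi> a t c) b < \<sigma>1 \<and>
            deriv (\<lambda>t. Q_fun \<psi> \<phi> a b t) c < \<sigma>1) \<and>
         inverse (min_dQ \<psi> \<phi>) < \<sigma>1 \<and>
         (\<exists>\<tau>>0. cone_invariant f \<tau> Euu Ec \<and> cone_invariant (inv f) \<tau> Ess Ec))"

end

(* The perturbation changes the fibre maps only near q1, adding to the displacement there a multiple of
   eps * (1 + cos (pi y)): the fibre point y = 1 stays fixed, while y = 0 is pushed upwards.  All
   derivatives are block triangular in the frame of the eigenvectors, so the dominated splitting is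
   found from bounded solutions of linear cohomological equations.  An iterate of a disk transverse
   to E^cs is long in the direction e^u of the first factor and meets the leaves that are stable for
   (q2, q2) there.  Over such a leaf the last factor is undeformed, hence E^cs is constant and equal to the
   tangent space of the stable set of (q2, 1, q2), and the only obstruction is that the circle
   coordinate may be trapped on the repelling level y = 0.  The disk then follows a homoclinic orbit
   through the neighbourhood of q1, where the push moves it off that level. *)

theory Submission
  imports Defs
begin

section \<open>Calculus of k times continuously differentiable maps\<close>

text \<open>For \<epsilon> = 0 every fibre map fixes both levels y = 0 and y = 1. Hence {y = 0} is
  invariant under f and misses the stable set of (q2, 1, q2), although it contains disks transverse
  to E^cs; so f itself does not have this skeleton and the invariance of that level has to be
  broken. The other obstacle is that E^cu is not uniformly expanding, since the deformation lets its
  rate drop to 3/4, so a disk cannot be made long along e^u of the last factor by iteration. The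
  condition there is met without any growth: over a leaf of q2 a small motion inside the disk
  changes the last e^u-coordinate freely, and the e^u-coordinates of lattice vectors are dense.
  Following the homoclinic orbit is a competition of rates. To be at distance of order 1 along e^u
  after m more steps, the disk parameter has size of order \<sigma>1^-m, while a deviation from the
  repelling level grows at most like the m-th power of \<open>max_dQ\<close>, which is smaller than
  \<sigma>1.\<close>

lemma Ck_on_cong:
  assumes "open U" "\<And>x. x \<in> U \<Longrightarrow> f x = g x" "Ck_on k U f"
  shows "Ck_on k U g"
  using assms(2,3)
proof (induction k arbitrary: f g)
  case 0
  then show ?case by (metis Ck_on.simps(1) continuous_on_cong)
next
  case (Suc k)
  have d: "(g has_derivative frechet_derivative f (at x)) (at x)" if "x \<in> U" for x
  proof (rule has_derivative_transform_within_open)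
    show "(f has_derivative frechet_derivative f (at x)) (at x)"
      using Suc.prems(2) that by (simp add: frechet_derivative_works)
  qed (use assms(1) that Suc.prems(1) in auto)
  have eq: "frechet_derivative f (at x) v = frechet_derivative g (at x) v" if "x \<in> U" for x v
    using frechet_derivative_at[OF d[OF that]] by simp
  have "Ck_on k U (\<lambda>x. frechet_derivative g (at x) v)" for v
    by (rule Suc.IH[of "\<lambda>x. frechet_derivative f (at x) v"]) (use Suc.prems(2) eq in auto)
  then show ?case using d by (auto simp: differentiable_def)
qed

text \<open>The working introduction rule: \<open>Ck_on\<close> speaks of the chosen
  \<open>frechet_derivative\<close>, which is replaced here by an explicit formula. U is open, so
  \<open>Ck_on_cong\<close> transfers the next order from the formula.\<close>

lemma Ck_on_Suc_has_derivative:
  assumes "open U" "\<And>x. x \<in> U \<Longrightarrow> (f has_derivative f' x) (at x)"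
    and "\<And>v. Ck_on k U (\<lambda>x. f' x v)"
  shows "Ck_on (Suc k) U f"
proof -
  have eq: "f' x v = frechet_derivative f (at x) v" if "x \<in> U" for x v
    using frechet_derivative_at[OF assms(2)[OF that]] by simp
  have "Ck_on k U (\<lambda>x. frechet_derivative f (at x) v)" for v
    by (rule Ck_on_cong[OF assms(1) eq assms(3)])
  then show ?thesis
    using assms(2) by (auto simp: differentiable_def)
qed

lemma Ck_on_SucD:
  assumes "Ck_on (Suc k) U f"
  shows "x \<in> U \<Longrightarrow> (f has_derivative frechet_derivative f (at x)) (at x)"
    and "Ck_on k U (\<lambda>x. frechet_derivative f (at x) v)"
  using assms frechet_derivative_works by auto

lemma Ck_on_subset: "Ck_on k U f \<Longrightarrow> W \<subseteq> U \<Longrightarrow> Ck_on k W f"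
  by (induction k arbitrary: f) (auto intro: continuous_on_subset)

lemma Ck_on_Suc_imp: "Ck_on (Suc k) U f \<Longrightarrow> Ck_on k U f"
proof (induction k arbitrary: f)
  case 0
  then show ?case
    by (auto intro!: continuous_at_imp_continuous_on differentiable_imp_continuous_within)
next
  case (Suc k)
  show ?case unfolding Ck_on.simps(2)[of k]
    using Suc.prems Suc.IH unfolding Ck_on.simps(2)[of "Suc k"] by blast
qed

lemma Ck_on_mono: "Ck_on k U f \<Longrightarrow> m \<le> k \<Longrightarrow> Ck_on m U f"
  by (induction k) (auto simp: le_Suc_eq simp del: Ck_on.simps dest: Ck_on_Suc_imp)

lemma Ck_on_imp_continuous_on: "Ck_on k U f \<Longrightarrow> continuous_on U f"
  using Ck_on_mono[of k U f 0] by simp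

text \<open>Derivatives are taken in the full space, so each of them depends on f near the point
  only.\<close>

lemma Ck_on_locally:
  assumes "\<And>x. x \<in> U \<Longrightarrow> \<exists>W. open W \<and> x \<in> W \<and> Ck_on k W f"
  shows "Ck_on k U f"
  using assms
proof (induction k arbitrary: f)
  case 0
  show ?case unfolding Ck_on.simps
  proof (rule continuous_at_imp_continuous_on, rule ballI)
    fix x assume "x \<in> U"
    then obtain W where "open W" "x \<in> W" "continuous_on W f" using 0 by auto
    then show "isCont f x" by (simp add: continuous_on_eq_continuous_at)
  qed
next
  case (Suc k)
  show ?case unfolding Ck_on.simps
  proof (intro conjI ballI allI)
    fix x assume "x \<in> U"
    then show "f differentiable at x" using Suc.prems by force
  next
    fix v
    show "Ck_on k U (\<lambda>x. frechet_derivative f (at x) v)"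
      by (rule Suc.IH) (use Suc.prems in force)
  qed
qed

lemma Ck_on_const: "open U \<Longrightarrow> Ck_on k U (\<lambda>x. c)"
proof (induction k arbitrary: c)
  case (Suc k)
  show ?case
    by (rule Ck_on_Suc_has_derivative[where f'="\<lambda>x v. 0"]) (use Suc in auto)
qed simp

lemma Ck_on_bounded_linear: 
  assumes "open U" "bounded_linear L"
  shows "Ck_on k U L"
proof (cases k)
  case 0
  then show ?thesis using assms by (simp add: linear_continuous_on)
next
  case (Suc n)
  show ?thesis unfolding Suc
    by (rule Ck_on_Suc_has_derivative[where f'="\<lambda>x. L"])
      (use assms Ck_on_const bounded_linear_imp_has_derivative in auto)
qed

lemma Ck_on_add: 
  assumes "open U" "Ck_on k U f" "Ck_on k U g"
  shows "Ck_on k U (\<lambda>x. f x + g x)"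
  using assms(2,3)
proof (induction k arbitrary: f g)
  case 0
  then show ?case by (simp add: continuous_on_add)
next
  case (Suc k)
  show ?case
  proof (rule Ck_on_Suc_has_derivative[OF assms(1)])
    show "((\<lambda>x. f x + g x) has_derivative
        (\<lambda>v. frechet_derivative f (at x) v + frechet_derivative g (at x) v)) (at x)"
      if "x \<in> U" for x
      using Ck_on_SucD(1)[OF Suc.prems(1) that] Ck_on_SucD(1)[OF Suc.prems(2) that]
      by (rule has_derivative_add)
  qed (use Ck_on_SucD(2)[OF Suc.prems(1)] Ck_on_SucD(2)[OF Suc.prems(2)] Suc.IH in auto)
qed

lemma Ck_on_sum:
  assumes "open U" "\<And>i. i \<in> I \<Longrightarrow> Ck_on k U (f i)"
  shows "Ck_on k U (\<lambda>x. \<Sum>i\<in>I. f i x)"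
  using assms(2)
  by (induction I rule: infinite_finite_induct) (auto intro: Ck_on_const Ck_on_add assms(1))

text \<open>Both terms of the Leibniz rule are again of this form, with one factor differentiated
  once, so the induction has to range over all pairs f, g.\<close>

lemma Ck_on_bilinear:
  assumes "open U" "bounded_bilinear p" "Ck_on k U f" "Ck_on k U g"
  shows "Ck_on k U (\<lambda>x. p (f x) (g x))"
  using assms(3,4)
proof (induction k arbitrary: f g)
  case 0
  then show ?case using bounded_bilinear.continuous_on[OF assms(2)] by auto
next
  case (Suc k)
  let ?f = "\<lambda>x. frechet_derivative f (at x)" and ?g = "\<lambda>x. frechet_derivative g (at x)"
  show ?case
  proof (rule Ck_on_Suc_has_derivative[OF assms(1)])
    show "((\<lambda>x. p (f x) (g x)) has_derivative (\<lambda>v. p (f x) (?g x v) + p (?f x v) (g x))) (at x)"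
      if "x \<in> U" for x
      using bounded_bilinear.FDERIV[OF assms(2) Ck_on_SucD(1)[OF Suc.prems(1) that]
          Ck_on_SucD(1)[OF Suc.prems(2) that]] .
    show "Ck_on k U (\<lambda>x. p (f x) (?g x v) + p (?f x v) (g x))" for v
      using Suc.prems by (intro Ck_on_add assms(1) Suc.IH Ck_on_Suc_imp[OF Suc.prems(1)]
          Ck_on_Suc_imp[OF Suc.prems(2)] Ck_on_SucD(2))
  qed
qed

lemmas Ck_on_scaleR = Ck_on_bilinear[OF _ bounded_bilinear_scaleR]
  and Ck_on_mult = Ck_on_bilinear[OF _ bounded_bilinear_mult]

text \<open>The chain rule evaluates the derivative of f in the direction \<open>?g x v\<close>,
  which varies with x, whereas \<open>Ck_on\<close> controls derivatives in fixed directions.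
  Expanding that direction in \<open>Basis\<close> gives a finite sum of products, to which the
  induction hypothesis applies.\<close>

lemma Ck_on_compose:
  fixes f :: "'b::euclidean_space \<Rightarrow> 'c::real_normed_vector" and g :: "'a::real_normed_vector \<Rightarrow> 'b"
  assumes "open U" "open W" "g ` U \<subseteq> W" "Ck_on k W f" "Ck_on k U g"
  shows "Ck_on k U (\<lambda>x. f (g x))"
  using assms(4,5)
proof (induction k arbitrary: f)
  case 0
  then show ?case using assms(3) by (auto intro: continuous_on_compose2)
next
  case (Suc k)
  let ?f = "\<lambda>x. frechet_derivative f (at x)" and ?g = "\<lambda>x. frechet_derivative g (at x)"
  have gk: "Ck_on k U g" by (rule Ck_on_Suc_imp) fact
  show ?case
  proof (rule Ck_on_Suc_has_derivative[OF assms(1)])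
    fix x assume x: "x \<in> U"
    have fd: "(f has_derivative ?f (g x)) (at (g x))"
      using Ck_on_SucD(1)[OF Suc.prems(1)] x assms(3) by auto
    have comp: "((\<lambda>x. f (g x)) has_derivative (\<lambda>v. ?f (g x) (?g x v))) (at x)"
      using has_derivative_compose[OF Ck_on_SucD(1)[OF Suc.prems(2) x] fd] .
    have expand: "?f (g x) w = (\<Sum>i\<in>Basis. (w \<bullet> i) *\<^sub>R ?f (g x) i)" for w
    proof -
      interpret bounded_linear "?f (g x)" using fd by (rule has_derivative_bounded_linear)
      have "?f (g x) w = ?f (g x) (\<Sum>i\<in>Basis. (w \<bullet> i) *\<^sub>R i)"
        by (simp only: euclidean_representation)
      also have "\<dots> = (\<Sum>i\<in>Basis. (w \<bullet> i) *\<^sub>R ?f (g x) i)"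
        by (simp only: sum scale)
      finally show ?thesis .
    qed
    show "((\<lambda>x. f (g x)) has_derivative
        (\<lambda>v. \<Sum>i\<in>Basis. (?g x v \<bullet> i) *\<^sub>R ?f (g x) i)) (at x)"
      by (rule has_derivative_eq_rhs[OF comp]) (rule ext, rule expand)
  next
    fix v
    show "Ck_on k U (\<lambda>x. \<Sum>i\<in>Basis. (?g x v \<bullet> i) *\<^sub>R ?f (g x) i)"
    proof (intro Ck_on_sum Ck_on_scaleR assms(1))
      fix i :: 'b
      show "Ck_on k U (\<lambda>x. ?g x v \<bullet> i)"
        by (intro Ck_on_bilinear[OF assms(1) bounded_bilinear_inner] Ck_on_const assms(1)
            Ck_on_SucD(2) Suc.prems)
      show "Ck_on k U (\<lambda>x. ?f (g x) i)"
        by (rule Suc.IH[OF Ck_on_SucD(2)[OF Suc.prems(1)] gk])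
    qed
  qed
qed

lemma Ck_on_inverse:
  fixes f :: "'a::real_normed_vector \<Rightarrow> real"
  assumes "open U" "\<And>x. x \<in> U \<Longrightarrow> f x \<noteq> 0" "Ck_on k U f"
  shows "Ck_on k U (\<lambda>x. inverse (f x))"
  using assms(3)
proof (induction k)
  case 0
  then show ?case using assms(2) by (auto intro: continuous_on_inverse)
next
  case (Suc k)
  let ?f = "\<lambda>x. frechet_derivative f (at x)"
  note IH = Suc.IH[OF Ck_on_Suc_imp[OF Suc.prems]]
  show ?case
  proof (rule Ck_on_Suc_has_derivative[OF assms(1)])
    show "((\<lambda>x. inverse (f x)) has_derivative (\<lambda>v. - (inverse (f x) * ?f x v * inverse (f x)))) (at x)"
      if "x \<in> U" for x
      using Deriv.has_derivative_inverse[OF assms(2)[OF that] Ck_on_SucD(1)[OF Suc.prems that]] .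
    have "Ck_on k U (\<lambda>x. (-1) * (inverse (f x) * ?f x v * inverse (f x)))" for v
      by (intro Ck_on_mult Ck_on_const assms(1) IH Ck_on_SucD(2) Suc.prems)
    then show "Ck_on k U (\<lambda>x. - (inverse (f x) * ?f x v * inverse (f x)))" for v by simp
  qed
qed

text \<open>The derivative is half the inverse of the function itself, so smoothness away from 0
  bootstraps from continuity.\<close>

lemma Ck_on_sqrt: "Ck_on k {0<..} sqrt"
proof (induction k)
  case 0
  show ?case by (simp add: continuous_on_real_sqrt)
next
  case (Suc k)
  show ?case
  proof (rule Ck_on_Suc_has_derivative[where f'="\<lambda>x v. v * (inverse (sqrt x) / 2)"])
    show "(sqrt has_derivative (\<lambda>v. v * (inverse (sqrt x) / 2))) (at x)" if "x \<in> {0<..}" for x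
      using DERIV_real_sqrt[of x] that
      unfolding has_field_derivative_def by (auto elim!: has_derivative_eq_rhs)
    have "Ck_on k {0<..} (\<lambda>x::real. (v / 2) * inverse (sqrt x))" for v
      by (intro Ck_on_mult Ck_on_const Ck_on_inverse Suc) auto
    then show "Ck_on k {0<..} (\<lambda>x::real. v * (inverse (sqrt x) / 2))" for v by simp
  qed simp
qed

lemma Ck_on_cos_sin: "Ck_on k UNIV (cos :: real \<Rightarrow> real) \<and> Ck_on k UNIV (sin :: real \<Rightarrow> real)"
proof (induction k)
  case 0
  show ?case by (auto intro: continuous_intros)
next
  case (Suc k)
  have "Ck_on (Suc k) UNIV (cos :: real \<Rightarrow> real)"
  proof (rule Ck_on_Suc_has_derivative)
    show "(cos has_derivative (\<lambda>v. (- v) * sin x)) (at x)" for x :: real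
      using DERIV_cos[of x]
      unfolding has_field_derivative_def by (auto elim!: has_derivative_eq_rhs)
    show "Ck_on k UNIV (\<lambda>x::real. (- v) * sin x)" for v
      using Suc by (intro Ck_on_mult Ck_on_const) auto
  qed simp
  moreover have "Ck_on (Suc k) UNIV (sin :: real \<Rightarrow> real)"
  proof (rule Ck_on_Suc_has_derivative)
    show "(sin has_derivative (\<lambda>v. v * cos x)) (at x)" for x :: real
      using DERIV_sin[of x]
      unfolding has_field_derivative_def by (auto elim!: has_derivative_eq_rhs)
    show "Ck_on k UNIV (\<lambda>x::real. v * cos x)" for v
      using Suc by (intro Ck_on_mult Ck_on_const) auto
  qed simp
  ultimately show ?case by simp
qed

section \<open>Closure rules and derivatives of smooth maps\<close>

lemma smooth_const: "smooth (\<lambda>x. c)"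
  and smooth_bounded_linear: "bounded_linear L \<Longrightarrow> smooth L"
  and smooth_add: "smooth f \<Longrightarrow> smooth g \<Longrightarrow> smooth (\<lambda>x. f x + g x)"
  and smooth_scaleR: "smooth r \<Longrightarrow> smooth f \<Longrightarrow> smooth (\<lambda>x. r x *\<^sub>R f x)"
  and smooth_mult: "smooth p \<Longrightarrow> smooth q \<Longrightarrow> smooth (\<lambda>x. p x * q x :: real)"
  and smooth_cos: "smooth (cos :: real \<Rightarrow> real)"
  by (auto simp: smooth_def Ck_on_const Ck_on_bounded_linear Ck_on_add Ck_on_scaleR Ck_on_mult
      Ck_on_cos_sin)

lemma smooth_compose:
  fixes f :: "'b::euclidean_space \<Rightarrow> 'c::real_normed_vector"
  shows "smooth f \<Longrightarrow> smooth g \<Longrightarrow> smooth (\<lambda>x. f (g x))"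
  by (auto simp: smooth_def intro: Ck_on_compose[of UNIV UNIV])

lemma smooth_compose_linear:
  fixes f :: "'b::euclidean_space \<Rightarrow> 'c::real_normed_vector"
  shows "bounded_linear L \<Longrightarrow> smooth f \<Longrightarrow> smooth (\<lambda>x. L (f x))"
proof -
  assume L: "bounded_linear L" and f: "smooth f"
  have "Ck_on k UNIV f \<Longrightarrow> Ck_on k UNIV (\<lambda>x. L (f x))" for k and f :: "'b \<Rightarrow> 'c"
  proof (induction k arbitrary: f)
    case 0
    then show ?case
      by (simp add: bounded_linear.continuous_on[OF L])
  next
    case (Suc k)
    show ?case
    proof (rule Ck_on_Suc_has_derivative)
      show "((\<lambda>x. L (f x)) has_derivative (\<lambda>v. L (frechet_derivative f (at x) v))) (at x)" for x
        using bounded_linear.has_derivative[OF L Ck_on_SucD(1)[OF Suc.prems]] by simp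
    qed (use Suc.IH Ck_on_SucD(2)[OF Suc.prems] in auto)
  qed
  then show "smooth (\<lambda>x. L (f x))" using f by (auto simp: smooth_def)
qed

lemma smooth_diff_const: "smooth f \<Longrightarrow> smooth (\<lambda>w. f (w - (c::'a::euclidean_space)))"
  using smooth_compose[OF _ smooth_add[OF smooth_bounded_linear[OF bounded_linear_ident] smooth_const[of "- c"]]]
  by simp

lemma smooth_sum: "(\<And>i. i \<in> I \<Longrightarrow> smooth (f i)) \<Longrightarrow> smooth (\<lambda>w. \<Sum>i\<in>I. f i w)"
  by (auto simp: smooth_def intro: Ck_on_sum)

lemma smooth_locally:
  assumes "\<And>x. \<exists>W g. open W \<and> x \<in> W \<and> smooth g \<and> (\<forall>y\<in>W. f y = g y)"
  shows "smooth f"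
  unfolding smooth_def
proof (intro allI Ck_on_locally)
  fix k x
  obtain W g where "open W" "x \<in> W" "smooth g" "\<forall>y\<in>W. f y = g y" using assms by meson
  moreover from this have "Ck_on k W f"
    by (intro Ck_on_cong[of W g f] Ck_on_subset[of k UNIV g W]) (auto simp: smooth_def)
  ultimately show "\<exists>W. open W \<and> x \<in> W \<and> Ck_on k W f" by blast
qed

lemma smooth_has_derivative:
  "smooth f \<Longrightarrow> (f has_derivative frechet_derivative f (at x)) (at x)"
  by (rule Ck_on_SucD(1)[of 0 UNIV]) (auto simp: smooth_def simp del: Ck_on.simps)

lemma smooth_frechet_derivative: "smooth f \<Longrightarrow> smooth (\<lambda>x. frechet_derivative f (at x) v)"
  unfolding smooth_def by (intro allI Ck_on_SucD(2)) simp

lemma smooth_continuous_on: "smooth f \<Longrightarrow> continuous_on S f"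
  using Ck_on_imp_continuous_on[of 0 UNIV f] continuous_on_subset[of UNIV f S]
  by (auto simp: smooth_def simp del: Ck_on.simps)

lemma smooth_deriv:
  fixes f :: "real \<Rightarrow> real"
  assumes "smooth f"
  shows "(f has_real_derivative deriv f x) (at x)" "continuous_on S (deriv f)"
proof -
  have d: "(f has_real_derivative frechet_derivative f (at x) 1) (at x)" for x
  proof -
    have lin: "linear (frechet_derivative f (at x))"
      using smooth_has_derivative[OF assms] has_derivative_bounded_linear bounded_linear.linear by blast
    have "frechet_derivative f (at x) v = frechet_derivative f (at x) 1 * v" for v
      using linear_scale[OF lin, of v 1] by simp
    then have "frechet_derivative f (at x) = (*) (frechet_derivative f (at x) 1)" by blast
    then show ?thesis
      unfolding has_field_derivative_def using smooth_has_derivative[OF assms, of x] by metis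
  qed
  then show "(f has_real_derivative deriv f x) (at x)" by (metis DERIV_imp_deriv)
  have "deriv f = (\<lambda>x. frechet_derivative f (at x) 1)" using d DERIV_imp_deriv by blast
  then show "continuous_on S (deriv f)"
    using smooth_continuous_on[OF smooth_frechet_derivative[OF assms]] by simp
qed

text \<open>A map that moves points along a fixed direction only has an inverse of the same kind; the
  derivative of the inverse is a rational expression in the inverse itself, whence smoothness by
  bootstrapping.\<close>

lemma shear_inverse:
  fixes r :: "'a::euclidean_space \<Rightarrow> real" and e :: 'a
  assumes r: "smooth r" and m: "m > 0" "\<And>w. 1 + frechet_derivative r (at w) e \<ge> m"
  shows "\<exists>h. smooth h \<and> (\<forall>w. h (w + r w *\<^sub>R e) = w) \<and> (\<forall>w. h w + r (h w) *\<^sub>R e = w)"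
proof -
  define S where "S = (\<lambda>w. w + r w *\<^sub>R e)"
  \<comment> \<open>On a line in direction e the map becomes a real function of t whose derivative
    is at least m; bijectivity is checked line by line.\<close>
  have line: "((\<lambda>t. t + r (w + t *\<^sub>R e)) has_real_derivative
      1 + frechet_derivative r (at (w + t *\<^sub>R e)) e) (at t)" for w t
  proof -
    let ?D = "frechet_derivative r (at (w + t *\<^sub>R e))"
    have lin: "bounded_linear ?D" using smooth_has_derivative[OF r] by (rule has_derivative_bounded_linear)
    have 1: "((\<lambda>t. w + t *\<^sub>R e) has_derivative (\<lambda>h. h *\<^sub>R e)) (at t)"
      by (auto intro!: derivative_eq_intros)
    have "((\<lambda>t. r (w + t *\<^sub>R e)) has_derivative (\<lambda>h. ?D (h *\<^sub>R e))) (at t)"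
      by (rule has_derivative_compose[OF 1 smooth_has_derivative[OF r]])
    then have "((\<lambda>t. t + r (w + t *\<^sub>R e)) has_derivative (\<lambda>h. h + ?D (h *\<^sub>R e))) (at t)"
      by (intro derivative_intros)
    moreover have "(\<lambda>h. h + ?D (h *\<^sub>R e)) = (*) (1 + ?D e)"
      using linear_scale[OF bounded_linear.linear[OF lin]] by (auto simp: algebra_simps)
    ultimately show ?thesis by (simp add: has_field_derivative_def)
  qed
  have incr: "(t + r (w + t *\<^sub>R e)) - (s + r (w + s *\<^sub>R e)) \<ge> m * (t - s)" if "s \<le> t" for w s t
  proof -
    let ?q = "\<lambda>t. t + r (w + t *\<^sub>R e) - m * t"
    have "?q s \<le> ?q t"
    proof (rule DERIV_nonneg_imp_nondecreasing[OF that])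
      fix x
      have "(?q has_real_derivative 1 + frechet_derivative r (at (w + x *\<^sub>R e)) e - m) (at x)"
        by (rule DERIV_diff[OF line DERIV_cmult_Id])
      then show "\<exists>y. (?q has_real_derivative y) (at x) \<and> 0 \<le> y" using m(2)[of "w + x *\<^sub>R e"] by force
    qed
    then show ?thesis by (simp add: algebra_simps)
  qed
  have inj: "w = w'" if eq: "S w = S w'" for w w'
  proof -
    have w': "w' = w + (r w - r w') *\<^sub>R e" using eq by (simp add: S_def algebra_simps)
    define t where "t = r w - r w'"
    have wt: "w' = w + t *\<^sub>R e" using w' t_def by simp
    have "t + r (w + t *\<^sub>R e) = 0 + r (w + 0 *\<^sub>R e)" using wt t_def by simp
    then have "t = 0"
      using incr[of 0 t w] incr[of t 0 w] m(1) by (smt (verit) mult_pos_neg mult_pos_pos)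
    then show ?thesis using wt by simp
  qed
  have surj: "\<exists>w'. S w' = w" for w
  proof -
    let ?q = "\<lambda>t. t + r (w + t *\<^sub>R e)"
    \<comment> \<open>By \<open>incr\<close> the values at K and at -K lie at least m * K = |r w|
      above and below the value r w at 0, so there is a zero in between.\<close>
    define K where "K = \<bar>r w\<bar> / m"
    have K: "K \<ge> 0" "m * K = \<bar>r w\<bar>" using m(1) by (auto simp: K_def)
    have "?q K \<ge> 0" using incr[of 0 K w] K by auto
    moreover have "?q (-K) \<le> 0" using incr[of "-K" 0 w] K by auto
    moreover have "continuous_on {-K..K} ?q"
      using line by (meson DERIV_isCont continuous_at_imp_continuous_on)
    ultimately obtain t where "?q t = 0" using IVT'[of ?q "-K" 0 K] K by auto
    then have "S (w + t *\<^sub>R e) = w" by (simp add: S_def algebra_simps flip: scaleR_add_left)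
    then show ?thesis by blast
  qed
  define h where "h = inv S"
  have hS: "h (S w) = w" for w unfolding h_def by (rule inv_f_f) (auto intro: injI inj)
  have Sh: "S (h w) = w" for w unfolding h_def by (rule surj_f_inv_f) (metis surj surj_def)
  let ?D = "\<lambda>w. frechet_derivative r (at w)"
  \<comment> \<open>The Sherman-Morrison formula for the inverse of a rank one perturbation of the
    identity; the denominator is at least m.\<close>
  have D: "(h has_derivative (\<lambda>v. v + ((-1) * ?D (h w) v * inverse (1 + ?D (h w) e)) *\<^sub>R e)) (at w)" for w
  proof (rule has_derivative_inverse_strong_x[where S=UNIV and f=S])
    have lin: "bounded_linear (?D (h w))"
      using smooth_has_derivative[OF r] by (rule has_derivative_bounded_linear)
    show "(S has_derivative (\<lambda>v. v + ?D (h w) v *\<^sub>R e)) (at (h w))"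
      unfolding S_def using smooth_has_derivative[OF r, of "h w"] by (intro derivative_intros)
    have pos: "1 + ?D (h w) e \<noteq> 0" using m(1) m(2)[of "h w"] by linarith
    show "(\<lambda>v. v + ?D (h w) v *\<^sub>R e) \<circ> (\<lambda>v. v + ((-1) * ?D (h w) v * inverse (1 + ?D (h w) e)) *\<^sub>R e) = id"
    proof
      fix v
      let ?c = "(-1) * ?D (h w) v * inverse (1 + ?D (h w) e)"
      have "?c + (?D (h w) v + ?c * ?D (h w) e) = ?D (h w) v + ?c * (1 + ?D (h w) e)"
        by (simp add: algebra_simps)
      also have "\<dots> = 0" using pos by simp
      finally have "?c + (?D (h w) v + ?c * ?D (h w) e) = 0" .
      moreover have "?D (h w) (v + ?c *\<^sub>R e) = ?D (h w) v + ?c * ?D (h w) e"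
        using bounded_linear.linear[OF lin] by (simp only: linear_add linear_scale real_scaleR_def)
      ultimately have "?c *\<^sub>R e + ?D (h w) (v + ?c *\<^sub>R e) *\<^sub>R e = 0"
        by (simp only: scaleR_zero_left flip: scaleR_add_left)
      then have "v + ?c *\<^sub>R e + ?D (h w) (v + ?c *\<^sub>R e) *\<^sub>R e = v"
        by (simp only: add.assoc add.right_neutral)
      then show "((\<lambda>v. v + ?D (h w) v *\<^sub>R e) \<circ> (\<lambda>v. v + ((-1) * ?D (h w) v * inverse (1 + ?D (h w) e)) *\<^sub>R e)) v = id v"
        by (simp only: o_apply id_apply)
    qed
    show "continuous_on UNIV S"
      unfolding S_def by (intro continuous_intros smooth_continuous_on r)
  qed (simp_all add: hS Sh)
  have "Ck_on k UNIV h" for k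
  proof (induction k)
    case 0
    show ?case unfolding Ck_on.simps
      by (intro continuous_at_imp_continuous_on ballI has_derivative_continuous[OF D])
  next
    case (Suc k)
    have c: "Ck_on k UNIV (\<lambda>w. ?D (h w) v)" for v
      by (rule Ck_on_compose[OF open_UNIV open_UNIV _ _ Suc])
        (use smooth_frechet_derivative[OF r] in \<open>auto simp: smooth_def\<close>)
    have nz: "1 + ?D (h w) e \<noteq> 0" for w using m(1) m(2)[of "h w"] by linarith
    have "Ck_on k UNIV (\<lambda>w. v + ((-1) * ?D (h w) v * inverse (1 + ?D (h w) e)) *\<^sub>R e)" for v
      by (intro Ck_on_add Ck_on_scaleR Ck_on_mult Ck_on_const Ck_on_inverse c nz open_UNIV)
    then show ?case
      by (rule Ck_on_Suc_has_derivative[OF open_UNIV D])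
  qed
  then have "smooth h" by (simp add: smooth_def)
  then show ?thesis using hS Sh unfolding S_def by (intro exI[of _ h]) simp
qed

section \<open>Lifts to the universal cover\<close>

lemma smooth_fst_cover: "smooth (\<lambda>w::cover. fst w)" "smooth (\<lambda>w::cover. fst (snd w))" "smooth (\<lambda>w::cover. snd (snd w))"
  by (intro smooth_bounded_linear bounded_linear_intros bounded_linear_fst bounded_linear_snd
      bounded_linear_fst_comp bounded_linear_snd_comp bounded_linear_ident)+

text \<open>The deck group of \<open>covering\<close>.\<close>

definition cover_lattice :: "cover set" where
  "cover_lattice = int_lattice \<times> even_lattice \<times> int_lattice"

lemma cover_lattice_add: "v \<in> cover_lattice \<Longrightarrow> w \<in> cover_lattice \<Longrightarrow> v + w \<in> cover_lattice"
  and cover_lattice_minus: "v \<in> cover_lattice \<Longrightarrow> - v \<in> cover_lattice"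
  and cover_lattice_zero: "0 \<in> cover_lattice"
  by (auto simp: cover_lattice_def int_lattice_add even_lattice_add int_lattice_minus
      even_lattice_minus int_lattice_zero even_lattice_zero zero_prod_def)

lemma cover_lattice_diff: "v \<in> cover_lattice \<Longrightarrow> w \<in> cover_lattice \<Longrightarrow> v - w \<in> cover_lattice"
  using cover_lattice_add[OF _ cover_lattice_minus, of v w] by simp

lemma norm_int_lattice_ge:
  assumes "l \<in> int_lattice" "l \<noteq> 0" shows "norm l \<ge> 1"
proof -
  obtain i where i: "l $ i \<noteq> 0" using assms(2) by (auto simp: vec_eq_iff)
  have "l $ i \<in> \<int>" using assms(1) by (simp add: int_lattice_def)
  then have "1 \<le> \<bar>l $ i\<bar>" using i Ints_nonzero_abs_ge1 by blast
  also have "\<dots> \<le> norm l" by (rule component_le_norm_cart)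
  finally show ?thesis .
qed

lemma norm_even_lattice_ge:
  assumes "t \<in> even_lattice" "t \<noteq> 0" shows "norm t \<ge> 1"
proof -
  have "t / 2 \<in> \<int>" "t / 2 \<noteq> 0" using assms by (auto simp: even_lattice_def)
  then have "1 \<le> \<bar>t / 2\<bar>" by (rule Ints_nonzero_abs_ge1)
  then show ?thesis by simp
qed

lemma norm_cover_lattice_ge:
  assumes "l \<in> cover_lattice" "l \<noteq> 0" shows "norm l \<ge> 1"
proof -
  obtain a b c where l: "l = (a, b, c)" by (cases l)
  have "norm a \<le> norm l" "norm b \<le> norm l" "norm c \<le> norm l"
    unfolding l norm_Pair by (simp_all add: real_le_rsqrt)
  moreover have "norm a \<ge> 1 \<or> norm b \<ge> 1 \<or> norm c \<ge> 1"
    using assms norm_int_lattice_ge[of a] norm_even_lattice_ge[of b] norm_int_lattice_ge[of c]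
    unfolding l cover_lattice_def by (auto simp: zero_prod_def)
  ultimately show ?thesis by linarith
qed

lemma abs_torus_eq_iff: "abs_torus a = abs_torus b \<longleftrightarrow> a - b \<in> int_lattice"
  and abs_circle_eq_iff: "abs_circle s = abs_circle t \<longleftrightarrow> s - t \<in> even_lattice"
  by (simp_all add: torus.abs_eq_iff circle.abs_eq_iff)

lemma covering_eq_iff: "covering a = covering b \<longleftrightarrow> a - b \<in> cover_lattice"
  by (cases a; cases b)
    (simp add: covering_def cover_lattice_def abs_torus_eq_iff abs_circle_eq_iff)

lemma covering_surj: "\<exists>a. covering a = x"
proof -
  obtain p q r where x: "x = (p, q, r)" by (cases x)
  have "covering (rep_torus p, rep_circle q, rep_torus r) = x"
    unfolding covering_def x
    using Quotient3_abs_rep[OF Quotient3_torus] Quotient3_abs_rep[OF Quotient3_circle] by simp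
  then show ?thesis by blast
qed

text \<open>The lattice is closed, so the infimum in the quotient distance is attained, and
  translation by the minimising vector gives the nearest lift.\<close>

lemma torus_lift: 
  fixes q :: torus
  shows "\<exists>b. abs_torus b = q \<and> dist a b = dist (abs_torus a) q"
proof -
  obtain c where c: "abs_torus c = q" by (metis Quotient3_abs_rep[OF Quotient3_torus])
  obtain l where l: "l \<in> int_lattice" "infdist (a - c) int_lattice = dist (a - c) l"
    using infdist_attains_inf[OF closed_int_lattice] int_lattice_zero by blast
  have "abs_torus (c + l) = q" using l(1) c abs_torus_eq_iff by force
  moreover have "dist a (c + l) = dist (abs_torus a) q"
    using l(2) by (simp add: c[symmetric] dist_torus.abs_eq dist_norm algebra_simps)
  ultimately show ?thesis by blast
qed

lemma circle_lift: 
  fixes q :: circle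
  shows "\<exists>b. abs_circle b = q \<and> dist a b = dist (abs_circle a) q"
proof -
  obtain c where c: "abs_circle c = q" by (metis Quotient3_abs_rep[OF Quotient3_circle])
  obtain l where l: "l \<in> even_lattice" "infdist (a - c) even_lattice = dist (a - c) l"
    using infdist_attains_inf[OF closed_even_lattice] even_lattice_zero by blast
  have "abs_circle (c + l) = q" using l(1) c abs_circle_eq_iff by force
  moreover have "dist a (c + l) = dist (abs_circle a) q"
    using l(2) by (simp add: c[symmetric] dist_circle.abs_eq dist_norm algebra_simps)
  ultimately show ?thesis by blast
qed

lemma dist_abs_torus_le: "dist (abs_torus a) (abs_torus b) \<le> dist a b"
  by (simp add: dist_torus.abs_eq dist_norm infdist_le2[OF int_lattice_zero])

lemma dist_abs_circle_le: "dist (abs_circle a) (abs_circle b) \<le> dist a b"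
  by (simp add: dist_circle.abs_eq dist_norm infdist_le2[OF even_lattice_zero])

lemma dist_covering_le: "dist (covering a) (covering b) \<le> dist a b"
  by (cases a; cases b)
    (simp add: covering_def dist_prod_def add_mono power_mono dist_abs_torus_le dist_abs_circle_le)

lemma covering_lift: "\<exists>b. covering b = q \<and> dist a b = dist (covering a) q"
proof -
  obtain a1 a2 a3 q1 q2 q3 where [simp]: "a = (a1, a2, a3)" "q = (q1, q2, q3)"
    by (cases a; cases q)
  obtain b1 b2 b3 where "abs_torus b1 = q1" "dist a1 b1 = dist (abs_torus a1) q1"
    "abs_circle b2 = q2" "dist a2 b2 = dist (abs_circle a2) q2"
    "abs_torus b3 = q3" "dist a3 b3 = dist (abs_torus a3) q3"
    using torus_lift circle_lift by meson
  then have "covering (b1, b2, b3) = q \<and> dist a (b1, b2, b3) = dist (covering a) q"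
    by (simp add: covering_def dist_prod_def)
  then show ?thesis by blast
qed

text \<open>The difference of two lifts is continuous and takes values in a translate of the
  lattice, whose points are at distance at least 1 from each other.\<close>

lemma lifts_differ_by_constant:
  assumes "continuous (at v within S) G" "continuous (at v within S) G'"
    and "covering (G v) = covering (G' v)"
    and "\<forall>\<^sub>F w in at v within S. covering (G w) = covering (G' w)"
  shows "\<forall>\<^sub>F w in at v within S. G w - G' w = G v - G' v"
proof -
  have "((\<lambda>w. G w - G' w) \<longlongrightarrow> G v - G' v) (at v within S)"
    using assms(1,2) unfolding continuous_within by (rule tendsto_diff)
  then have "\<forall>\<^sub>F w in at v within S. dist (G w - G' w) (G v - G' v) < 1"
    by (rule tendstoD) simp
  then show ?thesis using assms(4)
  proof eventually_elim
    case (elim w)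
    have "(G w - G' w) - (G v - G' v) \<in> cover_lattice"
      using elim(2) assms(3) unfolding covering_eq_iff by (rule cover_lattice_diff)
    then show ?case using norm_cover_lattice_ge elim(1) by (fastforce simp: dist_norm)
  qed
qed

text \<open>Shows that the \<open>THE\<close> in \<open>tangent_map\<close> is well defined: a
  competing local lift, over any preimage of the point, differs near it from a translate of G by a
  constant and so has the same derivative. Q is the point of the cover that serves as
  origin.\<close>

lemma tangent_map_lift:
  assumes lift: "\<And>w. covering (Q + G w) = g (covering (Q + w))"
    and D: "(G has_derivative D) (at w)"
  shows "tangent_map g (covering (Q + w)) = D"
  unfolding tangent_map_def
proof (rule the_equality)
  have D': "((\<lambda>v. Q + G (v - c)) has_derivative D) (at (w + c))" for c
  proof -
    have "((\<lambda>v. v - c) has_derivative (\<lambda>v. v)) (at (w + c))"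
      by (auto intro!: derivative_eq_intros)
    from has_derivative_compose[OF this, of G D] D
    have "((\<lambda>v. G (v - c)) has_derivative D) (at (w + c))" by simp
    then show ?thesis using has_derivative_add[OF has_derivative_const[of Q]] by fastforce
  qed
  have "has_lift_derivative (g \<circ> covering) D (Q + w) UNIV"
    unfolding has_lift_derivative_def
    by (rule exI[of _ "\<lambda>v. Q + G (v - Q)"]) (use D'[of Q] in \<open>auto simp: lift add.commute\<close>)
  then show "\<exists>a. covering a = covering (Q + w) \<and> has_lift_derivative (g \<circ> covering) D a UNIV"
    by blast
  fix D2
  assume "\<exists>a. covering a = covering (Q + w) \<and> has_lift_derivative (g \<circ> covering) D2 a UNIV"
  then obtain a G2 where a: "covering a = covering (Q + w)" and G2: "covering (G2 a) = g (covering a)"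
    "\<forall>\<^sub>F v in at a. covering (G2 v) = g (covering v)" "(G2 has_derivative D2) (at a)"
    unfolding has_lift_derivative_def by auto
  define c where "c = a - w"
  have c: "a = w + c" by (simp add: c_def)
  have l: "covering (Q + (v - c)) = covering v" for v
    using cover_lattice_minus[of "a - (Q + w)"] a
    unfolding covering_eq_iff c_def by (simp add: algebra_simps)
  let ?G = "\<lambda>v. Q + G (v - c)"
  have G1: "(?G has_derivative D) (at a)" using D'[of c] c by simp
  have "\<forall>\<^sub>F v in at a. ?G v - G2 v = ?G a - G2 a"
    by (rule lifts_differ_by_constant)
      (use G1 G2 in \<open>auto simp: lift l intro: has_derivative_continuous elim: eventually_mono\<close>)
  then have "\<forall>\<^sub>F v in at a. ?G v = G2 v + (?G a - G2 a)" by eventually_elim (simp add: algebra_simps)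
  then have "((\<lambda>v. G2 v + (?G a - G2 a)) has_derivative D) (at a)"
    by (rule has_derivative_transform_eventually[OF G1]) auto
  moreover have "((\<lambda>v. G2 v + (?G a - G2 a)) has_derivative D2) (at a)"
    using has_derivative_add[OF G2(3) has_derivative_const] by simp
  ultimately show "D2 = D" by (rule has_derivative_unique[symmetric])
qed

text \<open>\<open>C1_disk\<close> supplies lifts of h near each point separately. On a small ball
  they are glued to a single lift by always taking the preimage close to a fixed lift of h
  0.\<close>

lemma C1_disk_lift:
  assumes "C1_disk V h h'"
  shows "\<exists>r>0. r < 1 \<and> (\<exists>G. \<forall>v\<in>V. norm v < r \<longrightarrow>
    covering (Q + G v) = h v \<and> (G has_derivative h' v) (at v within V \<inter> cball 0 1))"
proof -
  let ?S = "V \<inter> cball 0 1"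
  have V: "0 \<in> V" using assms by (auto simp: C1_disk_def subspace_0)
  have lift: "has_lift_derivative h (h' v) v ?S" if "v \<in> ?S" for v
    using assms that by (auto simp: C1_disk_def)
  obtain a where a: "covering a = h 0" using covering_surj by blast
  obtain G0 where G0: "covering (G0 0) = h 0" "\<forall>\<^sub>F w in at 0 within ?S. covering (G0 w) = h w"
    "(G0 has_derivative h' 0) (at 0 within ?S)"
    using lift[of 0] V unfolding has_lift_derivative_def by auto
  have "(G0 \<longlongrightarrow> G0 0) (at 0 within ?S)"
    using has_derivative_continuous[OF G0(3)] by (simp add: continuous_within)
  then have "\<forall>\<^sub>F w in at 0 within ?S. dist (G0 w) (G0 0) < 1/4" by (rule tendstoD) simp
  then have "\<forall>\<^sub>F w in at 0 within ?S. dist (h w) (h 0) < 1/4"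
    using G0(2)
  proof eventually_elim
    case (elim w)
    then show ?case using dist_covering_le[of "G0 w" "G0 0"] G0(1) by simp
  qed
  then obtain r0 where r0: "r0 > 0" "\<And>w. w \<in> ?S \<Longrightarrow> w \<noteq> 0 \<Longrightarrow> dist w 0 < r0 \<Longrightarrow> dist (h w) (h 0) < 1/4"
    unfolding eventually_at by blast
  define r where "r = min r0 (1/2)"
  have near: "dist (h w) (h 0) < 1/4" if "w \<in> V" "norm w < r" for w
    using r0(2)[of w] that by (cases "w = 0") (auto simp: r_def)
  \<comment> \<open>Two preimages within 1/4 of a would differ by a lattice vector shorter than 1,
    so the choice is unique and must agree with every local lift that stays that close to a.\<close>
  define G where "G = (\<lambda>w. (SOME b. covering b = h w \<and> dist a b < 1/4) - Q)"
  have G: "covering (Q + G w) = h w \<and> dist a (Q + G w) < 1/4" if "w \<in> V" "norm w < r" for w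
  proof -
    obtain b where "covering b = h w" "dist a b = dist (covering a) (h w)" using covering_lift by blast
    then have "covering b = h w \<and> dist a b < 1/4"
      using near[OF that] a by (simp add: dist_commute)
    from someI[of "\<lambda>b. covering b = h w \<and> dist a b < 1/4", OF this] show ?thesis by (simp add: G_def)
  qed
  have uniq: "b = Q + G w" if "covering b = h w" "dist a b < 1/4" "w \<in> V" "norm w < r" for b w
  proof (rule ccontr)
    assume "b \<noteq> Q + G w"
    moreover have "b - (Q + G w) \<in> cover_lattice" using that G covering_eq_iff by metis
    ultimately have "1 \<le> dist b (Q + G w)" using norm_cover_lattice_ge by (fastforce simp: dist_norm)
    also have "\<dots> \<le> dist a b + dist a (Q + G w)" by (rule dist_triangle3)
    finally show False using that G[OF that(3,4)] by linarith
  qed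
  have "(G has_derivative h' v) (at v within ?S)" if v: "v \<in> V" "norm v < r" for v
  proof -
    have vS: "v \<in> ?S" using v by (auto simp: r_def)
    obtain G1 where G1: "covering (G1 v) = h v" "\<forall>\<^sub>F w in at v within ?S. covering (G1 w) = h w"
      "(G1 has_derivative h' v) (at v within ?S)"
      using lift[OF vS] unfolding has_lift_derivative_def by auto
    define c where "c = Q + G v - G1 v"
    have c: "covering (b + c) = covering b" for b
      using G[OF v] G1(1) covering_eq_iff unfolding c_def by (metis add_diff_cancel_left')
    have "((\<lambda>w. G1 w + c) has_derivative h' v) (at v within ?S)"
      using has_derivative_add[OF G1(3) has_derivative_const] by simp
    then have D: "((\<lambda>w. G1 w + c - Q) has_derivative h' v) (at v within ?S)"
      using has_derivative_diff[OF _ has_derivative_const] by fastforce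
    have "((\<lambda>w. G1 w + c) \<longlongrightarrow> Q + G v) (at v within ?S)"
      using has_derivative_continuous[OF G1(3)] unfolding continuous_within c_def
      by (auto intro!: tendsto_eq_intros)
    then have "\<forall>\<^sub>F w in at v within ?S. dist a (G1 w + c) < 1/4"
      using G[OF v] by (intro order_tendstoD(2)[OF tendsto_dist[OF tendsto_const]]) auto
    moreover have "\<forall>\<^sub>F w in at v within ?S. norm w < r"
      using v(2) by (intro order_tendstoD(2)[OF tendsto_norm[OF tendsto_ident_at]])
    moreover have "\<forall>\<^sub>F w in at v within ?S. w \<in> V"
      by (auto simp: eventually_at_filter)
    ultimately have "\<forall>\<^sub>F w in at v within ?S. G1 w + c - Q = G w"
      using G1(2)
    proof eventually_elim
      case (elim w)
      then show ?case using uniq[of "G1 w + c" w] c by simp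
    qed
    then show ?thesis
      by (rule has_derivative_transform_eventually[OF D]) (use vS c_def in auto)
  qed
  then have "\<forall>v\<in>V. norm v < r \<longrightarrow>
      covering (Q + G v) = h v \<and> (G has_derivative h' v) (at v within V \<inter> cball 0 1)"
    using G by blast
  moreover have "r > 0" "r < 1" using r0(1) by (auto simp: r_def)
  ultimately show ?thesis by blast
qed

text \<open>A diffeomorphism of M given by a global lift in coordinates centred at Q. The lift
  equation already makes G respect the lattice; the same property of its inverse H is what makes g
  injective.\<close>

locale lifted_diffeo =
  fixes g :: "mfd \<Rightarrow> mfd" and G H :: "cover \<Rightarrow> cover" and Q :: cover
  assumes lift: "\<And>w. covering (Q + G w) = g (covering (Q + w))"
    and smooth_G: "smooth G" and smooth_H: "smooth H"
    and GH: "\<And>w. G (H w) = w" and HG: "\<And>w. H (G w) = w"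
    and H_lattice: "\<And>v w. v - w \<in> cover_lattice \<Longrightarrow> H v - H w \<in> cover_lattice"
begin

definition pr :: "cover \<Rightarrow> mfd" where "pr w = covering (Q + w)"

lemma pr_eq_iff: "pr v = pr w \<longleftrightarrow> v - w \<in> cover_lattice"
  by (simp add: pr_def covering_eq_iff)

lemma pr_surj: "\<exists>w. pr w = x"
  using covering_surj[of x] unfolding pr_def by (metis add_diff_cancel_left' diff_add_cancel add.commute)

lemma g_pr: "g (pr w) = pr (G w)"
  by (simp add: pr_def lift)

lemma bij_g: "bij g"
proof (rule bijI)
  show "inj g"
  proof (rule injI)
    fix x y assume eq: "g x = g y"
    obtain v w where vw: "x = pr v" "y = pr w" using pr_surj by metis
    have "G v - G w \<in> cover_lattice" using eq by (simp add: vw g_pr pr_eq_iff)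
    from H_lattice[OF this] show "x = y" by (simp add: HG vw pr_eq_iff)
  qed
  show "surj g"
    unfolding surj_def
  proof
    fix y
    obtain w where "y = pr w" using pr_surj by metis
    then have "y = g (pr (H w))" by (simp add: g_pr GH)
    then show "\<exists>x. y = g x" by blast
  qed
qed

lemma inv_g_pr: "inv g (pr w) = pr (H w)"
proof -
  have "g (pr (H w)) = pr w" by (simp add: g_pr GH)
  then show ?thesis using bij_g by (metis bij_is_inj inv_f_f)
qed

lemma Ck_map_lift:
  assumes "\<And>w. covering (Q + F w) = f (covering (Q + w))" "smooth F"
  shows "Ck_map k f"
  unfolding Ck_map_def
proof
  fix a
  have "smooth (\<lambda>u. u + - Q)"
    by (intro smooth_add[of "\<lambda>x. x"] smooth_const smooth_bounded_linear bounded_linear_ident)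
  then have "smooth (\<lambda>u. Q + F (u + - Q))"
    by (rule smooth_add[OF smooth_const smooth_compose[OF assms(2)]])
  moreover have "covering (Q + F (u + - Q)) = f (covering u)" for u
    using assms(1)[of "u + - Q"] by simp
  ultimately show "\<exists>U G. open U \<and> a \<in> U \<and> Ck_on k U G \<and> (\<forall>u\<in>U. covering (G u) = f (covering u))"
    unfolding smooth_def by (intro exI[of _ UNIV]) auto
qed

lemma smooth_diffeo_g: "smooth_diffeo g"
  unfolding smooth_diffeo_def Ck_diffeo_def
  using bij_g Ck_map_lift[OF lift smooth_G] Ck_map_lift[OF _ smooth_H] inv_g_pr
  by (simp add: pr_def)

definition DG :: "cover \<Rightarrow> cover \<Rightarrow> cover" where "DG w = frechet_derivative G (at w)"

lemma G_has_derivative: "(G has_derivative DG w) (at w)"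
  unfolding DG_def by (rule smooth_has_derivative[OF smooth_G])

lemma tangent_map_pr: "tangent_map g (pr w) = DG w"
  unfolding pr_def by (rule tangent_map_lift[OF lift G_has_derivative])

lemma funpow_pr: "(g ^^ n) (pr w) = pr ((G ^^ n) w)"
  by (induction n) (simp_all add: g_pr)

lemma smooth_Gn: "smooth (G ^^ n)" and smooth_Hn: "smooth (H ^^ n)"
proof -
  have "smooth (\<lambda>w. (F ^^ n) w)" if "smooth F" for F :: "cover \<Rightarrow> cover"
    by (induction n) (auto intro: smooth_bounded_linear bounded_linear_ident smooth_compose that)
  then show "smooth (G ^^ n)" "smooth (H ^^ n)" using smooth_G smooth_H by auto
qed

lemma tangent_map_funpow_pr: "tangent_map (g ^^ n) (pr w) = frechet_derivative (G ^^ n) (at w)"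
  unfolding pr_def
  by (rule tangent_map_lift) (use funpow_pr in \<open>auto simp: pr_def smooth_has_derivative[OF smooth_Gn]\<close>)

lemma tangent_map_Suc:
  "tangent_map (g ^^ Suc n) x = tangent_map g ((g ^^ n) x) \<circ> tangent_map (g ^^ n) x"
proof -
  obtain w where x: "x = pr w" using pr_surj by metis
  have "(G ^^ Suc n has_derivative DG ((G ^^ n) w) \<circ> frechet_derivative (G ^^ n) (at w)) (at w)"
    unfolding funpow.simps
    by (rule diff_chain_at[OF smooth_has_derivative[OF smooth_Gn] G_has_derivative])
  then show ?thesis
    unfolding x tangent_map_funpow_pr funpow_pr tangent_map_pr
    by (rule frechet_derivative_at[symmetric])
qed

lemma tangent_map_0: "tangent_map (g ^^ 0) x = id"
proof -
  obtain w where x: "x = pr w" using pr_surj by metis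
  show ?thesis unfolding x tangent_map_funpow_pr by (simp add: frechet_derivative_id id_def)
qed

lemma GHn: "(G ^^ n) ((H ^^ n) w) = w" and HGn: "(H ^^ n) ((G ^^ n) w) = w"
  by (induction n arbitrary: w) (simp_all add: GH HG funpow_swap1)

lemma DGn_inverse: 
  "frechet_derivative (H ^^ n) (at ((G ^^ n) w)) (frechet_derivative (G ^^ n) (at w) v) = v"
  "frechet_derivative (G ^^ n) (at w) (frechet_derivative (H ^^ n) (at ((G ^^ n) w)) v) = v"
proof -
  let ?G = "frechet_derivative (G ^^ n) (at w)" and ?H = "frechet_derivative (H ^^ n) (at ((G ^^ n) w))"
  have "((H ^^ n) \<circ> (G ^^ n) has_derivative ?H \<circ> ?G) (at w)"
    by (intro diff_chain_at smooth_has_derivative smooth_Gn smooth_Hn)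
  moreover have "(H ^^ n) \<circ> (G ^^ n) = id" by (auto simp: HGn)
  ultimately have "?H \<circ> ?G = id"
    using has_derivative_id has_derivative_unique by metis
  then show "?H (?G v) = v" by (metis comp_apply id_apply)
  have "((G ^^ n) \<circ> (H ^^ n) has_derivative frechet_derivative (G ^^ n) (at ((H ^^ n) ((G ^^ n) w))) \<circ> ?H) (at ((G ^^ n) w))"
    by (intro diff_chain_at smooth_has_derivative smooth_Gn smooth_Hn)
  moreover have "(G ^^ n) \<circ> (H ^^ n) = id" by (auto simp: GHn)
  ultimately have "?G \<circ> ?H = id"
    using has_derivative_id has_derivative_unique unfolding HGn by metis
  then show "?G (?H v) = v" by (metis comp_apply id_apply)
qed

end

section \<open>Dominated splittings of block triangular cocycles\<close>

text \<open>Bounded solutions of this cohomological equation are the slopes of invariant line fields of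
  triangular cocycles.\<close>

lemma bounded_twisted_sum:
  fixes m u :: "'a \<Rightarrow> real"
  assumes \<theta>: "0 \<le> \<theta>" "\<theta> < 1" and m: "\<And>x. \<bar>m x\<bar> \<le> \<theta>" and u: "\<And>x. \<bar>u x\<bar> \<le> K"
  obtains \<beta> where "\<And>x. \<beta> x = m x * \<beta> (T x) + u x" "\<And>x. \<bar>\<beta> x\<bar> \<le> K / (1 - \<theta>)"
proof -
  \<comment> \<open>The terms of the series that results from iterating the equation along the
    T-orbit; \<open>t_le\<close> compares it with a geometric series.\<close>
  define t where "t = (\<lambda>x n. (\<Prod>j<n. m ((T ^^ j) x)) * u ((T ^^ n) x))"
  have K: "K \<ge> 0" using u[of undefined] by linarith
  have t_le: "\<bar>t x n\<bar> \<le> \<theta> ^ n * K" for x n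
  proof -
    have "\<bar>\<Prod>j<n. m ((T ^^ j) x)\<bar> \<le> (\<Prod>j<n. \<theta>)"
      unfolding abs_prod by (rule prod_mono) (use m in auto)
    then show ?thesis
      unfolding t_def abs_mult using u \<theta>(1) by (intro mult_mono) auto
  qed
  have geo: "summable (\<lambda>n. \<theta> ^ n * K)" using \<theta> by (intro summable_mult2 summable_geometric) auto
  have summ: "summable (t x)" for x
    by (rule summable_comparison_test'[OF geo]) (use t_le in auto)
  define \<beta> where "\<beta> = (\<lambda>x. suminf (t x))"
  have "\<beta> x = m x * \<beta> (T x) + u x" for x
  proof -
    have tS: "t x (Suc n) = m x * t (T x) n" for n
      unfolding t_def by (simp only: prod.lessThan_Suc_shift funpow_Suc_right o_apply) simp
    have "\<beta> x = t x 0 + (\<Sum>n. t x (Suc n))"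
      unfolding \<beta>_def by (subst suminf_split_head[OF summ]) simp
    also have "(\<Sum>n. t x (Suc n)) = m x * \<beta> (T x)"
      unfolding tS \<beta>_def by (rule suminf_mult[OF summ])
    finally show ?thesis by (simp add: t_def)
  qed
  moreover have "\<bar>\<beta> x\<bar> \<le> K / (1 - \<theta>)" for x
  proof -
    have "norm (\<Sum>n. t x n) \<le> (\<Sum>n. \<theta> ^ n * K)"
      by (rule norm_suminf_le[OF _ geo]) (use t_le in auto)
    also have "\<dots> = (\<Sum>n. \<theta> ^ n) * K"
      using suminf_mult2[OF summable_geometric[of \<theta>], of K] \<theta> by simp
    also have "\<dots> = K / (1 - \<theta>)" using suminf_geometric[of \<theta>] \<theta> by simp
    finally show ?thesis by (simp add: \<beta>_def)
  qed
  ultimately show thesis by (rule that)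
qed

text \<open>Along an orbit on which the source vanishes the equation is homogeneous and gains a
  factor \<theta> at each step, so a bounded solution must be zero. This will force the slopes of
  E^cs to vanish over the stable leaves of q2.\<close>

lemma bounded_twisted_sum_zero:
  fixes m \<beta> :: "'a \<Rightarrow> real"
  assumes \<theta>: "0 \<le> \<theta>" "\<theta> < 1" and m: "\<And>x. \<bar>m x\<bar> \<le> \<theta>" and \<beta>: "\<And>x. \<bar>\<beta> x\<bar> \<le> K"
    and eq: "\<And>x. \<beta> x = m x * \<beta> (T x) + u x" and z: "\<And>n. u ((T ^^ n) x) = 0"
  shows "\<beta> x = 0"
proof -
  have "\<bar>\<beta> x\<bar> \<le> \<theta> ^ n * \<bar>\<beta> ((T ^^ n) x)\<bar>" for n
  proof (induction n)
    case (Suc n)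
    have "\<bar>\<beta> ((T ^^ n) x)\<bar> = \<bar>m ((T ^^ n) x)\<bar> * \<bar>\<beta> ((T ^^ Suc n) x)\<bar>"
      using eq[of "(T ^^ n) x"] z[of n] by (simp add: abs_mult)
    also have "\<dots> \<le> \<theta> * \<bar>\<beta> ((T ^^ Suc n) x)\<bar>" by (intro mult_right_mono m) simp
    finally have "\<theta> ^ n * \<bar>\<beta> ((T ^^ n) x)\<bar> \<le> \<theta> ^ n * (\<theta> * \<bar>\<beta> ((T ^^ Suc n) x)\<bar>)"
      using \<theta>(1) by (intro mult_left_mono) auto
    with Suc show ?case by (simp add: mult.assoc mult.left_commute)
  qed simp
  then have "\<bar>\<beta> x\<bar> \<le> \<theta> ^ n * K" for n
    using \<beta> \<theta>(1) by (meson mult_left_mono order_trans zero_le_power)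
  moreover have "(\<lambda>n. \<theta> ^ n * K) \<longlonglongrightarrow> 0 * K"
    using \<theta> by (intro tendsto_mult tendsto_const LIMSEQ_power_zero) auto
  ultimately have "\<bar>\<beta> x\<bar> \<le> 0" by (intro LIMSEQ_le_const[of _ 0]) auto
  then show ?thesis by simp
qed

text \<open>C bounds the projection onto E along F. For unit vectors a and b this says that norm (a
  - b) is at least 1 / C, and the square of this norm is 2 minus twice the cosine of the
  angle.\<close>

lemma vec_angle_ge:
  fixes E F :: "'a::real_inner set"
  assumes E: "subspace E" and F: "subspace F" and C: "C \<ge> 1"
    and sep: "\<And>v w. v \<in> E \<Longrightarrow> w \<in> F \<Longrightarrow> norm v \<le> C * norm (v - w)"
    and v: "v \<in> E - {0}" and w: "w \<in> F - {0}"
  shows "arccos (1 - 1 / (2 * C\<^sup>2)) \<le> vec_angle v w"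
proof -
  define a where "a = inverse (norm v) *\<^sub>R v"
  define b where "b = inverse (norm w) *\<^sub>R w"
  have "a \<in> E" "b \<in> F" using v w E F by (auto simp: a_def b_def subspace_scale)
  moreover have n: "norm a = 1" "norm b = 1" using v w by (auto simp: a_def b_def)
  ultimately have "1 \<le> C * norm (a - b)" using sep by metis
  then have "1 \<le> (C * norm (a - b))\<^sup>2" by (simp add: one_le_power)
  also have "\<dots> = C\<^sup>2 * (2 - 2 * (a \<bullet> b))"
    using dot_norm_neg[of a b] n by (simp add: power_mult_distrib)
  finally have "a \<bullet> b \<le> 1 - 1 / (2 * C\<^sup>2)"
    using C by (simp add: field_simps)
  moreover have "(v \<bullet> w) / (norm v * norm w) = a \<bullet> b" by (simp add: a_def b_def divide_inverse)
  moreover have "\<bar>a \<bullet> b\<bar> \<le> 1" using Cauchy_Schwarz_ineq2[of a b] n by simp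
  moreover have "1 - 1 / (2 * C\<^sup>2) \<le> 1" by simp
  ultimately show ?thesis
    unfolding vec_angle_def by (intro arccos_le_arccos) auto
qed

lemma arccos_gap_pos: "C \<ge> 1 \<Longrightarrow> 0 < arccos (1 - 1 / (2 * C\<^sup>2))"
proof -
  assume C: "C \<ge> 1"
  have "1 / (2 * C\<^sup>2) \<le> 1" "1 / (2 * C\<^sup>2) > 0"
  proof -
    have "0 < 2 * C\<^sup>2" "1 \<le> 2 * C\<^sup>2" using one_le_power[OF C, of 2] by linarith+
    then show "1 / (2 * C\<^sup>2) \<le> 1" "1 / (2 * C\<^sup>2) > 0"
      by (simp_all only: divide_le_eq_1_pos zero_less_divide_1_iff)
  qed
  then have "arccos 1 < arccos (1 - 1 / (2 * C\<^sup>2))" by (intro arccos_less_arccos) linarith+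
  then show ?thesis by simp
qed

section \<open>The eigenframe and its coordinates on the cover\<close>

locale frame =
  fixes eu es :: "real^2"
  assumes norm_eu: "norm eu = 1" and norm_es: "norm es = 1" and eu_es: "eu \<bullet> es = 0"
begin

lemma eu_es_simps [simp]:
  "norm eu = 1" "norm es = 1" "eu \<bullet> es = 0" "es \<bullet> eu = 0" "eu \<bullet> eu = 1" "es \<bullet> es = 1"
  using norm_eu norm_es eu_es by (auto simp: inner_commute norm_eq_1)

lemma frame_expand: "v = (v \<bullet> eu) *\<^sub>R eu + (v \<bullet> es) *\<^sub>R es"
proof -
  define w where "w = v - ((v \<bullet> eu) *\<^sub>R eu + (v \<bullet> es) *\<^sub>R es)"
  have w: "w \<bullet> eu = 0" "w \<bullet> es = 0" by (simp_all add: w_def inner_diff_left inner_add_left)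
  have ne: "eu \<noteq> es" using eu_es_simps(3,5) by fastforce
  have "pairwise orthogonal {eu, es}" "0 \<notin> {eu, es}"
    using ne norm_eu norm_es eu_es_simps(3,4) by (auto simp: pairwise_def orthogonal_def simp del: eu_es_simps)
  then have "independent {eu, es}" by (rule pairwise_orthogonal_independent)
  then have "UNIV \<subseteq> span {eu, es}"
    using ne by (intro card_ge_dim_independent) simp_all
  then have "w \<in> span {eu, es}" by blast
  then have "w \<bullet> w = 0"
    by (intro orthogonal_to_span[of w "{eu, es}" w, unfolded orthogonal_def]) (use w in auto)
  then show ?thesis by (simp add: w_def)
qed

lemma frame_eqI: "v \<bullet> eu = w \<bullet> eu \<Longrightarrow> v \<bullet> es = w \<bullet> es \<Longrightarrow> v = w"
  using frame_expand[of v] frame_expand[of w] by simp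

lemma norm_frame: "norm v = sqrt ((v \<bullet> eu)\<^sup>2 + (v \<bullet> es)\<^sup>2)"
proof -
  have "v \<bullet> v = (v \<bullet> eu)\<^sup>2 + (v \<bullet> es)\<^sup>2"
    by (subst (1 2) frame_expand[of v])
      (simp add: inner_add_left inner_add_right power2_eq_square)
  then show ?thesis by (simp add: norm_eq_sqrt_inner)
qed

text \<open>Coordinates along E^uu, E^ss, the circle direction, E^u and E^s, in this order.\<close>

definition cA :: "cover \<Rightarrow> real" where "cA v = fst v \<bullet> eu"
definition cB :: "cover \<Rightarrow> real" where "cB v = fst v \<bullet> es"
definition cC :: "cover \<Rightarrow> real" where "cC v = fst (snd v)"
definition cD :: "cover \<Rightarrow> real" where "cD v = snd (snd v) \<bullet> eu"
definition cE :: "cover \<Rightarrow> real" where "cE v = snd (snd v) \<bullet> es"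
definition mk :: "real \<Rightarrow> real \<Rightarrow> real \<Rightarrow> real \<Rightarrow> real \<Rightarrow> cover" where
  "mk a b c d e = (a *\<^sub>R eu + b *\<^sub>R es, c, d *\<^sub>R eu + e *\<^sub>R es)"

lemmas coord_defs = cA_def cB_def cC_def cD_def cE_def

lemma coord_mk [simp]:
  "cA (mk a b c d e) = a" "cB (mk a b c d e) = b" "cC (mk a b c d e) = c"
  "cD (mk a b c d e) = d" "cE (mk a b c d e) = e"
  by (simp_all add: coord_defs mk_def inner_add_left)

lemma coord_linear [simp]:
  "cA (v + w) = cA v + cA w" "cB (v + w) = cB v + cB w" "cC (v + w) = cC v + cC w"
  "cD (v + w) = cD v + cD w" "cE (v + w) = cE v + cE w"
  "cA (v - w) = cA v - cA w" "cB (v - w) = cB v - cB w" "cC (v - w) = cC v - cC w"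
  "cD (v - w) = cD v - cD w" "cE (v - w) = cE v - cE w"
  "cA (t *\<^sub>R v) = t * cA v" "cB (t *\<^sub>R v) = t * cB v" "cC (t *\<^sub>R v) = t * cC v"
  "cD (t *\<^sub>R v) = t * cD v" "cE (t *\<^sub>R v) = t * cE v"
  "cA 0 = 0" "cB 0 = 0" "cC 0 = 0" "cD 0 = 0" "cE 0 = 0"
  by (simp_all add: coord_defs inner_add_left inner_diff_left)

lemma coord_eqI:
  "cA v = cA w \<Longrightarrow> cB v = cB w \<Longrightarrow> cC v = cC w \<Longrightarrow> cD v = cD w \<Longrightarrow> cE v = cE w \<Longrightarrow> v = w"
  by (cases v; cases w) (auto simp: coord_defs intro: frame_eqI)

lemma mk_coords: "mk (cA v) (cB v) (cC v) (cD v) (cE v) = v"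
  by (rule coord_eqI) simp_all

lemma coord_le_norm:
  "\<bar>cA v\<bar> \<le> norm v" "\<bar>cB v\<bar> \<le> norm v" "\<bar>cC v\<bar> \<le> norm v" "\<bar>cD v\<bar> \<le> norm v" "\<bar>cE v\<bar> \<le> norm v"
proof -
  obtain x y z where v: "v = (x, y, z)" by (cases v)
  have n: "norm x \<le> norm v" "\<bar>y\<bar> \<le> norm v" "norm z \<le> norm v"
    unfolding v norm_Pair by (simp_all add: real_le_rsqrt)
  have i: "\<bar>p \<bullet> eu\<bar> \<le> norm p" "\<bar>p \<bullet> es\<bar> \<le> norm p" for p
    using Cauchy_Schwarz_ineq2[of p eu] Cauchy_Schwarz_ineq2[of p es] by simp_all
  show "\<bar>cA v\<bar> \<le> norm v" "\<bar>cB v\<bar> \<le> norm v" "\<bar>cC v\<bar> \<le> norm v" "\<bar>cD v\<bar> \<le> norm v" "\<bar>cE v\<bar> \<le> norm v"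
    using n i[of x] i[of z] by (auto simp: coord_defs v)
qed

lemma norm_le_coords: "norm v \<le> \<bar>cA v\<bar> + \<bar>cB v\<bar> + \<bar>cC v\<bar> + \<bar>cD v\<bar> + \<bar>cE v\<bar>"
proof -
  have p: "norm p \<le> \<bar>p \<bullet> eu\<bar> + \<bar>p \<bullet> es\<bar>" for p
    unfolding norm_frame[of p] by (rule sqrt_sum_squares_le_sum_abs)
  obtain x y z where v: "v = (x, y, z)" by (cases v)
  have "norm v \<le> norm x + norm (y, z)" unfolding v by (rule norm_Pair_le)
  also have "norm (y, z) \<le> norm y + norm z" by (rule norm_Pair_le)
  finally show ?thesis using p[of x] p[of z] by (simp add: coord_defs v)
qed

lemma bounded_linear_coords:
  "bounded_linear cA" "bounded_linear cB" "bounded_linear cC" "bounded_linear cD" "bounded_linear cE"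
  by (rule bounded_linear_intro[where K=1]; simp add: coord_le_norm)+

end

lemma range_linear:
  fixes f :: "'a::euclidean_space \<Rightarrow> 'b::euclidean_space"
  assumes "linear f" "inj f"
  shows "subspace (range f)" "dim (range f) = DIM('a)"
  using linear_subspace_image[OF assms(1) subspace_UNIV] dim_image_eq[OF assms(1), of UNIV] assms(2)
  by auto

text \<open>In the order of the coordinates the diagonal of the derivative is s1, 1 / s1, qc, mu, 1
  / s0. The bounds of mu and qc by s1 separate E^uu from the other directions, those of qc, 1 / s0
  and 1 / s1 by mu separate E^cu from E^cs; the factor 1 / 2 in the last bound leaves room for the
  shear qb. The off-diagonal entries influence slopes but not growth rates, so boundedness is enough
  for them.\<close>

locale triangular_diffeo = lifted_diffeo g G H Q + frame eu es
  for g G H Q eu es +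
  fixes s0 s1 :: real and qa qb qc ra rb rc re mu :: "mfd \<Rightarrow> real" and \<theta> K :: real
  assumes tangent_g: "\<And>x v. tangent_map g x v =
      mk (s1 * cA v) (cB v / s1) (qa x * cA v + qb x * cB v + qc x * cC v)
         (ra x * cA v + rb x * cB v + rc x * cC v + mu x * cD v + re x * cE v) (cE v / s0)"
    and s0: "s0 > 1" and s1: "s1 > 1" and \<theta>: "1/2 \<le> \<theta>" "\<theta> < 1"
    and K: "K > 0" "\<And>x. \<bar>qa x\<bar> \<le> K" "\<And>x. \<bar>qb x\<bar> \<le> K" "\<And>x. \<bar>ra x\<bar> \<le> K" "\<And>x. \<bar>rb x\<bar> \<le> K"
      "\<And>x. \<bar>rc x\<bar> \<le> K" "\<And>x. \<bar>re x\<bar> \<le> K"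
    and qc_pos: "\<And>x. 0 < qc x" and mu_ge: "\<And>x. 3/4 \<le> mu x"
    and mu_le: "\<And>x. mu x \<le> \<theta> * s1" and qc_le: "\<And>x. qc x \<le> \<theta> * s1" "\<And>x. qc x \<le> \<theta> * mu x"
    and s0_le: "\<And>x. 1 / s0 \<le> \<theta> * mu x" and s1_le: "\<And>x. 1 / s1 \<le> \<theta> * mu x / 2"
begin

lemma mu_pos: "mu x > 0" using mu_ge[of x] by linarith

lemma linear_tangent: "linear (tangent_map g x)"
  by (rule linearI; rule coord_eqI) (simp_all add: tangent_g algebra_simps add_divide_distrib)

lemma inj_tangent: "inj (tangent_map g x)"
proof (rule injI)
  fix v w assume eq: "tangent_map g x v = tangent_map g x w"
  have A: "cA v = cA w" and B: "cB v = cB w" and E: "cE v = cE w"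
    using arg_cong[OF eq, of cA] arg_cong[OF eq, of cB] arg_cong[OF eq, of cE] s0 s1
    by (auto simp: tangent_g)
  have C: "cC v = cC w" using arg_cong[OF eq, of cC] A B qc_pos[of x] by (auto simp: tangent_g)
  have "cD v = cD w" using arg_cong[OF eq, of cD] A B C E mu_pos[of x] by (auto simp: tangent_g)
  with A B C E show "v = w" by (intro coord_eqI)
qed

lemma invariant_bundleI:
  assumes "\<And>x. subspace (E x)" "\<And>x. dim (E x) = d" "\<And>x v. v \<in> E x \<Longrightarrow> tangent_map g x v \<in> E (g x)"
  shows "invariant_bundle g E"
  unfolding invariant_bundle_def
proof (intro conjI allI exI)
  fix x
  show "tangent_map g x ` E x = E (g x)"
  proof (rule subspace_dim_equal)
    have "dim (tangent_map g x ` E x) = dim (E x)"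
      by (rule dim_image_eq[OF linear_tangent]) (use inj_tangent inj_on_subset in blast)
    then show "dim (E (g x)) \<le> dim (tangent_map g x ` E x)" by (simp add: assms(2))
  qed (use assms linear_subspace_image[OF linear_tangent] in blast)+
qed (use assms in auto)

text \<open>E^cu is the D-direction, E^uu a graph over the A-axis, and E^cs a graph over B, C, E
  inside cA = 0. Invariance of a graph is a cohomological equation for its slopes: those of E^uu are
  determined by the past and solved along the inverse of g, those of E^cs by the future and solved
  along g.\<close>

theorem ph_splitting_exists:
  obtains Euu Ecu Ecs where "ph_splitting g Euu Ecu Ecs"
    and "\<And>x v. v \<in> Ecs x \<Longrightarrow> cA v = 0"
    and "\<And>x. (\<And>n. rb ((g ^^ n) x) = 0 \<and> rc ((g ^^ n) x) = 0 \<and> re ((g ^^ n) x) = 0)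
      \<Longrightarrow> Ecs x = {v. cA v = 0 \<and> cD v = 0}"
proof -
  define S where "S = inv g"
  have Sg: "S (g x) = x" for x using bij_g by (simp add: S_def bij_is_inj)
  have \<theta>0: "0 \<le> \<theta>" using \<theta> by linarith
  have div_s1: "\<bar>y / s1\<bar> \<le> \<bar>y\<bar>" for y
  proof -
    have "\<bar>y\<bar> \<le> \<bar>y\<bar> * s1" using mult_left_mono[of 1 s1 "\<bar>y\<bar>"] s1 by simp
    then show ?thesis using s1 by (simp add: pos_divide_le_eq)
  qed
  \<comment> \<open>Slope of E^uu in the circle direction: the image of (1, \<gamma>) under the (A,
    C)-block, rescaled to A-coordinate 1.\<close>
  obtain \<gamma> where \<gamma>: "\<And>x. \<gamma> x = qc (S x) / s1 * \<gamma> (S x) + qa (S x) / s1" 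
    and \<gamma>b: "\<And>x. \<bar>\<gamma> x\<bar> \<le> K / (1 - \<theta>)"
  proof -
    have m: "\<bar>qc (S x) / s1\<bar> \<le> \<theta>" for x
      using qc_le(1)[of "S x"] qc_pos[of "S x"] s1 by (simp add: pos_divide_le_eq)
    have u: "\<bar>qa (S x) / s1\<bar> \<le> K" for x
      using div_s1[of "qa (S x)"] K(2)[of "S x"] by linarith
    show thesis by (rule bounded_twisted_sum[OF \<theta>0 \<theta>(2) m u, where T=S]) (rule that)
  qed
  define B1 where "B1 = K / (1 - \<theta>)"
  have B1: "B1 \<ge> 0" using K(1) \<theta> by (simp add: B1_def)
  \<comment> \<open>Slope of E^uu in the D-direction. It is fed by \<gamma> through rc, so it has to
    come second.\<close>
  obtain \<zeta> where \<zeta>: "\<And>x. \<zeta> x = mu (S x) / s1 * \<zeta> (S x) + (ra (S x) + rc (S x) * \<gamma> (S x)) / s1" 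
    and \<zeta>b: "\<And>x. \<bar>\<zeta> x\<bar> \<le> (K + K * B1) / (1 - \<theta>)"
  proof -
    have m: "\<bar>mu (S x) / s1\<bar> \<le> \<theta>" for x
      using mu_le[of "S x"] mu_pos[of "S x"] s1 by (simp add: pos_divide_le_eq)
    have u: "\<bar>(ra (S x) + rc (S x) * \<gamma> (S x)) / s1\<bar> \<le> K + K * B1" for x
    proof -
      have "\<bar>ra (S x) + rc (S x) * \<gamma> (S x)\<bar> \<le> K + K * B1"
      proof -
        have "\<bar>rc (S x) * \<gamma> (S x)\<bar> \<le> K * B1"
          unfolding abs_mult using K(1) K(6) \<gamma>b by (intro mult_mono) (auto simp: B1_def)
        then show ?thesis using K(4)[of "S x"] by linarith
      qed
      then show ?thesis using div_s1 order_trans by blast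
    qed
    show thesis by (rule bounded_twisted_sum[OF \<theta>0 \<theta>(2) m u, where T=S]) (rule that)
  qed
  have div_mu: "\<bar>y / mu x\<bar> \<le> 2 * \<bar>y\<bar>" for y x
  proof -
    have "\<bar>y\<bar> \<le> 2 * \<bar>y\<bar> * mu x" using mult_left_mono[OF mu_ge[of x], of "2 * \<bar>y\<bar>"] by simp
    then show ?thesis using mu_pos[of x] by (simp add: field_simps)
  qed
  have mB: "\<bar>qc x / mu x\<bar> \<le> \<theta>" and mE: "\<bar>1 / s0 / mu x\<bar> \<le> \<theta>" and mA: "\<bar>1 / s1 / mu x\<bar> \<le> \<theta>" for x
    using qc_le(2)[of x] s0_le[of x] s1_le[of x] mu_pos[of x] qc_pos[of x] s0 s1
      mult_nonneg_nonneg[OF \<theta>0 less_imp_le[OF mu_pos[of x]]]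
    by (simp_all only: abs_divide abs_of_pos zero_less_divide_iff zero_less_one abs_one pos_divide_le_eq[OF mu_pos])
  \<comment> \<open>The slopes of E^cs are the coefficients in cD = \<alpha> cB + \<beta> cC +
    \<epsilon> cE. As mu dominates the rates of B, C and E, the equation contracts when the slope at
    x is expressed through the slope at g x.\<close>
  obtain \<beta> where \<beta>: "\<And>x. \<beta> x = qc x / mu x * \<beta> (g x) + - rc x / mu x" 
    and \<beta>b: "\<And>x. \<bar>\<beta> x\<bar> \<le> 2 * K / (1 - \<theta>)"
  proof -
    have u: "\<bar>- rc x / mu x\<bar> \<le> 2 * K" for x
      using div_mu[of "- rc x" x] K(6)[of x] by linarith
    show thesis by (rule bounded_twisted_sum[OF \<theta>0 \<theta>(2) mB u, where T=g]) (rule that)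
  qed
  obtain \<epsilon> where \<epsilon>: "\<And>x. \<epsilon> x = 1 / s0 / mu x * \<epsilon> (g x) + - re x / mu x" 
    and \<epsilon>b: "\<And>x. \<bar>\<epsilon> x\<bar> \<le> 2 * K / (1 - \<theta>)"
  proof -
    have u: "\<bar>- re x / mu x\<bar> \<le> 2 * K" for x
      using div_mu[of "- re x" x] K(7)[of x] by linarith
    show thesis by (rule bounded_twisted_sum[OF \<theta>0 \<theta>(2) mE u, where T=g]) (rule that)
  qed
  \<comment> \<open>The shear qb sends B into C, so \<beta> at the image point enters the source for
    \<alpha>.\<close>
  obtain \<alpha> where \<alpha>: "\<And>x. \<alpha> x = 1 / s1 / mu x * \<alpha> (g x) + (\<beta> (g x) * qb x - rb x) / mu x" 
    and \<alpha>b: "\<And>x. \<bar>\<alpha> x\<bar> \<le> 2 * (2 * B1 * K + K) / (1 - \<theta>)"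
  proof -
    have u: "\<bar>(\<beta> (g x) * qb x - rb x) / mu x\<bar> \<le> 2 * (2 * B1 * K + K)" for x
    proof -
      have "\<bar>\<beta> (g x)\<bar> \<le> 2 * B1" using \<beta>b[of "g x"] by (simp add: B1_def)
      then have "\<bar>\<beta> (g x) * qb x\<bar> \<le> 2 * B1 * K"
        unfolding abs_mult using B1 K(3) by (intro mult_mono) auto
      then have "\<bar>\<beta> (g x) * qb x - rb x\<bar> \<le> 2 * B1 * K + K" using K(5)[of x] by linarith
      then show ?thesis using div_mu[of "\<beta> (g x) * qb x - rb x" x]
        by (meson mult_left_mono order_trans zero_le_numeral)
    qed
    show thesis by (rule bounded_twisted_sum[OF \<theta>0 \<theta>(2) mA u, where T=g]) (rule that)
  qed
  define B where "B = 1 + B1 + \<bar>(K + K * B1) / (1 - \<theta>)\<bar> + \<bar>2 * K / (1 - \<theta>)\<bar> + \<bar>2 * (2 * B1 * K + K) / (1 - \<theta>)\<bar>"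
  have B: "B \<ge> 1" "\<bar>\<gamma> x\<bar> \<le> B" "\<bar>\<zeta> x\<bar> \<le> B" "\<bar>\<beta> x\<bar> \<le> B" "\<bar>\<epsilon> x\<bar> \<le> B" "\<bar>\<alpha> x\<bar> \<le> B" for x
    using B1 \<gamma>b[of x] \<zeta>b[of x] \<beta>b[of x] \<epsilon>b[of x] \<alpha>b[of x] unfolding B_def B1_def by linarith+
  have \<gamma>g: "\<gamma> (g x) * s1 = qa x + qc x * \<gamma> x" for x
    using \<gamma>[of "g x"] s1 by (simp add: Sg field_simps)
  have \<zeta>g: "\<zeta> (g x) * s1 = ra x + rc x * \<gamma> x + mu x * \<zeta> x" for x
    using \<zeta>[of "g x"] s1 by (simp add: Sg field_simps)
  have \<beta>g: "mu x * \<beta> x + rc x = qc x * \<beta> (g x)" for x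
    using \<beta>[of x] mu_pos[of x] by (simp add: field_simps)
  have \<epsilon>g: "mu x * \<epsilon> x + re x = \<epsilon> (g x) / s0" for x
    using \<epsilon>[of x] mu_pos[of x] by (simp add: field_simps)
  have \<alpha>g: "mu x * \<alpha> x + rb x = \<alpha> (g x) / s1 + \<beta> (g x) * qb x" for x
    using \<alpha>[of x] mu_pos[of x] by (simp add: field_simps)
  have \<gamma>g': "qa x * a + qc x * (\<gamma> x * a) = \<gamma> (g x) * (s1 * a)" for x a
    unfolding mult.assoc[symmetric] \<gamma>g by (simp add: algebra_simps)
  have \<zeta>g': "ra x * a + rc x * (\<gamma> x * a) + mu x * (\<zeta> x * a) = \<zeta> (g x) * (s1 * a)" for x a
    unfolding mult.assoc[symmetric] \<zeta>g by (simp add: algebra_simps)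
  define Euu where "Euu x = {v. cB v = 0 \<and> cE v = 0 \<and> cC v = \<gamma> x * cA v \<and> cD v = \<zeta> x * cA v}" for x
  define Ecu where "Ecu x = {v. cA v = 0 \<and> cB v = 0 \<and> cC v = 0 \<and> cE v = 0}" for x :: mfd
  \<comment> \<open>The sum of \<open>Euu\<close> and \<open>Ecu\<close>; the D-coordinate is free
    in it, so \<zeta> disappears.\<close>
  define W where "W x = {v. cB v = 0 \<and> cE v = 0 \<and> cC v = \<gamma> x * cA v}" for x
  define Ecs where "Ecs x = {v. cA v = 0 \<and> cD v = \<alpha> x * cB v + \<beta> x * cC v + \<epsilon> x * cE v}" for x
  have Euu: "subspace (Euu x)" "dim (Euu x) = 1" for x
  proof -
    let ?f = "\<lambda>t. mk t 0 (\<gamma> x * t) (\<zeta> x * t) 0"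
    have "linear ?f" by (rule linearI; rule coord_eqI) (simp_all add: algebra_simps)
    moreover have "inj ?f" by (rule injI) (drule arg_cong[of _ _ cA], simp)
    moreover have "Euu x = range ?f"
      unfolding Euu_def by (auto intro!: rev_image_eqI[OF UNIV_I] coord_eqI)
    ultimately show "subspace (Euu x)" "dim (Euu x) = 1" using range_linear[of ?f] by simp_all
  qed
  have Ecu: "subspace (Ecu x)" "dim (Ecu x) = 1" for x
  proof -
    let ?f = "\<lambda>t. mk 0 0 0 t 0"
    have "linear ?f" by (rule linearI; rule coord_eqI) (simp_all add: algebra_simps)
    moreover have "inj ?f" by (rule injI) (drule arg_cong[of _ _ cD], simp)
    moreover have "Ecu x = range ?f"
      unfolding Ecu_def by (auto intro!: rev_image_eqI[OF UNIV_I] coord_eqI)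
    ultimately show "subspace (Ecu x)" "dim (Ecu x) = 1" using range_linear[of ?f] by simp_all
  qed
  have W: "subspace (W x)" "dim (W x) = 2" for x
  proof -
    let ?f = "\<lambda>p. mk (fst p) 0 (\<gamma> x * fst p) (snd p) 0"
    have "linear ?f" by (rule linearI; rule coord_eqI) (simp_all add: algebra_simps)
    moreover have "inj ?f"
    proof (rule injI)
      fix p q assume eq: "?f p = ?f q"
      show "p = q" using arg_cong[OF eq, of cA] arg_cong[OF eq, of cD] by (simp add: prod_eq_iff)
    qed
    moreover have "W x = range ?f"
    proof (intro set_eqI iffI)
      fix v assume "v \<in> W x"
      then have "v = ?f (cA v, cD v)" unfolding W_def by (intro coord_eqI) auto
      then show "v \<in> range ?f" by blast
    qed (auto simp: W_def)
    ultimately show "subspace (W x)" "dim (W x) = 2" using range_linear[of ?f] by simp_all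
  qed
  have Ecs: "subspace (Ecs x)" "dim (Ecs x) = 3" for x
  proof -
    let ?f = "\<lambda>p. mk 0 (fst p) (fst (snd p)) (\<alpha> x * fst p + \<beta> x * fst (snd p) + \<epsilon> x * snd (snd p)) (snd (snd p))"
    have "linear ?f" by (rule linearI; rule coord_eqI) (simp_all add: algebra_simps)
    moreover have "inj ?f"
    proof (rule injI)
      fix p q assume eq: "?f p = ?f q"
      show "p = q"
        using arg_cong[OF eq, of cB] arg_cong[OF eq, of cC] arg_cong[OF eq, of cE] by (simp add: prod_eq_iff)
    qed
    moreover have "Ecs x = range ?f"
    proof (intro set_eqI iffI)
      fix v assume "v \<in> Ecs x"
      then have "v = ?f (cB v, cC v, cE v)" unfolding Ecs_def by (intro coord_eqI) auto
      then show "v \<in> range ?f" by blast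
    qed (auto simp: Ecs_def)
    ultimately show "subspace (Ecs x)" "dim (Ecs x) = 3" using range_linear[of ?f] by simp_all
  qed
  have W_sum: "bundle_sum Euu Ecu = W"
  proof
    fix x
    show "bundle_sum Euu Ecu x = W x"
    proof (intro set_eqI iffI)
      fix v assume "v \<in> W x"
      then have v: "cB v = 0" "cE v = 0" "cC v = \<gamma> x * cA v" by (auto simp: W_def)
      have "v = mk (cA v) 0 (\<gamma> x * cA v) (\<zeta> x * cA v) 0 + mk 0 0 0 (cD v - \<zeta> x * cA v) 0"
        by (rule coord_eqI) (simp_all add: v)
      then show "v \<in> bundle_sum Euu Ecu x"
        unfolding bundle_sum_def subspace_sum_def Euu_def Ecu_def
        by (intro CollectI exI[of _ "mk (cA v) 0 (\<gamma> x * cA v) (\<zeta> x * cA v) 0"]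
            exI[of _ "mk 0 0 0 (cD v - \<zeta> x * cA v) 0"]) simp
    next
      fix v assume "v \<in> bundle_sum Euu Ecu x"
      then obtain a b where "v = a + b" "a \<in> Euu x" "b \<in> Ecu x"
        unfolding bundle_sum_def subspace_sum_def by blast
      then show "v \<in> W x" by (simp add: W_def Euu_def Ecu_def)
    qed
  qed
  have all: "subspace_sum (W x) (Ecs x) = UNIV" for x
  proof -
    have "v \<in> subspace_sum (W x) (Ecs x)" for v
    proof -
      define c where "c = cC v - \<gamma> x * cA v"
      define d where "d = \<alpha> x * cB v + \<beta> x * c + \<epsilon> x * cE v"
      have "v = mk (cA v) 0 (\<gamma> x * cA v) (cD v - d) 0 + mk 0 (cB v) c d (cE v)"
        by (rule coord_eqI) (simp_all add: c_def)
      then show ?thesis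
        unfolding subspace_sum_def W_def Ecs_def
        by (intro CollectI exI[of _ "mk (cA v) 0 (\<gamma> x * cA v) (cD v - d) 0"]
            exI[of _ "mk 0 (cB v) c d (cE v)"]) (simp add: d_def)
    qed
    then show ?thesis by blast
  qed
  have inv_Euu: "tangent_map g x v \<in> Euu (g x)" if "v \<in> Euu x" for x v
    using that unfolding Euu_def by (simp add: tangent_g \<gamma>g' \<zeta>g')
  have inv_Ecu: "tangent_map g x v \<in> Ecu (g x)" if "v \<in> Ecu x" for x v
    using that unfolding Ecu_def by (auto simp: tangent_g)
  have inv_W: "tangent_map g x v \<in> W (g x)" if "v \<in> W x" for x v
    using that unfolding W_def by (simp add: tangent_g \<gamma>g')
  have inv_Ecs: "tangent_map g x v \<in> Ecs (g x)" if "v \<in> Ecs x" for x v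
  proof -
    have v: "cA v = 0" "cD v = \<alpha> x * cB v + \<beta> x * cC v + \<epsilon> x * cE v" using that by (auto simp: Ecs_def)
    have "rb x * cB v + rc x * cC v + mu x * cD v + re x * cE v
        = (mu x * \<alpha> x + rb x) * cB v + (mu x * \<beta> x + rc x) * cC v + (mu x * \<epsilon> x + re x) * cE v"
      unfolding v(2) by (simp add: algebra_simps)
    also have "\<dots> = \<alpha> (g x) * (cB v / s1) + \<beta> (g x) * (qb x * cB v + qc x * cC v) + \<epsilon> (g x) * (cE v / s0)"
      unfolding \<alpha>g \<beta>g \<epsilon>g by (simp add: algebra_simps)
    finally show ?thesis unfolding Ecs_def by (simp add: tangent_g v(1))
  qed
  \<comment> \<open>The exact growth of the D-direction along an orbit. Both dominations are
    measured against it: E^uu grows faster, E^cs slower.\<close>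
  define M where "M n x = (\<Prod>j<n. mu ((g ^^ j) x))" for n x
  have M_Suc: "M (Suc n) x = mu ((g ^^ n) x) * M n x" for n x by (simp add: M_def)
  have M_pos: "M n x > 0" for n x unfolding M_def using mu_pos by (simp add: prod_pos)
  have M_le: "M n x \<le> (\<theta> * s1) ^ n" for n x
    unfolding M_def prod_constant[symmetric, of _ "{..<n}", simplified card_lessThan]
    by (rule prod_mono) (intro conjI mu_le less_imp_le[OF mu_pos])
  have g_Suc: "(g ^^ Suc n) x = g ((g ^^ n) x)"
    and D_Suc: "tangent_map (g ^^ Suc n) x v = tangent_map g ((g ^^ n) x) (tangent_map (g ^^ n) x v)" for n x v
    by (simp, subst tangent_map_Suc) (simp only: o_apply)
  let ?D = "\<lambda>n x. tangent_map (g ^^ n) x"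
  have iter_W: "?D n x v \<in> W ((g ^^ n) x) \<and> cA (?D n x v) = s1 ^ n * cA v \<and>
      cD (?D n x v) - \<zeta> ((g ^^ n) x) * cA (?D n x v) = M n x * (cD v - \<zeta> x * cA v)"
    if "v \<in> W x" for v x n
  proof (induction n)
    case 0
    then show ?case using that unfolding tangent_map_0 by (simp add: M_def)
  next
    case (Suc n)
    let ?x = "(g ^^ n) x" and ?v = "?D n x v"
    have "cD (tangent_map g ?x ?v) - \<zeta> (g ?x) * cA (tangent_map g ?x ?v)
        = ra ?x * cA ?v + rc ?x * cC ?v + mu ?x * cD ?v - (\<zeta> (g ?x) * s1) * cA ?v"
      using Suc unfolding W_def by (simp add: tangent_g)
    also have "\<dots> = mu ?x * (cD ?v - \<zeta> ?x * cA ?v)"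
      using Suc unfolding \<zeta>g W_def by (simp add: algebra_simps)
    also have "\<dots> = M (Suc n) x * (cD v - \<zeta> x * cA v)"
      using conjunct2[OF conjunct2[OF Suc]] unfolding M_Suc by (simp only: mult.assoc)
    finally have "cD (tangent_map g ?x ?v) - \<zeta> (g ?x) * cA (tangent_map g ?x ?v)
        = M (Suc n) x * (cD v - \<zeta> x * cA v)" .
    moreover have "tangent_map g ?x ?v \<in> W (g ?x)" using inv_W Suc by blast
    moreover have "cA (tangent_map g ?x ?v) = s1 ^ Suc n * cA v" using Suc by (simp add: tangent_g)
    ultimately show ?case unfolding D_Suc[of n x v] g_Suc[of n x] by blast
  qed
  have iter_Euu: "?D n x v \<in> Euu ((g ^^ n) x)" if "v \<in> Euu x" for v x n
  proof (induction n)
    case 0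
    then show ?case using that unfolding tangent_map_0 by simp
  next
    case (Suc n)
    then show ?case using inv_Euu unfolding D_Suc[of n x v] g_Suc[of n x] by blast
  qed
  have iter_Ecu: "?D n x v = mk 0 0 0 (M n x * cD v) 0" if "v \<in> Ecu x" for v x n
  proof -
    have "v \<in> W x" using that by (auto simp: Ecu_def W_def)
    note it = iter_W[OF this, of n]
    have A: "cA v = 0" using that by (simp add: Ecu_def)
    have "cA (?D n x v) = 0" using it A by simp
    with it A show ?thesis unfolding W_def by (intro coord_eqI) simp_all
  qed
  \<comment> \<open>Equivalent to the norm on E^cs, where cA = 0 and cD is a combination of the
    other coordinates. The first coordinate contracts by \<theta> mu / 2, and the remaining half of
    \<theta> mu pays for the shear: the weight is chosen such that 8 K \<theta> mu / 2 is at least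
    K.\<close>
  define N where "N v = 8 * K * \<bar>cB v\<bar> + \<bar>cC v\<bar> + \<bar>cE v\<bar>" for v
  have N_step: "N (tangent_map g x v) \<le> \<theta> * mu x * N v" if "v \<in> Ecs x" for x v
  proof -
    have a: "8 * K * \<bar>cB v / s1\<bar> \<le> 8 * K * (\<theta> * mu x / 2) * \<bar>cB v\<bar>"
      using mult_right_mono[OF s1_le[of x], of "8 * K * \<bar>cB v\<bar>"] K(1) s1 by (simp add: mult_ac)
    have "1 \<le> 8 * (\<theta> * mu x / 2)" using mult_mono[OF \<theta>(1) mu_ge[of x]] \<theta>0 by simp
    then have "K * \<bar>cB v\<bar> \<le> 8 * K * (\<theta> * mu x / 2) * \<bar>cB v\<bar>"
      using mult_right_mono[of 1 "8 * (\<theta> * mu x / 2)" "K * \<bar>cB v\<bar>"] K(1) by (simp add: mult_ac)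
    moreover have "\<bar>qb x * cB v\<bar> \<le> K * \<bar>cB v\<bar>" unfolding abs_mult by (intro mult_right_mono K) simp
    moreover have "\<bar>qc x * cC v\<bar> \<le> \<theta> * mu x * \<bar>cC v\<bar>"
      unfolding abs_mult using qc_le(2)[of x] qc_pos[of x] by (intro mult_right_mono) auto
    moreover have "\<bar>cE v / s0\<bar> \<le> \<theta> * mu x * \<bar>cE v\<bar>"
      using mult_right_mono[OF s0_le[of x], of "\<bar>cE v\<bar>"] s0 by simp
    moreover have "cA v = 0" using that by (simp add: Ecs_def)
    moreover have "\<bar>qb x * cB v + qc x * cC v\<bar> \<le> \<bar>qb x * cB v\<bar> + \<bar>qc x * cC v\<bar>" by (rule abs_triangle_ineq)
    moreover have "\<theta> * mu x * N v = 2 * (8 * K * (\<theta> * mu x / 2) * \<bar>cB v\<bar>) + \<theta> * mu x * \<bar>cC v\<bar> + \<theta> * mu x * \<bar>cE v\<bar>"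
      by (simp add: N_def algebra_simps)
    moreover have "N (tangent_map g x v) = 8 * K * \<bar>cB v / s1\<bar> + \<bar>qb x * cB v + qc x * cC v\<bar> + \<bar>cE v / s0\<bar>"
      using \<open>cA v = 0\<close> by (simp only: N_def tangent_g coord_mk mult_zero_right add_0)
    ultimately show ?thesis using a by linarith
  qed
  have iter_Ecs: "?D n x v \<in> Ecs ((g ^^ n) x) \<and> N (?D n x v) \<le> \<theta> ^ n * M n x * N v" if "v \<in> Ecs x" for v x n
  proof (induction n)
    case 0
    then show ?case using that unfolding tangent_map_0 by (simp add: M_def)
  next
    case (Suc n)
    let ?x = "(g ^^ n) x" and ?v = "?D n x v"
    have "N (tangent_map g ?x ?v) \<le> \<theta> * mu ?x * N ?v" using N_step Suc by blast
    also have "\<dots> \<le> \<theta> * mu ?x * (\<theta> ^ n * M n x * N v)"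
      using Suc mu_pos[of ?x] \<theta>0 by (intro mult_left_mono) auto
    finally show ?case
      using Suc inv_Ecs[of ?v ?x] unfolding D_Suc[of n x v] g_Suc[of n x] M_Suc by (simp add: mult_ac)
  qed
  have Euu_norm: "norm v \<le> 3 * B * \<bar>cA v\<bar>" if "v \<in> Euu x" for v x
  proof -
    have "\<bar>\<gamma> x * cA v\<bar> \<le> B * \<bar>cA v\<bar>" "\<bar>\<zeta> x * cA v\<bar> \<le> B * \<bar>cA v\<bar>" "\<bar>cA v\<bar> \<le> B * \<bar>cA v\<bar>"
      unfolding abs_mult using B(1) by (auto intro!: mult_right_mono B simp: mult_le_cancel_right1)
    then show ?thesis using norm_le_coords[of v] that unfolding Euu_def by simp
  qed
  have W_norm: "norm v \<le> 3 * B * (\<bar>cA v\<bar> + \<bar>cD v - \<zeta> x * cA v\<bar>)" if "v \<in> W x" for v x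
  proof -
    let ?t = "\<bar>cD v - \<zeta> x * cA v\<bar>"
    have "\<bar>\<gamma> x * cA v\<bar> \<le> B * \<bar>cA v\<bar>" "\<bar>\<zeta> x * cA v\<bar> \<le> B * \<bar>cA v\<bar>" "\<bar>cA v\<bar> \<le> B * \<bar>cA v\<bar>" "?t \<le> 3 * B * ?t"
      unfolding abs_mult using B(1) by (auto intro!: mult_right_mono B simp: mult_le_cancel_right1)
    moreover have "\<bar>cD v\<bar> \<le> ?t + \<bar>\<zeta> x * cA v\<bar>" by linarith
    moreover have "norm v \<le> \<bar>cA v\<bar> + \<bar>\<gamma> x * cA v\<bar> + \<bar>cD v\<bar>"
      using norm_le_coords[of v] that unfolding W_def by simp
    moreover have "3 * B * (\<bar>cA v\<bar> + ?t) = 3 * (B * \<bar>cA v\<bar>) + 3 * B * ?t" by (simp add: algebra_simps)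
    ultimately show ?thesis by linarith
  qed
  have W_norm_ge: "\<bar>cA v\<bar> + \<bar>cD v - \<zeta> x * cA v\<bar> \<le> 3 * B * norm v" for v x
  proof -
    have "\<bar>\<zeta> x * cA v\<bar> \<le> B * norm v"
      unfolding abs_mult using B(1) by (intro mult_mono B coord_le_norm) auto
    moreover have "norm v \<le> B * norm v" using B(1) by (simp add: mult_le_cancel_right1)
    ultimately show ?thesis using coord_le_norm(1)[of v] coord_le_norm(4)[of v] by linarith
  qed
  define C where "C = 3 * B * (2 + 1 / (8 * K))"
  have C: "C \<ge> 0" using B(1) K(1) by (simp add: C_def)
  have Ecs_norm: "norm v \<le> C * N v" if "v \<in> Ecs x" for v x
  proof -
    define T where "T = \<bar>cB v\<bar> + \<bar>cC v\<bar> + \<bar>cE v\<bar>"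
    have "\<bar>\<alpha> x * cB v\<bar> \<le> B * \<bar>cB v\<bar>" "\<bar>\<beta> x * cC v\<bar> \<le> B * \<bar>cC v\<bar>" "\<bar>\<epsilon> x * cE v\<bar> \<le> B * \<bar>cE v\<bar>"
      unfolding abs_mult by (intro mult_right_mono B; simp)+
    moreover have "T \<le> 2 * B * T" using B(1) by (simp add: T_def mult_le_cancel_right1)
    then have 1: "norm v \<le> 3 * B * T"
    proof -
      have "norm v \<le> T + \<bar>\<alpha> x * cB v + \<beta> x * cC v + \<epsilon> x * cE v\<bar>"
        using norm_le_coords[of v] that unfolding Ecs_def T_def by simp
      moreover have "3 * B * T = 2 * B * T + B * \<bar>cB v\<bar> + B * \<bar>cC v\<bar> + B * \<bar>cE v\<bar>"
        by (simp add: T_def algebra_simps)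
      ultimately show ?thesis
        using \<open>T \<le> 2 * B * T\<close> \<open>\<bar>\<alpha> x * cB v\<bar> \<le> B * \<bar>cB v\<bar>\<close> \<open>\<bar>\<beta> x * cC v\<bar> \<le> B * \<bar>cC v\<bar>\<close>
          \<open>\<bar>\<epsilon> x * cE v\<bar> \<le> B * \<bar>cE v\<bar>\<close> by linarith
    qed
    have "T \<le> (2 + 1 / (8 * K)) * N v"
      using K(1) unfolding T_def N_def by (simp add: algebra_simps)
    then have "3 * B * T \<le> 3 * B * ((2 + 1 / (8 * K)) * N v)" using B(1) by (intro mult_left_mono) auto
    with 1 show ?thesis by (simp add: C_def mult_ac)
  qed
  have N_norm: "N v \<le> (8 * K + 2) * norm v" for v
  proof -
    have "8 * K * \<bar>cB v\<bar> \<le> 8 * K * norm v" using coord_le_norm(2) K(1) by (intro mult_left_mono) auto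
    then show ?thesis using coord_le_norm(3)[of v] coord_le_norm(5)[of v] by (simp add: N_def distrib_right)
  qed
  have invE: "invariant_bundle g Euu" "invariant_bundle g Ecu" "invariant_bundle g W" "invariant_bundle g Ecs"
    using invariant_bundleI[OF Euu inv_Euu] invariant_bundleI[OF Ecu inv_Ecu] invariant_bundleI[OF W inv_W]
      invariant_bundleI[OF Ecs inv_Ecs] by auto
  have dom1: "dominates g Euu Ecu"
    unfolding dominates_def
  proof (intro conjI)
    show "\<forall>x. Euu x \<inter> Ecu x = {0}"
      by (auto simp: Euu_def Ecu_def intro!: coord_eqI)
    have sep: "norm v \<le> 3 * B * norm (v - w)" if "v \<in> Euu x" "w \<in> Ecu x" for x v w
    proof -
      have "cA (v - w) = cA v" using that by (simp add: Ecu_def)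
      then have "3 * B * \<bar>cA v\<bar> \<le> 3 * B * norm (v - w)"
        using coord_le_norm(1)[of "v - w"] B(1) by (intro mult_left_mono) auto
      then show ?thesis using Euu_norm[OF that(1)] by linarith
    qed
    have B3: "3 * B \<ge> 1" using B(1) by linarith
    show "\<exists>\<theta>>0. \<forall>x. \<forall>v\<in>Euu x - {0}. \<forall>w\<in>Ecu x - {0}. \<theta> \<le> vec_angle v w"
      by (intro exI conjI allI ballI, rule arccos_gap_pos[OF B3], rule vec_angle_ge[OF Euu(1) Ecu(1) B3 sep])
    show "\<exists>c>0. \<exists>\<sigma><1. \<forall>x. \<forall>v\<in>Euu x - {0}. \<forall>w\<in>Ecu x - {0}. \<forall>n\<ge>1.
        norm (?D n x w) / norm (?D n x v) \<le> c * \<sigma> ^ n * (norm w / norm v)"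
    proof (rule exI[of _ "3 * B"], intro conjI exI[of _ \<theta>] allI ballI impI)
      fix x v w n assume v: "v \<in> Euu x - {0}" and w: "w \<in> Ecu x - {0}"
      have nv: "norm v > 0" "v \<in> W x" using v by (auto simp: Euu_def W_def)
      have dw: "norm (?D n x w) = M n x * norm w"
      proof -
        have "?D n x w = M n x *\<^sub>R w" using iter_Ecu[of w x n] w
          by (intro coord_eqI) (auto simp: Ecu_def)
        then show ?thesis using M_pos[of n x] by simp
      qed
      have "s1 ^ n * norm v \<le> s1 ^ n * (3 * B * \<bar>cA v\<bar>)"
        using Euu_norm[of v x] v s1 by (intro mult_left_mono) auto
      also have "\<dots> = 3 * B * \<bar>cA (?D n x v)\<bar>" using iter_W[OF nv(2), of n] s1 by (simp add: abs_mult)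
      also have "\<dots> \<le> 3 * B * norm (?D n x v)" using coord_le_norm B(1) by (intro mult_left_mono) auto
      finally have lv: "s1 ^ n * norm v \<le> 3 * B * norm (?D n x v)" .
      have "0 < s1 ^ n * norm v" using s1 nv by simp
      then have pos: "norm (?D n x v) > 0" using lv B(1) by (smt (verit) mult_nonneg_nonpos norm_le_zero_iff)
      have "norm (?D n x w) * norm v \<le> (\<theta> * s1) ^ n * norm w * norm v"
        unfolding dw by (intro mult_right_mono M_le) auto
      also have "\<dots> = \<theta> ^ n * norm w * (s1 ^ n * norm v)" by (simp add: power_mult_distrib)
      also have "\<dots> \<le> \<theta> ^ n * norm w * (3 * B * norm (?D n x v))"
        using lv \<theta>0 by (intro mult_left_mono) auto
      finally show "norm (?D n x w) / norm (?D n x v) \<le> 3 * B * \<theta> ^ n * (norm w / norm v)"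
        using pos nv(1) by (simp add: field_simps)
    qed (use B(1) \<theta> in auto)
  qed (use invE in auto)
  have dom2: "dominates g W Ecs"
    unfolding dominates_def
  proof (intro conjI)
    show "\<forall>x. W x \<inter> Ecs x = {0}"
      by (auto simp: W_def Ecs_def intro!: coord_eqI)
    \<comment> \<open>The difference v - w isolates cA v, cB w and cE w; cC w and then cD w are
      recovered through the slopes, each time at the price of a factor B.\<close>
    define L where "L = 3 * B * (1 + 2 * B + 5 * B * B)"
    have L: "L \<ge> 1" unfolding L_def using B(1) mult_mono[OF B(1) B(1)]
        mult_mono[of 1 B 1 "1 + 2 * B + 5 * B * B"] by simp
    have sep: "norm v \<le> L * norm (v - w)" if "v \<in> W x" "w \<in> Ecs x" for x v w
    proof -
      define r where "r = norm (v - w)"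
      have v: "cB v = 0" "cE v = 0" "cC v = \<gamma> x * cA v" using that by (auto simp: W_def)
      have w: "cA w = 0" "cD w = \<alpha> x * cB w + \<beta> x * cC w + \<epsilon> x * cE w" using that by (auto simp: Ecs_def)
      have r: "r \<ge> 0" "\<bar>cA v\<bar> \<le> r" "\<bar>cB w\<bar> \<le> r" "\<bar>\<gamma> x * cA v - cC w\<bar> \<le> r" "\<bar>cD v - cD w\<bar> \<le> r" "\<bar>cE w\<bar> \<le> r"
        using coord_le_norm[of "v - w"] v w(1) unfolding r_def by auto
      have g: "\<bar>\<gamma> x * cA v\<bar> \<le> B * r" "\<bar>\<zeta> x * cA v\<bar> \<le> B * r"
        unfolding abs_mult using B(1) r by (auto intro!: mult_mono B)
      have rB: "r \<le> B * r" using B(1) r(1) by (simp add: mult_le_cancel_right1)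
      have cw: "\<bar>cC w\<bar> \<le> 2 * (B * r)" using r(4) g(1) rB by linarith
      have "\<bar>\<alpha> x * cB w\<bar> \<le> B * r" "\<bar>\<beta> x * cC w\<bar> \<le> B * (2 * (B * r))" "\<bar>\<epsilon> x * cE w\<bar> \<le> B * r"
        unfolding abs_mult using B(1) r cw by (auto intro!: mult_mono B)
      then have dw: "\<bar>cD w\<bar> \<le> 2 * (B * r) + 2 * (B * (B * r))" unfolding w(2) by linarith
      have "B * r \<le> B * (B * r)" using rB B(1) by (intro mult_left_mono) auto
      then have "\<bar>cA v\<bar> + \<bar>cD v - \<zeta> x * cA v\<bar> \<le> (1 + 2 * B + 5 * B * B) * r"
      proof -
        have "(1 + 2 * B + 5 * B * B) * r = r + 2 * (B * r) + 5 * (B * (B * r))" by (simp add: algebra_simps)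
        moreover have "\<bar>cD v\<bar> \<le> r + \<bar>cD w\<bar>" using r(5) by linarith
        moreover have "\<bar>cD v - \<zeta> x * cA v\<bar> \<le> \<bar>cD v\<bar> + \<bar>\<zeta> x * cA v\<bar>" by linarith
        ultimately show ?thesis using r(1,2) dw g(2) rB \<open>B * r \<le> B * (B * r)\<close> by linarith
      qed
      then have "3 * B * (\<bar>cA v\<bar> + \<bar>cD v - \<zeta> x * cA v\<bar>) \<le> 3 * B * ((1 + 2 * B + 5 * B * B) * r)"
        using B(1) by (intro mult_left_mono) auto
      with W_norm[OF that(1)] show ?thesis unfolding L_def r_def by (simp only: mult.assoc)
    qed
    show "\<exists>\<theta>>0. \<forall>x. \<forall>v\<in>W x - {0}. \<forall>w\<in>Ecs x - {0}. \<theta> \<le> vec_angle v w"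
      by (intro exI conjI allI ballI, rule arccos_gap_pos[OF L], rule vec_angle_ge[OF W(1) Ecs(1) L sep])
    \<comment> \<open>\<open>C\<close> and 8 K + 2 compare \<open>N\<close> with the norm on E^cs;
      the two factors 3 B compare the coordinates used on W with the norm, before and after the
      iteration.\<close>
    define c where "c = C * (8 * K + 2) * (3 * B) * (3 * B)"
    have c: "c > 0"
      using B(1) K(1) unfolding c_def C_def by (auto intro!: mult_pos_pos add_pos_pos)
    show "\<exists>c>0. \<exists>\<sigma><1. \<forall>x. \<forall>v\<in>W x - {0}. \<forall>w\<in>Ecs x - {0}. \<forall>n\<ge>1.
        norm (?D n x w) / norm (?D n x v) \<le> c * \<sigma> ^ n * (norm w / norm v)"
    proof (rule exI[of _ c], intro conjI exI[of _ \<theta>] allI ballI impI)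
      fix x v w n assume v: "v \<in> W x - {0}" and w: "w \<in> Ecs x - {0}"
      have nv: "norm v > 0" using v by simp
      have "norm (?D n x w) \<le> C * N (?D n x w)" using Ecs_norm iter_Ecs w by blast
      also have "\<dots> \<le> C * (\<theta> ^ n * M n x * ((8 * K + 2) * norm w))"
        using iter_Ecs[of w x n] w C N_norm[of w] \<theta>0 M_pos[of n x]
        by (intro mult_left_mono) (auto intro: order_trans[OF _ mult_left_mono])
      finally have dw: "norm (?D n x w) \<le> C * (8 * K + 2) * \<theta> ^ n * norm w * M n x" by (simp add: mult_ac)
      let ?t = "\<bar>cD v - \<zeta> x * cA v\<bar>"
      have Ms: "M n x \<le> s1 ^ n"
      proof -
        have "(\<theta> * s1) ^ n \<le> s1 ^ n"
          using \<theta> s1 by (intro power_mono) (auto simp: mult_le_cancel_right2)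
        then show ?thesis using M_le[of n x] by linarith
      qed
      have "M n x * (\<bar>cA v\<bar> + ?t) \<le> \<bar>s1 ^ n * cA v\<bar> + \<bar>M n x * (cD v - \<zeta> x * cA v)\<bar>"
        using mult_right_mono[OF Ms, of "\<bar>cA v\<bar>"] M_pos[of n x] s1
        by (simp only: abs_mult distrib_left) simp
      also have "\<dots> = \<bar>cA (?D n x v)\<bar> + \<bar>cD (?D n x v) - \<zeta> ((g ^^ n) x) * cA (?D n x v)\<bar>"
        using iter_W[of v x n] v by (metis DiffD1)
      also have "\<dots> \<le> 3 * B * norm (?D n x v)" by (rule W_norm_ge)
      finally have "3 * B * (M n x * (\<bar>cA v\<bar> + ?t)) \<le> 3 * B * (3 * B * norm (?D n x v))"
        using B(1) by (intro mult_left_mono) auto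
      moreover have "M n x * norm v \<le> M n x * (3 * B * (\<bar>cA v\<bar> + ?t))"
        using W_norm v M_pos[of n x] by (intro mult_left_mono) auto
      ultimately have lv: "M n x * norm v \<le> 3 * B * (3 * B * norm (?D n x v))" by (simp add: mult_ac)
      have "0 < M n x * norm v" using M_pos[of n x] nv by simp
      then have pos: "norm (?D n x v) > 0"
        using lv by (metis mult_zero_right norm_ge_zero order_less_le not_less)
      have "norm (?D n x w) * norm v \<le> C * (8 * K + 2) * \<theta> ^ n * norm w * M n x * norm v"
        by (intro mult_right_mono dw) auto
      also have "\<dots> = C * (8 * K + 2) * \<theta> ^ n * norm w * (M n x * norm v)" by simp
      also have "\<dots> \<le> C * (8 * K + 2) * \<theta> ^ n * norm w * (3 * B * (3 * B * norm (?D n x v)))"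
        using lv C K(1) \<theta>0 by (intro mult_left_mono) auto
      finally have "norm (?D n x w) * norm v \<le> c * \<theta> ^ n * norm w * norm (?D n x v)"
        unfolding c_def by (simp only: mult_ac)
      then show "norm (?D n x w) / norm (?D n x v) \<le> c * \<theta> ^ n * (norm w / norm v)"
        using pos nv by (simp add: field_simps)
    qed (use c \<theta> in auto)
  qed (use invE in auto)
  have expand: "uniformly_expanding g Euu"
    unfolding uniformly_expanding_def
  proof (rule exI[of _ "3 * B"], intro conjI exI[of _ "1 / s1"] allI ballI)
    fix x v n assume v: "v \<in> Euu x"
    then have vW: "v \<in> W x" by (auto simp: Euu_def W_def)
    have "\<bar>cA v\<bar> = (1 / s1) ^ n * \<bar>cA (?D n x v)\<bar>"
      using iter_W[OF vW, of n] s1 by (simp add: abs_mult power_one_over)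
    also have "\<dots> \<le> (1 / s1) ^ n * norm (?D n x v)"
      using s1 coord_le_norm by (intro mult_left_mono) auto
    finally have "3 * B * \<bar>cA v\<bar> \<le> 3 * B * ((1 / s1) ^ n * norm (?D n x v))"
      using B(1) by (intro mult_left_mono) auto
    then show "norm v \<le> 3 * B * (1 / s1) ^ n * norm (?D n x v)" using Euu_norm[OF v] by simp
  qed (use B(1) s1 in auto)
  have "ph_splitting g Euu Ecu Ecs"
    unfolding ph_splitting_def W_sum using dom1 dom2 expand Euu Ecu Ecs all by blast
  moreover have "cA v = 0" if "v \<in> Ecs x" for x v using that by (simp add: Ecs_def)
  moreover have "Ecs x = {v. cA v = 0 \<and> cD v = 0}"
    if z: "\<And>n. rb ((g ^^ n) x) = 0 \<and> rc ((g ^^ n) x) = 0 \<and> re ((g ^^ n) x) = 0" for x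
  proof -
    have z': "rb ((g ^^ n) ((g ^^ m) x)) = 0 \<and> rc ((g ^^ n) ((g ^^ m) x)) = 0 \<and> re ((g ^^ n) ((g ^^ m) x)) = 0" for n m
      using z[of "n + m"] by (simp add: funpow_add)
    \<comment> \<open>First \<beta> on the whole forward orbit, since its values there are part of
      the source for \<alpha>.\<close>
    have \<beta>0: "\<beta> ((g ^^ m) x) = 0" for m
      by (rule bounded_twisted_sum_zero[where T=g and m="\<lambda>x. qc x / mu x" and u="\<lambda>x. - rc x / mu x" and \<beta>=\<beta>,
            OF \<theta>0 \<theta>(2) mB \<beta>b \<beta>]) (use z' in simp)
    have "\<epsilon> x = 0"
      by (rule bounded_twisted_sum_zero[where T=g and m="\<lambda>x. 1 / s0 / mu x" and u="\<lambda>x. - re x / mu x" and \<beta>=\<epsilon>,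
            OF \<theta>0 \<theta>(2) mE \<epsilon>b \<epsilon>]) (use z in simp)
    moreover have "\<alpha> x = 0"
      by (rule bounded_twisted_sum_zero[where T=g and m="\<lambda>x. 1 / s1 / mu x"
            and u="\<lambda>x. (\<beta> (g x) * qb x - rb x) / mu x" and \<beta>=\<alpha>, OF \<theta>0 \<theta>(2) mA \<alpha>b \<alpha>])
        (use z \<beta>0[of "Suc _"] in simp)
    ultimately show ?thesis using \<beta>0[of 0] by (simp add: Ecs_def)
  qed
  ultimately show thesis using that by blast
qed

end

section \<open>Periodization of functions with small support\<close>

text \<open>Stands for the sum of all lattice translates of F. For F supported in the ball of radius
  1/4 and lattice vectors of length at least 1, at most one term is nonzero, and selecting it avoids
  an infinite sum.\<close>

definition periodize :: "'a::real_normed_vector set \<Rightarrow> ('a \<Rightarrow> real) \<Rightarrow> 'a \<Rightarrow> real" where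
  "periodize \<Lambda> F w = (if \<exists>l\<in>\<Lambda>. F (w - l) \<noteq> 0 then F (w - (SOME l. l \<in> \<Lambda> \<and> F (w - l) \<noteq> 0)) else 0)"

locale separated_lattice =
  fixes \<Lambda> :: "'a::euclidean_space set"
  assumes lattice_add: "l \<in> \<Lambda> \<Longrightarrow> l' \<in> \<Lambda> \<Longrightarrow> l + l' \<in> \<Lambda>"
    and lattice_minus: "l \<in> \<Lambda> \<Longrightarrow> - l \<in> \<Lambda>" and lattice_zero: "0 \<in> \<Lambda>"
    and lattice_norm: "l \<in> \<Lambda> \<Longrightarrow> l \<noteq> 0 \<Longrightarrow> norm l \<ge> 1"
begin

lemma lattice_eqI: "l \<in> \<Lambda> \<Longrightarrow> l' \<in> \<Lambda> \<Longrightarrow> norm (w - l) + norm (w - l') < 1 \<Longrightarrow> l = l'"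
proof (rule ccontr)
  assume l: "l \<in> \<Lambda>" "l' \<in> \<Lambda>" and n: "norm (w - l) + norm (w - l') < 1" and ne: "l \<noteq> l'"
  have "norm (l - l') \<ge> 1" using lattice_norm lattice_add[OF l(1) lattice_minus[OF l(2)]] ne by simp
  moreover have "norm (l - l') \<le> norm (w - l') + norm (w - l)"
    using norm_triangle_ineq4[of "w - l'" "w - l"] by simp
  ultimately show False using n by linarith
qed

context
  fixes F :: "'a \<Rightarrow> real"
  assumes supp: "\<And>x. F x \<noteq> 0 \<Longrightarrow> norm x < 1/4"
begin

lemma periodize_eqI:
  assumes "l \<in> \<Lambda>" and u: "\<And>l'. l' \<in> \<Lambda> \<Longrightarrow> F (w - l') \<noteq> 0 \<Longrightarrow> l' = l"
  shows "periodize \<Lambda> F w = F (w - l)"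
proof (cases "\<exists>l'\<in>\<Lambda>. F (w - l') \<noteq> 0")
  case True
  then have "\<exists>l'. l' \<in> \<Lambda> \<and> F (w - l') \<noteq> 0" by blast
  from someI_ex[OF this] have "(SOME l. l \<in> \<Lambda> \<and> F (w - l) \<noteq> 0) = l" using u by blast
  then show ?thesis using True by (simp add: periodize_def)
next
  case False
  then show ?thesis using assms(1) by (auto simp: periodize_def)
qed

text \<open>As 3/4 + 1/4 = 1, no second lattice point can contribute.\<close>

lemma periodize_eq:
  assumes "l \<in> \<Lambda>" "norm (w - l) \<le> 3/4"
  shows "periodize \<Lambda> F w = F (w - l)"
proof (rule periodize_eqI[OF assms(1)])
  fix l' assume "l' \<in> \<Lambda>" "F (w - l') \<noteq> 0"
  then show "l' = l" using lattice_eqI[of l' l w] supp[of "w - l'"] assms by auto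
qed

lemma periodize_zero: "(\<And>l. l \<in> \<Lambda> \<Longrightarrow> F (w - l) = 0) \<Longrightarrow> periodize \<Lambda> F w = 0"
  by (auto simp: periodize_def)

lemma periodize_nonzero:
  assumes "periodize \<Lambda> F w \<noteq> 0"
  obtains l where "l \<in> \<Lambda>" "periodize \<Lambda> F w = F (w - l)" "norm (w - l) < 1/4"
proof -
  obtain l where l: "l \<in> \<Lambda>" "F (w - l) \<noteq> 0" using periodize_zero[of w] assms by blast
  have n: "norm (w - l) < 1/4" using supp l(2) by blast
  show thesis by (rule that[OF l(1) periodize_eq[OF l(1)] n]) (use n in simp)
qed

lemma periodize_add: 
  assumes "l \<in> \<Lambda>" shows "periodize \<Lambda> F (w + l) = periodize \<Lambda> F w"
proof (cases "\<exists>m\<in>\<Lambda>. norm (w - m) \<le> 3/4")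
  case True
  then obtain m where m: "m \<in> \<Lambda>" "norm (w - m) \<le> 3/4" by blast
  then show ?thesis
    using periodize_eq[OF m] periodize_eq[OF lattice_add[OF m(1) assms], of "w + l"] by simp
next
  case False
  have "F (w - m) = 0" if "m \<in> \<Lambda>" for m using False supp[of "w - m"] that by fastforce
  moreover have "F (w + l - m) = 0" if "m \<in> \<Lambda>" for m
    using False supp[of "w + l - m"] lattice_add[OF that lattice_minus[OF assms]]
    by (fastforce simp: algebra_simps)
  ultimately show ?thesis by (simp add: periodize_zero)
qed

text \<open>A lattice point within 1/2 of the centre is within 3/4 of the whole ball, so
  \<open>periodize_eq\<close> applies throughout with the same l. If there is none, all translated
  supports miss the ball. Local properties of F thus pass to its periodization.\<close>

lemma periodize_local:
  "(\<exists>l\<in>\<Lambda>. \<forall>w\<in>ball w0 (1/4). periodize \<Lambda> F w = F (w - l)) \<or>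
   (\<forall>w\<in>ball w0 (1/4). periodize \<Lambda> F w = 0)"
proof (cases "\<exists>l\<in>\<Lambda>. norm (w0 - l) < 1/2")
  case True
  then obtain l where l: "l \<in> \<Lambda>" "norm (w0 - l) < 1/2" by blast
  have "norm (w - l) \<le> 3/4" if "w \<in> ball w0 (1/4)" for w
    using norm_triangle_ineq[of "w - w0" "w0 - l"] l(2) that by (simp add: dist_norm norm_minus_commute)
  then show ?thesis using periodize_eq[OF l(1)] l(1) by blast
next
  case False
  have "periodize \<Lambda> F w = 0" if w: "w \<in> ball w0 (1/4)" for w
  proof (rule periodize_zero, rule ccontr)
    fix l assume l: "l \<in> \<Lambda>" "F (w - l) \<noteq> 0"
    have "norm (w0 - l) \<le> norm (w0 - w) + norm (w - l)"
      using norm_triangle_ineq[of "w0 - w" "w - l"] by simp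
    also have "\<dots> < 1/2" using supp[OF l(2)] w by (simp add: dist_norm)
    finally show False using False l(1) by blast
  qed
  then show ?thesis by blast
qed

lemma smooth_periodize:
  assumes "smooth F" shows "smooth (periodize \<Lambda> F)"
proof (rule smooth_locally)
  fix w0 :: 'a
  have sh: "smooth (\<lambda>w. F (w - l))" for l
    using smooth_compose[OF assms smooth_add[OF smooth_bounded_linear[OF bounded_linear_ident] smooth_const[of "- l"]]]
    by simp
  have b: "open (ball w0 (1/4))" "w0 \<in> ball w0 (1/4)" by auto
  from periodize_local[of w0]
  show "\<exists>W g. open W \<and> w0 \<in> W \<and> smooth g \<and> (\<forall>y\<in>W. periodize \<Lambda> F y = g y)"
  proof (elim disjE bexE)
    fix l assume "\<forall>w\<in>ball w0 (1/4). periodize \<Lambda> F w = F (w - l)"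
    then show ?thesis using b sh[of l] by (intro exI[of _ "ball w0 (1/4)"] exI[of _ "\<lambda>w. F (w - l)"]) simp
  next
    assume "\<forall>w\<in>ball w0 (1/4). periodize \<Lambda> F w = 0"
    then show ?thesis using b smooth_const[of 0] by (intro exI[of _ "ball w0 (1/4)"] exI[of _ "\<lambda>w. 0"]) simp
  qed
qed

lemma periodize_derivative:
  assumes "smooth F"
  shows "(\<exists>l\<in>\<Lambda>. frechet_derivative (periodize \<Lambda> F) (at w) = frechet_derivative F (at (w - l))) \<or>
    frechet_derivative (periodize \<Lambda> F) (at w) = (\<lambda>v. 0)"
  using periodize_local[of w]
proof (elim disjE bexE)
  fix l assume l: "l \<in> \<Lambda>" "\<forall>v\<in>ball w (1/4). periodize \<Lambda> F v = F (v - l)"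
  have "((\<lambda>v. v - l) has_derivative (\<lambda>v. v)) (at w)"
    by (auto intro!: derivative_eq_intros)
  from has_derivative_compose[OF this smooth_has_derivative[OF assms]]
  have "((\<lambda>v. F (v - l)) has_derivative frechet_derivative F (at (w - l))) (at w)" by simp
  then have "(periodize \<Lambda> F has_derivative frechet_derivative F (at (w - l))) (at w)"
    by (rule has_derivative_transform_within_open[of _ _ _ _ "ball w (1/4)"]) (use l in auto)
  then show ?thesis using frechet_derivative_at l(1) by metis
next
  assume z: "\<forall>v\<in>ball w (1/4). periodize \<Lambda> F v = 0"
  have "(periodize \<Lambda> F has_derivative (\<lambda>v. 0)) (at w)"
    by (rule has_derivative_transform_within_open[where f="\<lambda>v. 0" and s="ball w (1/4)"]) (use z in auto)
  then show ?thesis using frechet_derivative_at by metis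
qed

end

end

text \<open>Each partial derivative is continuous on the compact ball and zero off it.\<close>

lemma derivative_bounded_of_support:
  fixes F :: "'a::euclidean_space \<Rightarrow> real"
  assumes F: "smooth F" and supp: "\<And>x. F x \<noteq> 0 \<Longrightarrow> norm x < r"
  shows "\<exists>C\<ge>0. \<forall>w v. \<bar>frechet_derivative F (at w) v\<bar> \<le> C * norm v"
proof -
  let ?D = "\<lambda>w. frechet_derivative F (at w)"
  have "\<exists>C\<ge>0. \<forall>w. \<bar>?D w i\<bar> \<le> C" for i
  proof -
    have "compact ((\<lambda>w. ?D w i) ` cball 0 r)"
      by (intro compact_continuous_image smooth_continuous_on smooth_frechet_derivative F compact_cball)
    then obtain C where C: "\<And>w. w \<in> cball 0 r \<Longrightarrow> \<bar>?D w i\<bar> \<le> C"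
      using compact_imp_bounded bounded_iff by (metis (no_types, lifting) image_eqI real_norm_def)
    have "\<bar>?D w i\<bar> \<le> max C 0" for w
    proof (cases "w \<in> cball 0 r")
      case False
      have "(F has_derivative (\<lambda>v. 0)) (at w)"
        by (rule has_derivative_transform_within_open[where f="\<lambda>v. 0" and s="- cball 0 r"])
          (use False supp in force)+
      then have "?D w = (\<lambda>v. 0)" using frechet_derivative_at by metis
      then show ?thesis by simp
    qed (use C in fastforce)
    then show ?thesis by (intro exI[of _ "max C 0"]) auto
  qed
  then obtain C where C: "\<And>i. C i \<ge> 0" "\<And>i w. \<bar>?D w i\<bar> \<le> C i" by metis
  have "\<bar>?D w v\<bar> \<le> (\<Sum>i\<in>Basis. C i) * norm v" for w v
  proof -
    have lin: "linear (?D w)"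
      using smooth_has_derivative[OF F] has_derivative_bounded_linear bounded_linear.linear by blast
    have "?D w v = ?D w (\<Sum>i\<in>Basis. (v \<bullet> i) *\<^sub>R i)" by (simp only: euclidean_representation)
    also have "\<dots> = (\<Sum>i\<in>Basis. (v \<bullet> i) * ?D w i)"
      by (simp only: linear_sum[OF lin] linear_scale[OF lin] real_scaleR_def)
    also have "\<bar>\<dots>\<bar> \<le> (\<Sum>i\<in>Basis. \<bar>(v \<bullet> i) * ?D w i\<bar>)" by (rule sum_abs)
    also have "\<dots> \<le> (\<Sum>i\<in>Basis. norm v * C i)"
      unfolding abs_mult by (intro sum_mono mult_mono Basis_le_norm C) auto
    finally show ?thesis by (simp add: sum_distrib_left mult.commute)
  qed
  then show ?thesis using C(1) by (intro exI[of _ "\<Sum>i\<in>Basis. C i"]) (auto intro: sum_nonneg)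
qed

interpretation int_lattice: separated_lattice int_lattice
  by standard (auto intro: int_lattice_add int_lattice_minus int_lattice_zero norm_int_lattice_ge)

interpretation cover_lattice: separated_lattice cover_lattice
  by standard (auto intro: cover_lattice_add cover_lattice_minus cover_lattice_zero norm_cover_lattice_ge)

section \<open>The cat map\<close>

locale cat_frame = frame eu es for eu es +
  fixes lam :: real
  assumes lam: "lam > 1" and cat_eu: "cat_matrix *v eu = lam *\<^sub>R eu"
    and cat_es: "cat_matrix *v es = (1 / lam) *\<^sub>R es"
begin

text \<open>For t = lam ^ n this is the n-th power of the cat matrix and for t = 1 / lam ^ n its
  inverse, diagonalised in the eigenframe.\<close>

definition hyp :: "real \<Rightarrow> real^2 \<Rightarrow> real^2" where
  "hyp t v = (t * (v \<bullet> eu)) *\<^sub>R eu + ((v \<bullet> es) / t) *\<^sub>R es"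

lemma hyp_inner [simp]: "hyp t v \<bullet> eu = t * (v \<bullet> eu)" "hyp t v \<bullet> es = (v \<bullet> es) / t"
  by (simp_all add: hyp_def inner_add_left)

lemma bounded_linear_hyp: "bounded_linear (hyp t)"
  unfolding linear_conv_bounded_linear[symmetric]
  by (rule linearI; rule frame_eqI) (simp_all add: inner_add_left algebra_simps add_divide_distrib)

lemma hyp_add: "hyp t (v + w) = hyp t v + hyp t w"
  and hyp_diff: "hyp t (v - w) = hyp t v - hyp t w"
  and hyp_scaleR: "hyp t (c *\<^sub>R v) = c *\<^sub>R hyp t v"
  using bounded_linear.linear[OF bounded_linear_hyp] linear_add linear_diff linear_scale by blast+

lemma hyp_hyp: "hyp s (hyp t v) = hyp (s * t) v"
  by (rule frame_eqI) simp_all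

lemma hyp_inverse: "t \<noteq> 0 \<Longrightarrow> hyp (1 / t) (hyp t v) = v" "t \<noteq> 0 \<Longrightarrow> hyp t (hyp (1 / t) v) = v"
  by (rule frame_eqI; simp)+

lemma cat_hyp: "cat_matrix *v v = hyp lam v"
  by (subst frame_expand[of v])
    (simp add: hyp_def matrix_vector_right_distrib matrix_vector_mult_scaleR cat_eu cat_es mult.commute)

lemma cat_pow_hyp: "(((*v) cat_matrix) ^^ n) v = hyp (lam ^ n) v"
  using lam by (induction n) (auto simp: cat_hyp hyp_hyp intro!: frame_eqI)

lemma cat_map_pow: "(cat_map ^^ n) (abs_torus v) = abs_torus (hyp (lam ^ n) v)"
proof -
  have "(cat_map ^^ n) (abs_torus v) = abs_torus ((((*v) cat_matrix) ^^ n) v)"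
    by (induction n) (simp_all add: cat_map.abs_eq)
  then show ?thesis by (simp add: cat_pow_hyp)
qed

text \<open>The cat matrix is integral with determinant 1. The explicit preimage used for the
  inverse comes from the matrix with rows (1, -1) and (-1, 2).\<close>

lemma hyp_lattice:
  assumes "l \<in> int_lattice" shows "hyp (lam ^ n) l \<in> int_lattice" "hyp (1 / lam ^ n) l \<in> int_lattice"
proof -
  have 1: "cat_matrix *v v \<in> int_lattice" if "v \<in> int_lattice" for v
    using that by (auto simp: int_lattice_def cat_matrix_def matrix_vector_mult_def sum_2 forall_2)
  have 2: "\<exists>w\<in>int_lattice. cat_matrix *v w = v" if v: "v \<in> int_lattice" for v
  proof
    show "vector [v $ 1 - v $ 2, 2 * v $ 2 - v $ 1] \<in> int_lattice"
      using v by (auto simp: int_lattice_def forall_2)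
    show "cat_matrix *v vector [v $ 1 - v $ 2, 2 * v $ 2 - v $ 1] = v"
      by (simp add: vec_eq_iff forall_2 cat_matrix_def matrix_vector_mult_def sum_2)
  qed
  have 3: "hyp (1 / lam) v \<in> int_lattice" if v: "v \<in> int_lattice" for v
  proof -
    obtain w where "w \<in> int_lattice" "hyp lam w = v" using 2[OF v] by (auto simp: cat_hyp)
    then show ?thesis using hyp_inverse(1)[of lam w] lam by auto
  qed
  show "hyp (lam ^ n) l \<in> int_lattice"
  proof (induction n)
    case 0
    show ?case using assms cat_pow_hyp[of 0 l] by simp
  next
    case (Suc n)
    then show ?case using 1[OF Suc] by (simp add: cat_hyp hyp_hyp)
  qed
  show "hyp (1 / lam ^ n) l \<in> int_lattice"
  proof (induction n)
    case 0
    show ?case using assms cat_pow_hyp[of 0 l] by simp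
  next
    case (Suc n)
    then show ?case using 3[OF Suc] by (simp add: hyp_hyp)
  qed
qed

lemma cat_pow_max_eigenvalue_eq: "cat_pow_max_eigenvalue n = lam ^ n"
proof -
  have "{\<mu>. \<exists>v. v \<noteq> 0 \<and> (((*v) cat_matrix) ^^ n) v = \<mu> *\<^sub>R v} = {lam ^ n, 1 / lam ^ n}"
  proof (intro set_eqI iffI)
    fix \<mu> assume "\<mu> \<in> {\<mu>. \<exists>v. v \<noteq> 0 \<and> (((*v) cat_matrix) ^^ n) v = \<mu> *\<^sub>R v}"
    then obtain v where v: "v \<noteq> 0" "hyp (lam ^ n) v = \<mu> *\<^sub>R v" by (auto simp: cat_pow_hyp)
    have "lam ^ n * (v \<bullet> eu) = \<mu> * (v \<bullet> eu)" "(v \<bullet> es) / lam ^ n = \<mu> * (v \<bullet> es)"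
      using arg_cong[OF v(2), of "\<lambda>w. w \<bullet> eu"] arg_cong[OF v(2), of "\<lambda>w. w \<bullet> es"] by simp_all
    moreover have "v \<bullet> eu \<noteq> 0 \<or> v \<bullet> es \<noteq> 0" using v(1) frame_eqI[of v 0] by auto
    ultimately show "\<mu> \<in> {lam ^ n, 1 / lam ^ n}" using lam by (auto simp: field_simps)
  next
    fix \<mu> assume "\<mu> \<in> {lam ^ n, 1 / lam ^ n}"
    then have "(eu \<noteq> 0 \<and> hyp (lam ^ n) eu = \<mu> *\<^sub>R eu) \<or> (es \<noteq> 0 \<and> hyp (lam ^ n) es = \<mu> *\<^sub>R es)"
      using norm_eu norm_es by (auto simp: hyp_def simp del: eu_es_simps(1,2))
    then show "\<mu> \<in> {\<mu>. \<exists>v. v \<noteq> 0 \<and> (((*v) cat_matrix) ^^ n) v = \<mu> *\<^sub>R v}"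
      by (auto simp: cat_pow_hyp)
  qed
  moreover have "1 / lam ^ n \<le> lam ^ n"
  proof -
    have "1 \<le> lam ^ n" using lam by (intro one_le_power) simp
    moreover from this have "1 / lam ^ n \<le> 1" by (subst divide_le_eq_1_pos) linarith+
    ultimately show ?thesis by linarith
  qed
  ultimately show ?thesis by (simp add: cat_pow_max_eigenvalue_def)
qed

text \<open>Dynamics takes the place of an irrationality argument. Some lattice vector has a nonzero
  component along e; a power of the cat matrix, negative for eu and positive for es, makes this
  component smaller than \<eta> without leaving the lattice, and the integer multiples of the result
  come close to every x.\<close>

lemma lattice_dense:
  assumes "e = eu \<or> e = es" "\<eta> > 0"
  shows "\<exists>l\<in>int_lattice. \<bar>l \<bullet> e - x\<bar> < \<eta>"
proof -
  obtain l0 where l0: "l0 \<in> int_lattice" "l0 \<bullet> e \<noteq> 0"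
  proof -
    have ax: "axis i 1 \<in> int_lattice" for i :: 2 by (auto simp: int_lattice_def axis_def)
    have "e \<noteq> 0" using assms(1) norm_eu norm_es by (metis norm_zero zero_neq_one)
    then obtain i where "e $ i \<noteq> 0" by (auto simp: vec_eq_iff)
    then have "axis i 1 \<bullet> e \<noteq> 0" by (simp add: inner_axis')
    with ax that show thesis by blast
  qed
  have "(\<lambda>n. \<bar>l0 \<bullet> e\<bar> * (1 / lam) ^ n) \<longlonglongrightarrow> \<bar>l0 \<bullet> e\<bar> * 0"
    using lam by (intro tendsto_mult tendsto_const LIMSEQ_power_zero) auto
  then have "\<forall>\<^sub>F n in sequentially. \<bar>l0 \<bullet> e\<bar> * (1 / lam) ^ n < \<eta>"
    using assms(2) by (auto dest: order_tendstoD)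
  then obtain n where "\<bar>l0 \<bullet> e\<bar> * (1 / lam) ^ n < \<eta>" by (auto simp: eventually_sequentially)
  then have n: "\<bar>l0 \<bullet> e\<bar> / lam ^ n < \<eta>" by (simp add: power_one_over divide_inverse power_inverse)
  obtain l1 where l1: "l1 \<in> int_lattice" "l1 \<bullet> e \<noteq> 0" "\<bar>l1 \<bullet> e\<bar> < \<eta>"
  proof (cases "e = eu")
    case True
    show thesis
      by (rule that[of "hyp (1 / lam ^ n) l0"])
        (use hyp_lattice[OF l0(1)] l0 n lam True in \<open>auto simp: abs_mult\<close>)
  next
    case False
    then have "e = es" using assms(1) by blast
    then show thesis
      by (intro that[of "hyp (lam ^ n) l0"])
        (use hyp_lattice[OF l0(1)] l0 n lam in \<open>auto simp: abs_mult\<close>)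
  qed
  define t where "t = l1 \<bullet> e"
  define j where "j = \<lfloor>x / t\<rfloor>"
  have "of_int j *\<^sub>R l1 \<in> int_lattice" using l1(1) by (auto simp: int_lattice_def)
  moreover have "\<bar>(of_int j *\<^sub>R l1) \<bullet> e - x\<bar> < \<eta>"
  proof -
    have "x - of_int j * t = (x / t - of_int j) * t" using l1(2) by (simp add: t_def field_simps)
    moreover have "\<bar>x / t - of_int j\<bar> \<le> 1" unfolding j_def by linarith
    ultimately have "\<bar>x - of_int j * t\<bar> \<le> 1 * \<bar>t\<bar>" unfolding abs_mult by (metis mult_right_mono abs_ge_zero abs_mult)
    then show ?thesis using l1(3) by (simp add: t_def abs_minus_commute)
  qed
  ultimately show ?thesis by blast
qed

end

text \<open>Both eigenvalues are roots of the characteristic polynomial t^2 - 3 t + 1, so they have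
  sum 3 and product 1; the larger one is positive because a^2 + 1 = 3 a.\<close>

lemma cat_eigenbasis_frame:
  assumes "cat_eigenbasis eu es" shows "\<exists>lam. cat_frame eu es lam"
proof -
  obtain a b where a: "\<bar>a\<bar> > 1" "cat_matrix *v eu = a *\<^sub>R eu" and b: "\<bar>b\<bar> < 1" "cat_matrix *v es = b *\<^sub>R es"
    and n: "norm eu = 1" "norm es = 1" "eu \<bullet> es = 0" using assms by (auto simp: cat_eigenbasis_def)
  have root: "t * t - 3 * t + 1 = 0" if "cat_matrix *v v = t *\<^sub>R v" "v \<noteq> 0" for t v
  proof -
    have e: "2 * v $ 1 + v $ 2 = t * v $ 1" "v $ 1 + v $ 2 = t * v $ 2"
      using that(1) by (simp_all add: vec_eq_iff forall_2 cat_matrix_def matrix_vector_mult_def sum_2)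
    have "(t * t - 3 * t + 1) * v $ 1 = 0" "(t * t - 3 * t + 1) * v $ 2 = 0"
      using e by algebra+
    moreover have "v $ 1 \<noteq> 0 \<or> v $ 2 \<noteq> 0" using that(2) by (simp add: vec_eq_iff forall_2)
    ultimately show ?thesis by auto
  qed
  have ra: "a * a - 3 * a + 1 = 0" using root[OF a(2)] n(1) by fastforce
  have rb: "b * b - 3 * b + 1 = 0" using root[OF b(2)] n(2) by fastforce
  have "a > 0" using ra zero_le_square[of a] by linarith
  then have a1: "a > 1" using a(1) by simp
  have "(a - b) * (a + b - 3) = 0" using ra rb by algebra
  moreover have "a \<noteq> b" using a1 b(1) by auto
  ultimately have "b = 3 - a" by simp
  then have "a * b = 1" using ra by algebra
  then have "b = 1 / a" using a1 by (simp add: field_simps)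
  then have "cat_frame eu es a" using n a b a1 by unfold_locales auto
  then show ?thesis by blast
qed

section \<open>The bump function and the circle diffeomorphism\<close>

locale bump_function =
  fixes \<psi> :: "real \<Rightarrow> real"
  assumes bump: "bump \<psi>"
begin

lemma smooth_\<psi>: "smooth \<psi>" using bump by (simp add: bump_def)

lemma \<psi>_even: "\<psi> (- t) = \<psi> t" using bump by (simp add: bump_def)

lemma \<psi>_abs: "\<psi> \<bar>t\<bar> = \<psi> t" by (simp add: abs_if \<psi>_even)

lemma \<delta>_pos: "\<delta> > 0" by (simp add: \<delta>_def)

lemma \<psi>_one: "\<bar>t\<bar> \<le> \<delta> / 2 \<Longrightarrow> \<psi> t = 1"
  using bump \<psi>_abs[of t] by (auto simp: bump_def)

lemma \<psi>_zero: "\<bar>t\<bar> \<ge> \<delta> \<Longrightarrow> \<psi> t = 0"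
  using bump \<psi>_abs[of t] by (auto simp: bump_def)

lemma continuous_\<psi>: "continuous_on S \<psi>" by (rule smooth_continuous_on[OF smooth_\<psi>])

text \<open>\<open>bump\<close> leaves the sense of monotonicity open. By continuity \<psi> is
  comparable with its values at the end points, and the values 1 at \<delta> / 2 and 0 at \<delta>
  rule out an increasing \<psi>.\<close>

lemma \<psi>_transition:
  assumes "\<delta> / 2 < t" "t < \<delta>" shows "0 \<le> \<psi> t" "\<psi> t \<le> 1"
    and "\<And>s. \<delta> / 2 < s \<Longrightarrow> s \<le> t \<Longrightarrow> \<psi> t \<le> \<psi> s"
proof -
  have cl: "closure {\<delta> / 2<..<t} = {\<delta> / 2..t}" "closure {t<..<\<delta>} = {t..\<delta>}"
    using assms by (simp_all add: closure_greaterThanLessThan)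
  have anti: "strict_antimono_on {\<delta> / 2<..<\<delta>} \<psi>"
  proof (rule ccontr)
    assume "\<not> ?thesis"
    then have m: "strict_mono_on {\<delta> / 2<..<\<delta>} \<psi>" using bump by (auto simp: bump_def)
    have "\<psi> (\<delta> / 2) \<le> \<psi> t"
      by (rule continuous_le_on_closure[of "{\<delta> / 2<..<t}"])
        (use assms cl m in \<open>auto simp: strict_mono_on_def continuous_\<psi> intro: less_imp_le\<close>)
    moreover have "\<psi> t \<le> \<psi> \<delta>"
      by (rule continuous_ge_on_closure[of "{t<..<\<delta>}"])
        (use assms cl m in \<open>auto simp: strict_mono_on_def continuous_\<psi> intro: less_imp_le\<close>)
    ultimately show False using \<psi>_one[of "\<delta> / 2"] \<psi>_zero[of \<delta>] \<delta>_pos by simp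
  qed
  then show "\<psi> t \<le> \<psi> s" if "\<delta> / 2 < s" "s \<le> t" for s
    using assms that by (cases "s = t") (auto simp: monotone_on_def intro: less_imp_le)
  have "\<psi> t \<le> \<psi> (\<delta> / 2)"
    by (rule continuous_ge_on_closure[of "{\<delta> / 2<..<t}"])
      (use assms cl anti in \<open>auto simp: monotone_on_def continuous_\<psi> intro: less_imp_le\<close>)
  then show "\<psi> t \<le> 1" using \<psi>_one[of "\<delta> / 2"] \<delta>_pos by simp
  have "\<psi> \<delta> \<le> \<psi> t"
    by (rule continuous_le_on_closure[of "{t<..<\<delta>}"])
      (use assms cl anti in \<open>auto simp: monotone_on_def continuous_\<psi> intro: less_imp_le\<close>)
  then show "0 \<le> \<psi> t" using \<psi>_zero[of \<delta>] \<delta>_pos by simp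
qed

lemma \<psi>_bounds: "0 \<le> \<psi> t" "\<psi> t \<le> 1"
proof -
  consider "\<bar>t\<bar> \<le> \<delta> / 2" | "\<bar>t\<bar> \<ge> \<delta>" | "\<delta> / 2 < \<bar>t\<bar>" "\<bar>t\<bar> < \<delta>" by linarith
  then have "0 \<le> \<psi> t \<and> \<psi> t \<le> 1"
  proof cases
    case 3
    then show ?thesis using \<psi>_transition(1,2)[of "\<bar>t\<bar>"] \<psi>_abs by simp
  qed (auto simp: \<psi>_one \<psi>_zero)
  then show "0 \<le> \<psi> t" "\<psi> t \<le> 1" by auto
qed

lemma \<psi>_antimono:
  assumes "0 \<le> s" "s \<le> t" shows "\<psi> t \<le> \<psi> s"
proof -
  consider "s \<le> \<delta> / 2" | "t \<ge> \<delta>" | "\<delta> / 2 < s" "t < \<delta>" by linarith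
  then show ?thesis
  proof cases
    case 1
    then show ?thesis using \<psi>_one[of s] assms \<psi>_bounds by simp
  next
    case 2
    then show ?thesis using \<psi>_zero[of t] assms \<psi>_bounds by simp
  next
    case 3
    then show ?thesis using \<psi>_transition(3)[of t s] assms by linarith
  qed
qed

lemma DERIV_\<psi>: "(\<psi> has_real_derivative deriv \<psi> t) (at t)"
  by (rule smooth_deriv(1)[OF smooth_\<psi>])

text \<open>\<psi> is even and decreases away from 0. The sign ensures that the derivative of t *
  \<psi> t never exceeds \<psi> t, which bounds the deformation of the last factor from
  below.\<close>

lemma deriv_\<psi>_nonpos: "t * deriv \<psi> t \<le> 0"
proof -
  have neg: "deriv \<psi> t \<le> 0" if "t > 0" for t
  proof -
    have "mono_on {0<..} (\<lambda>t. - \<psi> t)" using \<psi>_antimono by (auto intro!: mono_onI)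
    from mono_on_imp_deriv_nonneg[OF this DERIV_minus[OF DERIV_\<psi>]] that show ?thesis
      by (simp add: interior_open)
  qed
  have "deriv \<psi> (- t) = - deriv \<psi> t"
  proof -
    have "((\<lambda>t. \<psi> (- t)) has_real_derivative - deriv \<psi> (- t)) (at t)"
      using DERIV_chain'[OF DERIV_minus[OF DERIV_ident] DERIV_\<psi>] by simp
    then have "(\<psi> has_real_derivative - deriv \<psi> (- t)) (at t)" by (simp add: \<psi>_even)
    then show ?thesis using DERIV_unique[OF DERIV_\<psi>] by fastforce
  qed
  then show ?thesis using neg[of t] neg[of "- t"]
    by (cases t "0::real" rule: linorder_cases) (auto simp: mult_nonneg_nonpos mult_nonpos_nonneg)
qed

text \<open>The square root is not smooth where N vanishes, but near such points the composition is
  the constant 1.\<close>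

lemma smooth_bump_sqrt:
  fixes N :: "'a::euclidean_space \<Rightarrow> real"
  assumes N: "smooth N" "\<And>w. N w \<ge> 0" and c: "c > 0"
  shows "smooth (\<lambda>w. \<psi> (c * sqrt (N w)))"
  unfolding smooth_def
proof (intro allI Ck_on_locally)
  fix k w
  have cN: "continuous_on UNIV N" by (rule smooth_continuous_on[OF N(1)])
  show "\<exists>W. open W \<and> w \<in> W \<and> Ck_on k W (\<lambda>w. \<psi> (c * sqrt (N w)))"
  proof (cases "N w > 0")
    case True
    define W where "W = {v. N v > 0}"
    have o: "open W" unfolding W_def by (intro open_Collect_less continuous_on_const cN)
    have Ck: "Ck_on k UNIV \<psi>" "Ck_on k W N"
      using smooth_\<psi> N(1) Ck_on_subset[of k UNIV N W] by (auto simp: smooth_def)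
    have "Ck_on k W (\<lambda>w. sqrt (N w))"
      by (rule Ck_on_compose[OF o open_greaterThan _ Ck_on_sqrt Ck(2)]) (auto simp: W_def)
    then have "Ck_on k W (\<lambda>w. c * sqrt (N w))" by (intro Ck_on_mult Ck_on_const o)
    then have "Ck_on k W (\<lambda>w. \<psi> (c * sqrt (N w)))"
      by (intro Ck_on_compose[OF o open_UNIV _ Ck(1)]) auto
    then show ?thesis using o True W_def by blast
  next
    case False
    then have Nw: "N w = 0" using N(2)[of w] by linarith
    define W where "W = {v. c * sqrt (N v) < \<delta> / 2}"
    have o: "open W" unfolding W_def by (intro open_Collect_less continuous_intros cN)
    have "Ck_on k W (\<lambda>w. \<psi> (c * sqrt (N w)))"
    proof (rule Ck_on_cong[OF o _ Ck_on_const[OF o, of k 1]])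
      fix v assume "v \<in> W"
      then show "1 = \<psi> (c * sqrt (N v))" using \<psi>_one[of "c * sqrt (N v)"] c N(2)[of v] by (simp add: W_def)
    qed
    moreover have "w \<in> W" using Nw \<delta>_pos by (simp add: W_def)
    ultimately show ?thesis using o by blast
  qed
qed

end

section \<open>Periodic functions and the circle diffeomorphism\<close>

lemma periodic_int_multiple:
  fixes f :: "real \<Rightarrow> real"
  assumes "\<And>t. f (t + 2) = f t + c"
  shows "f (t + 2 * of_int j) = f t + of_int j * c"
proof (induction j rule: int_induct[where k=0])
  case (step1 i)
  then show ?case using assms[of "t + 2 * of_int i"] by (simp add: algebra_simps)
next
  case (step2 i)
  then show ?case using assms[of "t + 2 * of_int (i - 1)"] by (simp add: algebra_simps)
qed simp

lemma periodic_bounded: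
  fixes f :: "real \<Rightarrow> real"
  assumes "continuous_on UNIV f" "\<And>t. f (t + 2) = f t"
  shows "\<exists>C\<ge>0. \<forall>t. \<bar>f t\<bar> \<le> C"
proof -
  have "compact (f ` {0..2})"
    using assms(1) by (intro compact_continuous_image) (auto intro: continuous_on_subset)
  then obtain C where C: "\<And>t. t \<in> {0..2} \<Longrightarrow> \<bar>f t\<bar> \<le> C"
    using compact_imp_bounded bounded_iff by (metis (no_types, lifting) image_eqI real_norm_def)
  have "\<bar>f t\<bar> \<le> C" for t
  proof -
    define j where "j = \<lfloor>t / 2\<rfloor>"
    have j: "of_int j \<le> t / 2" "t / 2 < of_int j + 1" unfolding j_def by linarith+
    have "f (t - 2 * of_int j + 2 * of_int j) = f (t - 2 * of_int j) + of_int j * 0"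
      by (rule periodic_int_multiple) (simp add: assms(2))
    moreover have "t - 2 * of_int j \<in> {0..2}" using j by auto
    ultimately show ?thesis using C by fastforce
  qed
  moreover from this[of 0] have "C \<ge> 0" by linarith
  ultimately show ?thesis by blast
qed

locale circle_map = bump_function +
  fixes \<phi> :: "real \<Rightarrow> real"
  assumes circle: "circle_diffeo \<psi> \<phi>"
begin

lemma smooth_\<phi>: "smooth \<phi>" using circle by (simp add: circle_diffeo_def)

lemma \<phi>_2: "\<phi> (t + 2) = \<phi> t + 2" using circle by (simp add: circle_diffeo_def)

lemma \<phi>_int: "\<phi> (t + 2 * of_int j) = \<phi> t + 2 * of_int j"
  using periodic_int_multiple[of \<phi> 2, OF \<phi>_2] by simp

lemma DERIV_\<phi>: "(\<phi> has_real_derivative deriv \<phi> t) (at t)"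
  by (rule smooth_deriv(1)[OF smooth_\<phi>])

lemma \<phi>_fixed: "t \<in> {0..2} \<Longrightarrow> \<phi> t = t \<longleftrightarrow> t = 0 \<or> t = 1 \<or> t = 2"
proof -
  have "{t\<in>{0..2}. \<phi> t = t} = {0, 1, 2}" using circle by (simp add: circle_diffeo_def)
  then show "t \<in> {0..2} \<Longrightarrow> ?thesis" by blast
qed

lemma \<phi>_values: "\<phi> 0 = 0" "\<phi> 1 = 1" "\<phi> (- 1) = - 1"
  using \<phi>_fixed[of 0] \<phi>_fixed[of 1] \<phi>_2[of "- 1"] by auto

lemma deriv_\<phi>_values: "deriv \<phi> 0 = 1 / 2" "deriv \<phi> 1 = 3 / 2"
  using circle by (auto simp: circle_diffeo_def)

lemma deriv_\<phi>_2: "deriv \<phi> (t + 2) = deriv \<phi> t"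
proof -
  have "((\<lambda>t. \<phi> (t + 2)) has_real_derivative deriv \<phi> (t + 2)) (at t)"
    using DERIV_chain'[OF DERIV_add[OF DERIV_ident DERIV_const[of 2]] DERIV_\<phi>] by simp
  moreover have "((\<lambda>t. \<phi> (t + 2)) has_real_derivative deriv \<phi> t) (at t)"
    unfolding \<phi>_2 using DERIV_add[OF DERIV_\<phi> DERIV_const] by simp
  ultimately show ?thesis by (rule DERIV_unique)
qed

lemma deriv_\<phi>_int: "deriv \<phi> (t + 2 * of_int j) = deriv \<phi> t"
  using periodic_int_multiple[of "deriv \<phi>" 0] deriv_\<phi>_2 by simp

lemma deriv_\<phi>_bounded: "\<exists>C\<ge>0. \<forall>t. \<bar>deriv \<phi> t\<bar> \<le> C"
  by (rule periodic_bounded[OF smooth_deriv(2)[OF smooth_\<phi>] deriv_\<phi>_2])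

lemma displacement_bounded: "\<exists>C\<ge>0. \<forall>t. \<bar>\<phi> t - t\<bar> \<le> C"
  by (rule periodic_bounded) (auto intro!: continuous_intros smooth_continuous_on[OF smooth_\<phi>] simp: \<phi>_2)

lemma deriv_Q: "deriv (Q_fun \<psi> \<phi> a b) c = 1 + \<psi> (sqrt (a\<^sup>2 + b\<^sup>2)) * (deriv \<phi> c - 1)"
proof (rule DERIV_imp_deriv)
  show "(Q_fun \<psi> \<phi> a b has_real_derivative 1 + \<psi> (sqrt (a\<^sup>2 + b\<^sup>2)) * (deriv \<phi> c - 1)) (at c)"
    unfolding Q_fun_def[abs_def] using DERIV_\<phi> by (auto intro!: derivative_eq_intros)
qed

lemma dQ_bounded: "\<exists>C. \<forall>s t. \<bar>\<psi> t * (deriv \<phi> s - 1)\<bar> \<le> C"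
proof -
  obtain C where C: "C \<ge> 0" "\<And>t. \<bar>deriv \<phi> t\<bar> \<le> C" using deriv_\<phi>_bounded by blast
  have "\<bar>\<psi> t * (deriv \<phi> s - 1)\<bar> \<le> 1 * (C + 1)" for s t
    unfolding abs_mult using C(2)[of s] \<psi>_bounds[of t] by (intro mult_mono) auto
  then show ?thesis by blast
qed

text \<open>The parameters (t, 0, s) already realise all values of the derivative of Q. Boundedness
  gives the infimum and supremum their meaning, and positivity comes from the last condition of
  \<open>circle_diffeo\<close>.\<close>

lemma dQ_bounds:
  "min_dQ \<psi> \<phi> \<le> 1 + \<psi> t * (deriv \<phi> s - 1)" "1 + \<psi> t * (deriv \<phi> s - 1) \<le> max_dQ \<psi> \<phi>"
  "0 < min_dQ \<psi> \<phi>"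
proof -
  obtain C where C: "\<And>s t. \<bar>\<psi> t * (deriv \<phi> s - 1)\<bar> \<le> C" using dQ_bounded by blast
  let ?q = "\<lambda>(a, b, c). deriv (Q_fun \<psi> \<phi> a b) c"
  have "\<bar>?q x - 1\<bar> \<le> C" for x using C by (cases x) (simp add: deriv_Q)
  then have "- C + 1 \<le> ?q x \<and> ?q x \<le> C + 1" for x by (smt (verit))
  then have bdd: "bdd_below (range ?q)" "bdd_above (range ?q)"
    by (auto intro!: bdd_belowI2[where m="- C + 1"] bdd_aboveI2[where M="C + 1"])
  have q: "?q (t, 0, s) = 1 + \<psi> t * (deriv \<phi> s - 1)" by (simp add: deriv_Q \<psi>_abs)
  show "min_dQ \<psi> \<phi> \<le> 1 + \<psi> t * (deriv \<phi> s - 1)"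
    unfolding min_dQ_def q[symmetric] by (rule cINF_lower[OF bdd(1)]) simp
  show "1 + \<psi> t * (deriv \<phi> s - 1) \<le> max_dQ \<psi> \<phi>"
    unfolding max_dQ_def q[symmetric] by (rule cSUP_upper[OF _ bdd(2)]) simp
  let ?h = "\<lambda>(s, t). (deriv \<phi> s - 1) * \<psi> t"
  have "\<bar>?h x\<bar> \<le> C" for x using C by (cases x) (simp add: mult.commute)
  then have bddh: "bdd_below (range ?h)" by (intro bdd_belowI2[where m="- C"]) (smt (verit))
  have "1 + (INF x. ?h x) \<le> ?q x" for x
  proof (cases x)
    case (fields a b c)
    have "(INF x. ?h x) \<le> ?h (c, sqrt (a\<^sup>2 + b\<^sup>2))" by (rule cINF_lower[OF bddh]) simp
    then show ?thesis by (simp add: fields deriv_Q mult.commute)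
  qed
  then have "1 + (INF x. ?h x) \<le> min_dQ \<psi> \<phi>" unfolding min_dQ_def by (intro cINF_greatest) auto
  then show "0 < min_dQ \<psi> \<phi>" using circle by (simp add: circle_diffeo_def)
qed

lemma min_dQ_le_1: "min_dQ \<psi> \<phi> \<le> 1" and max_dQ_ge_1: "1 \<le> max_dQ \<psi> \<phi>"
  using dQ_bounds(1,2)[of \<delta>] \<psi>_zero[of \<delta>] \<delta>_pos by auto

lemma deriv_\<phi>_bounds: "min_dQ \<psi> \<phi> \<le> deriv \<phi> s" "deriv \<phi> s \<le> max_dQ \<psi> \<phi>"
  using dQ_bounds(1,2)[of 0 s] \<psi>_one[of 0] \<delta>_pos by auto

lemma \<phi>_strict_mono: "s < t \<Longrightarrow> \<phi> s < \<phi> t"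
  by (rule DERIV_pos_imp_increasing) (use DERIV_\<phi> deriv_\<phi>_bounds(1) dQ_bounds(3) in \<open>auto intro: less_le_trans\<close>)

text \<open>The slope 1/2 at 0 fixes the sign of \<phi> t - t near 0, and a change of sign before 1
  or -1 would create a further fixed point. On (-1, 0) this uses the translate (1, 2).\<close>

lemma \<phi>_contracts: "0 < t \<Longrightarrow> t < 1 \<Longrightarrow> \<phi> t < t" "- 1 < t \<Longrightarrow> t < 0 \<Longrightarrow> t < \<phi> t"
proof -
  let ?g = "\<lambda>t. \<phi> t - t"
  have c: "continuous_on S ?g" for S by (intro continuous_intros smooth_continuous_on smooth_\<phi>)
  have g0: "(?g has_real_derivative - 1 / 2) (at 0)"
    using DERIV_diff[OF DERIV_\<phi>[of 0] DERIV_ident] by (simp add: deriv_\<phi>_values)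
  obtain d where d: "d > 0" "\<And>h. 0 < h \<Longrightarrow> h < d \<Longrightarrow> ?g h < 0" "\<And>h. 0 < h \<Longrightarrow> h < d \<Longrightarrow> 0 < ?g (- h)"
  proof -
    obtain d1 where d1: "d1 > 0" "\<And>h. 0 < h \<Longrightarrow> h < d1 \<Longrightarrow> ?g (0 + h) < ?g 0"
      using DERIV_neg_dec_right[OF g0] by auto
    obtain d2 where d2: "d2 > 0" "\<And>h. 0 < h \<Longrightarrow> h < d2 \<Longrightarrow> ?g 0 < ?g (0 - h)"
      using DERIV_neg_dec_left[OF g0] by auto
    show thesis by (rule that[of "min d1 d2"]) (use d1 d2 in \<open>auto simp: \<phi>_values\<close>)
  qed
  have nz: "?g t \<noteq> 0" if "0 < t" "t < 1" for t using \<phi>_fixed[of t] that by auto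
  have nz': "?g t \<noteq> 0" if "- 1 < t" "t < 0" for t using \<phi>_fixed[of "t + 2"] \<phi>_2[of t] that by auto
  show "\<phi> t < t" if t: "0 < t" "t < 1"
  proof (rule ccontr)
    assume "\<not> ?thesis"
    then have pos: "?g t > 0" using nz[OF t] by simp
    define h where "h = min (d / 2) (t / 2)"
    have h: "0 < h" "h < d" "h < t" using d(1) t by (auto simp: h_def)
    obtain x where "h \<le> x" "x \<le> t" "?g x = 0"
      using IVT'[of ?g h 0 t] d(2)[OF h(1,2)] pos h c by (metis less_imp_le)
    then show False using nz[of x] h t by linarith
  qed
  show "t < \<phi> t" if t: "- 1 < t" "t < 0"
  proof (rule ccontr)
    assume "\<not> ?thesis"
    then have neg: "?g t < 0" using nz'[OF t] by simp
    define h where "h = min (d / 2) (- t / 2)"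
    have h: "0 < h" "h < d" "t < - h" using d(1) t by (auto simp: h_def min_def)
    obtain x where "t \<le> x" "x \<le> - h" "?g x = 0"
      using IVT'[of ?g t 0 "- h"] d(3)[OF h(1,2)] neg h c by (metis less_imp_le)
    then show False using nz'[of x] h t by linarith
  qed
qed

lemma \<phi>_maps: "0 \<le> t \<Longrightarrow> t < 1 \<Longrightarrow> 0 \<le> \<phi> t \<and> \<phi> t \<le> t" "- 1 < t \<Longrightarrow> t \<le> 0 \<Longrightarrow> t \<le> \<phi> t \<and> \<phi> t \<le> 0"
proof -
  show "0 \<le> t \<Longrightarrow> t < 1 \<Longrightarrow> 0 \<le> \<phi> t \<and> \<phi> t \<le> t"
    using \<phi>_contracts(1)[of t] \<phi>_strict_mono[of 0 t] \<phi>_values by (cases "t = 0") auto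
  show "- 1 < t \<Longrightarrow> t \<le> 0 \<Longrightarrow> t \<le> \<phi> t \<and> \<phi> t \<le> 0"
    using \<phi>_contracts(2)[of t] \<phi>_strict_mono[of t 0] \<phi>_values by (cases "t = 0") auto
qed

text \<open>The iterates are monotone and stay on one side of 0, so they converge to a fixed point
  of absolute value below 1, which can only be 0.\<close>

lemma \<phi>_iterates: 
  assumes "- 1 < t" "t < 1" shows "(\<lambda>n. (\<phi> ^^ n) t) \<longlonglongrightarrow> 0"
    and "\<bar>(\<phi> ^^ n) t\<bar> \<le> \<bar>t\<bar>"
proof -
  have step: "\<bar>\<phi> s\<bar> \<le> \<bar>s\<bar>" if "\<bar>s\<bar> < 1" for s using \<phi>_maps[of s] that by (cases "0 \<le> s") auto
  have lt: "\<bar>(\<phi> ^^ n) t\<bar> \<le> \<bar>t\<bar>" for n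
    by (induction n) (use step assms in \<open>auto intro!: order_trans[OF step]\<close>)
  then show "\<bar>(\<phi> ^^ n) t\<bar> \<le> \<bar>t\<bar>" .
  have fix0: "s = 0" if "\<phi> s = s" "\<bar>s\<bar> < 1" for s
    using \<phi>_contracts[of s] that by (cases s "0::real" rule: linorder_cases) auto
  have conv: "L = 0" if "(\<lambda>n. (\<phi> ^^ n) t) \<longlonglongrightarrow> L" for L
  proof -
    have "isCont \<phi> L" using DERIV_\<phi> DERIV_isCont by blast
    then have "(\<lambda>n. \<phi> ((\<phi> ^^ n) t)) \<longlonglongrightarrow> \<phi> L" using that by (rule isCont_tendsto_compose)
    moreover have "(\<lambda>n. (\<phi> ^^ Suc n) t) \<longlonglongrightarrow> L" using that by (rule LIMSEQ_Suc)
    ultimately have "\<phi> L = L" using LIMSEQ_unique by fastforce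
    moreover have "\<bar>L\<bar> \<le> \<bar>t\<bar>" using lt tendsto_rabs[OF that] by (intro LIMSEQ_le_const2) auto
    ultimately show ?thesis using fix0 assms by (cases "L = 0") auto
  qed
  show "(\<lambda>n. (\<phi> ^^ n) t) \<longlonglongrightarrow> 0"
  proof (cases "0 \<le> t")
    case True
    have nn: "0 \<le> (\<phi> ^^ n) t" for n
    proof (induction n)
      case (Suc n)
      then show ?case using \<phi>_maps(1)[of "(\<phi> ^^ n) t"] lt[of n] assms by simp
    qed (use True in simp)
    have "decseq (\<lambda>n. (\<phi> ^^ n) t)"
    proof (rule decseq_SucI)
      fix n show "(\<phi> ^^ Suc n) t \<le> (\<phi> ^^ n) t" using \<phi>_maps(1)[of "(\<phi> ^^ n) t"] nn[of n] lt[of n] assms by simp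
    qed
    then obtain L where "(\<lambda>n. (\<phi> ^^ n) t) \<longlonglongrightarrow> L" using nn decseq_convergent by blast
    then show ?thesis using conv by metis
  next
    case False
    have np: "(\<phi> ^^ n) t \<le> 0" for n
    proof (induction n)
      case (Suc n)
      then show ?case using \<phi>_maps(2)[of "(\<phi> ^^ n) t"] lt[of n] assms by simp
    qed (use False in simp)
    have "incseq (\<lambda>n. (\<phi> ^^ n) t)"
    proof (rule incseq_SucI)
      fix n show "(\<phi> ^^ n) t \<le> (\<phi> ^^ Suc n) t" using \<phi>_maps(2)[of "(\<phi> ^^ n) t"] np[of n] lt[of n] assms by simp
    qed
    then obtain L where "(\<lambda>n. (\<phi> ^^ n) t) \<longlonglongrightarrow> L" using np incseq_convergent by blast
    then show ?thesis using conv by metis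
  qed
qed

end

section \<open>The lifted skew product\<close>

text \<open>The indices \<open>0, 1, 2, 3\<close> stand for the fixed points \<open>p1, p2, q1, q2\<close>; \<open>r i\<close> is the
  position of the fixed point relative to \<open>q2\<close>, and \<open>Q\<close> places the origin of the cover at
  \<open>(q2, 0, q2)\<close>.  For \<open>\<epsilon> = 0\<close> one obtains the given map, and \<open>\<epsilon> > 0\<close> pushes the circle
  fibre upwards near \<open>q1\<close> without moving the point \<open>1\<close>.\<close>

locale skew_model = cat_frame eu es lam + circle_map \<psi> \<phi>
  for eu es lam \<psi> \<phi> +
  fixes n0 n1 :: nat and r :: "nat \<Rightarrow> real^2" and k \<beta> \<epsilon> :: real and Q :: cover
  assumes r3: "r 3 = 0"
    and r_sep: "\<And>i j l. i < 4 \<Longrightarrow> j < 4 \<Longrightarrow> i \<noteq> j \<Longrightarrow> l \<in> int_lattice \<Longrightarrow> norm (r i - r j - l) > 10 * \<delta>"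
    and s0_ge: "lam ^ n0 \<ge> 10000 * max_dQ \<psi> \<phi>"
    and eps: "0 \<le> \<epsilon>" "\<epsilon> \<le> min_dQ \<psi> \<phi> / 8"
    and k_pos: "k > 0" and \<beta>: "\<beta> > 0" "\<beta> \<le> \<delta> / 2 * (1 / 10000)"
    and \<phi>_\<beta>: "\<And>t. \<bar>t\<bar> \<le> \<beta> \<Longrightarrow> \<bar>deriv \<phi> t - 1 / 2\<bar> < 1 / 10000"
    and k_\<beta>: "3 * \<delta> / (2 * k) \<le> \<beta> / 10000"
    and dP: "\<And>a b c d e. deriv (\<lambda>t. lam ^ n0 * P_fun \<psi> k (lam ^ n0) a b c t e) d < lam ^ n1"
begin

abbreviation "\<sigma>0 \<equiv> lam ^ n0"
abbreviation "\<sigma>1 \<equiv> lam ^ n1"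

text \<open>At p2 and q2, the odd indices, the fibre map of the construction is conjugated by the
  translation by 1.\<close>

definition shift :: "nat \<Rightarrow> real" where "shift i = (if odd i then 1 else 0)"
definition push :: "nat \<Rightarrow> real \<Rightarrow> real" where
  "push i y = \<phi> (y - shift i) - (y - shift i) + (if i = 2 then \<epsilon> * (1 + cos (pi * y)) else 0)"
definition bmp :: "nat \<Rightarrow> real^2 \<Rightarrow> real" where
  "bmp i x = periodize int_lattice (\<lambda>v. \<psi> (norm v)) (x - r i)"
definition Uc :: "cover \<Rightarrow> real" where
  "Uc w = (\<Sum>i<4. bmp i (fst w) * push i (fst (snd w)))"
definition F5 :: "cover \<Rightarrow> real" where
  "F5 w = \<psi> (k * cD w) * \<psi> (k * sqrt ((cA w)\<^sup>2 + (cB w)\<^sup>2 + (cC w)\<^sup>2 + (cE w)\<^sup>2)) * ((3 / (4 * \<sigma>0) - 1) * cD w)"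
definition cent :: "nat \<Rightarrow> cover" where "cent i = (r i, shift i, r i)"
definition Rc :: "cover \<Rightarrow> real" where
  "Rc w = (\<Sum>i<2. periodize cover_lattice F5 (w - cent i))"
text \<open>With the origin at q2, a fixed point of both powers of A, these powers act on the cover
  as linear maps, and all nonlinearity is in the displacements \<open>Uc\<close> and
  \<open>Rc\<close>.\<close>

definition G :: "cover \<Rightarrow> cover" where
  "G w = (hyp \<sigma>1 (fst w), fst (snd w) + Uc w, hyp \<sigma>0 (snd (snd w) + Rc w *\<^sub>R eu))"

lemma lam_nz [simp]: "lam \<noteq> 0" using lam by simp

text \<open>Uses pi < 4. Together with \<epsilon> \<le> min_dQ / 8 the push changes the fibre
  derivative by at most min_dQ / 2, which is why the fibre maps stay invertible.\<close>

lemma push_sin_bound: "\<bar>if i = (2::nat) then \<epsilon> * pi * sin (pi * y) else 0\<bar> \<le> 4 * \<epsilon>"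
proof -
  have "\<epsilon> * pi * \<bar>sin (pi * y)\<bar> \<le> \<epsilon> * 4 * 1" using eps(1) pi_less_4 by (intro mult_mono) auto
  then show ?thesis using eps(1) by (simp add: abs_mult)
qed

lemma s0_gt: "\<sigma>0 \<ge> 10000" using s0_ge max_dQ_ge_1 by linarith

text \<open>\<delta> / k is the radius of the deformation of the last factor. It is so small that
  throughout the support the fibre bump equals 1 and the circle coordinate is within \<beta> of the
  centre.\<close>

lemma dk: "0 < \<delta> / k" "\<delta> / k \<le> \<beta>" "\<delta> / k \<le> \<delta> / 4"
proof -
  show "0 < \<delta> / k" using \<delta>_pos k_pos by simp
  have e: "3 * \<delta> / (2 * k) = 3 / 2 * (\<delta> / k)" by simp
  show "\<delta> / k \<le> \<beta>" "\<delta> / k \<le> \<delta> / 4" using k_\<beta> \<beta> \<delta>_pos unfolding e by linarith+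
qed

lemma P_fun_F5: "P_fun \<psi> k \<sigma>0 a b c d e = d + F5 (mk a b c d e)"
  by (simp add: P_fun_def F5_def algebra_simps)

lemma F5_support:
  assumes "F5 w \<noteq> 0"
  shows "\<bar>cD w\<bar> < \<delta> / k" "sqrt ((cA w)\<^sup>2 + (cB w)\<^sup>2 + (cC w)\<^sup>2 + (cE w)\<^sup>2) < \<delta> / k" "norm w < 1/4"
proof -
  let ?S = "sqrt ((cA w)\<^sup>2 + (cB w)\<^sup>2 + (cC w)\<^sup>2 + (cE w)\<^sup>2)"
  have "\<psi> (k * cD w) \<noteq> 0" "\<psi> (k * ?S) \<noteq> 0" using assms by (auto simp: F5_def)
  then have "\<bar>k * cD w\<bar> < \<delta>" "\<bar>k * ?S\<bar> < \<delta>" using \<psi>_zero by (meson not_less)+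
  then show D: "\<bar>cD w\<bar> < \<delta> / k" and S: "?S < \<delta> / k" using k_pos by (auto simp: abs_mult field_simps)
  have "\<bar>cA w\<bar> \<le> ?S" "\<bar>cB w\<bar> \<le> ?S" "\<bar>cC w\<bar> \<le> ?S" "\<bar>cE w\<bar> \<le> ?S"
    by (auto intro!: real_le_rsqrt simp: power2_abs)
  then show "norm w < 1/4" using norm_le_coords[of w] D S dk \<delta>_def by linarith
qed

lemma bump_norm_support: "\<psi> (norm v) \<noteq> 0 \<Longrightarrow> norm v < 1/4"
proof (rule ccontr)
  assume nz: "\<psi> (norm v) \<noteq> 0" and "\<not> norm v < 1/4"
  then have "\<delta> \<le> \<bar>norm v\<bar>" by (simp add: \<delta>_def)
  then show False using \<psi>_zero nz by blast
qed

lemma smooth_bump_norm: "smooth (\<lambda>v::real^2. \<psi> (norm v))"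
proof -
  have "smooth (\<lambda>v::real^2. v \<bullet> v)"
    unfolding smooth_def
    by (intro allI Ck_on_bilinear[OF open_UNIV bounded_bilinear_inner
          Ck_on_bounded_linear[OF open_UNIV bounded_linear_ident] Ck_on_bounded_linear[OF open_UNIV bounded_linear_ident]])
  from smooth_bump_sqrt[OF this _ zero_less_one] show ?thesis by (simp add: norm_eq_sqrt_inner)
qed

lemma smooth_push: "smooth (push i)"
proof -
  have lin: "smooth (\<lambda>y::real. y)" by (intro smooth_bounded_linear bounded_linear_ident)
  have 1: "smooth (\<lambda>y. \<phi> (y - shift i))" by (rule smooth_diff_const[OF smooth_\<phi>])
  have 2: "smooth (\<lambda>y. (- 1) * (y - shift i))"
    by (intro smooth_mult smooth_const smooth_diff_const[OF lin])
  have "smooth (\<lambda>y. cos (pi * y))" by (intro smooth_compose[OF smooth_cos] smooth_mult smooth_const lin)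
  then have 3: "smooth (\<lambda>y. (if i = 2 then \<epsilon> else 0) * (1 + cos (pi * y)))"
    by (intro smooth_mult smooth_add smooth_const)
  have "push i = (\<lambda>y. \<phi> (y - shift i) + (- 1) * (y - shift i) + (if i = 2 then \<epsilon> else 0) * (1 + cos (pi * y)))"
    by (auto simp: push_def)
  then show ?thesis using smooth_add[OF smooth_add[OF 1 2] 3] by simp
qed

lemma smooth_bmp: "smooth (bmp i)"
  unfolding bmp_def[abs_def]
  by (rule smooth_diff_const[OF int_lattice.smooth_periodize[OF bump_norm_support smooth_bump_norm]])

lemma smooth_Uc: "smooth Uc"
  unfolding Uc_def[abs_def]
  by (intro smooth_sum smooth_mult smooth_compose[OF smooth_bmp] smooth_compose[OF smooth_push] smooth_fst_cover)

lemma smooth_F5: "smooth F5"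
proof -
  note lin = smooth_bounded_linear[OF bounded_linear_coords(1)] smooth_bounded_linear[OF bounded_linear_coords(2)]
    smooth_bounded_linear[OF bounded_linear_coords(3)] smooth_bounded_linear[OF bounded_linear_coords(4)]
    smooth_bounded_linear[OF bounded_linear_coords(5)]
  have S: "smooth (\<lambda>w. (cA w)\<^sup>2 + (cB w)\<^sup>2 + (cC w)\<^sup>2 + (cE w)\<^sup>2)"
    unfolding power2_eq_square by (intro smooth_add smooth_mult lin)
  show ?thesis unfolding F5_def[abs_def]
    by (intro smooth_mult smooth_const lin smooth_bump_sqrt[OF S _ k_pos] smooth_compose[OF smooth_\<psi>]) auto
qed

lemma smooth_Rc: "smooth Rc"
  unfolding Rc_def[abs_def]
  by (intro smooth_sum smooth_diff_const cover_lattice.smooth_periodize F5_support(3) smooth_F5)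

section \<open>Derivatives of the two displacements\<close>

abbreviation "DU w \<equiv> frechet_derivative Uc (at w)"
abbreviation "DR w \<equiv> frechet_derivative Rc (at w)"
abbreviation "DF w \<equiv> frechet_derivative F5 (at w)"

lemma linear_DU: "linear (DU w)" and linear_DR: "linear (DR w)" and linear_DF: "linear (DF w)"
  using smooth_has_derivative[OF smooth_Uc] smooth_has_derivative[OF smooth_Rc] smooth_has_derivative[OF smooth_F5]
    has_derivative_bounded_linear bounded_linear.linear by blast+

lemma bmp_bounds: "0 \<le> bmp i x" "bmp i x \<le> 1"
proof -
  have "0 \<le> bmp i x \<and> bmp i x \<le> 1"
  proof (cases "bmp i x = 0")
    case False
    then obtain l where "bmp i x = \<psi> (norm (x - r i - l))"
      using int_lattice.periodize_nonzero[where F="\<lambda>v. \<psi> (norm v)", OF bump_norm_support]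
      unfolding bmp_def by blast
    then show ?thesis using \<psi>_bounds by simp
  qed simp
  then show "0 \<le> bmp i x" "bmp i x \<le> 1" by auto
qed

lemma bmp_eq: "l \<in> int_lattice \<Longrightarrow> norm (x - r i - l) \<le> 3/4 \<Longrightarrow> bmp i x = \<psi> (norm (x - r i - l))"
  unfolding bmp_def by (rule int_lattice.periodize_eq[OF bump_norm_support])

lemma bmp_nonzero:
  assumes "bmp i x \<noteq> 0"
  obtains l where "l \<in> int_lattice" "norm (x - r i - l) < \<delta>" "bmp i x = \<psi> (norm (x - r i - l))"
proof -
  obtain l where l: "l \<in> int_lattice" "bmp i x = \<psi> (norm (x - r i - l))"
    using int_lattice.periodize_nonzero[where F="\<lambda>v. \<psi> (norm v)", OF bump_norm_support] assms
    unfolding bmp_def by blast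
  then have "norm (x - r i - l) < \<delta>" using assms \<psi>_zero[of "norm (x - r i - l)"] by fastforce
  with l that show thesis by blast
qed

text \<open>Otherwise two centres would be at distance less than 8 \<delta> + \<delta>, against the
  separation 10 \<delta>. The radius 8 \<delta> covers the square boxes of the construction.\<close>

lemma bmp_far:
  assumes "i < 4" "j < 4" "i \<noteq> j" "l \<in> int_lattice" "norm (x - r i - l) < 8 * \<delta>"
  shows "bmp j x = 0"
proof (rule ccontr)
  assume "bmp j x \<noteq> 0"
  then obtain l' where l': "l' \<in> int_lattice" "norm (x - r j - l') < \<delta>" by (rule bmp_nonzero)
  have "norm (r i - r j - (l' - l)) \<le> norm (x - r j - l') + norm (x - r i - l)"
    using norm_triangle_ineq4[of "x - r j - l'" "x - r i - l"] by (simp add: algebra_simps)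
  moreover have "l' - l \<in> int_lattice" using int_lattice_add[OF l'(1) int_lattice_minus[OF assms(4)]] by simp
  ultimately show False using r_sep[OF assms(1-3)] l'(2) assms(5) \<delta>_pos by fastforce
qed

lemma Uc_single:
  assumes "i < 4" "l \<in> int_lattice" "norm (fst w - r i - l) < 8 * \<delta>"
  shows "Uc w = \<psi> (norm (fst w - r i - l)) * push i (fst (snd w))"
proof -
  have "Uc w = (\<Sum>j\<in>{i}. bmp j (fst w) * push j (fst (snd w)))"
    unfolding Uc_def by (rule sum.mono_neutral_right) (use assms bmp_far[OF assms(1) _ _ assms(2,3)] in auto)
  moreover have "norm (fst w - r i - l) \<le> 3/4" using assms(3) by (simp add: \<delta>_def)
  ultimately show ?thesis using bmp_eq[OF assms(2), of "fst w" i] by simp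
qed

lemma Uc_zero: "(\<And>i. i < 4 \<Longrightarrow> bmp i (fst w) = 0) \<Longrightarrow> Uc w = 0"
  by (simp add: Uc_def)

lemma DERIV_push:
  "(push i has_real_derivative deriv \<phi> (y - shift i) - 1 - (if i = 2 then \<epsilon> * pi * sin (pi * y) else 0)) (at y)"
proof -
  have 1: "((\<lambda>y. \<phi> (y - shift i)) has_real_derivative deriv \<phi> (y - shift i)) (at y)"
    using DERIV_chain'[OF DERIV_diff[OF DERIV_ident DERIV_const] DERIV_\<phi>] by simp
  show ?thesis unfolding push_def[abs_def]
  proof (cases "i = 2")
    case True
    show "((\<lambda>y. \<phi> (y - shift i) - (y - shift i) + (if i = 2 then \<epsilon> * (1 + cos (pi * y)) else 0))
        has_real_derivative deriv \<phi> (y - shift i) - 1 - (if i = 2 then \<epsilon> * pi * sin (pi * y) else 0)) (at y)"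
      by (auto intro!: derivative_eq_intros 1[unfolded True] simp: True)
  next
    case False
    then show "((\<lambda>y. \<phi> (y - shift i) - (y - shift i) + (if i = 2 then \<epsilon> * (1 + cos (pi * y)) else 0))
        has_real_derivative deriv \<phi> (y - shift i) - 1 - (if i = 2 then \<epsilon> * pi * sin (pi * y) else 0)) (at y)"
      by (auto intro!: derivative_eq_intros 1)
  qed
qed

lemma DU_formula:
  "DU w v = (\<Sum>i<4. bmp i (fst w) * (deriv (push i) (fst (snd w)) * fst (snd v)) +
     frechet_derivative (bmp i) (at (fst w)) (fst v) * push i (fst (snd w)))"
proof -
  have "(Uc has_derivative (\<lambda>v. \<Sum>i<4. bmp i (fst w) * (deriv (push i) (fst (snd w)) * fst (snd v)) +
     frechet_derivative (bmp i) (at (fst w)) (fst v) * push i (fst (snd w)))) (at w)"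
    unfolding Uc_def[abs_def]
  proof (rule has_derivative_sum, rule has_derivative_mult)
    fix i
    have f: "(fst has_derivative fst) (at w)" "((\<lambda>w. fst (snd w)) has_derivative (\<lambda>v. fst (snd v))) (at w)"
      by (auto intro!: derivative_eq_intros)
    show "((\<lambda>x. bmp i (fst x)) has_derivative (\<lambda>v. frechet_derivative (bmp i) (at (fst w)) (fst v))) (at w)"
      by (rule has_derivative_compose[OF f(1) smooth_has_derivative[OF smooth_bmp]])
    have "(push i has_derivative (*) (deriv (push i) (fst (snd w)))) (at (fst (snd w)))"
      using smooth_deriv(1)[OF smooth_push] by (simp add: has_field_derivative_def)
    from has_derivative_compose[OF f(2) this]
    show "((\<lambda>x. push i (fst (snd x))) has_derivative (\<lambda>v. deriv (push i) (fst (snd w)) * fst (snd v))) (at w)" .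
  qed
  from fun_cong[OF frechet_derivative_at[OF this], of v] show ?thesis by (rule sym)
qed

lemma push_deriv_eq: "deriv (push i) y = deriv \<phi> (y - shift i) - 1 - (if i = 2 then \<epsilon> * pi * sin (pi * y) else 0)"
  by (rule DERIV_imp_deriv[OF DERIV_push])

lemma frechet_bmp_zero: 
  "frechet_derivative (bmp i) (at x) 0 = 0"
  using smooth_has_derivative[OF smooth_bmp] has_derivative_bounded_linear bounded_linear.linear linear_0 by blast

lemma DU_fibre: "DU w (mk 0 0 c d e) = c * (\<Sum>i<4. bmp i (fst w) * deriv (push i) (fst (snd w)))"
  unfolding DU_formula by (simp add: mk_def frechet_bmp_zero sum_distrib_left mult_ac)

text \<open>The derivative of the circle coordinate of G along the fibre, that is, the diagonal
  entry qc.\<close>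

definition qc0 :: "cover \<Rightarrow> real" where
  "qc0 w = 1 + (\<Sum>i<4. bmp i (fst w) * deriv (push i) (fst (snd w)))"

lemma qc0_single:
  assumes "i < 4" "l \<in> int_lattice" "norm (fst w - r i - l) < 8 * \<delta>"
  shows "qc0 w = 1 + \<psi> (norm (fst w - r i - l)) * deriv (push i) (fst (snd w))"
proof -
  have "(\<Sum>j<4. bmp j (fst w) * deriv (push j) (fst (snd w))) = (\<Sum>j\<in>{i}. bmp j (fst w) * deriv (push j) (fst (snd w)))"
    by (rule sum.mono_neutral_right) (use assms bmp_far[OF assms(1) _ _ assms(2,3)] in auto)
  moreover have "norm (fst w - r i - l) \<le> 3/4" using assms(3) by (simp add: \<delta>_def)
  ultimately show ?thesis using bmp_eq[OF assms(2), of "fst w" i] by (simp add: qc0_def)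
qed

text \<open>At most one bump is active. It contributes the derivative of the unperturbed Q, between
  \<open>min_dQ\<close> and \<open>max_dQ\<close>, and a push term of size at most min_dQ /
  2.\<close>

lemma qc0_bounds: "min_dQ \<psi> \<phi> / 2 \<le> qc0 w" "qc0 w \<le> 2 * max_dQ \<psi> \<phi>" 
proof -
  have m: "min_dQ \<psi> \<phi> \<le> 1" "1 \<le> max_dQ \<psi> \<phi>" "0 < min_dQ \<psi> \<phi>"
    by (rule min_dQ_le_1 max_dQ_ge_1 dQ_bounds(3))+
  have "min_dQ \<psi> \<phi> / 2 \<le> qc0 w \<and> qc0 w \<le> 2 * max_dQ \<psi> \<phi>"
  proof (cases "\<exists>i<4. bmp i (fst w) \<noteq> 0")
    case True
    then obtain i l where i: "i < 4" and l: "l \<in> int_lattice" "norm (fst w - r i - l) < \<delta>" by (meson bmp_nonzero)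
    let ?t = "norm (fst w - r i - l)" and ?y = "fst (snd w)"
    have q: "qc0 w = 1 + \<psi> ?t * (deriv \<phi> (?y - shift i) - 1) - \<psi> ?t * (if i = 2 then \<epsilon> * pi * sin (pi * ?y) else 0)"
      using qc0_single[OF i l(1)] l(2) \<delta>_pos by (simp add: push_deriv_eq algebra_simps)
    have e: "\<bar>if i = 2 then \<epsilon> * pi * sin (pi * ?y) else 0\<bar> \<le> min_dQ \<psi> \<phi> / 2"
      using push_sin_bound[of i ?y] eps(2) by linarith
    have "\<bar>\<psi> ?t * (if i = 2 then \<epsilon> * pi * sin (pi * ?y) else 0)\<bar> \<le> 1 * (min_dQ \<psi> \<phi> / 2)"
      unfolding abs_mult using \<psi>_bounds[of ?t] e m(3) by (intro mult_mono) auto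
    then show ?thesis
      using dQ_bounds(1,2)[of ?t "?y - shift i"] m unfolding q by linarith
  next
    case False
    then have "qc0 w = 1" by (simp add: qc0_def)
    then show ?thesis using m by simp
  qed
  then show "min_dQ \<psi> \<phi> / 2 \<le> qc0 w" "qc0 w \<le> 2 * max_dQ \<psi> \<phi>" by auto
qed

lemma DF_support:
  assumes "DF w v \<noteq> 0"
  shows "sqrt ((cA w)\<^sup>2 + (cB w)\<^sup>2 + (cC w)\<^sup>2 + (cE w)\<^sup>2) \<le> \<delta> / k"
proof (rule ccontr)
  let ?S = "\<lambda>w. sqrt ((cA w)\<^sup>2 + (cB w)\<^sup>2 + (cC w)\<^sup>2 + (cE w)\<^sup>2)"
  assume "\<not> ?thesis"
  moreover have "continuous_on UNIV ?S"
    by (intro continuous_intros linear_continuous_on bounded_linear_coords)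
  ultimately have o: "open {w. ?S w > \<delta> / k}" "w \<in> {w. ?S w > \<delta> / k}"
    by (auto intro: open_Collect_less continuous_on_const)
  have "(F5 has_derivative (\<lambda>v. 0)) (at w)"
    by (rule has_derivative_transform_within_open[where f="\<lambda>v. 0", OF _ o])
      (use F5_support(2) in force)+
  from fun_cong[OF frechet_derivative_at[OF this], of v] show False using assms by simp
qed

lemma DF_d:
  "DF w (mk 0 0 0 1 0) = (3 / (4 * \<sigma>0) - 1) * (\<psi> (k * sqrt ((cA w)\<^sup>2 + (cB w)\<^sup>2 + (cC w)\<^sup>2 + (cE w)\<^sup>2)) *
     (\<psi> (k * cD w) + k * cD w * deriv \<psi> (k * cD w)))"
  and DERIV_F5_d: "((\<lambda>t. F5 (mk a b c t e)) has_real_derivative DF (mk a b c d e) (mk 0 0 0 1 0)) (at d)"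
proof -
  have D: "((\<lambda>t. F5 (mk a b c t e)) has_real_derivative DF (mk a b c d e) (mk 0 0 0 1 0)) (at d)" for a b c d e
  proof -
    have m: "mk a b c t e = mk a b c 0 e + t *\<^sub>R mk 0 0 0 1 0" for t by (rule coord_eqI) simp_all
    have "((\<lambda>t. mk a b c t e) has_derivative (\<lambda>h. h *\<^sub>R mk 0 0 0 1 0)) (at d)"
      by (subst m) (auto intro!: derivative_eq_intros)
    from has_derivative_compose[OF this smooth_has_derivative[OF smooth_F5]]
    have "((\<lambda>t. F5 (mk a b c t e)) has_derivative (\<lambda>h. DF (mk a b c d e) (h *\<^sub>R mk 0 0 0 1 0))) (at d)" .
    moreover have "(\<lambda>h. DF (mk a b c d e) (h *\<^sub>R mk 0 0 0 1 0)) = (*) (DF (mk a b c d e) (mk 0 0 0 1 0))"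
      using linear_scale[OF linear_DF] by (auto simp: mult.commute)
    ultimately show ?thesis by (simp add: has_field_derivative_def)
  qed
  then show "((\<lambda>t. F5 (mk a b c t e)) has_real_derivative DF (mk a b c d e) (mk 0 0 0 1 0)) (at d)" .
  let ?S = "\<psi> (k * sqrt ((cA w)\<^sup>2 + (cB w)\<^sup>2 + (cC w)\<^sup>2 + (cE w)\<^sup>2))"
  have 1: "((\<lambda>t. \<psi> (k * t)) has_real_derivative k * deriv \<psi> (k * cD w)) (at (cD w))"
    by (rule DERIV_cong[OF DERIV_chain'[OF DERIV_cmult_Id DERIV_\<psi>]]) (simp add: mult.commute)
  have "((\<lambda>t. \<psi> (k * t) * ?S * ((3 / (4 * \<sigma>0) - 1) * t)) has_real_derivative
     (k * deriv \<psi> (k * cD w) * ?S) * ((3 / (4 * \<sigma>0) - 1) * cD w) + (3 / (4 * \<sigma>0) - 1) * (\<psi> (k * cD w) * ?S)) (at (cD w))"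
    by (rule DERIV_mult[OF DERIV_cmult_right[OF 1] DERIV_cmult_Id])
  moreover have "c * (?S * (p + k * x * q)) = (k * q * ?S) * (c * x) + c * (p * ?S)" for c p q x
    by (simp add: algebra_simps)
  ultimately have "((\<lambda>t. F5 (mk (cA w) (cB w) (cC w) t (cE w))) has_real_derivative
     (3 / (4 * \<sigma>0) - 1) * (?S * (\<psi> (k * cD w) + k * cD w * deriv \<psi> (k * cD w)))) (at (cD w))"
    by (simp only: F5_def coord_mk)
  from DERIV_unique[OF D this] show "DF w (mk 0 0 0 1 0) = (3 / (4 * \<sigma>0) - 1) * (?S *
     (\<psi> (k * cD w) + k * cD w * deriv \<psi> (k * cD w)))" by (simp add: mk_coords)
qed

text \<open>The strongest contraction is at the centre, where d becomes 3 d / (4 \<sigma>0). In the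
  transition zone t * \<psi>' t \<le> 0 keeps the bracket in \<open>DF_d\<close> at most 1, so the
  derivative is nowhere smaller.\<close>

lemma DF_d_ge: "3 / 4 \<le> \<sigma>0 * (1 + DF w (mk 0 0 0 1 0))"
proof -
  let ?S = "\<psi> (k * sqrt ((cA w)\<^sup>2 + (cB w)\<^sup>2 + (cC w)\<^sup>2 + (cE w)\<^sup>2))"
  let ?h = "\<psi> (k * cD w) + k * cD w * deriv \<psi> (k * cD w)"
  have "?h \<le> 1" using deriv_\<psi>_nonpos[of "k * cD w"] \<psi>_bounds(2)[of "k * cD w"] by simp
  then have "?S * ?h \<le> ?S * 1" using \<psi>_bounds(1) by (intro mult_left_mono)
  then have "?S * ?h \<le> 1" using \<psi>_bounds(2)[of "k * sqrt ((cA w)\<^sup>2 + (cB w)\<^sup>2 + (cC w)\<^sup>2 + (cE w)\<^sup>2)"] by linarith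
  moreover have "1 - 3 / (4 * \<sigma>0) \<ge> 0" using s0_gt by (simp add: field_simps)
  ultimately have "(1 - 3 / (4 * \<sigma>0)) * (?S * ?h) \<le> (1 - 3 / (4 * \<sigma>0)) * 1" by (rule mult_left_mono)
  then have "3 / (4 * \<sigma>0) \<le> 1 + DF w (mk 0 0 0 1 0)" unfolding DF_d by (simp add: algebra_simps)
  then have "\<sigma>0 * (3 / (4 * \<sigma>0)) \<le> \<sigma>0 * (1 + DF w (mk 0 0 0 1 0))" using s0_gt by (intro mult_left_mono) auto
  then show ?thesis using s0_gt by simp
qed

lemma DF_d_less: "\<sigma>0 * (1 + DF w (mk 0 0 0 1 0)) < \<sigma>1"
proof -
  have "((\<lambda>t. P_fun \<psi> k \<sigma>0 (cA w) (cB w) (cC w) t (cE w)) has_real_derivative 1 + DF w (mk 0 0 0 1 0)) (at (cD w))"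
    unfolding P_fun_F5
    using DERIV_add[OF DERIV_ident DERIV_F5_d[of "cA w" "cB w" "cC w" "cE w" "cD w"]] by (simp add: mk_coords)
  then have "((\<lambda>t. \<sigma>0 * P_fun \<psi> k \<sigma>0 (cA w) (cB w) (cC w) t (cE w)) has_real_derivative \<sigma>0 * (1 + DF w (mk 0 0 0 1 0))) (at (cD w))"
    by (rule DERIV_cmult)
  from DERIV_imp_deriv[OF this] dP[of "cA w" "cB w" "cC w" "cE w" "cD w"] show ?thesis by simp
qed

text \<open>The bound on the derivatives of \<sigma>0 P is evaluated at a point outside the support
  of the deformation, where the derivative of P in d equals 1.\<close>

lemma s0_s1: "\<sigma>0 < \<sigma>1"
proof -
  define t where "t = \<delta> / k"
  have "t > 0" unfolding t_def by (rule dk(1))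
  moreover from this have "sqrt ((2 * t)\<^sup>2 + 0\<^sup>2 + 0\<^sup>2 + 0\<^sup>2) = 2 * t"
    by (intro real_sqrt_unique) auto
  ultimately have "\<not> sqrt ((2 * t)\<^sup>2 + 0\<^sup>2 + 0\<^sup>2 + 0\<^sup>2) \<le> t" by linarith
  then have "DF (mk (2 * t) 0 0 0 0) v = 0" for v
    using DF_support[of "mk (2 * t) 0 0 0 0" v] unfolding coord_mk t_def[symmetric] by blast
  then show ?thesis using DF_d_less[of "mk (2 * t) 0 0 0 0"] by simp
qed

text \<open>The strict pointwise bound by \<sigma>1 becomes uniform because the derivative is
  constantly \<sigma>0 off a compact ball. Requiring \<theta> \<ge> 3/4 makes \<theta> mu at least
  9/16.\<close>

lemma mu_ratio: "\<exists>\<theta><1. 3 / 4 \<le> \<theta> \<and> \<sigma>0 \<le> \<theta> * \<sigma>1 \<and> (\<forall>w. \<sigma>0 * (1 + DF w (mk 0 0 0 1 0)) \<le> \<theta> * \<sigma>1)"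
proof -
  let ?h = "\<lambda>w. \<sigma>0 * (1 + DF w (mk 0 0 0 1 0))"
  have "continuous_on (cball 0 1) ?h"
    by (intro continuous_intros smooth_continuous_on smooth_frechet_derivative smooth_F5)
  then obtain w0 where w0: "\<And>w. w \<in> cball 0 1 \<Longrightarrow> ?h w \<le> ?h w0"
    using continuous_attains_sup[of "cball (0::cover) 1" ?h] by fastforce
  have out: "?h w = \<sigma>0" if "w \<notin> cball 0 1" for w
  proof -
    have "(F5 has_derivative (\<lambda>v. 0)) (at w)"
      by (rule has_derivative_transform_within_open[where f="\<lambda>v. 0" and s="- cball 0 1"])
        (use that F5_support(3) in force)+
    from fun_cong[OF frechet_derivative_at[OF this], of "mk 0 0 0 1 0"] show ?thesis by simp
  qed
  define \<theta> where "\<theta> = max (3 / 4) (max (?h w0 / \<sigma>1) (\<sigma>0 / \<sigma>1))"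
  have s1: "\<sigma>1 > 0" using s0_s1 s0_gt by linarith
  have "\<theta> < 1" using DF_d_less[of w0] s0_s1 s1 by (simp add: \<theta>_def)
  moreover have ge: "?h w0 \<le> \<theta> * \<sigma>1" "\<sigma>0 \<le> \<theta> * \<sigma>1"
    unfolding pos_divide_le_eq[OF s1, symmetric] by (simp_all add: \<theta>_def)
  moreover have "?h w \<le> \<theta> * \<sigma>1" for w
    using w0[of w] out[of w] ge by (cases "w \<in> cball 0 1") auto
  moreover have "3 / 4 \<le> \<theta>" by (simp add: \<theta>_def)
  ultimately show ?thesis by blast
qed

lemma cent_coords: "fst (cent i) = r i" "fst (snd (cent i)) = shift i"
  by (simp_all add: cent_def)

text \<open>The deformation of the last factor weakens the expansion along \<open>e\<^sup>u\<close> to \<open>3/4\<close>; that the circle fibre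
  is contracted by almost \<open>1/2\<close> at the same place keeps the splitting dominated.\<close>

lemma DR_cases:
  "(\<forall>v. DR w v = 0) \<or>
   (\<exists>i<2. \<exists>l\<in>cover_lattice. (\<forall>v. DR w v = DF (w - cent i - l) v) \<and> norm (fst w - r i - fst l) \<le> \<delta> / k \<and>
      qc0 w \<le> 1 / 2 + 1 / 10000)"
proof -
  let ?P = "\<lambda>i w. periodize cover_lattice F5 (w - cent i)"
  have sm: "smooth (?P i)" for i
    by (intro smooth_diff_const cover_lattice.smooth_periodize F5_support(3) smooth_F5)
  have P: "frechet_derivative (?P i) (at w) = frechet_derivative (periodize cover_lattice F5) (at (w - cent i))" for i
  proof -
    have "((\<lambda>v. v - cent i) has_derivative (\<lambda>v. v)) (at w)"
      by (auto intro!: derivative_eq_intros)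
    from has_derivative_compose[OF this smooth_has_derivative[OF cover_lattice.smooth_periodize[OF F5_support(3) smooth_F5]]]
    show ?thesis using frechet_derivative_at by fastforce
  qed
  have "(Rc has_derivative (\<lambda>v. \<Sum>i<2. frechet_derivative (?P i) (at w) v)) (at w)"
    unfolding Rc_def[abs_def] by (intro has_derivative_sum smooth_has_derivative sm)
  from fun_cong[OF frechet_derivative_at[OF this]]
  have "DR w v = (\<Sum>i<2. frechet_derivative (?P i) (at w) v)" for v by (rule sym)
  then have DR: "DR w v = frechet_derivative (?P 0) (at w) v + frechet_derivative (?P 1) (at w) v" for v
    by (simp add: numeral_2_eq_2)
  have near: "\<exists>l\<in>cover_lattice. (\<forall>v. frechet_derivative (?P i) (at w) v = DF (w - cent i - l) v) \<and>
      sqrt ((cA (w - cent i - l))\<^sup>2 + (cB (w - cent i - l))\<^sup>2 + (cC (w - cent i - l))\<^sup>2 + (cE (w - cent i - l))\<^sup>2) \<le> \<delta> / k"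
    if "frechet_derivative (?P i) (at w) v \<noteq> 0" for i v
    using cover_lattice.periodize_derivative[OF F5_support(3) smooth_F5, of "w - cent i"] that DF_support
    unfolding P by fastforce
  \<comment> \<open>One support bound controls both the first factor, which tells which centre is
    active, and the circle coordinate, which tells where \<phi>' is evaluated.\<close>
  have zone: "norm (fst w - r i - fst l) \<le> \<delta> / k \<and> \<bar>fst (snd w) - shift i - fst (snd l)\<bar> \<le> \<delta> / k"
    if "sqrt ((cA (w - cent i - l))\<^sup>2 + (cB (w - cent i - l))\<^sup>2 + (cC (w - cent i - l))\<^sup>2 + (cE (w - cent i - l))\<^sup>2) \<le> \<delta> / k"
    for i l
  proof -
    let ?u = "w - cent i - l"
    have "norm (fst ?u) = sqrt ((cA ?u)\<^sup>2 + (cB ?u)\<^sup>2)" unfolding cA_def cB_def by (rule norm_frame)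
    also have "\<dots> \<le> \<delta> / k" by (rule order_trans[OF real_sqrt_le_mono that]) simp
    finally have "norm (fst ?u) \<le> \<delta> / k" .
    moreover have "\<bar>cC ?u\<bar> \<le> \<delta> / k" by (rule order_trans[OF real_le_rsqrt that]) simp
    ultimately show ?thesis by (simp add: cC_def cent_coords)
  qed
  have main: ?thesis if i: "i < 2" "j < 2" "i \<noteq> j" and v: "frechet_derivative (?P i) (at w) v0 \<noteq> 0"
    and sum: "\<And>v. DR w v = frechet_derivative (?P i) (at w) v + frechet_derivative (?P j) (at w) v" for i j v0
  proof -
    obtain l where l: "l \<in> cover_lattice" "\<And>v. frechet_derivative (?P i) (at w) v = DF (w - cent i - l) v"
      and z: "norm (fst w - r i - fst l) \<le> \<delta> / k" "\<bar>fst (snd w) - shift i - fst (snd l)\<bar> \<le> \<delta> / k"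
      using near[OF v] zone by blast
    have l1: "fst l \<in> int_lattice" and l2: "fst (snd l) \<in> even_lattice" using l(1) by (auto simp: cover_lattice_def)
    have j0: "frechet_derivative (?P j) (at w) v = 0" for v
    proof (rule ccontr)
      assume "frechet_derivative (?P j) (at w) v \<noteq> 0"
      then obtain l' where l': "l' \<in> cover_lattice" and z': "norm (fst w - r j - fst l') \<le> \<delta> / k"
        using near zone by blast
      have "fst l' \<in> int_lattice" using l' by (auto simp: cover_lattice_def)
      then have "fst l' - fst l \<in> int_lattice" using int_lattice_add[OF _ int_lattice_minus[OF l1]] by force
      then have "10 * \<delta> < norm (r i - r j - (fst l' - fst l))" using r_sep[of i j] i by simp
      also have "\<dots> \<le> norm (fst w - r j - fst l') + norm (fst w - r i - fst l)"
        using norm_triangle_ineq4[of "fst w - r j - fst l'" "fst w - r i - fst l"] by (simp add: algebra_simps)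
      finally show False using z z' dk \<delta>_pos by linarith
    qed
    obtain m :: int where m: "fst (snd l) = 2 * of_int m"
      using l2 by (force simp: even_lattice_def elim!: Ints_cases)
    \<comment> \<open>Here the fibre bump equals 1, so \<open>qc0\<close> is exactly \<phi>' at a
      point within \<beta> of an attracting level, where it is almost 1/2.\<close>
    have "norm (fst w - r i - fst l) \<le> \<delta> / 2" using z(1) dk(3) \<delta>_pos by linarith
    then have "\<psi> (norm (fst w - r i - fst l)) = 1" by (intro \<psi>_one) (simp only: abs_norm_cancel)
    then have "qc0 w = deriv \<phi> (fst (snd w) - shift i)"
      using qc0_single[of i "fst l" w] i l1 z(1) dk \<delta>_pos by (simp add: push_deriv_eq)
    also have "\<dots> = deriv \<phi> (fst (snd w) - shift i - fst (snd l))"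
      using deriv_\<phi>_int[of "fst (snd w) - shift i - fst (snd l)" m] unfolding m by simp
    also have "\<dots> \<le> 1 / 2 + 1 / 10000"
      using \<phi>_\<beta>[of "fst (snd w) - shift i - fst (snd l)"] z(2) dk(2) by linarith
    finally show ?thesis using i(1) l z(1) j0 sum by (intro disjI2 exI[of _ i]) (auto intro!: bexI[of _ l])
  qed
  show ?thesis
  proof (cases "\<forall>v. DR w v = 0")
    case False
    then obtain v where "frechet_derivative (?P 0) (at w) v \<noteq> 0 \<or> frechet_derivative (?P 1) (at w) v \<noteq> 0"
      unfolding DR by fastforce
    then show ?thesis using main[of 0 1 v] main[of 1 0 v] DR by (auto simp: add.commute)
  qed blast
qed

lemma DR_casesE:
  obtains "\<And>v. DR w v = 0"
    | i l where "i < 2" "l \<in> cover_lattice" "\<And>v. DR w v = DF (w - cent i - l) v"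
      "norm (fst w - r i - fst l) \<le> \<delta> / k" "qc0 w \<le> 1 / 2 + 1 / 10000"
  using DR_cases[of w] by meson

text \<open>The derivatives of the bumps are bounded by compactness of the support, the push and its
  derivative by periodicity. The bound serves for the entries of the derivative and again for the
  C^1 distance to f.\<close>

lemma linear_has_deriv_bound_U: "\<exists>C. \<forall>w v. \<bar>DU w v\<bar> \<le> C * norm v"
proof -
  obtain C where C: "C \<ge> 0" "\<And>w v. \<bar>frechet_derivative (\<lambda>v::real^2. \<psi> (norm v)) (at w) v\<bar> \<le> C * norm v"
    using derivative_bounded_of_support[OF smooth_bump_norm bump_norm_support] by blast
  have bC: "\<bar>frechet_derivative (bmp i) (at x) v\<bar> \<le> C * norm v" for i x v
  proof -
    let ?p = "periodize int_lattice (\<lambda>v::real^2. \<psi> (norm v))"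
    have "((\<lambda>v. v - r i) has_derivative (\<lambda>v. v)) (at x)"
      by (auto intro!: derivative_eq_intros)
    from has_derivative_compose[OF this smooth_has_derivative[OF int_lattice.smooth_periodize[OF bump_norm_support smooth_bump_norm]]]
    have "(bmp i has_derivative frechet_derivative ?p (at (x - r i))) (at x)" unfolding bmp_def[abs_def] by simp
    from frechet_derivative_at[OF this] have e: "frechet_derivative (bmp i) (at x) = frechet_derivative ?p (at (x - r i))" by simp
    have "(\<exists>l\<in>int_lattice. frechet_derivative ?p (at (x - r i)) = frechet_derivative (\<lambda>v. \<psi> (norm v)) (at (x - r i - l))) \<or>
        frechet_derivative ?p (at (x - r i)) = (\<lambda>v. 0)"
      by (rule int_lattice.periodize_derivative[OF bump_norm_support smooth_bump_norm])
    then show ?thesis unfolding e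
    proof (elim disjE bexE)
      fix l assume "frechet_derivative ?p (at (x - r i)) = frechet_derivative (\<lambda>v. \<psi> (norm v)) (at (x - r i - l))"
      then show "\<bar>frechet_derivative ?p (at (x - r i)) v\<bar> \<le> C * norm v" using C(2) by simp
    next
      assume "frechet_derivative ?p (at (x - r i)) = (\<lambda>v. 0)"
      then show "\<bar>frechet_derivative ?p (at (x - r i)) v\<bar> \<le> C * norm v" using C(1) by simp
    qed
  qed
  obtain D where D: "D \<ge> 0" "\<And>t. \<bar>deriv \<phi> t\<bar> \<le> D" using deriv_\<phi>_bounded by blast
  obtain E where E: "E \<ge> 0" "\<And>t. \<bar>\<phi> t - t\<bar> \<le> E" using displacement_bounded by blast
  have e1: "\<bar>if i = (2::nat) then \<epsilon> * (1 + cos (pi * y)) else 0\<bar> \<le> 2 * \<epsilon>" for i y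
  proof -
    have "1 + cos (pi * y) \<le> 2" "0 \<le> 1 + cos (pi * y)" using cos_le_one cos_ge_minus_one by (smt (verit))+
    then show ?thesis using eps(1) mult_left_mono[of "1 + cos (pi * y)" 2 \<epsilon>] by simp
  qed
  have pb: "\<bar>push i y\<bar> \<le> E + 2 * \<epsilon>" for i y
    using E(2)[of "y - shift i"] e1[of i y] unfolding push_def by linarith
  have db: "\<bar>deriv (push i) y\<bar> \<le> D + 1 + 4 * \<epsilon>" for i y
    using D(2)[of "y - shift i"] push_sin_bound[of i y] unfolding push_deriv_eq by linarith
  let ?K = "(D + 1 + 4 * \<epsilon>) + C * (E + 2 * \<epsilon>)"
  have "\<bar>DU w v\<bar> \<le> (\<Sum>i<4::nat. ?K * norm v)" for w v
    unfolding DU_formula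
  proof (rule order_trans[OF sum_abs], rule sum_mono)
    fix i
    have n: "\<bar>fst (snd v)\<bar> \<le> norm v" "norm (fst v) \<le> norm v"
      using coord_le_norm(3)[of v] norm_fst_le[of "fst v" "snd v"] by (simp_all add: cC_def)
    have "\<bar>bmp i (fst w) * (deriv (push i) (fst (snd w)) * fst (snd v))\<bar> \<le> 1 * ((D + 1 + 4 * \<epsilon>) * norm v)"
      unfolding abs_mult using bmp_bounds[of i "fst w"] db n D(1) eps(1) by (intro mult_mono) auto
    moreover have "\<bar>frechet_derivative (bmp i) (at (fst w)) (fst v) * push i (fst (snd w))\<bar> \<le> (C * norm v) * (E + 2 * \<epsilon>)"
      unfolding abs_mult
      using order_trans[OF bC mult_left_mono[OF n(2) C(1)]] pb E(1) eps(1) C(1) by (intro mult_mono) auto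
    ultimately show "\<bar>bmp i (fst w) * (deriv (push i) (fst (snd w)) * fst (snd v)) +
        frechet_derivative (bmp i) (at (fst w)) (fst v) * push i (fst (snd w))\<bar> \<le> ?K * norm v"
      by (simp add: algebra_simps) 
  qed
  then have "\<bar>DU w v\<bar> \<le> (4 * ?K) * norm v" for w v
    by (simp only: sum_constant card_lessThan of_nat_numeral mult.assoc)
  then show ?thesis by blast
qed

lemma DR_bounded: "\<exists>C. \<forall>w v. \<bar>DR w v\<bar> \<le> C * norm v"
proof -
  obtain C where C: "C \<ge> 0" "\<And>w v. \<bar>DF w v\<bar> \<le> C * norm v"
    using derivative_bounded_of_support[OF smooth_F5 F5_support(3)] by blast
  have "\<bar>DR w v\<bar> \<le> C * norm v" for w v
    by (rule DR_casesE[of w]) (simp_all only: C abs_zero mult_nonneg_nonneg norm_ge_zero)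
  then show ?thesis by blast
qed

section \<open>Equivariance under the deck group and the inverse lift\<close>

lemma Uc_shift:
  assumes "fst v - fst w \<in> int_lattice" "fst (snd v) - fst (snd w) \<in> even_lattice"
  shows "Uc v = Uc w"
proof -
  obtain m :: int where m: "fst (snd v) = fst (snd w) + 2 * of_int m"
  proof -
    from assms(2) obtain m where "(fst (snd v) - fst (snd w)) / 2 = of_int m"
      by (auto simp: even_lattice_def elim: Ints_cases)
    then have "fst (snd v) = fst (snd w) + 2 * of_int m" by (simp add: field_simps)
    with that show thesis by blast
  qed
  have "bmp i (fst v) = bmp i (fst w)" for i
    using int_lattice.periodize_add[where F="\<lambda>v. \<psi> (norm v)", OF bump_norm_support assms(1), where w="fst w - r i"]
    by (simp add: bmp_def algebra_simps)
  moreover have "push i (fst (snd v)) = push i (fst (snd w))" for i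
  proof -
    have "cos (pi * (y + 2 * of_int m)) = cos (pi * y)" for y
    proof -
      have "pi * (y + 2 * of_int m) = pi * y + (2 * pi) * of_int m" by (simp add: algebra_simps)
      then show ?thesis
        by (simp only: cos_add sin_int_2pin cos_int_2pin mult_1_right mult_zero_right diff_zero)
    qed
    moreover have "\<phi> (y + 2 * of_int m - s) - (y + 2 * of_int m - s) = \<phi> (y - s) - (y - s)" for y s
      using \<phi>_int[of "y - s" m] by (simp add: algebra_simps)
    ultimately show ?thesis by (simp only: push_def m)
  qed
  ultimately show ?thesis by (simp add: Uc_def)
qed

lemma Uc_add: "l \<in> cover_lattice \<Longrightarrow> Uc (w + l) = Uc w"
  by (rule Uc_shift) (auto simp: cover_lattice_def)

lemma Rc_add: "l \<in> cover_lattice \<Longrightarrow> Rc (w + l) = Rc w"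
  unfolding Rc_def
proof (rule sum.cong)
  fix i assume l: "l \<in> cover_lattice"
  have "w + l - cent i = w - cent i + l" by simp
  then show "periodize cover_lattice F5 (w + l - cent i) = periodize cover_lattice F5 (w - cent i)"
    using cover_lattice.periodize_add[OF F5_support(3) l, where w="w - cent i"] by (simp only:)
qed simp

lemma mu0_bounds: "3 / 4 \<le> \<sigma>0 * (1 + DR w (mk 0 0 0 1 0))"
proof (rule DR_casesE[of w])
  assume z: "\<And>v. DR w v = 0"
  show ?thesis unfolding z using s0_gt by simp
qed (simp only: DF_d_ge)

definition lin :: "real \<Rightarrow> real \<Rightarrow> cover \<Rightarrow> cover" where
  "lin s t w = (hyp s (fst w), fst (snd w), hyp t (snd (snd w)))"

lemma bounded_linear_lin: "bounded_linear (lin s t)"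
  unfolding lin_def[abs_def]
  by (intro bounded_linear_Pair bounded_linear_compose[OF bounded_linear_hyp]
      bounded_linear_fst bounded_linear_compose[OF bounded_linear_fst bounded_linear_snd]
      bounded_linear_compose[OF bounded_linear_snd bounded_linear_snd])

text \<open>\<open>Uc\<close> does not see the last factor, so the two displacements can be
  performed one after the other; each is then a shear that \<open>shear_inverse\<close>
  inverts.\<close>

lemma G_decomp: "G w = lin \<sigma>1 \<sigma>0 ((w + Rc w *\<^sub>R mk 0 0 0 1 0) + Uc (w + Rc w *\<^sub>R mk 0 0 0 1 0) *\<^sub>R mk 0 0 1 0 0)"
proof -
  have "Uc (w + Rc w *\<^sub>R mk 0 0 0 1 0) = Uc w" by (simp add: Uc_def mk_def)
  then show ?thesis by (simp add: G_def lin_def mk_def)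
qed

lemma lattice_lin: "l \<in> cover_lattice \<Longrightarrow> lin \<sigma>1 \<sigma>0 l \<in> cover_lattice"
  "l \<in> cover_lattice \<Longrightarrow> lin (1 / \<sigma>1) (1 / \<sigma>0) l \<in> cover_lattice"
  by (auto simp: cover_lattice_def lin_def hyp_lattice)

lemma G_add: "l \<in> cover_lattice \<Longrightarrow> G (w + l) = G w + lin \<sigma>1 \<sigma>0 l"
  using Uc_add[of l w] Rc_add[of l w] by (simp add: G_def lin_def hyp_add)

lemma G_has_inverse:
  "\<exists>H. smooth H \<and> (\<forall>w. G (H w) = w) \<and> (\<forall>w. H (G w) = w) \<and>
    (\<forall>v w. v - w \<in> cover_lattice \<longrightarrow> H v - H w \<in> cover_lattice)"
proof -
  let ?e1 = "mk 0 0 1 0 0" and ?e2 = "mk 0 0 0 1 0"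
  have s0: "\<sigma>0 > 0" and s1: "\<sigma>1 > 0" using s0_gt s0_s1 by linarith+
  have "min_dQ \<psi> \<phi> / 2 > 0" "\<And>w. 1 + DU w ?e1 \<ge> min_dQ \<psi> \<phi> / 2"
    using dQ_bounds(3) qc0_bounds(1) by (simp_all add: DU_fibre qc0_def)
  from shear_inverse[OF smooth_Uc this] obtain h1 where h1: "smooth h1" "\<And>w. h1 (w + Uc w *\<^sub>R ?e1) = w"
    "\<And>w. h1 w + Uc (h1 w) *\<^sub>R ?e1 = w" by blast
  have "3 / (4 * \<sigma>0) > 0" "\<And>w. 1 + DR w ?e2 \<ge> 3 / (4 * \<sigma>0)"
    using s0
  proof -
    fix w
    have "(1 + DR w ?e2) * (4 * \<sigma>0) = 4 * (\<sigma>0 * (1 + DR w ?e2))" by (simp only: mult_ac)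
    then have "3 \<le> (1 + DR w ?e2) * (4 * \<sigma>0)" using mu0_bounds[of w] by linarith
    then show "3 / (4 * \<sigma>0) \<le> 1 + DR w ?e2" using s0 by (subst pos_divide_le_eq) simp_all
  qed simp
  from shear_inverse[OF smooth_Rc this] obtain h2 where h2: "smooth h2" "\<And>w. h2 (w + Rc w *\<^sub>R ?e2) = w"
    "\<And>w. h2 w + Rc (h2 w) *\<^sub>R ?e2 = w" by blast
  define H where "H w = h2 (h1 (lin (1 / \<sigma>1) (1 / \<sigma>0) w))" for w
  have ll: "lin \<sigma>1 \<sigma>0 (lin (1 / \<sigma>1) (1 / \<sigma>0) w) = w" "lin (1 / \<sigma>1) (1 / \<sigma>0) (lin \<sigma>1 \<sigma>0 w) = w" for w
    using s0 s1 by (simp_all add: lin_def hyp_inverse)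
  have "smooth H" unfolding H_def[abs_def]
    by (intro smooth_compose[OF h2(1)] smooth_compose[OF h1(1)] smooth_bounded_linear bounded_linear_lin)
  moreover have "G (H w) = w" "H (G w) = w" for w
    by (simp_all add: H_def G_decomp h1 h2 ll)
  moreover have "H v - H w \<in> cover_lattice" if vw: "v - w \<in> cover_lattice" for v w
  proof -
    define l where "l = lin (1 / \<sigma>1) (1 / \<sigma>0) (v - w)"
    have l: "l \<in> cover_lattice" unfolding l_def using vw by (rule lattice_lin)
    \<comment> \<open>By periodicity of the displacement both sides have the same image under the
      shear.\<close>
    have 1: "h1 (x + l) = h1 x + l" for x
      using h1(2)[of "h1 x + l"] h1(3)[of x] Uc_add[OF l, of "h1 x"] by (simp add: algebra_simps)
    have 2: "h2 (x + l) = h2 x + l" for x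
      using h2(2)[of "h2 x + l"] h2(3)[of x] Rc_add[OF l, of "h2 x"] by (simp add: algebra_simps)
    have "lin (1 / \<sigma>1) (1 / \<sigma>0) v = lin (1 / \<sigma>1) (1 / \<sigma>0) w + l"
      unfolding l_def using linear_diff[OF bounded_linear.linear[OF bounded_linear_lin]] by (simp add: algebra_simps)
    then have "H v = H w + l" by (simp add: H_def 1 2)
    then show ?thesis using l by simp
  qed
  ultimately show ?thesis by blast
qed

definition H :: "cover \<Rightarrow> cover" where
  "H = (SOME H. smooth H \<and> (\<forall>w. G (H w) = w) \<and> (\<forall>w. H (G w) = w) \<and>
    (\<forall>v w. v - w \<in> cover_lattice \<longrightarrow> H v - H w \<in> cover_lattice))"

lemma H: "smooth H" "G (H w) = w" "H (G w) = w" "v - w \<in> cover_lattice \<Longrightarrow> H v - H w \<in> cover_lattice"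
  using someI_ex[OF G_has_inverse] unfolding H_def[symmetric] by blast+

definition g :: "mfd \<Rightarrow> mfd" where
  "g x = covering (Q + G (SOME w. covering (Q + w) = x))"

text \<open>A deck translation of the argument changes G by the deck translation \<open>lin\<close>
  of it, so the lift chosen in the definition of \<open>g\<close> does not matter.\<close>

lemma g_covering: "covering (Q + G w) = g (covering (Q + w))"
proof -
  define w' where "w' = (SOME v. covering (Q + v) = covering (Q + w))"
  have "covering (Q + w') = covering (Q + w)" unfolding w'_def by (rule someI[of _ w]) simp
  then have "w - w' \<in> cover_lattice" using cover_lattice_minus[of "w' - w"] by (simp add: covering_eq_iff)
  then have "G (w' + (w - w')) - G w' \<in> cover_lattice" by (subst G_add) (simp_all add: lattice_lin)
  then have "G w - G w' \<in> cover_lattice" by simp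
  then show ?thesis unfolding g_def w'_def[symmetric] by (simp add: covering_eq_iff)
qed

lemma G_derivative:
  "(G has_derivative (\<lambda>v. mk (\<sigma>1 * cA v) (cB v / \<sigma>1) (cC v + DU w v) (\<sigma>0 * (cD v + DR w v)) (cE v / \<sigma>0))) (at w)"
proof -
  have "((\<lambda>w. lin \<sigma>1 \<sigma>0 (w + Uc w *\<^sub>R mk 0 0 1 0 0 + Rc w *\<^sub>R mk 0 0 0 1 0)) has_derivative
      (\<lambda>v. lin \<sigma>1 \<sigma>0 (v + DU w v *\<^sub>R mk 0 0 1 0 0 + DR w v *\<^sub>R mk 0 0 0 1 0))) (at w)"
    by (intro bounded_linear.has_derivative[OF bounded_linear_lin] has_derivative_add has_derivative_ident
        bounded_linear.has_derivative[OF bounded_linear_scaleR_left] smooth_has_derivative smooth_Uc smooth_Rc)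
  moreover have "(\<lambda>w. lin \<sigma>1 \<sigma>0 (w + Uc w *\<^sub>R mk 0 0 1 0 0 + Rc w *\<^sub>R mk 0 0 0 1 0)) = G"
    by (rule ext) (simp add: G_def lin_def mk_def)
  moreover have "lin \<sigma>1 \<sigma>0 (v + DU w v *\<^sub>R mk 0 0 1 0 0 + DR w v *\<^sub>R mk 0 0 0 1 0)
      = mk (\<sigma>1 * cA v) (cB v / \<sigma>1) (cC v + DU w v) (\<sigma>0 * (cD v + DR w v)) (cE v / \<sigma>0)" for v
    by (rule coord_eqI) (simp_all add: coord_defs lin_def mk_def inner_add_left)
  ultimately show ?thesis by simp
qed

lemma smooth_G: "smooth G"
proof -
  have id: "smooth (\<lambda>w::cover. w)" by (intro smooth_bounded_linear bounded_linear_ident)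
  have "smooth (\<lambda>w. lin \<sigma>1 \<sigma>0 (w + Uc w *\<^sub>R mk 0 0 1 0 0 + Rc w *\<^sub>R mk 0 0 0 1 0))"
    by (intro smooth_compose_linear[OF bounded_linear_lin] smooth_add smooth_scaleR smooth_const
        smooth_Uc smooth_Rc id)
  moreover have "(\<lambda>w. lin \<sigma>1 \<sigma>0 (w + Uc w *\<^sub>R mk 0 0 1 0 0 + Rc w *\<^sub>R mk 0 0 0 1 0)) = G"
    by (rule ext) (simp add: G_def lin_def mk_def)
  ultimately show ?thesis by simp
qed

sublocale lifted_diffeo g G H Q
  by (rule lifted_diffeo.intro[OF g_covering smooth_G H(1) H(2) H(3) H(4)])

lemma DG_eq: "DG w v = mk (\<sigma>1 * cA v) (cB v / \<sigma>1) (cC v + DU w v) (\<sigma>0 * (cD v + DR w v)) (cE v / \<sigma>0)"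
  by (simp only: DG_def fun_cong[OF frechet_derivative_at[OF G_derivative[of w], symmetric]])

text \<open>Matrix entries of the derivative as functions on M, the form required by
  \<open>triangular_diffeo\<close>.\<close>

definition coef :: "(cover \<Rightarrow> real) \<Rightarrow> cover \<Rightarrow> mfd \<Rightarrow> real" where
  "coef c v x = c (tangent_map g x v)"

lemma coef_pr: "coef c v (pr w) = c (DG w v)"
  by (simp add: coef_def tangent_map_pr)

lemma triangular: 
  "\<exists>\<theta> K. triangular_diffeo g G H Q eu es \<sigma>0 \<sigma>1
    (coef cC (mk 1 0 0 0 0)) (coef cC (mk 0 1 0 0 0)) (coef cC (mk 0 0 1 0 0))
    (coef cD (mk 1 0 0 0 0)) (coef cD (mk 0 1 0 0 0)) (coef cD (mk 0 0 1 0 0)) (coef cD (mk 0 0 0 0 1))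
    (coef cD (mk 0 0 0 1 0)) \<theta> K"
proof -
  obtain \<theta> where \<theta>: "\<theta> < 1" "3 / 4 \<le> \<theta>" "\<sigma>0 \<le> \<theta> * \<sigma>1" "\<And>w. \<sigma>0 * (1 + DF w (mk 0 0 0 1 0)) \<le> \<theta> * \<sigma>1"
    using mu_ratio by blast
  obtain C1 where C1: "\<And>w v. \<bar>DU w v\<bar> \<le> C1 * norm v" using linear_has_deriv_bound_U by blast
  obtain C2 where C2: "\<And>w v. \<bar>DR w v\<bar> \<le> C2 * norm v" using DR_bounded by blast
  define M where "M = norm (mk 1 0 0 0 0) + norm (mk 0 1 0 0 0) + norm (mk 0 0 1 0 0) + norm (mk 0 0 0 0 1)"
  define K where "K = 1 + \<bar>C1\<bar> * M + \<sigma>0 * (\<bar>C2\<bar> * M)"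
  have s0: "\<sigma>0 \<ge> 10000" "\<sigma>1 > \<sigma>0" by (rule s0_gt s0_s1)+
  have M: "M \<ge> 0" by (simp add: M_def)
  have b: "\<bar>DU w v\<bar> \<le> K" "\<bar>\<sigma>0 * DR w v\<bar> \<le> K" if "norm v \<le> M" for w v
  proof -
    have "C1 * norm v \<le> \<bar>C1\<bar> * M" "C2 * norm v \<le> \<bar>C2\<bar> * M" using that by (auto intro!: mult_mono)
    then have d: "\<bar>DU w v\<bar> \<le> \<bar>C1\<bar> * M" "\<bar>DR w v\<bar> \<le> \<bar>C2\<bar> * M" using C1[of w v] C2[of w v] by linarith+
    have "\<sigma>0 * (\<bar>C2\<bar> * M) \<ge> 0" "\<bar>C1\<bar> * M \<ge> 0" using s0 M by auto
    moreover have "\<bar>\<sigma>0 * DR w v\<bar> \<le> \<sigma>0 * (\<bar>C2\<bar> * M)" using d(2) s0 by (simp add: abs_mult)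
    ultimately show "\<bar>DU w v\<bar> \<le> K" "\<bar>\<sigma>0 * DR w v\<bar> \<le> K" using d unfolding K_def by linarith+
  qed
  have nM: "norm (mk 1 0 0 0 0) \<le> M" "norm (mk 0 1 0 0 0) \<le> M" "norm (mk 0 0 1 0 0) \<le> M" "norm (mk 0 0 0 0 1) \<le> M"
    by (simp_all add: M_def)
  have K0: "K > 0" using s0 M by (simp add: K_def add_pos_nonneg)
  have DUe: "DU w (mk 0 0 0 d e) = 0" for w d e using DU_fibre[of w 0 d e] by simp
  have expandU: "DU w v = cA v * DU w (mk 1 0 0 0 0) + cB v * DU w (mk 0 1 0 0 0) + cC v * DU w (mk 0 0 1 0 0)" for w v
  proof -
    have "v = cA v *\<^sub>R mk 1 0 0 0 0 + cB v *\<^sub>R mk 0 1 0 0 0 + cC v *\<^sub>R mk 0 0 1 0 0 + mk 0 0 0 (cD v) (cE v)"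
      by (rule coord_eqI) simp_all
    then have "DU w v = DU w (cA v *\<^sub>R mk 1 0 0 0 0 + cB v *\<^sub>R mk 0 1 0 0 0 + cC v *\<^sub>R mk 0 0 1 0 0 + mk 0 0 0 (cD v) (cE v))"
      by (rule arg_cong)
    then show ?thesis by (simp only: linear_add[OF linear_DU] linear_scale[OF linear_DU] DUe real_scaleR_def add_0_right)
  qed
  have expandR: "DR w v = cA v * DR w (mk 1 0 0 0 0) + cB v * DR w (mk 0 1 0 0 0) + cC v * DR w (mk 0 0 1 0 0)
      + cD v * DR w (mk 0 0 0 1 0) + cE v * DR w (mk 0 0 0 0 1)" for w v
  proof -
    have "v = cA v *\<^sub>R mk 1 0 0 0 0 + cB v *\<^sub>R mk 0 1 0 0 0 + cC v *\<^sub>R mk 0 0 1 0 0 + cD v *\<^sub>R mk 0 0 0 1 0 + cE v *\<^sub>R mk 0 0 0 0 1"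
      by (rule coord_eqI) simp_all
    then have "DR w v = DR w (cA v *\<^sub>R mk 1 0 0 0 0 + cB v *\<^sub>R mk 0 1 0 0 0 + cC v *\<^sub>R mk 0 0 1 0 0 + cD v *\<^sub>R mk 0 0 0 1 0 + cE v *\<^sub>R mk 0 0 0 0 1)"
      by (rule arg_cong)
    then show ?thesis by (simp only: linear_add[OF linear_DR] linear_scale[OF linear_DR] real_scaleR_def)
  qed
  have qc0: "1 + DU w (mk 0 0 1 0 0) = qc0 w" for w by (simp add: DU_fibre qc0_def)
  have qc0_pos: "qc0 w > 0" for w using qc0_bounds(1)[of w] dQ_bounds(3) by linarith
  have qc0_small: "qc0 w \<le> \<sigma>0 / 5000" for w using qc0_bounds(2)[of w] s0_ge by linarith
  have mu: "3 / 4 \<le> \<sigma>0 * (1 + DR w (mk 0 0 0 1 0))" "\<sigma>0 * (1 + DR w (mk 0 0 0 1 0)) \<le> \<theta> * \<sigma>1"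
    "qc0 w \<le> \<theta> * (\<sigma>0 * (1 + DR w (mk 0 0 0 1 0)))" for w
  proof -
    show ge: "3 / 4 \<le> \<sigma>0 * (1 + DR w (mk 0 0 0 1 0))" by (rule mu0_bounds)
    show "\<sigma>0 * (1 + DR w (mk 0 0 0 1 0)) \<le> \<theta> * \<sigma>1"
    proof (rule DR_casesE[of w])
      assume z: "\<And>v. DR w v = 0"
      show ?thesis unfolding z using \<theta>(3) by simp
    qed (simp only: \<theta>(4))
    \<comment> \<open>The critical inequality. Off the deformation mu = \<sigma>0 while qc0 \<le>
      \<sigma>0 / 5000. On it mu may be as small as 3/4, but there qc0 \<le> 1/2 + 1/10000 < 9/16
      \<le> \<theta> mu.\<close>
    show "qc0 w \<le> \<theta> * (\<sigma>0 * (1 + DR w (mk 0 0 0 1 0)))"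
    proof (rule DR_casesE[of w])
      assume z: "\<And>v. DR w v = 0"
      have "\<sigma>0 / 5000 \<le> \<theta> * \<sigma>0" using \<theta>(2) s0 mult_right_mono[of "3/4" \<theta> \<sigma>0] by linarith
      then show ?thesis using qc0_small[of w] unfolding z by simp
    next
      assume "qc0 w \<le> 1 / 2 + 1 / 10000"
      moreover have "3 / 4 * (3 / 4) \<le> \<theta> * (\<sigma>0 * (1 + DR w (mk 0 0 0 1 0)))"
        using \<theta>(2) ge by (intro mult_mono) auto
      ultimately show ?thesis by linarith
    qed
  qed
  have cq: "coef cC (mk 0 0 1 0 0) (pr w) = qc0 w" for w
    by (simp only: coef_pr DG_eq coord_mk qc0)
  have cmu: "coef cD (mk 0 0 0 1 0) (pr w) = \<sigma>0 * (1 + DR w (mk 0 0 0 1 0))" for w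
    by (simp only: coef_pr DG_eq coord_mk)
  have tm: "3 / 4 * (3 / 4) \<le> \<theta> * (\<sigma>0 * (1 + DR w (mk 0 0 0 1 0)))" for w
    using \<theta>(2) mu(1) by (intro mult_mono) auto
  have "triangular_diffeo g G H Q eu es \<sigma>0 \<sigma>1
    (coef cC (mk 1 0 0 0 0)) (coef cC (mk 0 1 0 0 0)) (coef cC (mk 0 0 1 0 0))
    (coef cD (mk 1 0 0 0 0)) (coef cD (mk 0 1 0 0 0)) (coef cD (mk 0 0 1 0 0)) (coef cD (mk 0 0 0 0 1))
    (coef cD (mk 0 0 0 1 0)) \<theta> K"
  proof (unfold_locales, goal_cases)
    case (1 x v)
    obtain w where x: "x = pr w" using pr_surj by metis
    show ?case unfolding x coef_pr tangent_map_pr DG_eq coord_mk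
      by (subst expandU[of w v], subst expandR[of w v]) (simp add: algebra_simps)
  next
    case 2 then show ?case using s0 by linarith
  next
    case 3 then show ?case using s0 by linarith
  next
    case 4 then show ?case using \<theta>(2) by linarith
  next
    case 5 then show ?case by (rule \<theta>(1))
  next
    case 6 then show ?case by (rule K0)
  next
    case (7 x)
    obtain w where x: "x = pr w" using pr_surj by metis
    show ?case unfolding x coef_pr DG_eq coord_mk using b(1)[OF nM(1)] by simp
  next
    case (8 x)
    obtain w where x: "x = pr w" using pr_surj by metis
    show ?case unfolding x coef_pr DG_eq coord_mk using b(1)[OF nM(2)] by simp
  next
    case (9 x)
    obtain w where x: "x = pr w" using pr_surj by metis
    show ?case unfolding x coef_pr DG_eq coord_mk using b(2)[OF nM(1)] by simp
  next
    case (10 x)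
    obtain w where x: "x = pr w" using pr_surj by metis
    show ?case unfolding x coef_pr DG_eq coord_mk using b(2)[OF nM(2)] by simp
  next
    case (11 x)
    obtain w where x: "x = pr w" using pr_surj by metis
    show ?case unfolding x coef_pr DG_eq coord_mk using b(2)[OF nM(3)] by simp
  next
    case (12 x)
    obtain w where x: "x = pr w" using pr_surj by metis
    show ?case unfolding x coef_pr DG_eq coord_mk using b(2)[OF nM(4)] by simp
  next
    case (13 x)
    obtain w where x: "x = pr w" using pr_surj by metis
    show ?case unfolding x cq using qc0_pos .
  next
    case (14 x)
    obtain w where x: "x = pr w" using pr_surj by metis
    show ?case unfolding x cmu by (rule mu(1))
  next
    case (15 x)
    obtain w where x: "x = pr w" using pr_surj by metis
    show ?case unfolding x cmu by (rule mu(2))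
  next
    case (16 x)
    obtain w where x: "x = pr w" using pr_surj by metis
    have "\<sigma>0 / 5000 \<le> \<theta> * \<sigma>1" using \<theta>(3) s0(1) by linarith
    then show ?case unfolding x cq using qc0_small[of w] by linarith
  next
    case (17 x)
    obtain w where x: "x = pr w" using pr_surj by metis
    show ?case unfolding x cq cmu by (rule mu(3))
  next
    case (18 x)
    obtain w where x: "x = pr w" using pr_surj by metis
    have "1 / \<sigma>0 \<le> 1 / 10000" using s0(1) by (intro divide_left_mono) auto
    then show ?case unfolding x cmu using tm[of w] by linarith
  next
    case (19 x)
    obtain w where x: "x = pr w" using pr_surj by metis
    have "1 / \<sigma>1 \<le> 1 / 10000" using s0 by (intro divide_left_mono) auto
    then show ?case unfolding x cmu using tm[of w] by linarith
  qed
  then show ?thesis by blast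
qed

end

section \<open>Dynamics near the distinguished fixed point\<close>

text \<open>A one-dimensional open mapping statement that asks for differentiability at 0 only. The
  bound on the parameter is what later controls the drift of the other coordinates.\<close>

lemma DERIV_hits_values:
  fixes f :: "real \<Rightarrow> real"
  assumes d: "d > 0" and c: "continuous_on {-d..d} f" and D: "(f has_real_derivative 1) (at 0)"
  shows "\<exists>\<eta>0>0. \<forall>\<eta>. \<bar>\<eta>\<bar> < \<eta>0 \<longrightarrow> (\<exists>t. \<bar>t\<bar> \<le> 2 * \<bar>\<eta>\<bar> \<and> f t = f 0 + \<eta>)"
proof -
  have "\<exists>e>0. \<forall>t. 0 < \<bar>t\<bar> \<and> \<bar>t\<bar> < e \<longrightarrow> \<bar>(f t - f 0) / t - 1\<bar> < 1/2"
    using LIM_D[OF D[unfolded has_field_derivative_iff], of "1/2"] by auto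
  then obtain e where e: "e > 0" "\<And>t. 0 < \<bar>t\<bar> \<Longrightarrow> \<bar>t\<bar> < e \<Longrightarrow> \<bar>(f t - f 0) / t - 1\<bar> < 1/2" by blast
  define \<eta>0 where "\<eta>0 = min d e / 2"
  have "\<exists>t. \<bar>t\<bar> \<le> 2 * \<bar>\<eta>\<bar> \<and> f t = f 0 + \<eta>" if \<eta>: "\<bar>\<eta>\<bar> < \<eta>0" for \<eta>
  proof -
    have s: "\<bar>2 * \<eta>\<bar> < d" "\<bar>2 * \<eta>\<bar> < e" using \<eta> by (auto simp: \<eta>0_def)
    consider "\<eta> = 0" | "\<eta> > 0" | "\<eta> < 0" by linarith
    then show ?thesis
    proof cases
      case 1 then show ?thesis by (intro exI[of _ 0]) simp
    next
      case 2
      have "(f (2 * \<eta>) - f 0) / (2 * \<eta>) \<ge> 1/2" using e(2)[of "2 * \<eta>"] s 2 by linarith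
      then have "f (2 * \<eta>) \<ge> f 0 + \<eta>" using 2 by (simp add: pos_le_divide_eq)
      moreover have "continuous_on {0..2 * \<eta>} f" by (rule continuous_on_subset[OF c]) (use s 2 in auto)
      ultimately obtain t where "0 \<le> t" "t \<le> 2 * \<eta>" "f t = f 0 + \<eta>" using IVT'[of f 0 "f 0 + \<eta>" "2 * \<eta>"] 2 by auto
      then show ?thesis using 2 by (intro exI[of _ t]) simp
    next
      case 3
      have "(f (2 * \<eta>) - f 0) / (2 * \<eta>) \<ge> 1/2" using e(2)[of "2 * \<eta>"] s 3 by linarith
      then have "f (2 * \<eta>) \<le> f 0 + \<eta>" using 3 by (simp add: neg_le_divide_eq)
      moreover have "continuous_on {2 * \<eta>..0} f" by (rule continuous_on_subset[OF c]) (use s 3 in auto)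
      ultimately obtain t where "2 * \<eta> \<le> t" "t \<le> 0" "f t = f 0 + \<eta>" using IVT'[of f "2 * \<eta>" "f 0 + \<eta>" 0] 3 by auto
      then show ?thesis using 3 by (intro exI[of _ t]) simp
    qed
  qed
  moreover have "\<eta>0 > 0" using d e(1) by (simp add: \<eta>0_def)
  ultimately show ?thesis by blast
qed

lemma DERIV_local_Lipschitz:
  fixes f :: "real \<Rightarrow> real"
  assumes D: "(f has_real_derivative D) (at 0)"
  shows "\<exists>d>0. \<forall>t. \<bar>t\<bar> < d \<longrightarrow> \<bar>f t - f 0\<bar> \<le> (\<bar>D\<bar> + 1) * \<bar>t\<bar>"
proof -
  have "\<exists>e>0. \<forall>t. 0 < \<bar>t\<bar> \<and> \<bar>t\<bar> < e \<longrightarrow> \<bar>(f t - f 0) / t - D\<bar> < 1"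
    using LIM_D[OF D[unfolded has_field_derivative_iff], of 1] by auto
  then obtain e where e: "e > 0" "\<And>t. 0 < \<bar>t\<bar> \<Longrightarrow> \<bar>t\<bar> < e \<Longrightarrow> \<bar>(f t - f 0) / t - D\<bar> < 1" by blast
  have "\<bar>f t - f 0\<bar> \<le> (\<bar>D\<bar> + 1) * \<bar>t\<bar>" if "\<bar>t\<bar> < e" for t
  proof (cases "t = 0")
    case False
    then have "\<bar>(f t - f 0) / t\<bar> \<le> \<bar>D\<bar> + 1" using e(2)[of t] that by linarith
    then show ?thesis using False by (simp add: abs_divide pos_divide_le_eq)
  qed simp
  then show ?thesis using e(1) by blast
qed

locale perturbed_model = skew_model +
  assumes eps_pos: "\<epsilon> > 0"
begin

text \<open>The lift of (q2, 1, q2); the origin Q lies over (q2, 0, q2).\<close>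

abbreviation "tp \<equiv> mk 0 0 1 0 0"

lemma s1_gt: "\<sigma>1 \<ge> 10000" "\<sigma>1 > 0" "\<sigma>0 > 0" using s0_s1 s0_gt by linarith+

lemma power_tendsto: "(\<lambda>n. c / \<sigma>1 ^ n) \<longlonglongrightarrow> 0" "(\<lambda>n. c / \<sigma>0 ^ n) \<longlonglongrightarrow> 0"
proof -
  have "(\<lambda>n. c / t ^ n) \<longlonglongrightarrow> 0" if "t \<ge> 10000" for t :: real
  proof -
    have "(\<lambda>n. c * (1 / t) ^ n) \<longlonglongrightarrow> c * 0"
      using that by (intro tendsto_mult tendsto_const LIMSEQ_power_zero) auto
    then show ?thesis by (simp add: power_one_over divide_inverse power_inverse)
  qed
  then show "(\<lambda>n. c / \<sigma>1 ^ n) \<longlonglongrightarrow> 0" "(\<lambda>n. c / \<sigma>0 ^ n) \<longlonglongrightarrow> 0"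
    using s1_gt(1) s0_gt by blast+
qed

lemma s1_pow_ge: "1 \<le> \<sigma>1 ^ n"
  by (rule one_le_power) (use s1_gt(1) in linarith)

lemma div_s1_pow_le: "\<bar>b / \<sigma>1 ^ n\<bar> \<le> \<bar>b\<bar>"
proof -
  have "\<bar>b\<bar> * 1 \<le> \<bar>b\<bar> * \<sigma>1 ^ n" using s1_pow_ge by (intro mult_left_mono) auto
  moreover have "\<sigma>1 ^ n > 0" using s1_pow_ge[of n] by linarith
  ultimately show ?thesis by (simp add: abs_divide pos_divide_le_eq)
qed

lemma hyp_lattice_pow:
  "l \<in> int_lattice \<Longrightarrow> hyp (\<sigma>1 ^ n) l \<in> int_lattice" "l \<in> int_lattice \<Longrightarrow> hyp (\<sigma>0 ^ n) l \<in> int_lattice"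
  "l \<in> int_lattice \<Longrightarrow> hyp (1 / \<sigma>1 ^ n) l \<in> int_lattice"
  unfolding power_mult[symmetric] by (rule hyp_lattice; assumption)+

lemma hyp_1: "hyp 1 v = v" by (rule frame_eqI) simp_all

text \<open>Within \<delta> / 2 of q2 the bump equals 1, so the fibre map is exactly 1 + \<phi> (y -
  1), and the centres p1, p2 of the deformation are more than 10 \<delta> away from q2.\<close>

lemma near_q2:
  assumes l: "l \<in> int_lattice" and n: "norm (fst w - l) \<le> \<delta> / 2"
  shows "Uc w = 1 + \<phi> (fst (snd w) - 1) - fst (snd w)" "Rc w = 0" "DR w v = 0"
proof -
  have "norm (fst w - r 3 - l) < 8 * \<delta>" using n \<delta>_pos by (simp add: r3)
  from Uc_single[OF _ l this] \<psi>_one[of "norm (fst w - l)"] n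
  show "Uc w = 1 + \<phi> (fst (snd w) - 1) - fst (snd w)" by (simp add: r3 push_def shift_def)
  have far: False if i: "i < 2" and l': "l' \<in> cover_lattice" and le: "norm (fst w - r i - fst l') \<le> \<delta> / k" for i l'
  proof -
    have "fst l' \<in> int_lattice" using l' by (auto simp: cover_lattice_def)
    then have "l - fst l' \<in> int_lattice" using int_lattice_add[OF l int_lattice_minus] by force
    then have "10 * \<delta> < norm (r 3 - r i - (fst l' - l))"
      using r_sep[of 3 i "fst l' - l"] i int_lattice_minus[of "l - fst l'"] by simp
    also have "\<dots> \<le> norm (fst w - r i - fst l') + norm (fst w - l)"
      using norm_triangle_ineq4[of "fst w - r i - fst l'" "fst w - l"] by (simp add: r3 algebra_simps)
    finally show False using n le dk \<delta>_pos by linarith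
  qed
  have "periodize cover_lattice F5 (w - cent i) = 0" if i: "i < 2" for i
  proof (rule ccontr)
    assume "periodize cover_lattice F5 (w - cent i) \<noteq> 0"
    then obtain l' where l': "l' \<in> cover_lattice" "F5 (w - cent i - l') \<noteq> 0"
      using cover_lattice.periodize_nonzero[OF F5_support(3)] by metis
    let ?u = "w - cent i - l'"
    have "norm (fst ?u) = sqrt ((cA ?u)\<^sup>2 + (cB ?u)\<^sup>2)" unfolding cA_def cB_def by (rule norm_frame)
    also have "\<dots> \<le> sqrt ((cA ?u)\<^sup>2 + (cB ?u)\<^sup>2 + (cC ?u)\<^sup>2 + (cE ?u)\<^sup>2)" by (rule real_sqrt_le_mono) simp
    also have "\<dots> \<le> \<delta> / k" using F5_support(2)[OF l'(2)] by simp
    finally show False using far[OF i l'(1)] by (simp add: cent_coords)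
  qed
  then show "Rc w = 0" by (simp add: Rc_def)
  show "DR w v = 0" by (rule DR_casesE[of w]) (use far in blast)+
qed

lemma G_near_q2:
  assumes "l \<in> int_lattice" "norm (fst w - l) \<le> \<delta> / 2"
  shows "G w = (hyp \<sigma>1 (fst w), 1 + \<phi> (fst (snd w) - 1), hyp \<sigma>0 (snd (snd w)))"
  using near_q2[OF assms] by (simp add: G_def)

lemma fst_G_iter: "fst ((G ^^ n) w) = hyp (\<sigma>1 ^ n) (fst w)"
  by (induction n) (simp_all add: hyp_1 G_def hyp_hyp)

lemma norm_leaf_diff: "norm (l + b *\<^sub>R es - l) = \<bar>b\<bar>" by simp

text \<open>The leaf is contracted towards lattice points, so its orbit never leaves the region
  where G is a product map.\<close>

lemma G_iter_stable_leaf: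
  assumes l: "l \<in> int_lattice" and b: "\<bar>b\<bar> \<le> \<delta> / 4"
  shows "(G ^^ n) (l + b *\<^sub>R es, y, z) =
    (hyp (\<sigma>1 ^ n) l + (b / \<sigma>1 ^ n) *\<^sub>R es, 1 + (\<phi> ^^ n) (y - 1), hyp (\<sigma>0 ^ n) z)"
proof (induction n)
  case 0
  show ?case by (simp add: hyp_1)
next
  case (Suc n)
  let ?l = "hyp (\<sigma>1 ^ n) l" and ?b = "b / \<sigma>1 ^ n"
  have "\<bar>?b\<bar> \<le> \<bar>b\<bar>" by (rule div_s1_pow_le)
  then have "norm (?l + ?b *\<^sub>R es - ?l) \<le> \<delta> / 2" unfolding norm_leaf_diff using b \<delta>_pos by linarith
  then have "G (?l + ?b *\<^sub>R es, 1 + (\<phi> ^^ n) (y - 1), hyp (\<sigma>0 ^ n) z) =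
      (hyp \<sigma>1 (?l + ?b *\<^sub>R es), 1 + \<phi> ((\<phi> ^^ n) (y - 1)), hyp \<sigma>0 (hyp (\<sigma>0 ^ n) z))"
    by (subst G_near_q2[OF hyp_lattice_pow(1)[OF l, of n]]) simp_all
  moreover have "hyp \<sigma>1 (?l + ?b *\<^sub>R es) = hyp (\<sigma>1 ^ Suc n) l + (b / \<sigma>1 ^ Suc n) *\<^sub>R es"
    by (rule frame_eqI) (simp_all add: inner_add_left distrib_left add_divide_distrib mult.commute)
  ultimately show ?case using Suc by (simp add: hyp_hyp)
qed

text \<open>Lifts of the local stable leaf of q2 in the first factor; the other two factors are
  free.\<close>

definition on_leaf :: "cover \<Rightarrow> bool" where
  "on_leaf w \<longleftrightarrow> (\<exists>l\<in>int_lattice. \<exists>b. \<bar>b\<bar> \<le> \<delta> / 4 \<and> fst w = l + b *\<^sub>R es)"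

lemma on_leaf_iter: 
  assumes "on_leaf w" shows "on_leaf ((G ^^ n) w)"
proof -
  obtain l b where l: "l \<in> int_lattice" "\<bar>b\<bar> \<le> \<delta> / 4" "fst w = l + b *\<^sub>R es" using assms by (auto simp: on_leaf_def)
  have w: "w = (l + b *\<^sub>R es, fst (snd w), snd (snd w))" using l(3) by (simp add: prod_eq_iff)
  have "\<bar>b / \<sigma>1 ^ n\<bar> \<le> \<delta> / 4" using div_s1_pow_le[of b n] l(2) by linarith
  moreover have "fst ((G ^^ n) w) = hyp (\<sigma>1 ^ n) l + (b / \<sigma>1 ^ n) *\<^sub>R es"
    by (subst w, subst G_iter_stable_leaf[OF l(1,2)]) simp
  ultimately show ?thesis using hyp_lattice_pow(1)[OF l(1)] unfolding on_leaf_def by blast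
qed

lemma on_leaf_DR: "on_leaf w \<Longrightarrow> DR w v = 0"
proof -
  assume "on_leaf w"
  then obtain l b where l: "l \<in> int_lattice" "\<bar>b\<bar> \<le> \<delta> / 4" "fst w = l + b *\<^sub>R es" by (auto simp: on_leaf_def)
  have "norm (fst w - l) \<le> \<delta> / 2" unfolding l(3) norm_leaf_diff using l(2) \<delta>_pos by linarith
  from near_q2(3)[OF l(1) this] show ?thesis .
qed

text \<open>The hypothesis under which \<open>ph_splitting_exists\<close> makes E^cs constant; it
  holds since leaves are forward invariant and avoid the deformation.\<close>

lemma coef_on_leaf:
  assumes "on_leaf w"
  shows "coef cD (mk 0 1 0 0 0) ((g ^^ n) (pr w)) = 0 \<and> coef cD (mk 0 0 1 0 0) ((g ^^ n) (pr w)) = 0 \<and>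
    coef cD (mk 0 0 0 0 1) ((g ^^ n) (pr w)) = 0"
  using on_leaf_DR[OF on_leaf_iter[OF assms]] by (simp add: funpow_pr coef_pr DG_eq)

lemma pr_add: "l \<in> cover_lattice \<Longrightarrow> pr (w + l) = pr w"
  by (simp add: pr_eq_iff)

lemma dist_pr_le: "dist (pr v) (pr w) \<le> dist v w"
  unfolding pr_def using dist_covering_le[of "Q + v" "Q + w"] by simp

lemma on_leaf_top: "on_leaf tp"
  unfolding on_leaf_def by (rule bexI[OF _ int_lattice_zero], rule exI[of _ 0]) (simp add: mk_def \<delta>_def)

lemma G_top: "G tp = tp"
  using G_near_q2[OF int_lattice_zero, of tp] \<delta>_pos by (simp add: mk_def \<phi>_values hyp_def)

lemma g_top: "(g ^^ n) (pr tp) = pr tp"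
  by (induction n) (simp_all add: g_pr G_top)

lemma orbit_top: "orbit g (pr tp) = {pr tp}"
  by (auto simp: orbit_def g_top)

lemma mem_Ws_top: "x \<in> Ws g (pr tp) \<longleftrightarrow> (\<lambda>n. dist ((g ^^ n) x) (pr tp)) \<longlonglongrightarrow> 0"
  by (simp add: Ws_def orbit_top)

lemma Ws_top_funpow: 
  assumes "(g ^^ M) x \<in> Ws g (pr tp)" shows "x \<in> Ws g (pr tp)"
proof -
  have "(\<lambda>n. dist ((g ^^ (n + M)) x) (pr tp)) \<longlonglongrightarrow> 0"
    using assms by (simp add: mem_Ws_top funpow_add)
  then show ?thesis unfolding mem_Ws_top by (rule LIMSEQ_offset)
qed

text \<open>A criterion for lying in the stable set of (q2, 1, q2): the first factor is on a local
  stable leaf of q2, the circle coordinate is off the repelling level, and the last factor is on the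
  global stable line of some lift of q2.\<close>

definition stable_point :: "cover \<Rightarrow> bool" where
  "stable_point w \<longleftrightarrow> (\<exists>l\<in>int_lattice. \<exists>b. \<bar>b\<bar> \<le> \<delta> / 4 \<and> fst w = l + b *\<^sub>R es) \<and> fst (snd w) \<notin> even_lattice \<and>
    (\<exists>l\<in>int_lattice. snd (snd w) \<bullet> eu = l \<bullet> eu)"

lemma stable_point_iterates:
  assumes "stable_point w"
  obtains b t e where "\<bar>b\<bar> \<le> \<delta> / 4" "\<bar>t\<bar> < 1"
    "\<And>n. \<exists>l\<in>cover_lattice. (G ^^ n) w = l + (tp + mk 0 (b / \<sigma>1 ^ n) ((\<phi> ^^ n) t) 0 (e / \<sigma>0 ^ n))"
proof -
  obtain l b where l: "l \<in> int_lattice" and b: "\<bar>b\<bar> \<le> \<delta> / 4" and w1: "fst w = l + b *\<^sub>R es"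
    using assms by (auto simp: stable_point_def)
  obtain l' where l': "l' \<in> int_lattice" and w3: "snd (snd w) \<bullet> eu = l' \<bullet> eu" using assms by (auto simp: stable_point_def)
  define e where "e = (snd (snd w) - l') \<bullet> es"
  have z: "snd (snd w) = l' + e *\<^sub>R es"
    by (rule frame_eqI) (simp_all add: w3 e_def inner_add_left inner_diff_left)
  define y where "y = fst (snd w)"
  \<comment> \<open>Reduces y to [0, 2). As y is not in the lattice, 0 is excluded, and t, the
    reduced value minus 1, lies in the basin (-1, 1) of the fixed point 0 of \<phi>.\<close>
  define j where "j = \<lfloor>y / 2\<rfloor>"
  define t where "t = y - 2 * of_int j - 1"
  have j: "of_int j \<le> y / 2" "y / 2 < of_int j + 1" unfolding j_def by linarith+
  have "y \<notin> even_lattice" using assms by (simp add: stable_point_def y_def)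
  then have "y / 2 \<noteq> of_int j" by (auto simp: even_lattice_def)
  then have t: "\<bar>t\<bar> < 1" using j by (auto simp: t_def)
  have pow: "(\<phi> ^^ n) (s + 2 * of_int j) = (\<phi> ^^ n) s + 2 * of_int j" for n s
    by (induction n) (simp_all add: \<phi>_int)
  have "\<exists>m\<in>cover_lattice. (G ^^ n) w = m + (tp + mk 0 (b / \<sigma>1 ^ n) ((\<phi> ^^ n) t) 0 (e / \<sigma>0 ^ n))" for n
  proof
    let ?m = "(hyp (\<sigma>1 ^ n) l, 2 * of_int j :: real, hyp (\<sigma>0 ^ n) l')"
    show "?m \<in> cover_lattice"
      using hyp_lattice_pow(1)[OF l] hyp_lattice_pow(2)[OF l'] by (simp add: cover_lattice_def even_lattice_def)
    have w: "w = (l + b *\<^sub>R es, y, l' + e *\<^sub>R es)" using w1 z by (simp add: y_def prod_eq_iff)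
    have "y - 1 = t + 2 * of_int j" by (simp add: t_def)
    then have "(\<phi> ^^ n) (y - 1) = (\<phi> ^^ n) t + 2 * of_int j" by (simp only: pow)
    moreover have "hyp (\<sigma>0 ^ n) (l' + e *\<^sub>R es) = hyp (\<sigma>0 ^ n) l' + (e / \<sigma>0 ^ n) *\<^sub>R es"
      by (rule frame_eqI) (simp_all add: inner_add_left add_divide_distrib)
    ultimately show "(G ^^ n) w = ?m + (tp + mk 0 (b / \<sigma>1 ^ n) ((\<phi> ^^ n) t) 0 (e / \<sigma>0 ^ n))"
      unfolding w G_iter_stable_leaf[OF l b] by (simp add: mk_def)
  qed
  with b t that show thesis by blast
qed

lemma stable_coords_tendsto:
  assumes "\<bar>t\<bar> < 1"
  shows "(\<lambda>n. mk 0 (b / \<sigma>1 ^ n) ((\<phi> ^^ n) t) 0 (e / \<sigma>0 ^ n)) \<longlonglongrightarrow> 0"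
proof -
  have "(\<lambda>n. mk 0 (b / \<sigma>1 ^ n) ((\<phi> ^^ n) t) 0 (e / \<sigma>0 ^ n)) \<longlonglongrightarrow> mk 0 0 0 0 0"
    unfolding mk_def by (intro tendsto_intros power_tendsto \<phi>_iterates(1)) (use assms in auto)
  moreover have "mk 0 0 0 0 0 = 0" by (rule coord_eqI) simp_all
  ultimately show ?thesis by simp
qed

lemma stable_point_Ws: 
  assumes "stable_point w" shows "pr w \<in> Ws g (pr tp)"
proof -
  obtain b t e where t: "\<bar>t\<bar> < 1"
    and it: "\<And>n. \<exists>l\<in>cover_lattice. (G ^^ n) w = l + (tp + mk 0 (b / \<sigma>1 ^ n) ((\<phi> ^^ n) t) 0 (e / \<sigma>0 ^ n))"
    using stable_point_iterates[OF assms] by metis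
  let ?\<xi> = "\<lambda>n. mk 0 (b / \<sigma>1 ^ n) ((\<phi> ^^ n) t) 0 (e / \<sigma>0 ^ n)"
  have eq: "(g ^^ n) (pr w) = pr (tp + ?\<xi> n)" for n
    using it[of n] pr_add[of _ "tp + ?\<xi> n"] by (auto simp: funpow_pr add.commute)
  have le: "dist ((g ^^ n) (pr w)) (pr tp) \<le> norm (?\<xi> n)" for n
    unfolding eq using dist_pr_le[of "tp + ?\<xi> n" tp] by (simp add: dist_norm)
  have "(\<lambda>n. norm (?\<xi> n)) \<longlonglongrightarrow> 0" using stable_coords_tendsto[OF t] by (rule tendsto_norm_zero)
  then show ?thesis unfolding mem_Ws_top
    by (rule tendsto_sandwich[OF _ _ tendsto_const, rotated 2]) (use le in auto)
qed

lemma stable_point_near_top: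
  assumes "cA \<xi> = 0" "cD \<xi> = 0" "norm \<xi> \<le> \<delta> / 4"
  shows "stable_point (tp + \<xi>)" "on_leaf (tp + \<xi>)"
proof -
  have c: "\<bar>cB \<xi>\<bar> \<le> \<delta> / 4" "\<bar>cC \<xi>\<bar> \<le> \<delta> / 4" using coord_le_norm[of \<xi>] assms(3) by linarith+
  have f: "fst (tp + \<xi>) = 0 + cB \<xi> *\<^sub>R es"
    by (rule frame_eqI) (use assms(1) in \<open>simp_all add: mk_def cA_def cB_def\<close>)
  have s: "fst (snd (tp + \<xi>)) = 1 + cC \<xi>" by (simp add: mk_def cC_def)
  have ne: "1 + cC \<xi> \<notin> even_lattice"
  proof
    assume "1 + cC \<xi> \<in> even_lattice"
    then obtain m :: int where "(1 + cC \<xi>) / 2 = of_int m" by (auto simp: even_lattice_def elim: Ints_cases)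
    moreover have "0 < (1 + cC \<xi>) / 2" "(1 + cC \<xi>) / 2 < 1" using c(2) by (auto simp: \<delta>_def)
    ultimately have "0 < m" "m < 1" by simp_all
    then show False by simp
  qed
  have z: "snd (snd (tp + \<xi>)) \<bullet> eu = 0 \<bullet> eu" using assms(2) by (simp add: mk_def cD_def)
  show "stable_point (tp + \<xi>)" unfolding stable_point_def f s z using c(1) ne int_lattice_zero by blast
  show "on_leaf (tp + \<xi>)" unfolding on_leaf_def f using c(1) int_lattice_zero by blast
qed

section \<open>Leaving the repelling level\<close>

text \<open>The first two factors do not see the last one, so they carry a map of their own.\<close>

definition base_map :: "(real^2) \<times> real \<Rightarrow> (real^2) \<times> real" where
  "base_map p = (hyp \<sigma>1 (fst p), snd p + Uc (fst p, snd p, 0))"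

lemma Uc_base: "Uc (x, y, z) = Uc (x, y, 0)" by (simp add: Uc_def)

lemma base_iter: "(fst ((G ^^ n) w), fst (snd ((G ^^ n) w))) = (base_map ^^ n) (fst w, fst (snd w))"
proof (induction n)
  case (Suc n)
  have "(base_map ^^ Suc n) (fst w, fst (snd w)) = base_map (fst ((G ^^ n) w), fst (snd ((G ^^ n) w)))" using Suc by simp
  also have "\<dots> = (fst (G ((G ^^ n) w)), fst (snd (G ((G ^^ n) w))))"
    by (simp add: base_map_def G_def Uc_base[of "fst ((G ^^ n) w)" "fst (snd ((G ^^ n) w))" "snd (snd ((G ^^ n) w))", symmetric])
  finally show ?case by simp
qed simp

lemma continuous_base_map: "continuous_on UNIV (base_map ^^ n)"
proof (induction n)
  case 0
  show ?case by (simp add: id_def)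
next
  case (Suc n)
  have "continuous_on UNIV base_map"
    unfolding base_map_def[abs_def]
    by (intro continuous_intros bounded_linear.continuous_on[OF bounded_linear_hyp]
        continuous_on_compose2[OF smooth_continuous_on[OF smooth_Uc]]) auto
  then have "continuous_on UNIV (\<lambda>p. base_map ((base_map ^^ n) p))" by (rule continuous_on_compose2[OF _ Suc]) simp
  then show ?case by (simp add: o_def)
qed

lemma base_map_shift:
  assumes "l \<in> int_lattice" "m \<in> even_lattice"
  shows "(base_map ^^ n) (x + l, y + m) = (fst ((base_map ^^ n) (x, y)) + hyp (\<sigma>1 ^ n) l, snd ((base_map ^^ n) (x, y)) + m)"
proof (induction n)
  case 0
  show ?case by (simp add: hyp_1)
next
  case (Suc n)
  let ?p = "(base_map ^^ n) (x, y)" and ?l = "hyp (\<sigma>1 ^ n) l"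
  have "Uc (fst ?p + ?l, snd ?p + m, 0) = Uc (fst ?p, snd ?p, 0)"
    by (rule Uc_shift) (use hyp_lattice_pow(1)[OF assms(1)] assms(2) in auto)
  then have "base_map (fst ?p + ?l, snd ?p + m) = (fst (base_map ?p) + hyp \<sigma>1 ?l, snd (base_map ?p) + m)"
    by (simp add: base_map_def hyp_add)
  then show ?case using Suc by (simp add: hyp_hyp)
qed

lemma fst_base_map: "fst ((base_map ^^ n) p) = hyp (\<sigma>1 ^ n) (fst p)"
  by (induction n) (simp_all add: hyp_1 base_map_def hyp_hyp)

lemma base_map_strict_mono:
  assumes "y < y'" shows "y + Uc (x, y, 0) < y' + Uc (x, y', 0)"
proof (rule DERIV_pos_imp_increasing[OF assms])
  fix t
  have "((\<lambda>t. t + (\<Sum>i<4. bmp i x * push i t)) has_real_derivative 1 + (\<Sum>i<4. bmp i x * deriv (push i) t)) (at t)"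
    by (intro DERIV_add DERIV_ident DERIV_sum DERIV_cmult smooth_deriv(1)[OF smooth_push])
  moreover have "1 + (\<Sum>i<4. bmp i x * deriv (push i) t) > 0"
    using qc0_bounds(1)[of "(x, t, 0)"] dQ_bounds(3) by (simp add: qc0_def)
  ultimately show "\<exists>d. ((\<lambda>t. t + Uc (x, t, 0)) has_real_derivative d) (at t) \<and> 0 < d"
    by (auto simp: Uc_def)
qed

lemma shift_cases: "shift i = 0 \<or> shift i = 1" by (simp add: shift_def)

lemma Uc_1: "Uc (x, 1, 0) = 0"
proof -
  have "push i 1 = 0" for i
    using shift_cases[of i] by (auto simp: push_def \<phi>_values shift_def)
  then show ?thesis by (simp add: Uc_def)
qed

text \<open>\<phi> fixes 0 and -1, so at level 0 only the push at index 2 survives, with the factor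
  1 + cos 0 = 2.\<close>

lemma Uc_0: "0 \<le> Uc (x, 0, 0)" "bmp 2 x > 0 \<Longrightarrow> 0 < Uc (x, 0, 0)"
proof -
  have p: "push i 0 = (if i = 2 then 2 * \<epsilon> else 0)" for i
    using shift_cases[of i] by (auto simp: push_def \<phi>_values shift_def)
  have u: "Uc (x, 0, 0) = bmp 2 x * (2 * \<epsilon>)"
    unfolding Uc_def by (simp add: p numeral_eq_Suc)
  show "0 \<le> Uc (x, 0, 0)" using bmp_bounds(1) eps_pos by (simp add: u)
  show "bmp 2 x > 0 \<Longrightarrow> 0 < Uc (x, 0, 0)" using eps_pos by (simp add: u)
qed

text \<open>Every fibre map is increasing, fixes level 1 and does not move level 0 down. An orbit
  starting in [0, 1) is therefore trapped there, and once positive it stays positive.\<close>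

lemma base_map_interval:
  assumes "0 \<le> snd p" "snd p < 1"
  shows "0 \<le> snd (base_map p)" "snd (base_map p) < 1" "0 < snd p \<or> bmp 2 (fst p) > 0 \<Longrightarrow> 0 < snd (base_map p)"
proof -
  have lt: "snd (base_map p) < 1"
    using base_map_strict_mono[OF assms(2), of "fst p"] by (simp add: base_map_def Uc_1)
  have ge: "snd (base_map p) \<ge> 0 + Uc (fst p, 0, 0)" and gt: "0 < snd p \<Longrightarrow> snd (base_map p) > 0 + Uc (fst p, 0, 0)"
    using base_map_strict_mono[of 0 "snd p" "fst p"] assms(1) by (cases "snd p = 0"; simp add: base_map_def)+
  show "0 \<le> snd (base_map p)" "snd (base_map p) < 1" using ge Uc_0(1)[of "fst p"] lt by auto
  show "0 < snd p \<or> bmp 2 (fst p) > 0 \<Longrightarrow> 0 < snd (base_map p)"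
    using ge gt Uc_0[of "fst p"] by linarith
qed

text \<open>An orbit that is homoclinic to the leaf of \<open>q2\<close> and visits the place where the fibres are
  pushed.\<close>

lemma homoclinic:
  obtains l M where "l \<in> int_lattice" "\<bar>l \<bullet> eu\<bar> \<le> \<delta> / 4" "(\<bar>l \<bullet> es\<bar> + 1) / \<sigma>1 ^ M \<le> \<delta> / 4"
    "0 < snd ((base_map ^^ M) ((l \<bullet> eu) *\<^sub>R eu, 0))" "snd ((base_map ^^ M) ((l \<bullet> eu) *\<^sub>R eu, 0)) < 1"
proof -
  have d8: "\<delta> / 8 > 0" using \<delta>_pos by simp
  \<comment> \<open>Translates q1 to a point x almost on the unstable line through the
    origin.\<close>
  obtain l1 where l1: "l1 \<in> int_lattice" "\<bar>l1 \<bullet> es - (- (r 2 \<bullet> es))\<bar> < \<delta> / 8"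
    using lattice_dense[of es "\<delta> / 8"] d8 by blast
  define x where "x = r 2 + l1"
  \<comment> \<open>A lattice point whose stable line crosses that unstable line close to x, at the
    point with coordinate a.\<close>
  obtain l2 where l2: "l2 \<in> int_lattice" "\<bar>l2 \<bullet> eu - x \<bullet> eu\<bar> < \<delta> / 8"
    using lattice_dense[of eu "\<delta> / 8"] d8 by blast
  define a where "a = l2 \<bullet> eu"
  have "norm (a *\<^sub>R eu - r 2 - l1) \<le> \<bar>a - x \<bullet> eu\<bar> + \<bar>x \<bullet> es\<bar>"
  proof -
    have "norm (a *\<^sub>R eu - x) = sqrt ((a - x \<bullet> eu)\<^sup>2 + (- (x \<bullet> es))\<^sup>2)"
      by (subst norm_frame) (simp add: inner_diff_left)
    also have "\<dots> \<le> \<bar>a - x \<bullet> eu\<bar> + \<bar>- (x \<bullet> es)\<bar>" by (rule sqrt_sum_squares_le_sum_abs)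
    finally show ?thesis by (simp add: x_def algebra_simps)
  qed
  also have "\<dots> \<le> \<delta> / 2" using l1(2) l2(2) \<delta>_pos unfolding a_def x_def inner_add_left by linarith
  finally have n: "norm (a *\<^sub>R eu - r 2 - l1) \<le> \<delta> / 2" .
  have "bmp 2 (a *\<^sub>R eu) = \<psi> (norm (a *\<^sub>R eu - r 2 - l1))"
    by (rule bmp_eq[OF l1(1)]) (use n in \<open>simp add: \<delta>_def\<close>)
  then have b2: "bmp 2 (a *\<^sub>R eu) > 0" using n \<psi>_one[of "norm (a *\<^sub>R eu - r 2 - l1)"] by simp
  have "\<forall>\<^sub>F n in sequentially. \<bar>a\<bar> / \<sigma>1 ^ n < \<delta> / 4"
    by (rule order_tendstoD(2)[OF power_tendsto(1)]) (simp add: \<delta>_def)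
  then obtain m where m: "\<bar>a\<bar> / \<sigma>1 ^ m < \<delta> / 4" by (auto simp: eventually_sequentially)
  \<comment> \<open>Pulling back by m steps moves the crossing into the local unstable segment of
    the origin. The new point lies on the stable line of l and is near q1 at time m.\<close>
  define l where "l = hyp (1 / \<sigma>1 ^ m) l2"
  have l: "l \<in> int_lattice" unfolding l_def by (rule hyp_lattice_pow(3)[OF l2(1)])
  have leu: "l \<bullet> eu = a / \<sigma>1 ^ m" by (simp add: l_def a_def)
  let ?p = "((l \<bullet> eu) *\<^sub>R eu, 0 :: real)"
  have range: "0 \<le> snd ((base_map ^^ n) ?p) \<and> snd ((base_map ^^ n) ?p) < 1" for n
    by (induction n) (use base_map_interval in auto)
  have "fst ((base_map ^^ m) ?p) = a *\<^sub>R eu"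
    unfolding fst_base_map leu by (rule frame_eqI) (simp_all add: s1_gt)
  then have pos: "0 < snd ((base_map ^^ Suc m) ?p)"
    using base_map_interval(3)[of "(base_map ^^ m) ?p"] range[of m] b2 by simp
  have pos': "0 < snd ((base_map ^^ (n + Suc m)) ?p)" for n
  proof (induction n)
    case (Suc n)
    then show ?case using base_map_interval(3)[of "(base_map ^^ (n + Suc m)) ?p"] range[of "n + Suc m"] by simp
  qed (use pos in simp)
  \<comment> \<open>The summand 1 reserves room for the stable displacement with which a disk will
    later shadow this orbit.\<close>
  have "\<forall>\<^sub>F n in sequentially. (\<bar>l \<bullet> es\<bar> + 1) / \<sigma>1 ^ n < \<delta> / 4"
    by (rule order_tendstoD(2)[OF power_tendsto(1)]) (simp add: \<delta>_def)
  then obtain n0' where n0': "\<And>n. n \<ge> n0' \<Longrightarrow> (\<bar>l \<bullet> es\<bar> + 1) / \<sigma>1 ^ n < \<delta> / 4" by (auto simp: eventually_sequentially)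
  show thesis
  proof (rule that[OF l])
    show "\<bar>l \<bullet> eu\<bar> \<le> \<delta> / 4" using m s1_gt by (simp add: leu abs_divide)
    show "(\<bar>l \<bullet> es\<bar> + 1) / \<sigma>1 ^ (n0' + Suc m) \<le> \<delta> / 4" using n0'[of "n0' + Suc m"] by simp
    show "0 < snd ((base_map ^^ (n0' + Suc m)) ?p)" by (rule pos')
    show "snd ((base_map ^^ (n0' + Suc m)) ?p) < 1" using range by blast
  qed
qed

lemma \<phi>_Lipschitz: "\<bar>\<phi> s - \<phi> t\<bar> \<le> max_dQ \<psi> \<phi> * \<bar>s - t\<bar>"
proof -
  have "norm (\<phi> s - \<phi> t) \<le> max_dQ \<psi> \<phi> * norm (s - t)"
  proof (rule field_differentiable_bound[where S=UNIV and f'="deriv \<phi>"])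
    show "norm (deriv \<phi> z) \<le> max_dQ \<psi> \<phi>" for z
      using deriv_\<phi>_bounds[of z] dQ_bounds(3) by simp
  qed (use DERIV_\<phi> in auto)
  then show ?thesis by simp
qed

text \<open>The unstable displacement a / \<sigma>1 ^ m is scaled so that for m steps the point
  stays within \<delta> / 2 of a lattice point, where the base map is a product. The passage ends at
  unstable displacement a.\<close>

lemma base_map_saddle:
  assumes l: "l \<in> int_lattice" and a: "\<bar>a\<bar> \<le> \<delta> / 4" and b: "\<bar>b\<bar> \<le> \<delta> / 4" and jm: "j \<le> m"
  shows "(base_map ^^ j) (l + (a / \<sigma>1 ^ m) *\<^sub>R eu + b *\<^sub>R es, y) =
    (hyp (\<sigma>1 ^ j) l + (a * \<sigma>1 ^ j / \<sigma>1 ^ m) *\<^sub>R eu + (b / \<sigma>1 ^ j) *\<^sub>R es, 1 + (\<phi> ^^ j) (y - 1))"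
  using jm
proof (induction j)
  case 0
  show ?case by (simp add: hyp_1)
next
  case (Suc j)
  let ?l = "hyp (\<sigma>1 ^ j) l" and ?a = "a * \<sigma>1 ^ j / \<sigma>1 ^ m" and ?b = "b / \<sigma>1 ^ j" and ?y = "1 + (\<phi> ^^ j) (y - 1)"
  have pos: "\<sigma>1 ^ i > 0" for i using s1_gt by simp
  have "\<bar>?a\<bar> \<le> \<bar>a\<bar>"
  proof -
    have "\<sigma>1 ^ j \<le> \<sigma>1 ^ m" using Suc.prems s1_gt(1) by (intro power_increasing) auto
    then have "\<bar>a\<bar> * \<sigma>1 ^ j \<le> \<bar>a\<bar> * \<sigma>1 ^ m" by (intro mult_left_mono) auto
    then show ?thesis using pos[of m] pos[of j] by (simp add: abs_mult pos_divide_le_eq)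
  qed
  moreover have "\<bar>?b\<bar> \<le> \<bar>b\<bar>" by (rule div_s1_pow_le)
  moreover have "norm (?a *\<^sub>R eu + ?b *\<^sub>R es) \<le> \<bar>?a\<bar> + \<bar>?b\<bar>"
    using norm_triangle_ineq[of "?a *\<^sub>R eu" "?b *\<^sub>R es"] by simp
  ultimately have "norm (?l + ?a *\<^sub>R eu + ?b *\<^sub>R es - ?l) \<le> \<delta> / 2" using a b by (simp add: add.assoc)
  then have "Uc (?l + ?a *\<^sub>R eu + ?b *\<^sub>R es, ?y, 0) = 1 + \<phi> (?y - 1) - ?y"
    using near_q2(1)[OF hyp_lattice_pow(1)[OF l, of j], of "(?l + ?a *\<^sub>R eu + ?b *\<^sub>R es, ?y, 0)"] by simp
  then have "base_map (?l + ?a *\<^sub>R eu + ?b *\<^sub>R es, ?y) = (hyp \<sigma>1 (?l + ?a *\<^sub>R eu + ?b *\<^sub>R es), 1 + (\<phi> ^^ Suc j) (y - 1))"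
    by (simp add: base_map_def)
  moreover have "hyp \<sigma>1 (?l + ?a *\<^sub>R eu + ?b *\<^sub>R es) =
      hyp (\<sigma>1 ^ Suc j) l + (a * \<sigma>1 ^ Suc j / \<sigma>1 ^ m) *\<^sub>R eu + (b / \<sigma>1 ^ Suc j) *\<^sub>R es"
    by (rule frame_eqI) (simp_all add: inner_add_left distrib_left add_divide_distrib mult.commute)
  ultimately show ?case using Suc by simp
qed

end

section \<open>The skeleton of the perturbed map\<close>

text \<open>A functional c with c (L u) = t * c u is an eigenvector of the transpose. Applied to
  both parts of a complex eigenvector it yields (t - Re \<mu>)^2 + (Im \<mu>)^2 = 0, unless c kills
  both of them.\<close>

lemma complex_eigenvalue_coordinate:
  assumes "complex_eigenvalue L \<mu>"
  obtains v w where "(v, w) \<noteq> (0, 0)"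
    "\<And>c t. linear c \<Longrightarrow> (\<And>u. c (L u) = t * c u) \<Longrightarrow> c v \<noteq> 0 \<or> c w \<noteq> (0::real) \<Longrightarrow> \<mu> = complex_of_real t"
proof -
  obtain v w where vw: "(v, w) \<noteq> (0, 0)" and L: "L v = Re \<mu> *\<^sub>R v - Im \<mu> *\<^sub>R w" "L w = Im \<mu> *\<^sub>R v + Re \<mu> *\<^sub>R w"
    using assms by (auto simp: complex_eigenvalue_def)
  have "\<mu> = complex_of_real t"
    if c: "linear c" and t: "\<And>u. c (L u) = t * c u" and nz: "c v \<noteq> 0 \<or> c w \<noteq> 0" for c and t :: real
  proof -
    have 1: "t * c v = Re \<mu> * c v - Im \<mu> * c w"
      using t[of v] unfolding L by (simp add: linear_diff[OF c] linear_scale[OF c])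
    have 2: "t * c w = Im \<mu> * c v + Re \<mu> * c w"
      using t[of w] unfolding L by (simp add: linear_add[OF c] linear_scale[OF c])
    have "((t - Re \<mu>)\<^sup>2 + (Im \<mu>)\<^sup>2) * c v = 0" "((t - Re \<mu>)\<^sup>2 + (Im \<mu>)\<^sup>2) * c w = 0"
      using 1 2 by algebra+
    then have "(t - Re \<mu>)\<^sup>2 + (Im \<mu>)\<^sup>2 = 0" using nz by auto
    then have "t = Re \<mu>" "Im \<mu> = 0" by (auto simp: sum_power2_eq_zero_iff)
    then show ?thesis by (simp add: complex_eq_iff)
  qed
  with vw that show thesis by blast
qed

context perturbed_model
begin

section \<open>Hyperbolicity and stable index of the fixed point\<close>

definition stab :: "cover set" where "stab = {v. cA v = 0 \<and> cD v = 0}"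

lemma subspace_stab: "subspace stab"
  by (rule subspaceI) (simp_all add: stab_def)

lemma DU_tp: "DU tp v = - (cC v / 2)"
proof -
  have f: "((\<lambda>w. fst (snd w) - 1) has_derivative (\<lambda>v. fst (snd v))) (at tp)"
    by (auto intro!: derivative_eq_intros)
  have y: "fst (snd tp) - 1 = 0" by (simp add: mk_def)
  have "(\<phi> has_derivative (*) (1 / 2)) (at (fst (snd tp) - 1))"
    unfolding y using DERIV_\<phi>[of 0] by (simp add: has_field_derivative_def deriv_\<phi>_values)
  from has_derivative_compose[OF f this]
  have "((\<lambda>w. 1 + \<phi> (fst (snd w) - 1) - fst (snd w)) has_derivative (\<lambda>v. 0 + 1 / 2 * fst (snd v) - fst (snd v))) (at tp)"
    by (intro has_derivative_diff has_derivative_add has_derivative_const has_derivative_fst has_derivative_snd has_derivative_ident)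
  then have "(Uc has_derivative (\<lambda>v. 0 + 1 / 2 * fst (snd v) - fst (snd v))) (at tp)"
  proof (rule has_derivative_transform_within_open)
    show "open {w::cover. norm (fst w) < \<delta> / 2}" by (intro open_Collect_less continuous_intros)
    show "tp \<in> {w::cover. norm (fst w) < \<delta> / 2}" using \<delta>_pos by (simp add: mk_def)
  qed (use near_q2(1)[OF int_lattice_zero] in simp)
  from fun_cong[OF frechet_derivative_at[OF this], of v] show ?thesis by (simp add: cC_def)
qed

lemma tangent_tp: 
  "tangent_map g (pr tp) v = mk (\<sigma>1 * cA v) (cB v / \<sigma>1) (cC v / 2) (\<sigma>0 * cD v) (cE v / \<sigma>0)"
  using on_leaf_DR[OF on_leaf_top] by (simp add: tangent_map_pr DG_eq DU_tp)

lemma tangent_tp_pow: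
  "(tangent_map g (pr tp) ^^ m) v = mk (\<sigma>1 ^ m * cA v) (cB v / \<sigma>1 ^ m) (cC v / 2 ^ m) (\<sigma>0 ^ m * cD v) (cE v / \<sigma>0 ^ m)"
  by (induction m) (simp_all add: mk_coords tangent_tp mult_ac)

lemma linear_coords: "linear cA" "linear cB" "linear cC" "linear cD" "linear cE"
  by (rule linearI; simp)+

lemma hyperbolic_tp: "hyperbolic_periodic g (pr tp) 1"
  unfolding hyperbolic_periodic_def
proof (intro conjI allI impI)
  show "(g ^^ 1) (pr tp) = pr tp" by (rule g_top)
  fix \<mu> assume "complex_eigenvalue (tangent_map (g ^^ 1) (pr tp)) \<mu>"
  then have "complex_eigenvalue (tangent_map g (pr tp)) \<mu>" by simp
  then obtain v w where vw: "(v, w) \<noteq> (0, 0)" and ev: "\<And>c t. linear c \<Longrightarrow> (\<And>u. c (tangent_map g (pr tp) u) = t * c u)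
      \<Longrightarrow> c v \<noteq> 0 \<or> c w \<noteq> (0::real) \<Longrightarrow> \<mu> = complex_of_real t"
    by (rule complex_eigenvalue_coordinate) blast
  have s: "\<sigma>0 \<noteq> 1" "\<sigma>1 \<noteq> 1" "\<bar>\<sigma>0\<bar> = \<sigma>0" "\<bar>\<sigma>1\<bar> = \<sigma>1" using s0_gt s1_gt by auto
  have "v \<noteq> 0 \<or> w \<noteq> 0" using vw by auto
  then have "(cA v \<noteq> 0 \<or> cA w \<noteq> 0) \<or> (cB v \<noteq> 0 \<or> cB w \<noteq> 0) \<or> (cC v \<noteq> 0 \<or> cC w \<noteq> 0) \<or>
      (cD v \<noteq> 0 \<or> cD w \<noteq> 0) \<or> (cE v \<noteq> 0 \<or> cE w \<noteq> 0)"
    using coord_eqI[of v 0] coord_eqI[of w 0] by auto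
  moreover have "cA v \<noteq> 0 \<or> cA w \<noteq> 0 \<Longrightarrow> \<mu> = complex_of_real \<sigma>1"
    by (rule ev[OF linear_coords(1)]) (simp_all add: tangent_tp)
  moreover have "cB v \<noteq> 0 \<or> cB w \<noteq> 0 \<Longrightarrow> \<mu> = complex_of_real (1 / \<sigma>1)"
    by (rule ev[OF linear_coords(2)]) (simp_all add: tangent_tp)
  moreover have "cC v \<noteq> 0 \<or> cC w \<noteq> 0 \<Longrightarrow> \<mu> = complex_of_real (1 / 2)"
    by (rule ev[OF linear_coords(3)]) (simp_all add: tangent_tp)
  moreover have "cD v \<noteq> 0 \<or> cD w \<noteq> 0 \<Longrightarrow> \<mu> = complex_of_real \<sigma>0"
    by (rule ev[OF linear_coords(4)]) (simp_all add: tangent_tp)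
  moreover have "cE v \<noteq> 0 \<or> cE w \<noteq> 0 \<Longrightarrow> \<mu> = complex_of_real (1 / \<sigma>0)"
    by (rule ev[OF linear_coords(5)]) (simp_all add: tangent_tp)
  ultimately have "\<mu> = complex_of_real \<sigma>1 \<or> \<mu> = complex_of_real (1 / \<sigma>1) \<or> \<mu> = complex_of_real (1 / 2) \<or>
      \<mu> = complex_of_real \<sigma>0 \<or> \<mu> = complex_of_real (1 / \<sigma>0)"
    by blast
  then show "norm \<mu> \<noteq> 1" using s by (elim disjE) (simp_all only: norm_of_real, auto simp: abs_divide)
qed simp

lemma stable_index_tp: "stable_index g (pr tp) 1 = dim stab"
proof -
  have "(\<lambda>m. (tangent_map g (pr tp) ^^ m) v) \<longlonglongrightarrow> 0 \<longleftrightarrow> v \<in> stab" for v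
  proof
    assume lim: "(\<lambda>m. (tangent_map g (pr tp) ^^ m) v) \<longlonglongrightarrow> 0"
    have zero: "x = 0" if "t \<ge> 10000" "(\<lambda>m. t ^ m * x) \<longlonglongrightarrow> 0" for t x :: real
    proof -
      have "\<bar>x\<bar> \<le> \<bar>t ^ m * x\<bar>" for m
      proof -
        have "1 \<le> t ^ m" by (rule one_le_power) (use that(1) in linarith)
        then have "1 * \<bar>x\<bar> \<le> t ^ m * \<bar>x\<bar>" by (intro mult_right_mono) auto
        then show ?thesis using that(1) by (simp add: abs_mult)
      qed
      moreover have "(\<lambda>m. \<bar>t ^ m * x\<bar>) \<longlonglongrightarrow> 0" using tendsto_rabs[OF that(2)] by simp
      ultimately have "\<bar>x\<bar> \<le> 0" by (intro LIMSEQ_le_const) auto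
      then show ?thesis by simp
    qed
    have "(\<lambda>m. cA ((tangent_map g (pr tp) ^^ m) v)) \<longlonglongrightarrow> cA 0" "(\<lambda>m. cD ((tangent_map g (pr tp) ^^ m) v)) \<longlonglongrightarrow> cD 0"
      by (intro bounded_linear.tendsto[OF bounded_linear_coords(1)] bounded_linear.tendsto[OF bounded_linear_coords(4)] lim)+
    then show "v \<in> stab" using zero[of \<sigma>1 "cA v"] zero[of \<sigma>0 "cD v"] s1_gt s0_gt
      by (simp add: tangent_tp_pow stab_def)
  next
    assume "v \<in> stab"
    then have eq: "(\<lambda>m. (tangent_map g (pr tp) ^^ m) v) = (\<lambda>m. mk 0 (cB v / \<sigma>1 ^ m) (cC v / 2 ^ m) 0 (cE v / \<sigma>0 ^ m))"
      by (auto simp: stab_def tangent_tp_pow)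
    have lim: "(\<lambda>m. cC v * (1 / 2) ^ m) \<longlonglongrightarrow> cC v * 0"
      by (intro tendsto_mult tendsto_const LIMSEQ_power_zero) auto
    have pw: "cC v * (1 / 2) ^ m = cC v / 2 ^ m" for m by (simp add: power_one_over)
    have "(\<lambda>m. cC v / 2 ^ m) \<longlonglongrightarrow> 0" using lim unfolding pw mult_zero_right .
    then have "(\<lambda>m. mk 0 (cB v / \<sigma>1 ^ m) (cC v / 2 ^ m) 0 (cE v / \<sigma>0 ^ m)) \<longlonglongrightarrow> mk 0 0 0 0 0"
      unfolding mk_def using \<open>(\<lambda>m. cC v / 2 ^ m) \<longlonglongrightarrow> 0\<close>
      by (intro tendsto_Pair tendsto_add tendsto_scaleR tendsto_const power_tendsto)
    moreover have "mk 0 0 0 0 0 = 0" by (rule coord_eqI) simp_all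
    ultimately show "(\<lambda>m. (tangent_map g (pr tp) ^^ m) v) \<longlonglongrightarrow> 0" unfolding eq by simp
  qed
  then show ?thesis by (simp add: stable_index_def)
qed

lemma linear_DGn: "linear (frechet_derivative (G ^^ n) (at w))" and linear_DHn: "linear (frechet_derivative (H ^^ n) (at w))"
  using smooth_has_derivative[OF smooth_Gn] smooth_has_derivative[OF smooth_Hn]
    has_derivative_bounded_linear bounded_linear.linear by blast+

section \<open>Stable disks and the bundle E^cs\<close>

context
  fixes Ecs :: subbundle
  assumes Ecs_cA: "\<And>x v. v \<in> Ecs x \<Longrightarrow> cA v = 0"
    and Ecs_leaf: "\<And>w. on_leaf w \<Longrightarrow> Ecs (pr w) = stab"
    and Ecs_inv: "invariant_bundle g Ecs"
begin

lemma Ecs_funpow: "tangent_map (g ^^ n) x ` Ecs x = Ecs ((g ^^ n) x)"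
proof (induction n)
  case 0
  show ?case unfolding tangent_map_0 by simp
next
  case (Suc n)
  have "tangent_map (g ^^ Suc n) x ` Ecs x = tangent_map g ((g ^^ n) x) ` (tangent_map (g ^^ n) x ` Ecs x)"
    unfolding tangent_map_Suc by (rule image_comp[symmetric])
  also have "\<dots> = Ecs (g ((g ^^ n) x))" unfolding Suc using Ecs_inv unfolding invariant_bundle_def by blast
  also have "\<dots> = Ecs ((g ^^ Suc n) x)" by simp
  finally show ?case .
qed

text \<open>Over the leaves the bundle is known, and invariance transports this back along the
  orbit.\<close>

lemma Ecs_pullback:
  assumes "on_leaf ((G ^^ n) w)"
  shows "Ecs (pr w) = frechet_derivative (H ^^ n) (at ((G ^^ n) w)) ` stab"
proof -
  have "frechet_derivative (G ^^ n) (at w) ` Ecs (pr w) = stab"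
    using Ecs_funpow[of n "pr w"] Ecs_leaf[OF assms] by (simp only: tangent_map_funpow_pr funpow_pr)
  then have "frechet_derivative (H ^^ n) (at ((G ^^ n) w)) ` stab =
      (\<lambda>v. frechet_derivative (H ^^ n) (at ((G ^^ n) w)) (frechet_derivative (G ^^ n) (at w) v)) ` Ecs (pr w)"
    by (metis image_image)
  then show ?thesis by (simp add: DGn_inverse(1))
qed

lemma inj_funpow: "(g ^^ n) x = (g ^^ n) y \<Longrightarrow> x = y"
proof (induction n)
  case (Suc n)
  then show ?case using bij_g by (auto simp: bij_def dest: injD)
qed simp

text \<open>The plaque of radius \<delta> / 4 in \<open>stab\<close> around \<open>tp\<close>
  consists of stable points over a leaf. Pulled back by \<open>H ^^ M\<close> it becomes a disk in
  the stable set through h v, whose tangent space is E^cs by \<open>Ecs_pullback\<close>. Hence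
  transversality to E^cs is transversality to the stable set.\<close>

lemma stable_point_meets:
  assumes disk: "disk_transverse V h h' Ecs" and v: "v \<in> V \<inter> cball 0 1"
    and hv: "h v = pr w" and stable_point: "stable_point ((G ^^ N) w)"
  shows "meets_transversely V h h' (dim stab) (Ws g (pr tp))"
proof -
  define s where "s = \<delta> / 4"
  have s: "s > 0" using \<delta>_pos by (simp add: s_def)
  obtain b t e where t: "\<bar>t\<bar> < 1" and
    it: "\<And>n. \<exists>l\<in>cover_lattice. (G ^^ n) ((G ^^ N) w) = l + (tp + mk 0 (b / \<sigma>1 ^ n) ((\<phi> ^^ n) t) 0 (e / \<sigma>0 ^ n))"
    using stable_point_iterates[OF stable_point] by metis
  have "\<forall>\<^sub>F n in sequentially. dist (mk 0 (b / \<sigma>1 ^ n) ((\<phi> ^^ n) t) 0 (e / \<sigma>0 ^ n)) 0 < s"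
    using stable_coords_tendsto[OF t] s by (rule tendstoD)
  then obtain n where n: "norm (mk 0 (b / \<sigma>1 ^ n) ((\<phi> ^^ n) t) 0 (e / \<sigma>0 ^ n)) < s"
    by (auto simp: eventually_sequentially)
  define \<xi> where "\<xi> = mk 0 (b / \<sigma>1 ^ n) ((\<phi> ^^ n) t) 0 (e / \<sigma>0 ^ n)"
  have \<xi>: "\<xi> \<in> stab" "norm \<xi> < s" using n by (simp_all add: \<xi>_def stab_def)
  define M where "M = n + N"
  obtain l where l: "l \<in> cover_lattice" "(G ^^ M) w = l + (tp + \<xi>)"
    using it[of n] unfolding M_def funpow_add \<xi>_def by auto
  define \<kappa> where "\<kappa> = (\<lambda>\<zeta>. pr ((H ^^ M) (tp + s *\<^sub>R \<zeta>)))"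
  define \<kappa>' where "\<kappa>' = (\<lambda>\<zeta> v. frechet_derivative (H ^^ M) (at (tp + s *\<^sub>R \<zeta>)) (s *\<^sub>R v))"
  let ?S = "stab \<inter> cball 0 1"
  have gk: "(g ^^ M) (\<kappa> \<zeta>) = pr (tp + s *\<^sub>R \<zeta>)" for \<zeta> by (simp add: \<kappa>_def funpow_pr GHn)
  have in_good: "stable_point (tp + s *\<^sub>R \<zeta>)" "on_leaf (tp + s *\<^sub>R \<zeta>)" if "\<zeta> \<in> ?S" for \<zeta>
  proof -
    have "norm (s *\<^sub>R \<zeta>) \<le> \<delta> / 4" using that s mult_left_mono[of "norm \<zeta>" 1 s] by (simp add: s_def)
    then show "stable_point (tp + s *\<^sub>R \<zeta>)" "on_leaf (tp + s *\<^sub>R \<zeta>)"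
      using stable_point_near_top[of "s *\<^sub>R \<zeta>"] that by (auto simp: stab_def)
  qed
  have deriv: "((\<lambda>\<zeta>. (H ^^ M) (tp + s *\<^sub>R \<zeta>)) has_derivative \<kappa>' \<zeta>) (at \<zeta>)" for \<zeta>
  proof -
    have "((\<lambda>\<zeta>. tp + s *\<^sub>R \<zeta>) has_derivative (\<lambda>v. s *\<^sub>R v)) (at \<zeta>)"
      by (auto intro!: derivative_eq_intros)
    from has_derivative_compose[OF this smooth_has_derivative[OF smooth_Hn]] show ?thesis by (simp add: \<kappa>'_def)
  qed
  have D_inj: "v = v'" if "\<kappa>' \<zeta> v = \<kappa>' \<zeta> v'" for \<zeta> v v'
  proof -
    have "s *\<^sub>R v = s *\<^sub>R v'"
      using that DGn_inverse(2)[of M "(H ^^ M) (tp + s *\<^sub>R \<zeta>)"] unfolding \<kappa>'_def GHn by metis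
    then show ?thesis using s by simp
  qed
  have disk': "C1_disk stab \<kappa> \<kappa>'"
    unfolding C1_disk_def
  proof (intro conjI ballI)
    show "subspace stab" by (rule subspace_stab)
    \<comment> \<open>The plaque has diameter at most 2 s < 1, so no two of its points differ by a
      nonzero lattice vector.\<close>
    show "inj_on \<kappa> ?S"
    proof (rule inj_onI)
      fix \<zeta> \<zeta>' assume \<zeta>: "\<zeta> \<in> ?S" "\<zeta>' \<in> ?S" and "\<kappa> \<zeta> = \<kappa> \<zeta>'"
      then have "pr (tp + s *\<^sub>R \<zeta>) = pr (tp + s *\<^sub>R \<zeta>')" using gk by metis
      then have L: "s *\<^sub>R (\<zeta> - \<zeta>') \<in> cover_lattice" by (simp add: pr_eq_iff scaleR_diff_right)
      have "norm (\<zeta> - \<zeta>') \<le> 2" using \<zeta> norm_triangle_ineq4[of \<zeta> \<zeta>'] by simp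
      then have "norm (s *\<^sub>R (\<zeta> - \<zeta>')) \<le> s * 2" using s by (simp add: mult_left_mono)
      also have "\<dots> < 1" by (simp add: s_def \<delta>_def)
      finally have "s *\<^sub>R (\<zeta> - \<zeta>') = 0" using norm_cover_lattice_ge[OF L] by fastforce
      then show "\<zeta> = \<zeta>'" using s by simp
    qed
    fix \<zeta> assume "\<zeta> \<in> ?S"
    show "has_lift_derivative \<kappa> (\<kappa>' \<zeta>) \<zeta> ?S"
      unfolding has_lift_derivative_def
    proof (intro exI conjI)
      show "((\<lambda>\<zeta>. Q + (H ^^ M) (tp + s *\<^sub>R \<zeta>)) has_derivative \<kappa>' \<zeta>) (at \<zeta> within ?S)"
        using has_derivative_add[OF has_derivative_const[of Q] has_derivative_at_withinI[OF deriv]] by simp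
    qed (simp_all add: \<kappa>_def pr_def)
    show "inj_on (\<kappa>' \<zeta>) stab" using D_inj by (intro inj_onI)
  next
    fix v
    show "continuous_on ?S (\<lambda>\<zeta>. \<kappa>' \<zeta> v)" unfolding \<kappa>'_def
      by (intro continuous_on_compose2[OF smooth_continuous_on[OF smooth_frechet_derivative[OF smooth_Hn], of UNIV]] continuous_intros) auto
  qed
  have sub: "\<kappa> ` ?S \<subseteq> Ws g (pr tp)"
    using stable_point_Ws[OF in_good(1)] Ws_top_funpow[of M] gk by (metis image_subsetI)
  define \<zeta> where "\<zeta> = (1 / s) *\<^sub>R \<xi>"
  have \<zeta>: "\<zeta> \<in> ?S" "s *\<^sub>R \<zeta> = \<xi>"
    using \<xi> s subspace_scale[OF subspace_stab \<xi>(1), of "1 / s"] by (auto simp: \<zeta>_def)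
  have hk: "h v = \<kappa> \<zeta>"
  proof (rule inj_funpow[of M])
    have "(g ^^ M) (h v) = pr (tp + \<xi>)"
      unfolding hv funpow_pr l(2) using pr_add[OF l(1), of "tp + \<xi>"] by (simp add: add.commute)
    then show "(g ^^ M) (h v) = (g ^^ M) (\<kappa> \<zeta>)" by (simp add: gk \<zeta>(2))
  qed
  have "\<kappa>' \<zeta> ` stab = frechet_derivative (H ^^ M) (at (tp + \<xi>)) ` ((\<lambda>v. s *\<^sub>R v) ` stab)"
    by (simp add: \<kappa>'_def \<zeta>(2) image_image)
  also have "(\<lambda>v. s *\<^sub>R v) ` stab = stab"
  proof
    show "(\<lambda>v. s *\<^sub>R v) ` stab \<subseteq> stab" using subspace_scale[OF subspace_stab] by blast
    show "stab \<subseteq> (\<lambda>v. s *\<^sub>R v) ` stab"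
    proof
      fix u assume "u \<in> stab"
      then have "(1 / s) *\<^sub>R u \<in> stab" by (rule subspace_scale[OF subspace_stab])
      then show "u \<in> (\<lambda>v. s *\<^sub>R v) ` stab" using s by (intro image_eqI[of _ _ "(1 / s) *\<^sub>R u"]) auto
    qed
  qed
  also have "frechet_derivative (H ^^ M) (at (tp + \<xi>)) ` stab = Ecs (pr ((H ^^ M) (tp + \<xi>)))"
    using Ecs_pullback[of M "(H ^^ M) (tp + \<xi>)"] in_good(2)[OF \<zeta>(1)] by (simp add: GHn \<zeta>(2))
  also have "pr ((H ^^ M) (tp + \<xi>)) = h v" unfolding hk by (simp add: \<kappa>_def \<zeta>(2))
  finally have "subspace_sum (h' v ` V) (\<kappa>' \<zeta> ` stab) = UNIV"
    using disk v by (simp add: disk_transverse_def)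
  then show ?thesis
    unfolding meets_transversely_def using disk' sub v \<zeta>(1) hk by blast
qed

section \<open>Disks transverse to E^cs\<close>

context
  fixes V :: "cover set" and h :: "cover \<Rightarrow> mfd" and h' :: "cover \<Rightarrow> cover \<Rightarrow> cover" and \<rho> :: real and D :: "cover \<Rightarrow> cover"
  assumes disk: "C1_disk V h h'" and transverse: "disk_transverse V h h' Ecs"
    and \<rho>: "\<rho> > 0" "\<rho> < 1" and D_lift: "\<And>v. v \<in> V \<Longrightarrow> norm v < \<rho> \<Longrightarrow> pr (D v) = h v"
    and D_deriv: "\<And>v. v \<in> V \<Longrightarrow> norm v < \<rho> \<Longrightarrow> (D has_derivative h' v) (at v within V \<inter> cball 0 1)"
begin

lemma subspace_V: "subspace V" using disk by (simp add: C1_disk_def)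

text \<open>The derivative of D is relative to V only. Composition with a linear family in V gives
  an ordinary derivative in the parameters, to which the usual local theorems apply.\<close>

lemma D_along:
  fixes L :: "'a::euclidean_space \<Rightarrow> cover"
  assumes v: "v \<in> V" and L: "bounded_linear L" "\<And>t. L t \<in> V" and n: "norm (v + L t0) < \<rho>"
  shows "((\<lambda>t. D (v + L t)) has_derivative (\<lambda>s. h' (v + L t0) (L s))) (at t0)"
proof -
  define W where "W = {t. norm (v + L t) < \<rho>}"
  have W: "open W" unfolding W_def
    by (intro open_Collect_less continuous_intros bounded_linear.continuous_on[OF L(1)])
  have t0: "t0 \<in> W" using n by (simp add: W_def)
  have inV: "v + L t \<in> V" for t using subspace_add[OF subspace_V v L(2)] .
  have sub: "(\<lambda>t. v + L t) ` W \<subseteq> V \<inter> cball 0 1" using inV \<rho>(2) by (auto simp: W_def)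
  have 1: "((\<lambda>t. v + L t) has_derivative L) (at t0 within W)"
    using has_derivative_add[OF has_derivative_const bounded_linear_imp_has_derivative[OF L(1)]] by simp
  have 2: "(D has_derivative h' (v + L t0)) (at (v + L t0) within (\<lambda>t. v + L t) ` W)"
    using D_deriv[OF inV n] sub by (rule has_derivative_subset)
  have "((\<lambda>t. D (v + L t)) has_derivative (\<lambda>s. h' (v + L t0) (L s))) (at t0 within W)"
    by (rule has_derivative_in_compose[OF 1 2])
  then show ?thesis using at_within_open[OF t0 W] by simp
qed

lemma transverse_split:
  assumes "v \<in> V" "norm v < \<rho>"
  obtains e c where "e \<in> V" "c \<in> Ecs (h v)" "u = h' v e + c"
proof -
  have "u \<in> subspace_sum (h' v ` V) (Ecs (h v))"
    using transverse assms \<rho>(2) by (simp add: disk_transverse_def)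
  then obtain a c where "u = a + c" "a \<in> h' v ` V" "c \<in> Ecs (h v)" unfolding subspace_sum_def by blast
  then show thesis using that by blast
qed

text \<open>Lying in the stable set imposes conditions on cA and cD. Over a leaf E^cs is the common
  kernel of these two, so by transversality a two-parameter family in the disk moves the pair in all
  directions. It can then be given the values l \<bullet> eu and l' \<bullet> eu, with l' supplied
  by \<open>lattice_dense\<close>.\<close>

lemma hits_leaf_meets:
  assumes v: "v \<in> V" "norm v < \<rho>" and l: "l \<in> int_lattice" and b: "\<bar>b\<bar> < \<delta> / 4"
    and leaf: "fst ((G ^^ N) (D v)) = l + b *\<^sub>R es" and y: "fst (snd ((G ^^ N) (D v))) \<notin> even_lattice"
  shows "meets_transversely V h h' (dim stab) (Ws g (pr tp))"
proof -
  let ?DN = "frechet_derivative (G ^^ N) (at (D v))"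
  have on: "on_leaf ((G ^^ N) (D v))" unfolding on_leaf_def leaf using l less_imp_le[OF b] by blast
  have "?DN ` Ecs (h v) = stab"
    using Ecs_funpow[of N "pr (D v)"] unfolding funpow_pr Ecs_leaf[OF on] tangent_map_funpow_pr
    unfolding D_lift[OF v] .
  then have Ecs_img: "?DN c \<in> stab" if "c \<in> Ecs (h v)" for c using that by (metis imageI)
  \<comment> \<open>Pull the wanted vector back, split it along the disk and E^cs, and push it
    forward again: the E^cs part lands in \<open>stab\<close> and does not change cA and cD.\<close>
  have ex: "\<exists>e\<in>V. cA (?DN (h' v e)) = p \<and> cD (?DN (h' v e)) = q" for p q
  proof -
    let ?u = "frechet_derivative (H ^^ N) (at ((G ^^ N) (D v))) (mk p 0 0 q 0)"
    obtain e c where e: "e \<in> V" and c: "c \<in> Ecs (h v)" and u: "?u = h' v e + c"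
      using transverse_split[OF v, of ?u] by metis
    have "mk p 0 0 q 0 = ?DN (h' v e) + ?DN c"
      using DGn_inverse(2)[of N "D v" "mk p 0 0 q 0"] unfolding u by (simp only: linear_add[OF linear_DGn])
    then have E: "?DN (h' v e) = mk p 0 0 q 0 - ?DN c" by (simp add: algebra_simps)
    have "cA (?DN (h' v e)) = p \<and> cD (?DN (h' v e)) = q"
      unfolding E using Ecs_img[OF c] by (simp add: stab_def)
    with e show ?thesis by blast
  qed
  obtain e1 where e1: "e1 \<in> V" "cA (?DN (h' v e1)) = 1" "cD (?DN (h' v e1)) = 0" using ex by blast
  obtain e2 where e2: "e2 \<in> V" "cA (?DN (h' v e2)) = 0" "cD (?DN (h' v e2)) = 1" using ex by blast
  define L where "L = (\<lambda>t::real \<times> real. fst t *\<^sub>R e1 + snd t *\<^sub>R e2)"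
  have L: "bounded_linear L" unfolding L_def
    by (intro bounded_linear_add bounded_linear_compose[OF bounded_linear_scaleR_left] bounded_linear_fst bounded_linear_snd)
  have LV: "L t \<in> V" for t unfolding L_def
    using e1(1) e2(1) by (intro subspace_add[OF subspace_V] subspace_scale[OF subspace_V])
  define F where "F = (\<lambda>t. (G ^^ N) (D (v + L t)))"
  define W where "W = {t. norm (v + L t) < \<rho>}"
  have W: "open W" unfolding W_def
    by (intro open_Collect_less continuous_intros bounded_linear.continuous_on[OF L])
  have F_deriv: "(F has_derivative (\<lambda>s. frechet_derivative (G ^^ N) (at (D (v + L t))) (h' (v + L t) (L s)))) (at t)"
    if "t \<in> W" for t
    unfolding F_def
    by (rule has_derivative_compose[OF D_along[OF v(1) L LV] smooth_has_derivative[OF smooth_Gn]])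
      (use that in \<open>simp add: W_def\<close>)
  have F_cont: "continuous_on W F"
    by (intro continuous_at_imp_continuous_on ballI has_derivative_continuous[OF F_deriv])
  \<comment> \<open>The conditions in \<open>stable_point\<close> that are open and must survive the
    small motion.\<close>
  define Op where "Op = {w. \<bar>cB w - l \<bullet> es\<bar> < \<delta> / 4} \<inter> cC -` (- even_lattice)"
  have "open Op" unfolding Op_def
    by (intro open_Int open_Collect_less continuous_intros linear_continuous_on bounded_linear_coords
        open_vimage open_Compl closed_even_lattice)
  then have S: "open (W \<inter> F -` Op)" using continuous_open_preimage[OF F_cont W] by blast
  have L0: "L 0 = 0" by (simp add: L_def)
  have F0: "F 0 = (G ^^ N) (D v)" by (simp add: F_def L0)
  have "cB (F 0) - l \<bullet> es = b" unfolding F0 cB_def leaf by (simp add: inner_add_left)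
  then have S0: "0 \<in> W \<inter> F -` Op" using v(2) b y by (simp add: W_def L0 Op_def cC_def F0)
  define \<Psi> where "\<Psi> = (\<lambda>t. (cA (F t), cD (F t)))"
  have "(\<Psi> has_derivative (\<lambda>s. (cA (?DN (h' v (L s))), cD (?DN (h' v (L s)))))) (at 0)"
    unfolding \<Psi>_def
    using F_deriv[of 0] S0
    by (intro has_derivative_Pair bounded_linear.has_derivative[OF bounded_linear_coords(1)]
        bounded_linear.has_derivative[OF bounded_linear_coords(4)]) (simp_all add: L0)
  moreover have "(cA (?DN (h' v (L s))), cD (?DN (h' v (L s)))) = s" for s
  proof -
    have h'lin: "linear (h' v)"
      using D_deriv[OF v] has_derivative_bounded_linear bounded_linear.linear by blast
    show ?thesis
      by (simp add: L_def linear_add[OF h'lin] linear_scale[OF h'lin] linear_add[OF linear_DGn]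
          linear_scale[OF linear_DGn] e1 e2)
  qed
  ultimately have \<Psi>': "(\<Psi> has_derivative id) (at 0)" by (simp add: id_def)
  have \<Psi>_cont: "continuous_on (W \<inter> F -` Op) \<Psi>"
    unfolding \<Psi>_def
    by (intro continuous_on_Pair bounded_linear.continuous_on[OF bounded_linear_coords(1)]
        bounded_linear.continuous_on[OF bounded_linear_coords(4)] continuous_on_subset[OF F_cont]) auto
  \<comment> \<open>This open mapping theorem asks for continuity and an invertible derivative at
    the single point 0.\<close>
  have "\<Psi> 0 \<in> interior (\<Psi> ` (W \<inter> F -` Op))"
    by (rule sussmann_open_mapping[OF S \<Psi>_cont S0 \<Psi>' bounded_linear_ident[folded id_def] _ subset_refl])
      (simp_all only: interior_open[OF S] S0 comp_id)
  then obtain \<eta> where \<eta>: "\<eta> > 0" "ball (\<Psi> 0) \<eta> \<subseteq> \<Psi> ` (W \<inter> F -` Op)" by (auto simp: mem_interior)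
  obtain l' where l': "l' \<in> int_lattice" "\<bar>l' \<bullet> eu - cD (F 0)\<bar> < \<eta>" using lattice_dense[of eu \<eta>] \<eta>(1) by blast
  have "cA (F 0) = l \<bullet> eu" unfolding F0 cA_def leaf by (simp add: inner_add_left)
  then have "(l \<bullet> eu, l' \<bullet> eu) \<in> ball (\<Psi> 0) \<eta>"
    using l'(2) by (simp add: \<Psi>_def dist_prod_def dist_real_def abs_minus_commute)
  then obtain t where t: "t \<in> W" "F t \<in> Op" "cA (F t) = l \<bullet> eu" "cD (F t) = l' \<bullet> eu"
    using \<eta>(2) by (auto simp: \<Psi>_def)
  have "fst (F t) = l + (cB (F t) - l \<bullet> es) *\<^sub>R es"
    using t(3) by (intro frame_eqI) (simp_all add: cA_def cB_def inner_add_left)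
  then have "stable_point (F t)"
    using t l l'(1) unfolding stable_point_def Op_def cC_def cD_def by (auto intro: less_imp_le)
  moreover have "v + L t \<in> V" using subspace_add[OF subspace_V v(1) LV] .
  moreover have "norm (v + L t) < \<rho>" using t(1) by (simp add: W_def)
  ultimately show ?thesis
    using stable_point_meets[OF transverse, of "v + L t" "D (v + L t)" N] D_lift \<rho>(2) by (simp add: F_def)
qed

text \<open>Iterates of the disk become long in the direction \<open>e\<^sup>u\<close>, so they reach points of the homoclinic
  orbit, which has left the repelling level by the time it returns.\<close>

lemma meets_skeleton: "meets_transversely V h h' (dim stab) (Ws g (pr tp))"
proof -
  \<comment> \<open>E^cs lies in cA = 0, so transversality provides a direction in the disk along
    which cA has derivative 1, and \<open>DERIV_hits_values\<close> applies.\<close>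
  have line: "\<exists>e\<in>V. \<exists>\<eta>0>0. \<forall>\<eta>. \<bar>\<eta>\<bar> < \<eta>0 \<longrightarrow> (\<exists>t. \<bar>t\<bar> \<le> 2 * \<bar>\<eta>\<bar> \<and> norm (v + t *\<^sub>R e) < \<rho> \<and> cA (D (v + t *\<^sub>R e)) = cA (D v) + \<eta>)
      \<and> ((\<lambda>t. D (v + t *\<^sub>R e)) has_derivative (\<lambda>s. h' v (s *\<^sub>R e))) (at 0)"
    if v: "v \<in> V" "norm v < \<rho>" for v
  proof -
    obtain e c where e: "e \<in> V" and c: "c \<in> Ecs (h v)" and u: "mk 1 0 0 0 0 = h' v e + c"
      using transverse_split[OF v] by metis
    have h1: "cA (h' v e) = 1" using arg_cong[OF u, of cA] Ecs_cA[OF c] by simp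
    have L: "bounded_linear (\<lambda>t. t *\<^sub>R e)" by (rule bounded_linear_scaleR_left)
    have LV: "t *\<^sub>R e \<in> V" for t :: real using subspace_scale[OF subspace_V e] .
    have d: "((\<lambda>t. D (v + t *\<^sub>R e)) has_derivative (\<lambda>s. h' (v + t0 *\<^sub>R e) (s *\<^sub>R e))) (at t0)"
      if "norm (v + t0 *\<^sub>R e) < \<rho>" for t0 by (rule D_along[OF v(1) L LV that])
    obtain d0 where d0: "d0 > 0" "\<And>t. \<bar>t\<bar> \<le> d0 \<Longrightarrow> norm (v + t *\<^sub>R e) < \<rho>"
    proof -
      define d0 where "d0 = (\<rho> - norm v) / (2 * (norm e + 1))"
      have p: "norm e + 1 > 0" by (simp add: add_nonneg_pos)
      have "d0 > 0" unfolding d0_def using v(2) p by (intro divide_pos_pos) auto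
      moreover have "norm (v + t *\<^sub>R e) < \<rho>" if "\<bar>t\<bar> \<le> d0" for t
      proof -
        have "norm (v + t *\<^sub>R e) \<le> norm v + \<bar>t\<bar> * norm e" using norm_triangle_ineq[of v "t *\<^sub>R e"] by simp
        moreover have "\<bar>t\<bar> * norm e \<le> (\<rho> - norm v) / 2"
        proof -
          have "\<bar>t\<bar> * norm e \<le> d0 * (norm e + 1)" using that \<open>d0 > 0\<close> by (intro mult_mono) auto
          also have "\<dots> = (\<rho> - norm v) / 2" unfolding d0_def using p by (simp add: field_simps)
          finally show ?thesis .
        qed
        moreover have "norm v + (\<rho> - norm v) / 2 < \<rho>" using v(2) by (simp add: field_simps)
        ultimately show ?thesis by linarith
      qed
      ultimately show thesis using that by blast
    qed
    let ?f = "\<lambda>t. cA (D (v + t *\<^sub>R e))"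
    have fd: "(?f has_derivative (\<lambda>s. cA (h' (v + t0 *\<^sub>R e) (s *\<^sub>R e)))) (at t0)" if "\<bar>t0\<bar> \<le> d0" for t0
      by (rule bounded_linear.has_derivative[OF bounded_linear_coords(1) d[OF d0(2)[OF that]]])
    have "continuous_on {-d0..d0} ?f"
      by (intro continuous_at_imp_continuous_on ballI has_derivative_continuous[OF fd]) auto
    moreover have "(?f has_real_derivative 1) (at 0)"
    proof -
      have h'lin: "linear (h' v)"
        using D_deriv[OF v] has_derivative_bounded_linear bounded_linear.linear by blast
      have "(\<lambda>s. cA (h' v (s *\<^sub>R e))) = (*) 1" using h1 by (auto simp: linear_scale[OF h'lin])
      then show ?thesis using fd[of 0] d0(1) by (simp add: has_field_derivative_def)
    qed
    ultimately obtain \<eta>0 where \<eta>0: "\<eta>0 > 0" "\<And>\<eta>. \<bar>\<eta>\<bar> < \<eta>0 \<Longrightarrow> \<exists>t. \<bar>t\<bar> \<le> 2 * \<bar>\<eta>\<bar> \<and> ?f t = ?f 0 + \<eta>"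
      using DERIV_hits_values[OF d0(1)] by blast
    have "\<exists>t. \<bar>t\<bar> \<le> 2 * \<bar>\<eta>\<bar> \<and> norm (v + t *\<^sub>R e) < \<rho> \<and> ?f t = cA (D v) + \<eta>" if "\<bar>\<eta>\<bar> < min \<eta>0 (d0 / 2)" for \<eta>
    proof -
      have 1: "\<bar>\<eta>\<bar> < \<eta>0" "2 * \<bar>\<eta>\<bar> \<le> d0" using that by auto
      obtain t where t: "\<bar>t\<bar> \<le> 2 * \<bar>\<eta>\<bar>" "?f t = ?f 0 + \<eta>" using \<eta>0(2)[OF 1(1)] by blast
      have "norm (v + t *\<^sub>R e) < \<rho>" using d0(2)[of t] t(1) 1(2) by linarith
      then show ?thesis using t by (intro exI[of _ t]) simp
    qed
    moreover have "min \<eta>0 (d0 / 2) > 0" using \<eta>0(1) d0(1) by simp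
    moreover have "((\<lambda>t. D (v + t *\<^sub>R e)) has_derivative (\<lambda>s. h' v (s *\<^sub>R e))) (at 0)"
      using d[of 0] v(2) by simp
    ultimately show ?thesis using e by blast
  qed
  \<comment> \<open>By density of the lattice an arbitrarily small motion puts the disk on the
    stable line of some lattice vector.\<close>
  obtain v l where v: "v \<in> V" "norm v < \<rho>" and l: "l \<in> int_lattice" "cA (D v) = l \<bullet> eu"
  proof -
    have 0: "0 \<in> V" "norm (0::cover) < \<rho>" using subspace_0[OF subspace_V] \<rho>(1) by auto
    obtain e \<eta>0 where e: "e \<in> V" "\<eta>0 > 0" and
      hit: "\<And>\<eta>. \<bar>\<eta>\<bar> < \<eta>0 \<Longrightarrow> \<exists>t. norm (0 + t *\<^sub>R e) < \<rho> \<and> cA (D (0 + t *\<^sub>R e)) = cA (D 0) + \<eta>"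
      using line[OF 0] by blast
    obtain l where l: "l \<in> int_lattice" "\<bar>l \<bullet> eu - cA (D 0)\<bar> < \<eta>0" using lattice_dense[of eu \<eta>0] e(2) by blast
    obtain t where "norm (0 + t *\<^sub>R e) < \<rho>" "cA (D (0 + t *\<^sub>R e)) = l \<bullet> eu" using hit[OF l(2)] by auto
    moreover have "0 + t *\<^sub>R e \<in> V" using subspace_scale[OF subspace_V e(1)] by simp
    ultimately show thesis using that l(1) by blast
  qed
  define b where "b = cB (D v) - l \<bullet> es"
  have fD: "fst (D v) = l + b *\<^sub>R es"
    using l(2) by (intro frame_eqI) (simp_all add: cA_def cB_def b_def inner_add_left)
  have "\<forall>\<^sub>F n in sequentially. \<bar>b\<bar> / \<sigma>1 ^ n < \<delta> / 8"
    by (rule order_tendstoD(2)[OF power_tendsto(1)]) (simp add: \<delta>_def)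
  then obtain N where N: "\<bar>b\<bar> / \<sigma>1 ^ N < \<delta> / 8" by (auto simp: eventually_sequentially)
  define lN where "lN = hyp (\<sigma>1 ^ N) l"
  have lN: "lN \<in> int_lattice" unfolding lN_def by (rule hyp_lattice_pow(1)[OF l(1)])
  define bN where "bN = b / \<sigma>1 ^ N"
  \<comment> \<open>Half of the allowed \<delta> / 4, so that the drift of the disk in the stable
    direction can use the other half.\<close>
  have bN: "\<bar>bN\<bar> < \<delta> / 8" using N s1_gt by (simp add: bN_def abs_divide)
  have fN: "fst ((G ^^ N) (D v)) = lN + bN *\<^sub>R es"
    unfolding fst_G_iter fD lN_def bN_def by (rule frame_eqI) (simp_all add: inner_add_left add_divide_distrib)
  define yN where "yN = fst (snd ((G ^^ N) (D v)))"
  show ?thesis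
  proof (cases "yN \<in> even_lattice")
    case False
    show ?thesis
      by (rule hits_leaf_meets[OF v lN _ fN]) (use False bN \<delta>_pos in \<open>simp_all add: yN_def\<close>)
  next
    case True
    \<comment> \<open>The disk meets the leaf exactly on the repelling level, so it is steered to
      the start of the homoclinic orbit instead.\<close>
    obtain ls M where ls: "ls \<in> int_lattice" "\<bar>ls \<bullet> eu\<bar> \<le> \<delta> / 4" "(\<bar>ls \<bullet> es\<bar> + 1) / \<sigma>1 ^ M \<le> \<delta> / 4"
      and yM: "0 < snd ((base_map ^^ M) ((ls \<bullet> eu) *\<^sub>R eu, 0))" "snd ((base_map ^^ M) ((ls \<bullet> eu) *\<^sub>R eu, 0)) < 1"
      by (rule homoclinic)
    define a where "a = ls \<bullet> eu"
    obtain e \<eta>0 where e: "e \<in> V" "\<eta>0 > 0" and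
      hit: "\<And>\<eta>. \<bar>\<eta>\<bar> < \<eta>0 \<Longrightarrow> \<exists>t. \<bar>t\<bar> \<le> 2 * \<bar>\<eta>\<bar> \<and> norm (v + t *\<^sub>R e) < \<rho> \<and> cA (D (v + t *\<^sub>R e)) = cA (D v) + \<eta>"
      and deriv: "((\<lambda>t. D (v + t *\<^sub>R e)) has_derivative (\<lambda>s. h' v (s *\<^sub>R e))) (at 0)"
      using line[OF v] by (metis abs_zero)
    define c where "c = (\<lambda>t. (G ^^ N) (D (v + t *\<^sub>R e)))"
    have c0: "c 0 = (G ^^ N) (D v)" by (simp add: c_def)
    have "(c has_derivative (\<lambda>s. frechet_derivative (G ^^ N) (at (D (v + 0 *\<^sub>R e))) (h' v (s *\<^sub>R e)))) (at 0)"
      unfolding c_def by (rule has_derivative_compose[OF deriv smooth_has_derivative[OF smooth_Gn]])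
    then have cd: "(c has_derivative (\<lambda>s. frechet_derivative (G ^^ N) (at (D v)) (h' v (s *\<^sub>R e)))) (at 0)" by simp
    \<comment> \<open>The remaining coordinates drift at most linearly in the disk
      parameter.\<close>
    have Lip: "\<exists>C\<ge>0. \<exists>d>0. \<forall>t. \<bar>t\<bar> < d \<longrightarrow> \<bar>p (c t) - p (c 0)\<bar> \<le> C * \<bar>t\<bar>" if "bounded_linear p" for p :: "cover \<Rightarrow> real"
    proof -
      have "((\<lambda>t. p (c t)) has_derivative (\<lambda>s. p (frechet_derivative (G ^^ N) (at (D v)) (h' v (s *\<^sub>R e))))) (at 0)"
        by (rule bounded_linear.has_derivative[OF that cd])
      then obtain q where q: "((\<lambda>t. p (c t)) has_derivative q) (at 0)" by blast
      then have "linear q" using has_derivative_bounded_linear bounded_linear.linear by blast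
      then have "q s = q 1 * s" for s using linear_scale[of q s 1] by simp
      then have "q = (*) (q 1)" by blast
      then obtain E where "((\<lambda>t. p (c t)) has_real_derivative E) (at 0)"
        using q unfolding has_field_derivative_def by metis
      from DERIV_local_Lipschitz[OF this] obtain d where "d > 0" "\<forall>t. \<bar>t\<bar> < d \<longrightarrow> \<bar>p (c t) - p (c 0)\<bar> \<le> (\<bar>E\<bar> + 1) * \<bar>t\<bar>"
        by blast
      then show ?thesis by (intro exI[of _ "\<bar>E\<bar> + 1"]) auto
    qed
    obtain CB dB where CB: "CB \<ge> 0" "dB > 0" "\<And>t. \<bar>t\<bar> < dB \<Longrightarrow> \<bar>cB (c t) - cB (c 0)\<bar> \<le> CB * \<bar>t\<bar>"
      using Lip[OF bounded_linear_coords(2)] by blast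
    obtain CC dC where CC: "CC \<ge> 0" "dC > 0" "\<And>t. \<bar>t\<bar> < dC \<Longrightarrow> \<bar>cC (c t) - cC (c 0)\<bar> \<le> CC * \<bar>t\<bar>"
      using Lip[OF bounded_linear_coords(3)] by blast
    have "isCont (\<lambda>p. snd ((base_map ^^ M) p)) (a *\<^sub>R eu, 0)"
      using continuous_on_snd[OF continuous_base_map[of M]] by (simp add: continuous_on_eq_continuous_at)
    then have lim: "((\<lambda>p. snd ((base_map ^^ M) p)) \<longlongrightarrow> snd ((base_map ^^ M) (a *\<^sub>R eu, 0))) (at (a *\<^sub>R eu, 0))"
      by (simp add: isCont_def)
    have "\<forall>\<^sub>F p in at (a *\<^sub>R eu, 0). 0 < snd ((base_map ^^ M) p) \<and> snd ((base_map ^^ M) p) < 1"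
      using order_tendstoD[OF lim] yM by (auto simp: a_def intro: eventually_conj)
    then obtain \<omega> where \<omega>: "\<omega> > 0" "\<And>p. dist p (a *\<^sub>R eu, 0) < \<omega> \<Longrightarrow> 0 < snd ((base_map ^^ M) p) \<and> snd ((base_map ^^ M) p) < 1"
      using yM unfolding eventually_at a_def by (metis UNIV_I)
    \<comment> \<open>A displacement a / \<sigma>1 ^ (m + N) of cA has grown to a after N + m steps,
      where the homoclinic orbit starts. T m bounds the parameter that produces it, the factor 2
      coming from \<open>DERIV_hits_values\<close>.\<close>
    define T where "T = (\<lambda>m. 2 * (\<bar>a\<bar> / \<sigma>1 ^ (m + N)))"
    \<comment> \<open>During the m steps the circle drift grows at most by Lp ^ m, whereas T m
      decays like \<sigma>1 ^ -m; since Lp < \<sigma>1 the drift on arrival tends to 0.\<close>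
    define Lp where "Lp = max_dQ \<psi> \<phi>"
    have Lp: "1 \<le> Lp" "Lp / \<sigma>1 < 1" "Lp < \<sigma>1"
      using max_dQ_ge_1 s0_ge s0_s1 s1_gt by (simp_all add: Lp_def)
    have T0: "T \<longlonglongrightarrow> 0" unfolding T_def
      using tendsto_mult_right_zero[OF LIMSEQ_ignore_initial_segment[OF power_tendsto(1)[of "\<bar>a\<bar>"], of N], of 2] by simp
    have LT: "(\<lambda>m. Lp ^ m * (CC * T m)) \<longlonglongrightarrow> 0"
    proof -
      have lim: "(\<lambda>m. (CC * 2 * \<bar>a\<bar> / \<sigma>1 ^ N) * (Lp / \<sigma>1) ^ m) \<longlonglongrightarrow> (CC * 2 * \<bar>a\<bar> / \<sigma>1 ^ N) * 0"
        using Lp s1_gt by (intro tendsto_mult tendsto_const LIMSEQ_power_zero) auto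
      have eq: "(CC * 2 * \<bar>a\<bar> / \<sigma>1 ^ N) * (Lp / \<sigma>1) ^ m = Lp ^ m * (CC * T m)" for m
        unfolding T_def by (simp add: power_add power_divide mult_ac)
      show ?thesis using lim unfolding eq mult_zero_right .
    qed
    have "\<forall>\<^sub>F m in sequentially. T m < 2 * \<eta>0 \<and> T m < dB \<and> T m < dC \<and> CB * T m < \<delta> / 8 \<and>
        Lp ^ m * (CC * T m) < \<omega> / 2 \<and> \<delta> / 4 / \<sigma>1 ^ m < \<omega> / 2"
      using e(2) CB CC \<omega>(1) \<delta>_pos
      by (intro eventually_conj order_tendstoD(2)[OF T0] order_tendstoD(2)[OF tendsto_mult_right_zero[OF T0]]
          order_tendstoD(2)[OF LT] order_tendstoD(2)[OF power_tendsto(1)]) auto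
    then obtain m where m: "T m < 2 * \<eta>0" "T m < dB" "T m < dC" "CB * T m < \<delta> / 8"
        "Lp ^ m * (CC * T m) < \<omega> / 2" "\<delta> / 4 / \<sigma>1 ^ m < \<omega> / 2"
      by (auto simp: eventually_sequentially)
    define \<eta> where "\<eta> = a / \<sigma>1 ^ (m + N)"
    have T\<eta>: "T m = 2 * \<bar>\<eta>\<bar>" using s1_gt by (simp add: T_def \<eta>_def abs_divide)
    obtain t where t: "\<bar>t\<bar> \<le> T m" "norm (v + t *\<^sub>R e) < \<rho>" "cA (D (v + t *\<^sub>R e)) = cA (D v) + \<eta>"
      using hit[of \<eta>] m(1) unfolding T\<eta> by auto
    define v' where "v' = v + t *\<^sub>R e"
    have v': "v' \<in> V" "norm v' < \<rho>"
      using t(2) subspace_add[OF subspace_V v(1) subspace_scale[OF subspace_V e(1)]] by (simp_all add: v'_def)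
    define b' where "b' = cB (c t) - lN \<bullet> es"
    have "\<bar>cB (c t) - cB (c 0)\<bar> \<le> CB * T m"
      using CB(3)[of t] t(1) m(2) mult_left_mono[OF t(1) CB(1)] by linarith
    moreover have "cB (c 0) - lN \<bullet> es = bN" unfolding c0 cB_def fN by (simp add: inner_add_left)
    ultimately have b': "\<bar>b'\<bar> \<le> \<delta> / 4" using bN m(4) unfolding b'_def by linarith
    define s where "s = cC (c t) - yN"
    have cC0: "cC (c 0) = yN" by (simp add: c0 cC_def yN_def)
    have s: "\<bar>s\<bar> \<le> CC * T m"
      using CC(3)[of t] t(1) m(3) mult_left_mono[OF t(1) CC(1)] unfolding cC0 s_def by linarith
    have base: "(fst (c t), cC (c t)) = (lN + (a / \<sigma>1 ^ m) *\<^sub>R eu + b' *\<^sub>R es, yN + s)"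
    proof -
      have "cA (c t) = \<sigma>1 ^ N * (l \<bullet> eu + a / \<sigma>1 ^ (m + N))"
        unfolding c_def cA_def fst_G_iter hyp_inner using t(3) l(2) by (simp add: cA_def \<eta>_def)
      also have "\<dots> = lN \<bullet> eu + a / \<sigma>1 ^ m" using s1_gt by (simp add: lN_def distrib_left power_add)
      finally have "fst (c t) = lN + (a / \<sigma>1 ^ m) *\<^sub>R eu + b' *\<^sub>R es"
        by (intro frame_eqI) (simp_all add: cA_def b'_def cB_def inner_add_left)
      then show ?thesis by (simp add: s_def)
    qed
    define s' where "s' = 1 + (\<phi> ^^ m) (yN + s - 1) - yN"
    define lm where "lm = hyp (\<sigma>1 ^ m) lN"
    have lm: "lm \<in> int_lattice" unfolding lm_def by (rule hyp_lattice_pow(1)[OF lN])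
    have "(base_map ^^ m) (fst (c t), cC (c t)) =
        (lm + (a * \<sigma>1 ^ m / \<sigma>1 ^ m) *\<^sub>R eu + (b' / \<sigma>1 ^ m) *\<^sub>R es, 1 + (\<phi> ^^ m) (yN + s - 1))"
      unfolding base lm_def by (rule base_map_saddle[OF lN _ b' order_refl]) (use ls(2) a_def in simp)
    then have km: "(base_map ^^ m) (fst (c t), cC (c t)) = (a *\<^sub>R eu + (b' / \<sigma>1 ^ m) *\<^sub>R es + lm, s' + yN)"
      using s1_gt by (simp add: s'_def algebra_simps)
    have s': "\<bar>s'\<bar> \<le> Lp ^ m * (CC * T m)"
    proof -
      \<comment> \<open>yN - 1 is congruent to -1, the repelling fixed point of \<phi>, so the
        deviation from it is multiplied by at most Lp in each step.\<close>
      obtain j :: int where "yN / 2 = of_int j" using True by (auto simp: even_lattice_def elim: Ints_cases)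
      then have j: "yN = 2 * of_int j" by simp
      have fixed: "\<phi> (yN - 1) = yN - 1" using \<phi>_int[of "- 1" j] by (simp add: j \<phi>_values algebra_simps)
      have "\<bar>(\<phi> ^^ i) (yN + s - 1) - (yN - 1)\<bar> \<le> Lp ^ i * \<bar>s\<bar>" for i
      proof (induction i)
        case (Suc i)
        have "\<bar>\<phi> ((\<phi> ^^ i) (yN + s - 1)) - \<phi> (yN - 1)\<bar> \<le> Lp * \<bar>(\<phi> ^^ i) (yN + s - 1) - (yN - 1)\<bar>"
          unfolding Lp_def by (rule \<phi>_Lipschitz)
        also have "\<dots> \<le> Lp * (Lp ^ i * \<bar>s\<bar>)" using Suc Lp(1) by (intro mult_left_mono) auto
        finally show ?case by (simp add: fixed mult.assoc)
      qed simp
      from this[of m] have "\<bar>s'\<bar> \<le> Lp ^ m * \<bar>s\<bar>" by (simp add: s'_def algebra_simps)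
      also have "\<dots> \<le> Lp ^ m * (CC * T m)" using s Lp(1) by (intro mult_left_mono) auto
      finally show ?thesis .
    qed
    \<comment> \<open>The position at time N + m up to the lattice vector (lm, yN). It is within
      \<omega> of the start of the homoclinic orbit, hence shares its departure from level
      0.\<close>
    define p where "p = (a *\<^sub>R eu + (b' / \<sigma>1 ^ m) *\<^sub>R es, s')"
    have "dist p (a *\<^sub>R eu, 0) \<le> norm ((b' / \<sigma>1 ^ m) *\<^sub>R es) + norm s'"
      unfolding p_def dist_norm using norm_Pair_le[of "(b' / \<sigma>1 ^ m) *\<^sub>R es" s'] by simp
    also have "norm ((b' / \<sigma>1 ^ m) *\<^sub>R es) \<le> \<delta> / 4 / \<sigma>1 ^ m"
      using divide_right_mono[OF b', of "\<sigma>1 ^ m"] s1_gt by (simp add: abs_divide)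
    finally have "dist p (a *\<^sub>R eu, 0) < \<omega>" using m(5,6) s' by simp
    from \<omega>(2)[OF this] have p01: "0 < snd ((base_map ^^ M) p)" "snd ((base_map ^^ M) p) < 1" by auto
    let ?N = "M + (m + N)"
    let ?l = "hyp (\<sigma>1 ^ M) (ls + lm)" and ?b = "(b' / \<sigma>1 ^ m - ls \<bullet> es) / \<sigma>1 ^ M"
    have it: "(fst ((G ^^ ?N) (D v')), fst (snd ((G ^^ ?N) (D v')))) =
        (fst ((base_map ^^ M) p) + hyp (\<sigma>1 ^ M) lm, snd ((base_map ^^ M) p) + yN)"
    proof -
      have "(G ^^ ?N) (D v') = (G ^^ M) ((G ^^ m) (c t))" by (simp add: funpow_add c_def v'_def)
      then have "(fst ((G ^^ ?N) (D v')), fst (snd ((G ^^ ?N) (D v')))) = (base_map ^^ M) ((base_map ^^ m) (fst (c t), cC (c t)))"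
        by (simp only: base_iter cC_def)
      then show ?thesis unfolding km base_map_shift[OF lm True] p_def by simp
    qed
    have "a *\<^sub>R eu = ls - (ls \<bullet> es) *\<^sub>R es" by (rule frame_eqI) (simp_all add: a_def inner_diff_left)
    then have leaf: "fst ((G ^^ ?N) (D v')) = ?l + ?b *\<^sub>R es"
      using it unfolding prod.inject fst_base_map p_def
      by (auto intro!: frame_eqI simp: inner_add_left inner_diff_left diff_divide_distrib add_divide_distrib distrib_left)
    have ls': "?l \<in> int_lattice" by (rule hyp_lattice_pow(1)[OF int_lattice_add[OF ls(1) lm]])
    \<comment> \<open>b' / \<sigma>1 ^ m is less than the 1 reserved in
      \<open>homoclinic\<close>.\<close>
    have bb: "\<bar>?b\<bar> < \<delta> / 4"
    proof -
      have "\<bar>b' / \<sigma>1 ^ m\<bar> < 1" using div_s1_pow_le[of b' m] b' unfolding \<delta>_def by linarith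
      then have "\<bar>b' / \<sigma>1 ^ m - ls \<bullet> es\<bar> < \<bar>ls \<bullet> es\<bar> + 1" by linarith
      moreover have "\<sigma>1 ^ M > 0" using s1_gt by simp
      ultimately have "\<bar>?b\<bar> < (\<bar>ls \<bullet> es\<bar> + 1) / \<sigma>1 ^ M" by (simp add: abs_divide divide_strict_right_mono)
      then show ?thesis using ls(3) by linarith
    qed
    have "fst (snd ((G ^^ ?N) (D v'))) \<notin> even_lattice"
    proof
      assume "fst (snd ((G ^^ ?N) (D v'))) \<in> even_lattice"
      then have "snd ((base_map ^^ M) p) + yN \<in> even_lattice" using it by simp
      then have "snd ((base_map ^^ M) p) \<in> even_lattice"
        using even_lattice_add[OF _ even_lattice_minus[OF True]] by force
      then show False using norm_even_lattice_ge[of "snd ((base_map ^^ M) p)"] p01 by simp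
    qed
    then show ?thesis by (rule hits_leaf_meets[OF v' ls' bb leaf])
  qed
qed

end

lemma skeleton_tp: "skeleton g Ecs {pr tp}"
  unfolding skeleton_def
proof (intro conjI ballI allI impI)
  fix p assume p: "p \<in> {pr tp}"
  have "dim (Ecs p) = dim stab" using p Ecs_leaf[OF on_leaf_top] by simp
  then show "\<exists>n. hyperbolic_periodic g p n \<and> stable_index g p n = dim (Ecs p)"
    using p hyperbolic_tp stable_index_tp by auto
next
  fix V h h' assume d: "C1_disk V h h' \<and> disk_transverse V h h' Ecs"
  obtain \<rho> D where "\<rho> > 0" "\<rho> < 1" and D: "\<And>v. v \<in> V \<Longrightarrow> norm v < \<rho> \<Longrightarrow> covering (Q + D v) = h v"
    "\<And>v. v \<in> V \<Longrightarrow> norm v < \<rho> \<Longrightarrow> (D has_derivative h' v) (at v within V \<inter> cball 0 1)"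
    using C1_disk_lift[of V h h' Q] d by blast
  then have "meets_transversely V h h' (dim stab) (Ws g (pr tp))"
    using d by (intro meets_skeleton[of V h h' \<rho> D]) (auto simp: pr_def)
  then show "\<exists>p\<in>{pr tp}. meets_transversely V h h' (dim (Ecs p)) (Ws g p)"
    using Ecs_leaf[OF on_leaf_top] by simp
qed auto

end

theorem ph_splitting_skeleton: "\<exists>Euu Ecu Ecs. ph_splitting g Euu Ecu Ecs \<and> skeleton g Ecs {pr tp}"
proof -
  obtain \<theta> K where T: "triangular_diffeo g G H Q eu es \<sigma>0 \<sigma>1
    (coef cC (mk 1 0 0 0 0)) (coef cC (mk 0 1 0 0 0)) (coef cC (mk 0 0 1 0 0))
    (coef cD (mk 1 0 0 0 0)) (coef cD (mk 0 1 0 0 0)) (coef cD (mk 0 0 1 0 0)) (coef cD (mk 0 0 0 0 1))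
    (coef cD (mk 0 0 0 1 0)) \<theta> K" using triangular by blast
  obtain Euu Ecu Ecs where ph: "ph_splitting g Euu Ecu Ecs" and cA: "\<And>x v. v \<in> Ecs x \<Longrightarrow> cA v = 0"
    and leaf: "\<And>x. (\<And>n. coef cD (mk 0 1 0 0 0) ((g ^^ n) x) = 0 \<and> coef cD (mk 0 0 1 0 0) ((g ^^ n) x) = 0 \<and>
      coef cD (mk 0 0 0 0 1) ((g ^^ n) x) = 0) \<Longrightarrow> Ecs x = {v. cA v = 0 \<and> cD v = 0}"
    by (rule triangular_diffeo.ph_splitting_exists[OF T]) blast
  have "invariant_bundle g Ecs" using ph by (simp add: ph_splitting_def dominates_def)
  moreover have "Ecs (pr w) = stab" if "on_leaf w" for w
    unfolding stab_def by (rule leaf) (rule coef_on_leaf[OF that])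
  ultimately have "skeleton g Ecs {pr tp}" using cA by (intro skeleton_tp)
  with ph show ?thesis by blast
qed

end

section \<open>The construction as a skew product\<close>

lemma circle_rep_eqI:
  assumes "- 1 \<le> s" "s < 1" "t - s \<in> even_lattice"
  shows "circle_rep (abs_circle t) = s"
  unfolding circle_rep_def
proof (rule the_equality)
  show "- 1 \<le> s \<and> s < 1 \<and> abs_circle s = abs_circle t"
    using assms even_lattice_minus[OF assms(3)] by (simp add: abs_circle_eq_iff)
  fix s' assume s': "- 1 \<le> s' \<and> s' < 1 \<and> abs_circle s' = abs_circle t"
  then have "s' - t \<in> even_lattice" by (simp add: abs_circle_eq_iff)
  then have "(s' - t) + (t - s) \<in> even_lattice" using assms(3) by (rule even_lattice_add)
  then have "(s' - s) / 2 \<in> \<int>" by (simp add: even_lattice_def)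
  moreover have "\<bar>(s' - s) / 2\<bar> < 1" using s' assms by auto
  ultimately have "(s' - s) / 2 = 0" using Ints_nonzero_abs_less1 by blast
  then show "s' = s" by simp
qed

lemma circle_rep_exists:
  obtains j where "j \<in> even_lattice" "- 1 \<le> t - j" "t - j < 1" "circle_rep (abs_circle t) = t - j"
proof -
  define i where "i = \<lfloor>(t + 1) / 2\<rfloor>"
  have i: "of_int i \<le> (t + 1) / 2" "(t + 1) / 2 < of_int i + 1" unfolding i_def by linarith+
  have "2 * of_int i \<in> even_lattice" by (simp add: even_lattice_def)
  moreover have "- 1 \<le> t - 2 * of_int i" "t - 2 * of_int i < 1" using i by (simp_all add: field_simps)
  ultimately show thesis using that[of "2 * of_int i"] circle_rep_eqI[of "t - 2 * of_int i" t] by simp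
qed

section \<open>The boxes of the construction seen in the cover\<close>

context cat_frame
begin

lemma box_point_eq_iff:
  "abs_torus X = box_point eu es (abs_torus P) a b \<longleftrightarrow>
    (\<exists>l\<in>int_lattice. a = (X - P - l) \<bullet> eu \<and> b = (X - P - l) \<bullet> es)"
proof -
  have "abs_torus X = box_point eu es (abs_torus P) a b \<longleftrightarrow> X - (P + (a *\<^sub>R eu + b *\<^sub>R es)) \<in> int_lattice"
    by (simp add: box_point_def plus_torus.abs_eq abs_torus_eq_iff)
  also have "\<dots> \<longleftrightarrow> (\<exists>l\<in>int_lattice. a = (X - P - l) \<bullet> eu \<and> b = (X - P - l) \<bullet> es)"
  proof
    assume "X - (P + (a *\<^sub>R eu + b *\<^sub>R es)) \<in> int_lattice"
    then show "\<exists>l\<in>int_lattice. a = (X - P - l) \<bullet> eu \<and> b = (X - P - l) \<bullet> es"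
      by (rule rev_bexI) (simp add: inner_diff_left inner_add_left)
  next
    assume "\<exists>l\<in>int_lattice. a = (X - P - l) \<bullet> eu \<and> b = (X - P - l) \<bullet> es"
    then obtain l where l: "l \<in> int_lattice" "a = (X - P - l) \<bullet> eu" "b = (X - P - l) \<bullet> es" by blast
    have "a *\<^sub>R eu + b *\<^sub>R es = X - P - l" unfolding l(2,3) by (rule frame_expand[symmetric])
    then have "X - (P + (a *\<^sub>R eu + b *\<^sub>R es)) = l" by simp
    then show "X - (P + (a *\<^sub>R eu + b *\<^sub>R es)) \<in> int_lattice" using l(1) by simp
  qed
  finally show ?thesis .
qed

definition near :: "real^2 \<Rightarrow> bool" where
  "near v \<longleftrightarrow> \<bar>v \<bullet> eu\<bar> < 5 * \<delta> \<and> \<bar>v \<bullet> es\<bar> < 5 * \<delta>"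

text \<open>5 * sqrt 2 < 8; this is the origin of the radius 8 \<delta> in \<open>bmp_far\<close>
  and \<open>Uc_single\<close>.\<close>

lemma near_norm: "near v \<Longrightarrow> norm v < 8 * \<delta>"
proof -
  assume n: "near v"
  then have "\<bar>v \<bullet> eu\<bar> \<le> 5 * \<delta>" "\<bar>v \<bullet> es\<bar> \<le> 5 * \<delta>" by (simp_all add: near_def)
  from this[THEN power_mono, OF abs_ge_zero, of 2]
  have "(v \<bullet> eu)\<^sup>2 + (v \<bullet> es)\<^sup>2 < (8 * \<delta>)\<^sup>2" by (simp add: \<delta>_def power2_eq_square)
  then show ?thesis unfolding norm_frame[of v] by (intro real_less_lsqrt) (auto simp: \<delta>_def)
qed

lemma near_of_norm: "norm v < 5 * \<delta> \<Longrightarrow> near v"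
  using Cauchy_Schwarz_ineq2[of v eu] Cauchy_Schwarz_ineq2[of v es] by (simp add: near_def)

lemma in_box_iff: "in_box eu es (abs_torus P) (abs_torus X) \<longleftrightarrow> (\<exists>l\<in>int_lattice. near (X - P - l))"
  unfolding in_box_def box_point_eq_iff near_def by blast

text \<open>The box is much smaller than the lattice spacing, so only one lattice vector brings X -
  P into it and the \<open>THE\<close> is justified.\<close>

lemma box_coords_eq:
  assumes l: "l \<in> int_lattice" "near (X - P - l)"
  shows "box_coords eu es (abs_torus P) (abs_torus X) = ((X - P - l) \<bullet> eu, (X - P - l) \<bullet> es)"
  unfolding box_coords_def
proof (rule the_equality)
  show "case ((X - P - l) \<bullet> eu, (X - P - l) \<bullet> es) of (a, b) \<Rightarrow>
      \<bar>a\<bar> < 5 * \<delta> \<and> \<bar>b\<bar> < 5 * \<delta> \<and> abs_torus X = box_point eu es (abs_torus P) a b"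
    using l unfolding near_def box_point_eq_iff by blast
  fix ab assume "case ab of (a, b) \<Rightarrow> \<bar>a\<bar> < 5 * \<delta> \<and> \<bar>b\<bar> < 5 * \<delta> \<and> abs_torus X = box_point eu es (abs_torus P) a b"
  then obtain a b l' where ab: "ab = (a, b)" and ab_le: "\<bar>a\<bar> < 5 * \<delta>" "\<bar>b\<bar> < 5 * \<delta>"
    and l': "l' \<in> int_lattice" "a = (X - P - l') \<bullet> eu" "b = (X - P - l') \<bullet> es"
    by (cases ab) (auto simp: box_point_eq_iff)
  have "near (X - P - l')" using ab_le l'(2,3) by (simp add: near_def)
  then have "norm (X - P - l) + norm (X - P - l') < 1"
    using near_norm[OF l(2)] near_norm[of "X - P - l'"] by (simp add: \<delta>_def)
  from int_lattice.lattice_eqI[OF l(1) l'(1) this] show "ab = ((X - P - l) \<bullet> eu, (X - P - l) \<bullet> es)"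
    using ab l' by simp
qed

end

context skew_model
begin

lemma Rc_nonzero:
  assumes "Rc w \<noteq> 0"
  obtains i l where "i < 2" "l \<in> cover_lattice" "F5 (w - cent i - l) \<noteq> 0"
proof -
  have "\<exists>i<2. periodize cover_lattice F5 (w - cent i) \<noteq> 0"
    using assms unfolding Rc_def by (metis lessThan_iff sum.neutral)
  then show thesis using cover_lattice.periodize_nonzero[OF F5_support(3)] that by metis
qed

lemma F5_near:
  assumes "F5 u \<noteq> 0" shows "norm (fst u) < \<delta> / k" "near (fst u)" "near (snd (snd u))" "norm (fst u) < \<delta>"
proof -
  have "norm (fst u) = sqrt ((cA u)\<^sup>2 + (cB u)\<^sup>2)" unfolding cA_def cB_def by (rule norm_frame)
  also have "\<dots> \<le> sqrt ((cA u)\<^sup>2 + (cB u)\<^sup>2 + (cC u)\<^sup>2 + (cE u)\<^sup>2)" by (rule real_sqrt_le_mono) simp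
  finally show n: "norm (fst u) < \<delta> / k" using F5_support(2)[OF assms] by linarith
  then show "norm (fst u) < \<delta>" using dk \<delta>_pos by linarith
  show "near (fst u)" by (rule near_of_norm) (use n dk \<delta>_pos in linarith)
  have "\<bar>cE u\<bar> \<le> sqrt ((cA u)\<^sup>2 + (cB u)\<^sup>2 + (cC u)\<^sup>2 + (cE u)\<^sup>2)" by (rule real_le_rsqrt) simp
  then show "near (snd (snd u))"
    using F5_support(1,2)[OF assms] dk \<delta>_pos unfolding near_def cD_def[symmetric] cE_def[symmetric] by linarith
qed

lemma lattice_parts: "l \<in> cover_lattice \<Longrightarrow> fst l \<in> int_lattice" "l \<in> cover_lattice \<Longrightarrow> fst (snd l) \<in> even_lattice"
  "l \<in> cover_lattice \<Longrightarrow> snd (snd l) \<in> int_lattice"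
  by (auto simp: cover_lattice_def)

lemma F5_other_box:
  assumes "i < 4" "l \<in> int_lattice" "norm (fst w - r i - l) < 8 * \<delta>"
    and "j < 2" "m \<in> cover_lattice" "F5 (w - cent j - m) \<noteq> 0"
  shows "j = i"
proof (rule ccontr)
  assume ne: "j \<noteq> i"
  have n: "norm (fst w - r j - fst m) < \<delta>" using F5_near(4)[OF assms(6)] by (simp add: cent_coords)
  have "l - fst m \<in> int_lattice"
    using int_lattice_add[OF assms(2) int_lattice_minus[OF lattice_parts(1)[OF assms(5)]]] by simp
  then have "10 * \<delta> < norm (r j - r i - (l - fst m))" using r_sep[of j i] assms(1,4) ne by simp
  also have "\<dots> \<le> norm (fst w - r i - l) + norm (fst w - r j - fst m)"
    using norm_triangle_ineq4[of "fst w - r i - l" "fst w - r j - fst m"] by (simp add: algebra_simps)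
  finally show False using n assms(3) \<delta>_pos by linarith
qed

text \<open>Only one centre can be active, and only one translate of the support can contain w. Its
  torus parts are forced by the small boxes, its circle part by uniqueness of the representative in
  [-1, 1).\<close>

lemma Rc_in_box:
  assumes i: "i < 2" and l: "l \<in> int_lattice" "near (fst w - r i - l)"
    and j: "j \<in> even_lattice" "- 1 \<le> fst (snd w) - shift i - j" "fst (snd w) - shift i - j < 1"
    and l': "l' \<in> int_lattice" "near (snd (snd w) - r i - l')"
  shows "Rc w = F5 (w - cent i - (l, j, l'))"
proof -
  have n: "norm (fst w - r i - l) < 8 * \<delta>" by (rule near_norm[OF l(2)])
  have i4: "i < 4" using i by simp
  have "Rc w = (\<Sum>m\<in>{i}. periodize cover_lattice F5 (w - cent m))"
    unfolding Rc_def
  proof (rule sum.mono_neutral_right)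
    show "\<forall>m\<in>{..<2} - {i}. periodize cover_lattice F5 (w - cent m) = 0"
      using cover_lattice.periodize_nonzero[OF F5_support(3)] F5_other_box[OF i4 l(1) n]
      by (metis Diff_iff insertI1 lessThan_iff)
  qed (use i in auto)
  also have "\<dots> = F5 (w - cent i - (l, j, l'))"
  proof (simp, rule cover_lattice.periodize_eqI[OF F5_support(3)])
    show "(l, j, l') \<in> cover_lattice" using l j l' by (simp add: cover_lattice_def)
    fix m assume m: "m \<in> cover_lattice" and nz: "F5 (w - cent i - m) \<noteq> 0"
    let ?u = "w - cent i - m"
    have "near (fst ?u)" "near (snd (snd ?u))" by (rule F5_near[OF nz])+
    then have n1: "norm (fst w - r i - fst m) < 8 * \<delta>" and n3: "norm (snd (snd w) - r i - snd (snd m)) < 8 * \<delta>"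
      using near_norm by (auto simp: cent_def)
    have "fst m = l"
      by (rule int_lattice.lattice_eqI[of _ _ "fst w - r i"]) (use lattice_parts(1)[OF m] l n n1 in \<open>auto simp: \<delta>_def\<close>)
    moreover have "snd (snd m) = l'"
      by (rule int_lattice.lattice_eqI[of _ _ "snd (snd w) - r i"])
        (use lattice_parts(3)[OF m] l' near_norm[OF l'(2)] n3 in \<open>auto simp: \<delta>_def\<close>)
    moreover have "fst (snd m) = j"
    proof -
      have "\<bar>fst (snd ?u)\<bar> < 1 / 4" using F5_support(3)[OF nz] coord_le_norm(3)[of ?u] by (simp add: cC_def)
      then have "\<bar>fst (snd w) - shift i - fst (snd m)\<bar> < 1 / 4" by (simp add: cent_def)
      then have "circle_rep (abs_circle (fst (snd w) - shift i)) = fst (snd w) - shift i - fst (snd m)"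
        by (intro circle_rep_eqI) (linarith, linarith, use lattice_parts(2)[OF m] in simp)
      moreover have "circle_rep (abs_circle (fst (snd w) - shift i)) = fst (snd w) - shift i - j"
        using j by (intro circle_rep_eqI) auto
      ultimately show ?thesis by simp
    qed
    ultimately show "m = (l, j, l')" by (simp add: prod_eq_iff)
  qed
  finally show ?thesis .
qed

lemma Rc_outside_box:
  assumes "\<And>i l. i < 2 \<Longrightarrow> l \<in> cover_lattice \<Longrightarrow> near (fst w - r i - fst l) \<Longrightarrow> near (snd (snd w) - r i - snd (snd l)) \<Longrightarrow> False"
  shows "Rc w = 0"
proof (rule ccontr)
  assume "Rc w \<noteq> 0"
  then obtain i l where i: "i < 2" "l \<in> cover_lattice" and nz: "F5 (w - cent i - l) \<noteq> 0" by (rule Rc_nonzero)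
  from F5_near(2,3)[OF nz] assms[OF i] show False by (simp add: cent_def)
qed

context
  fixes X :: "nat \<Rightarrow> real^2"
  assumes eps0: "\<epsilon> = 0" and r_X: "\<And>i. r i = X i - X 3" and Q_X: "Q = (X 3, 0, X 3)"
begin

abbreviation "P i \<equiv> abs_torus (X i)"

lemma push_0: "push i y = \<phi> (y - shift i) - (y - shift i)" unfolding push_def using eps0 by simp

text \<open>Q commutes with translation by 2, so it may be applied to any representative of the
  circle point.\<close>

lemma circle_component:
  assumes i: "i < 4" and l: "l \<in> int_lattice" "near (x - r i - l)"
    and j: "j \<in> even_lattice"
  shows "abs_circle (shift i + Q_fun \<psi> \<phi> ((x - r i - l) \<bullet> eu) ((x - r i - l) \<bullet> es) (y - shift i - j)) =
    abs_circle (y + Uc (x, y, z))"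
proof -
  let ?n = "norm (x - r i - l)" and ?c = "y - shift i"
  obtain m :: int where "j / 2 = of_int m" using j by (auto simp: even_lattice_def elim: Ints_cases)
  then have m: "j = 2 * of_int m" by simp
  have \<phi>j: "\<phi> (?c - j) = \<phi> ?c - j" using \<phi>_int[of "?c - j" m] by (simp add: m)
  have "Uc (x, y, z) = \<psi> ?n * push i y" using Uc_single[OF i l(1), of "(x, y, z)"] near_norm[OF l(2)] by simp
  moreover have "shift i + Q_fun \<psi> \<phi> ((x - r i - l) \<bullet> eu) ((x - r i - l) \<bullet> es) (?c - j) = y - j + \<psi> ?n * push i y"
    unfolding Q_fun_def norm_frame[symmetric] \<phi>j push_0 by simp
  ultimately have "shift i + Q_fun \<psi> \<phi> ((x - r i - l) \<bullet> eu) ((x - r i - l) \<bullet> es) (?c - j) - (y + Uc (x, y, z)) = - j"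
    by simp
  then show ?thesis using even_lattice_minus[OF j] by (simp add: abs_circle_eq_iff)
qed

text \<open>In box coordinates P adds \<open>F5\<close> to d. When z lies in no translate of the
  box, \<open>F5\<close> vanishes and both sides leave z unchanged.\<close>

lemma last_component:
  assumes i: "i < 2" and l: "l \<in> int_lattice" "near (x - r i - l)"
    and j: "j \<in> even_lattice" "- 1 \<le> y - shift i - j" "y - shift i - j < 1"
  shows "last_factor \<psi> k \<sigma>0 eu es (P i) ((x - r i - l) \<bullet> eu) ((x - r i - l) \<bullet> es) (y - shift i - j) (abs_torus (X 3 + z)) =
    abs_torus (X 3 + (z + Rc (x, y, z) *\<^sub>R eu))"
proof (cases "\<exists>l'\<in>int_lattice. near (z - r i - l')")
  case True
  then obtain l' where l': "l' \<in> int_lattice" "near (z - r i - l')" by blast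
  let ?u = "(x, y, z) - cent i - (l, j, l')"
  have e: "X 3 + z - X i - l' = z - r i - l'" by (simp add: r_X)
  have box: "in_box eu es (P i) (abs_torus (X 3 + z))"
    unfolding in_box_iff using l'(2) by (intro bexI[OF _ l'(1)]) (simp only: e)
  have coords: "box_coords eu es (P i) (abs_torus (X 3 + z)) = ((z - r i - l') \<bullet> eu, (z - r i - l') \<bullet> es)"
    using box_coords_eq[OF l'(1), of "X 3 + z" "X i"] l'(2) unfolding e by blast
  have R: "Rc (x, y, z) = F5 ?u" using Rc_in_box[OF i l(1), of "(x, y, z)" j l'] l(2) j l' by simp
  have u: "?u = mk ((x - r i - l) \<bullet> eu) ((x - r i - l) \<bullet> es) (y - shift i - j) ((z - r i - l') \<bullet> eu) ((z - r i - l') \<bullet> es)"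
    using frame_expand[of "x - r i - l"] frame_expand[of "z - r i - l'"] by (simp add: mk_def cent_def)
  have "X 3 + (z + Rc (x, y, z) *\<^sub>R eu) - (X i + (((z - r i - l') \<bullet> eu + F5 ?u) *\<^sub>R eu + ((z - r i - l') \<bullet> es) *\<^sub>R es)) = l'"
    using frame_expand[of "z - r i - l'"] by (simp add: R r_X algebra_simps)
  then have "abs_torus (X i + (((z - r i - l') \<bullet> eu + F5 ?u) *\<^sub>R eu + ((z - r i - l') \<bullet> es) *\<^sub>R es)) =
      abs_torus (X 3 + (z + Rc (x, y, z) *\<^sub>R eu))"
    using l'(1) abs_torus_eq_iff by metis
  then show ?thesis
    unfolding last_factor_def using box coords
    by (simp add: P_fun_F5 u[symmetric] box_point_def plus_torus.abs_eq)
next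
  case False
  have box: "\<not> in_box eu es (P i) (abs_torus (X 3 + z))"
    unfolding in_box_iff using False by (simp add: r_X algebra_simps)
  have "Rc (x, y, z) = 0"
  proof (rule ccontr)
    assume "Rc (x, y, z) \<noteq> 0"
    then obtain m n where m: "m < 2" "n \<in> cover_lattice" and nz: "F5 ((x, y, z) - cent m - n) \<noteq> 0" by (rule Rc_nonzero)
    have "m = i" using F5_other_box[of i l "(x, y, z)" m n] i l near_norm[OF l(2)] m nz by simp
    then have "near (z - r i - snd (snd n))" using F5_near(3)[OF nz] by (simp add: cent_def)
    then show False using False lattice_parts(3)[OF m(2)] by blast
  qed
  then show ?thesis using box by (simp add: last_factor_def)
qed

lemma I_map_lift:
  "I_map \<psi> \<phi> k \<sigma>0 eu es (P 0) (P 1) (P 2) (P 3) (covering (Q + (x, y, z))) =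
    covering (Q + (x, y + Uc (x, y, z), z + Rc (x, y, z) *\<^sub>R eu))"
proof -
  let ?x = "abs_torus (X 3 + x)" and ?z = "abs_torus (X 3 + z)"
  have cov: "covering (Q + (x, s, v)) = (?x, abs_circle s, abs_torus (X 3 + v))" for s v
    by (simp add: covering_def Q_X)
  have box: "in_box eu es (P i) ?x \<longleftrightarrow> (\<exists>l\<in>int_lattice. near (x - r i - l))" for i
    unfolding in_box_iff by (simp add: r_X algebra_simps)
  have coords: "box_coords eu es (P i) ?x = ((x - r i - l) \<bullet> eu, (x - r i - l) \<bullet> es)"
    if "l \<in> int_lattice" "near (x - r i - l)" for i l
    using box_coords_eq[OF that(1), of "X 3 + x" "X i"] that(2) by (simp add: r_X algebra_simps)
  obtain j0 where j0: "j0 \<in> even_lattice" "- 1 \<le> y - j0" "y - j0 < 1" "circle_rep (abs_circle y) = y - j0"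
    by (rule circle_rep_exists)
  obtain j1 where j1: "j1 \<in> even_lattice" "- 1 \<le> y - 1 - j1" "y - 1 - j1 < 1"
    "circle_rep (abs_circle y - abs_circle 1) = y - 1 - j1"
    using circle_rep_exists[of "y - 1"] by (metis minus_circle.abs_eq)
  have sh: "shift 0 = 0" "shift 1 = 1" "shift (Suc 0) = 1" "shift 2 = 0" "shift 3 = 1" by (simp_all add: shift_def)
  \<comment> \<open>Around q1 and q2 the construction does not touch the last factor; in the model
    the deformation is centred at the indices 0 and 1 only.\<close>
  have Rq: "Rc (x, y, z) = 0" if "2 \<le> i" "i < 4" "l \<in> int_lattice" "near (x - r i - l)" for i l
  proof (rule ccontr)
    assume "Rc (x, y, z) \<noteq> 0"
    then obtain m n where m: "m < 2" "n \<in> cover_lattice" and nz: "F5 ((x, y, z) - cent m - n) \<noteq> 0" by (rule Rc_nonzero)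
    have "m = i" using F5_other_box[of i l "(x, y, z)" m n] that near_norm[OF that(4)] m nz by simp
    then show False using m(1) that(1) by simp
  qed
  consider "in_box eu es (P 0) ?x" | "\<not> in_box eu es (P 0) ?x" "in_box eu es (P 1) ?x"
    | "\<not> in_box eu es (P 0) ?x" "\<not> in_box eu es (P 1) ?x" "in_box eu es (P 2) ?x"
    | "\<not> in_box eu es (P 0) ?x" "\<not> in_box eu es (P 1) ?x" "\<not> in_box eu es (P 2) ?x" "in_box eu es (P 3) ?x"
    | "\<not> in_box eu es (P 0) ?x" "\<not> in_box eu es (P 1) ?x" "\<not> in_box eu es (P 2) ?x" "\<not> in_box eu es (P 3) ?x"
    by blast
  then show ?thesis
  proof cases
    case 1
    then obtain l where l: "l \<in> int_lattice" "near (x - r 0 - l)" unfolding box by blast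
    have y: "- 1 \<le> y - shift 0 - j0" "y - shift 0 - j0 < 1" using j0(2,3) by (simp_all add: sh)
    show ?thesis
      unfolding cov I_map_def using 1 j0(4) coords[OF l]
        circle_component[OF _ l j0(1), of y z, unfolded sh] last_component[OF _ l j0(1) y, of z, unfolded sh]
      by (simp add: Let_def)
  next
    case 2
    then obtain l where l: "l \<in> int_lattice" "near (x - r 1 - l)" unfolding box by blast
    have y: "- 1 \<le> y - shift 1 - j1" "y - shift 1 - j1 < 1" using j1(2,3) by (simp_all add: sh)
    show ?thesis
      unfolding cov I_map_def using 2 j1(4) coords[OF l]
        circle_component[OF _ l j1(1), of y z, unfolded sh] last_component[OF _ l j1(1) y, of z, unfolded sh]
      by (simp add: Let_def)
  next
    case 3
    then obtain l where l: "l \<in> int_lattice" "near (x - r 2 - l)" unfolding box by blast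
    show ?thesis
      unfolding cov I_map_def using 3 j0(4) coords[OF l]
        circle_component[OF _ l j0(1), of y z] Rq[OF _ _ l]
      by (simp add: sh Let_def)
  next
    case 4
    then obtain l where l: "l \<in> int_lattice" "near (x - r 3 - l)" unfolding box by blast
    show ?thesis
      unfolding cov I_map_def using 4 j1(4) coords[OF l]
        circle_component[OF _ l j1(1), of y z] Rq[OF _ _ l]
      by (simp add: sh Let_def)
  next
    case 5
    have far: False if "i < 4" "l \<in> int_lattice" "near (x - r i - l)" for i l
    proof -
      have "i = 0 \<or> i = 1 \<or> i = 2 \<or> i = 3" using that(1) by linarith
      then show False using 5 that(2,3) unfolding box by blast
    qed
    \<comment> \<open>The bumps have radius \<delta> and so live well inside the boxes of half side
      5 \<delta>.\<close>
    have "bmp i x = 0" if i: "i < 4" for i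
    proof (rule ccontr)
      assume "bmp i x \<noteq> 0"
      then obtain l where "l \<in> int_lattice" "norm (x - r i - l) < \<delta>" by (rule bmp_nonzero)
      then show False using far[OF i] near_of_norm \<delta>_pos by fastforce
    qed
    then have "Uc (x, y, z) = 0" by (intro Uc_zero) simp
    moreover have "Rc (x, y, z) = 0"
      by (rule Rc_outside_box) (use far lattice_parts(1) in fastforce)
    ultimately show ?thesis unfolding cov I_map_def using 5 by simp
  qed
qed

text \<open>Because q2 is fixed by both powers of A, moving the origin to its lift X 3 costs only
  lattice vectors, which disappear in the quotient.\<close>

lemma f_map_eq_g:
  assumes fix0: "hyp \<sigma>0 (X 3) - X 3 \<in> int_lattice" and fix1: "hyp \<sigma>1 (X 3) - X 3 \<in> int_lattice"
  shows "f_map \<psi> \<phi> k \<sigma>0 eu es (P 0) (P 1) (P 2) (P 3) n0 n1 = g"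
proof
  fix p
  obtain x y z where p: "p = pr (x, y, z)" using pr_surj[of p] by (metis prod_cases3)
  have "f_map \<psi> \<phi> k \<sigma>0 eu es (P 0) (P 1) (P 2) (P 3) n0 n1 p =
      map_prod (cat_map ^^ n1) (map_prod id (cat_map ^^ n0)) (covering (Q + (x, y + Uc (x, y, z), z + Rc (x, y, z) *\<^sub>R eu)))"
    unfolding p pr_def f_map_def o_apply I_map_lift ..
  also have "\<dots> = (abs_torus (hyp \<sigma>1 (X 3 + x)), abs_circle (y + Uc (x, y, z)), abs_torus (hyp \<sigma>0 (X 3 + (z + Rc (x, y, z) *\<^sub>R eu))))"
    by (simp add: covering_def Q_X cat_map_pow)
  also have "abs_torus (hyp \<sigma>1 (X 3 + x)) = abs_torus (X 3 + hyp \<sigma>1 x)"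
    unfolding abs_torus_eq_iff using fix1 by (simp add: hyp_add)
  also have "abs_torus (hyp \<sigma>0 (X 3 + (z + Rc (x, y, z) *\<^sub>R eu))) = abs_torus (X 3 + hyp \<sigma>0 (z + Rc (x, y, z) *\<^sub>R eu))"
    unfolding abs_torus_eq_iff using fix0 by (simp add: hyp_add[of _ "X 3"])
  also have "(abs_torus (X 3 + hyp \<sigma>1 x), abs_circle (y + Uc (x, y, z)), abs_torus (X 3 + hyp \<sigma>0 (z + Rc (x, y, z) *\<^sub>R eu)))
      = pr (G (x, y, z))"
    unfolding pr_def by (simp add: covering_def Q_X G_def)
  finally show "f_map \<psi> \<phi> k \<sigma>0 eu es (P 0) (P 1) (P 2) (P 3) n0 n1 p = g p" by (simp add: p g_pr)
qed

end

end

section \<open>The theorem\<close>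

theorem theorem6p1:
  fixes \<psi> \<phi> :: "real \<Rightarrow> real" and eu es :: "real^2" and p1 p2 q1 q2 :: torus
    and n0 n1 :: nat and \<beta> k \<sigma>0 :: real and f :: "mfd \<Rightarrow> mfd" and U :: "(mfd \<Rightarrow> mfd) set"
  assumes "cat_eigenbasis eu es"
    and "bump \<psi>"
    and "circle_diffeo \<psi> \<phi>"
    and "base_parameters \<psi> \<phi> p1 p2 q1 q2 n0 \<sigma>0 \<beta> k"
    and "f = f_map \<psi> \<phi> k \<sigma>0 eu es p1 p2 q1 q2 n0 n1"
    and "n1_large \<psi> \<phi> eu es n0 n1 \<sigma>0 k f"
    and "C1_neighbourhood f U"
  shows "\<exists>g\<in>U. smooth_diffeo g \<and>
           (\<exists>Euu Ecu Ecs. ph_splitting g Euu Ecu Ecs \<and>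
              skeleton g Ecs {(q2, abs_circle 1, q2)})"
proof -
  obtain lam where cf: "cat_frame eu es lam" using cat_eigenbasis_frame[OF assms(1)] by blast
  interpret C: cat_frame eu es lam by (rule cf)
  interpret D: circle_map \<psi> \<phi> by unfold_locales (rule assms(2), rule assms(3))
  note base = assms(4)[unfolded base_parameters_def C.cat_pow_max_eigenvalue_eq]
  have \<sigma>0: "\<sigma>0 = lam ^ n0" using base by blast
  obtain Y where Y: "abs_torus (Y p) = p" for p by (metis Quotient3_abs_rep[OF Quotient3_torus])
  define pt where "pt i = (if i = 0 then p1 else if i = 1 then p2 else if i = 2 then q1 else q2)" for i :: nat
  define X where "X i = Y (pt i)" for i
  define r where "r i = X i - X 3" for i
  define Q :: cover where "Q = (X 3, 0, X 3)"
  have PX: "abs_torus (X i) = pt i" for i by (simp add: X_def Y)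
  have pt: "pt 0 = p1" "pt 1 = p2" "pt 2 = q1" "pt 3 = q2" by (simp_all add: pt_def)
  have sep: "norm (r i - r j - l) > 10 * \<delta>" if "i < 4" "j < 4" "i \<noteq> j" "l \<in> int_lattice" for i j l
  proof -
    have "dist (pt i) (pt j) > 10 * \<delta>"
    proof -
      have "(i = 0 \<or> i = 1 \<or> i = 2 \<or> i = 3) \<and> (j = 0 \<or> j = 1 \<or> j = 2 \<or> j = 3)" using that(1,2) by linarith
      then show ?thesis using base that(3) by (elim conjE disjE) (simp_all add: pt_def dist_commute)
    qed
    also have "dist (pt i) (pt j) = infdist (X i - X j) int_lattice"
      unfolding PX[symmetric] by (simp add: dist_torus.abs_eq)
    also have "\<dots> \<le> dist (X i - X j) l" by (rule infdist_le[OF that(4)])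
    finally show ?thesis by (simp add: r_def dist_norm)
  qed
  have n1: "n0 dvd n1" and dP: "deriv (\<lambda>t. lam ^ n0 * P_fun \<psi> k (lam ^ n0) a b c t e) d < lam ^ n1" for a b c d e
    using assms(6) by (auto simp: n1_large_def Let_def \<sigma>0 C.cat_pow_max_eigenvalue_eq)
  \<comment> \<open>The largest push that the model admits.\<close>
  define \<epsilon>1 where "\<epsilon>1 = min_dQ \<psi> \<phi> / 8"
  have \<epsilon>1: "\<epsilon>1 > 0" using D.dQ_bounds(3) by (simp add: \<epsilon>1_def)
  have model: "skew_model eu es lam \<psi> \<phi> n0 n1 r k \<beta> \<epsilon>" if "0 \<le> \<epsilon>" "\<epsilon> \<le> \<epsilon>1" for \<epsilon>
  proof (unfold_locales)
    show "r 3 = 0" by (simp add: r_def)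
    show "lam ^ n0 \<ge> 10000 * max_dQ \<psi> \<phi>" using base max.cobounded1[of "max_dQ \<psi> \<phi>" "inverse (min_dQ \<psi> \<phi>)"] unfolding \<sigma>0 by linarith
    show "\<bar>deriv \<phi> t - 1 / 2\<bar> < 1 / 10000" if "\<bar>t\<bar> \<le> \<beta>" for t
      using base that by (auto simp: abs_le_iff)
  qed (use base sep dP that in \<open>auto simp: \<epsilon>1_def\<close>)
  have fixed: "C.hyp (lam ^ n) (X 3) - X 3 \<in> int_lattice" if "n0 dvd n" for n
  proof -
    have q2: "(cat_map ^^ n0) q2 = q2" using base by blast
    obtain m where m: "n = n0 * m" using \<open>n0 dvd n\<close> by (auto elim: dvdE)
    have "((cat_map ^^ n0) ^^ m) q2 = q2" by (induction m) (simp_all add: q2)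
    then have "(cat_map ^^ n) q2 = q2" by (simp add: m funpow_mult)
    then have "abs_torus (C.hyp (lam ^ n) (X 3)) = abs_torus (X 3)"
      unfolding C.cat_map_pow[symmetric] PX pt .
    then show ?thesis by (simp add: abs_torus_eq_iff)
  qed
  \<comment> \<open>\<open>Uc\<close> is affine in the push, so the model with push s * \<epsilon>1
    interpolates linearly between these two, the first of which is f.\<close>
  interpret M0: skew_model eu es lam \<psi> \<phi> n0 n1 r k \<beta> 0 Q by (rule model) (use \<epsilon>1 in auto)
  interpret M1: skew_model eu es lam \<psi> \<phi> n0 n1 r k \<beta> \<epsilon>1 Q by (rule model) (use \<epsilon>1 in auto)
  have f: "f = M0.g"
    using M0.f_map_eq_g[OF refl r_def Q_def fixed[OF dvd_refl] fixed[OF n1]]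
    unfolding assms(5) PX pt \<sigma>0 by simp
  obtain C0 where C0: "\<And>w v. \<bar>frechet_derivative M0.Uc (at w) v\<bar> \<le> C0 * norm v"
    using M0.linear_has_deriv_bound_U by blast
  obtain C1 where C1: "\<And>w v. \<bar>frechet_derivative M1.Uc (at w) v\<bar> \<le> C1 * norm v"
    using M1.linear_has_deriv_bound_U by blast
  obtain \<eta> where \<eta>: "\<eta> > 0" and U: "\<And>g. Ck_diffeo 1 g \<Longrightarrow> (\<And>x. dist (f x) (g x) < \<eta> \<and>
      onorm (\<lambda>v. tangent_map f x v - tangent_map g x v) < \<eta>) \<Longrightarrow> g \<in> U"
    using assms(7) unfolding C1_neighbourhood_def by blast
  define K where "K = \<bar>C0\<bar> + \<bar>C1\<bar> + 2 * \<epsilon>1 + 1"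
  \<comment> \<open>Scaling the push by s scales both the C^0 and the C^1 distance to f. K bounds
    them for the full push \<epsilon>1, and the factor 2 makes the final inequality strict.\<close>
  define s where "s = min 1 (\<eta> / (2 * K))"
  have K: "K > 0" using \<epsilon>1 by (simp add: K_def)
  have s: "0 < s" "s \<le> 1" "s * K < \<eta>"
  proof -
    show "0 < s" "s \<le> 1" using \<eta> K by (simp_all add: s_def)
    have "s * K \<le> \<eta> / (2 * K) * K" using K by (intro mult_right_mono) (auto simp: s_def)
    also have "\<dots> < \<eta>" using K \<eta> by simp
    finally show "s * K < \<eta>" .
  qed
  define \<epsilon> where "\<epsilon> = s * \<epsilon>1"
  have \<epsilon>: "\<epsilon> > 0" "\<epsilon> \<le> \<epsilon>1" using s \<epsilon>1 mult_right_mono[of s 1 \<epsilon>1] by (simp_all add: \<epsilon>_def)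
  interpret M: skew_model eu es lam \<psi> \<phi> n0 n1 r k \<beta> \<epsilon> Q by (rule model) (use \<epsilon> in auto)
  interpret M: perturbed_model eu es lam \<psi> \<phi> n0 n1 r k \<beta> \<epsilon> Q by unfold_locales (rule \<epsilon>(1))
  have Uc: "M.Uc w = M0.Uc w + s * (M1.Uc w - M0.Uc w)" for w
  proof -
    have "M.push i y = M0.push i y + s * (M1.push i y - M0.push i y)" for i y
      unfolding M.push_def M0.push_def M1.push_def by (simp add: \<epsilon>_def)
    then have "M.Uc w = (\<Sum>i<4. M.bmp i (fst w) * (M0.push i (fst (snd w)) + s * (M1.push i (fst (snd w)) - M0.push i (fst (snd w)))))"
      unfolding M.Uc_def by presburger
    also have "\<dots> = M0.Uc w + s * (M1.Uc w - M0.Uc w)"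
      unfolding M0.Uc_def M1.Uc_def by (simp only: distrib_left right_diff_distrib sum.distrib sum_subtractf sum_distrib_left mult.left_commute)
    finally show ?thesis .
  qed
  have Uc_diff: "\<bar>M1.Uc w - M0.Uc w\<bar> \<le> 2 * \<epsilon>1" for w
  proof -
    let ?c = "1 + cos (pi * fst (snd w))"
    have "M1.Uc w - M0.Uc w = (\<Sum>i<4. M0.bmp i (fst w) * (if i = 2 then \<epsilon>1 * ?c else 0))"
      unfolding M1.Uc_def M0.Uc_def sum_subtractf[symmetric] right_diff_distrib[symmetric]
      by (rule sum.cong) (simp_all add: M1.push_def M0.push_def)
    also have "\<dots> = M0.bmp 2 (fst w) * (\<epsilon>1 * ?c)" by (simp add: numeral_eq_Suc)
    also have "\<bar>\<dots>\<bar> \<le> 1 * (\<epsilon>1 * 2)"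
    proof -
      have "0 \<le> ?c" "?c \<le> 2" using cos_le_one cos_ge_minus_one by (smt (verit))+
      then show ?thesis unfolding abs_mult using M0.bmp_bounds[of 2 "fst w"] \<epsilon>1 by (intro mult_mono) auto
    qed
    finally show ?thesis by simp
  qed
  have DU: "M.DU w v = M0.DU w v + s * (M1.DU w v - M0.DU w v)" for w v
  proof -
    have "(M.Uc has_derivative (\<lambda>v. M0.DU w v + s * (M1.DU w v - M0.DU w v))) (at w)"
      unfolding Uc
      by (intro has_derivative_add has_derivative_mult_right has_derivative_diff
          smooth_has_derivative M0.smooth_Uc M1.smooth_Uc)
    from fun_cong[OF frechet_derivative_at[OF this], of v] show ?thesis by (rule sym)
  qed
  have "M.g \<in> U"
  proof (rule U)
    show "Ck_diffeo 1 M.g" using M.smooth_diffeo_g by (simp add: smooth_diffeo_def)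
    fix x
    obtain w where x: "x = covering (Q + w)" using covering_surj[of x] by (metis add_diff_cancel_left' diff_add_cancel add.commute)
    have x0: "x = M0.pr w" "x = M.pr w" by (simp_all add: x M0.pr_def M.pr_def)
    have "dist (f x) (M.g x) \<le> dist (Q + M0.G w) (Q + M.G w)"
      unfolding f x M0.g_covering[symmetric] M.g_covering[symmetric] by (rule dist_covering_le)
    also have "\<dots> = norm (M0.G w - M.G w)" by (simp add: dist_norm)
    also have "M0.G w - M.G w = (0, M0.Uc w - M.Uc w, 0)" by (simp add: M0.G_def M.G_def)
    also have "norm (0 :: real^2, M0.Uc w - M.Uc w, 0 :: real^2) = s * \<bar>M1.Uc w - M0.Uc w\<bar>"
      using s(1) by (simp add: norm_Pair Uc abs_mult)
    also have "\<dots> \<le> s * K"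
      using Uc_diff[of w] s(1) by (intro mult_left_mono) (auto simp: K_def)
    finally have d: "dist (f x) (M.g x) < \<eta>" using s(3) by linarith
    have "onorm (\<lambda>v. tangent_map f x v - tangent_map M.g x v) \<le> s * K"
    proof (rule onorm_bound)
      show "0 \<le> s * K" using s K by simp
      fix v
      have "tangent_map f x v - tangent_map M.g x v = C.mk 0 0 (M0.DU w v - M.DU w v) 0 0"
        unfolding f
        by (subst x0(1), subst x0(2), subst M0.tangent_map_pr, subst M.tangent_map_pr, rule C.coord_eqI)
          (simp_all add: M0.DG_eq M.DG_eq)
      also have "norm \<dots> \<le> \<bar>M0.DU w v - M.DU w v\<bar>"
        using C.norm_le_coords[of "C.mk 0 0 (M0.DU w v - M.DU w v) 0 0"] by simp
      also have "\<dots> = s * \<bar>M1.DU w v - M0.DU w v\<bar>" using s(1) by (simp add: DU abs_mult)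
      also have "\<dots> \<le> s * ((\<bar>C0\<bar> + \<bar>C1\<bar>) * norm v)"
      proof -
        have "C0 * norm v \<le> \<bar>C0\<bar> * norm v" "C1 * norm v \<le> \<bar>C1\<bar> * norm v" by (intro mult_right_mono; simp)+
        then have "\<bar>M1.DU w v - M0.DU w v\<bar> \<le> (\<bar>C0\<bar> + \<bar>C1\<bar>) * norm v"
          using C0[of w v] C1[of w v] unfolding distrib_right by linarith
        then show ?thesis using s(1) by (intro mult_left_mono) auto
      qed
      also have "\<dots> \<le> s * (K * norm v)"
        using s(1) \<epsilon>1 by (intro mult_left_mono mult_right_mono) (auto simp: K_def)
      finally show "norm (tangent_map f x v - tangent_map M.g x v) \<le> s * K * norm v" by simp
    qed
    then show "dist (f x) (M.g x) < \<eta> \<and> onorm (\<lambda>v. tangent_map f x v - tangent_map M.g x v) < \<eta>"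
      using d s(3) by linarith
  qed
  moreover have "M.pr (C.mk 0 0 1 0 0) = (q2, abs_circle 1, q2)"
    unfolding M.pr_def by (simp add: Q_def C.mk_def covering_def PX pt)
  ultimately show ?thesis using M.smooth_diffeo_g M.ph_splitting_skeleton by auto
qed

end
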